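(* Let $\ell_1\mid\ell$ be positive integers, and let $f^{*}$ be a weight $0$ cuspidal Maass newform of level $\ell_1$ (trivial nebentypus) that is normalized to have norm $1$ in $L^2(\Gamma_0(\ell)\backslash\mathbb{H})$. Then the set of functions $$\Bigl\{f^{(g)}:=\sum_{d\mid g}\xi_g(d)\,f^{*}|_d\ :\ g\mid\tfrac{\ell}{\ell_1}\Bigr\}$$ is an orthonormal basis (with respect to the inner product of $L^2(\Gamma_0(\ell)\backslash\mathbb{H})$) of the space $\bigoplus_{d\mid\ell/\ell_1}f^{*}|_d\cdot\mathbb{C}$. If $f$ is any member of this basis, then for every $\varepsilon>0$ and every $n\in\mathbb{N}$ its Fourier coefficients satisfy $$\sqrt n\,\rho_f(n)\ll_\varepsilon(n\ell)^{\varepsilon}n^{\theta}(\ell,n)^{1/2-\theta}|\rho_{f^{*}}(1)|.$$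
   Context: Inner product: $\langle f,g\rangle=\int_{\Gamma_0(\ell)\backslash\mathbb{H}}f(z)\overline{g(z)}\,\frac{dx\,dy}{y^2}$. Write $f|_d(z):=f(dz)$. A Maass form $f$ with spectral parameter $t$ has Fourier expansion $f(z)=\sum_{n\ne0}\rho_f(n)W_{0,it}(4\pi|n|y)e(nx)$ with $e(x)=e^{2\pi ix}$ and $W_{0,it}(y)=(y/\pi)^{1/2}K_{it}(y/2)$. For a newform the normalized Hecke eigenvalues $\lambda_f(n)$ satisfy $\lambda_f(n)\rho_f(1)=\sqrt n\,\rho_f(n)$ for $n\ge1$. $\theta$ is an admissible exponent towards the Ramanujan--Petersson conjecture, i.e. $\lambda_f(n)\ll_\varepsilon n^{\theta+\varepsilon}$ for all Maass newforms (e.g. $\theta=7/64$). Definition of $\xi_g(d)$, for the newform $f=f^{*}$ with $\chi_0$ the trivial character modulo $\ell_1$: $$r_f(c)=\sum_{b\mid c}\frac{\mu(b)\lambda_f(b)^2}{b\,\sigma_{-1}(b)^2},\quad \alpha(c)=\sum_{b\mid c}\frac{\mu(b)}{b^2},\quad \beta(c)=\sum_{b\mid c}\frac{\mu^2(b)}{b},$$ where $\sigma_{-1}(b)=\sum_{d\mid b}1/d$ is the sum of the reciprocal divisors of $b$, and $\mu_f$ is the multiplicative function with $\sum_c\mu_f(c)c^{-s}=L(f,s)^{-1}$, where $L(f,s)=\sum_n\lambda_f(n)n^{-s}$, i.e. $\mu_f(p)=-\lambda_f(p)$, $\mu_f(p^2)=\chi_0(p)$, $\mu_f(p^\nu)=0$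 for $\nu>2$. For $d\mid g$ put $$\xi'_g(d)=\frac{\mu(g/d)\lambda_f(g/d)}{r_f(g)^{1/2}(g/d)^{1/2}\beta(g/d)},\qquad \xi''_g(d)=\frac{\mu_f(g/d)}{(g/d)^{1/2}(r_f(g)\alpha(g))^{1/2}}.$$ Write $g=g_1g_2$ uniquely with $g_1$ squarefree, $g_2$ squarefull, $(g_1,g_2)=1$, and for $d\mid g$ set $\xi_g(d)=\xi'_{g_1}((g_1,d))\,\xi''_{g_2}((g_2,d))$.
   Formalization: The trivial character modulo ℓ₁ is inserted into the sums σ_{-1}, α and β (as printed, orthonormality fails when a prime divides both ℓ₁ and ℓ/ℓ₁, e.g. ℓ₁=5, ℓ=25); the admissible exponent θ is taken to be less than 1/2. *)

theory Defs
  imports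
    "HOL-Analysis.Analysis"
    "HOL-Computational_Algebra.Computational_Algebra"
    "HOL-Library.Function_Algebras"
begin

section \<open>The upper half plane and the groups $\Gamma_0(N)$\<close>

definition uhp :: "complex set" where
  "uhp = {z. Im z > 0}"

definition Gamma0 :: "nat \<Rightarrow> (int ^ 2 ^ 2) set" where
  "Gamma0 N = {A. det A = 1 \<and> int N dvd A $ 2 $ 1}"

definition moebius :: "int ^ 2 ^ 2 \<Rightarrow> complex \<Rightarrow> complex" where
  "moebius A z =
     (of_int (A $ 1 $ 1) * z + of_int (A $ 1 $ 2)) / (of_int (A $ 2 $ 1) * z + of_int (A $ 2 $ 2))"

definition is_fundamental_domain :: "nat \<Rightarrow> complex set \<Rightarrow> bool" where
  "is_fundamental_domain N F \<longleftrightarrow>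
     F \<in> sets borel \<and> F \<subseteq> uhp \<and>
     (\<forall>z\<in>uhp. \<exists>!w. w \<in> F \<and> (\<exists>A\<in>Gamma0 N. w = moebius A z))"

(* Borel sets meeting every orbit exactly once exist for every N > 0: in each orbit take the
   points of maximal imaginary part with 0 \<le> Re z < 1, and among these finitely many the one of
   least real part.  For \<Gamma>_0(N)-invariant integrands the integral below does not depend on the
   domain chosen. *)
definition fundamental_domain :: "nat \<Rightarrow> complex set" where
  "fundamental_domain N = (SOME F. is_fundamental_domain N F)"

definition petersson :: "nat \<Rightarrow> (complex \<Rightarrow> complex) \<Rightarrow> (complex \<Rightarrow> complex) \<Rightarrow> complex" where
  "petersson N f g =
     (LINT z:fundamental_domain N|lborel. f z * cnj (g z) / of_real ((Im z)\<^sup>2))"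


section \<open>Maass cusp forms of weight 0 and trivial nebentypus\<close>

definition dir_deriv :: "complex \<Rightarrow> (complex \<Rightarrow> complex) \<Rightarrow> complex \<Rightarrow> complex" where
  "dir_deriv v f z = frechet_derivative f (at z) v"

(* Differentiability over the reals: all iterated directional derivatives exist and are
   differentiable. *)
definition real_smooth_on :: "complex set \<Rightarrow> (complex \<Rightarrow> complex) \<Rightarrow> bool" where
  "real_smooth_on S f \<longleftrightarrow> (\<forall>vs. \<forall>z\<in>S. foldr dir_deriv vs f differentiable (at z))"

definition hyp_laplacian :: "(complex \<Rightarrow> complex) \<Rightarrow> complex \<Rightarrow> complex" where
  "hyp_laplacian f z =
     - of_real ((Im z)\<^sup>2) * (dir_deriv 1 (dir_deriv 1 f) z + dir_deriv \<i> (dir_deriv \<i> f) z)"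

(* Functions on the upper half plane are represented by functions on the complex numbers that
   vanish off it.  In the cuspidality condition, f composed with A is periodic with period N
   because Gamma0 N contains the principal congruence subgroup of level N; hence the integral is
   the constant Fourier term at the cusp A(infinity) up to a nonzero factor. *)
definition maass_cusp_form :: "nat \<Rightarrow> complex \<Rightarrow> (complex \<Rightarrow> complex) \<Rightarrow> bool" where
  "maass_cusp_form N t f \<longleftrightarrow>
     (\<forall>z. z \<notin> uhp \<longrightarrow> f z = 0) \<and>
     real_smooth_on uhp f \<and>
     (\<forall>z\<in>uhp. hyp_laplacian f z = (1 / 4 + t\<^sup>2) * f z) \<and>
     (\<forall>A\<in>Gamma0 N. \<forall>z\<in>uhp. f (moebius A z) = f z) \<and>
     set_integrable lborel (fundamental_domain N) (\<lambda>z. (cmod (f z))\<^sup>2 / (Im z)\<^sup>2) \<and>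
     (\<forall>A\<in>Gamma0 1. \<forall>y>0. (LINT x:{0..real N}|lborel. f (moebius A (Complex x y))) = 0)"

definition dilate :: "nat \<Rightarrow> (complex \<Rightarrow> complex) \<Rightarrow> complex \<Rightarrow> complex" where
  "dilate d f z = f (of_nat d * z)"

(* n^(-1/2) times the sum over the upper triangular matrices (a b; 0 d) of determinant n with a
   prime to the level; for the primes p dividing N this is the operator usually called U_p. *)
definition hecke_op :: "nat \<Rightarrow> nat \<Rightarrow> (complex \<Rightarrow> complex) \<Rightarrow> complex \<Rightarrow> complex" where
  "hecke_op N n f z =
     (\<Sum>a | a dvd n \<and> coprime a N.
        \<Sum>b<n div a. f ((of_nat a * z + of_nat b) / of_nat (n div a))) / of_real (sqrt (real n))"

(* A newform is a nonzero form in the orthogonal complement of the forms coming from lower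
   levels that is an eigenfunction of all Hecke operators. *)
definition maass_newform :: "nat \<Rightarrow> complex \<Rightarrow> (complex \<Rightarrow> complex) \<Rightarrow> bool" where
  "maass_newform N t f \<longleftrightarrow>
     maass_cusp_form N t f \<and>
     f \<noteq> (\<lambda>z. 0) \<and>
     (\<forall>M s h d. M dvd N \<and> M \<noteq> N \<and> d dvd N div M \<and> maass_cusp_form M s h
        \<longrightarrow> petersson N f (dilate d h) = 0) \<and>
     (\<forall>n>0. \<exists>c. hecke_op N n f = (\<lambda>z. c * f z))"

definition hecke_eigenvalue :: "nat \<Rightarrow> (complex \<Rightarrow> complex) \<Rightarrow> nat \<Rightarrow> complex" where
  "hecke_eigenvalue N f n = (THE c. hecke_op N n f = (\<lambda>z. c * f z))"

(* The implied constant depends on \<epsilon> only.  The exponent 1/2 is the trivial one; an exponent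
   towards the Ramanujan--Petersson conjecture is understood to improve on it. *)
definition ramanujan_petersson_exponent :: "real \<Rightarrow> bool" where
  "ramanujan_petersson_exponent \<theta> \<longleftrightarrow>
     \<theta> < 1 / 2 \<and>
     (\<forall>\<epsilon>>0. \<exists>C. \<forall>N t f n. N > 0 \<and> maass_newform N t f \<and> n > 0
        \<longrightarrow> cmod (hecke_eigenvalue N f n) \<le> C * real n powr (\<theta> + \<epsilon>))"


section \<open>Fourier expansions\<close>

definition bessel_K :: "complex \<Rightarrow> real \<Rightarrow> complex" where
  "bessel_K \<nu> x = (LINT u:{0..}|lborel. exp (- of_real (x * cosh u)) * cosh (\<nu> * of_real u))"

definition whittaker_W :: "complex \<Rightarrow> real \<Rightarrow> complex" where
  "whittaker_W t y = of_real (sqrt (y / pi)) * bessel_K (\<i> * t) (y / 2)"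

definition is_fourier_coeffs :: "complex \<Rightarrow> (complex \<Rightarrow> complex) \<Rightarrow> (int \<Rightarrow> complex) \<Rightarrow> bool" where
  "is_fourier_coeffs t f \<rho> \<longleftrightarrow>
     (\<forall>z\<in>uhp. ((\<lambda>n. \<rho> n * whittaker_W t (4 * pi * \<bar>real_of_int n\<bar> * Im z)
                        * cis (2 * pi * real_of_int n * Re z)) has_sum f z) (UNIV - {0}))"


section \<open>The coefficients $\xi_g(d)$\<close>

definition moebius_mu :: "nat \<Rightarrow> complex" where
  "moebius_mu n = (if squarefree n then (- 1) ^ card (prime_factors n) else 0)"

definition chi0 :: "nat \<Rightarrow> nat \<Rightarrow> complex" where
  "chi0 N n = (if coprime n N then 1 else 0)"

(* N is the level of the newform and lam its sequence of Hecke eigenvalues.  The sums below carry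
   the trivial character chi0 N.  On arguments prime to N it may be omitted (see the lemmas that
   follow).  At the primes dividing N it is indispensable: for p dividing N, f(pz) and f(z) have
   inner product lam p / sqrt p times the square of the norm of f, in place of
   lam p / (sqrt p * (1 + 1/p)) for p not dividing N. *)
definition sigma_m1 :: "nat \<Rightarrow> nat \<Rightarrow> complex" where
  "sigma_m1 N b = (\<Sum>d | d dvd b. chi0 N d / of_nat d)"

definition r_coeff :: "nat \<Rightarrow> (nat \<Rightarrow> complex) \<Rightarrow> nat \<Rightarrow> complex" where
  "r_coeff N lam c =
     (\<Sum>b | b dvd c. moebius_mu b * (lam b)\<^sup>2 / (of_nat b * (sigma_m1 N b)\<^sup>2))"

definition alpha_coeff :: "nat \<Rightarrow> nat \<Rightarrow> complex" where
  "alpha_coeff N c = (\<Sum>b | b dvd c. chi0 N b * moebius_mu b / (of_nat b)\<^sup>2)"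

definition beta_coeff :: "nat \<Rightarrow> nat \<Rightarrow> complex" where
  "beta_coeff N c = (\<Sum>b | b dvd c. chi0 N b * (moebius_mu b)\<^sup>2 / of_nat b)"

lemma chi0_dvd_coprime: "coprime c N \<Longrightarrow> d dvd c \<Longrightarrow> chi0 N d = 1"
  by (auto simp: chi0_def intro: coprime_divisors[where b = N])

lemma sigma_m1_coprime:
  assumes "coprime b N"
  shows "sigma_m1 N b = (\<Sum>d | d dvd b. 1 / of_nat d)"
  unfolding sigma_m1_def by (rule sum.cong) (use assms in \<open>auto simp: chi0_dvd_coprime\<close>)

lemma r_coeff_coprime:
  assumes "coprime c N"
  shows "r_coeff N lam c =
    (\<Sum>b | b dvd c. moebius_mu b * (lam b)\<^sup>2 / (of_nat b * (\<Sum>d | d dvd b. 1 / of_nat d)\<^sup>2))"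
  unfolding r_coeff_def
proof (rule sum.cong)
  fix b assume "b \<in> {b. b dvd c}"
  then have "coprime b N"
    using assms by (auto intro: coprime_divisors[where b = N])
  then show "moebius_mu b * (lam b)\<^sup>2 / (of_nat b * (sigma_m1 N b)\<^sup>2) =
      moebius_mu b * (lam b)\<^sup>2 / (of_nat b * (\<Sum>d | d dvd b. 1 / of_nat d)\<^sup>2)"
    by (simp add: sigma_m1_coprime)
qed simp

lemma alpha_coeff_coprime:
  assumes "coprime c N"
  shows "alpha_coeff N c = (\<Sum>b | b dvd c. moebius_mu b / (of_nat b)\<^sup>2)"
  unfolding alpha_coeff_def by (rule sum.cong) (use assms in \<open>auto simp: chi0_dvd_coprime\<close>)

lemma beta_coeff_coprime:
  assumes "coprime c N"
  shows "beta_coeff N c = (\<Sum>b | b dvd c. (moebius_mu b)\<^sup>2 / of_nat b)"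
  unfolding beta_coeff_def by (rule sum.cong) (use assms in \<open>auto simp: chi0_dvd_coprime\<close>)

(* The Dirichlet inverse of lam, given by its values at prime powers. *)
definition mu_coeff :: "nat \<Rightarrow> (nat \<Rightarrow> complex) \<Rightarrow> nat \<Rightarrow> complex" where
  "mu_coeff N lam c =
     (\<Prod>p\<in>prime_factors c.
        if multiplicity p c = 1 then - lam p
        else if multiplicity p c = 2 then chi0 N p
        else 0)"

definition xi1 :: "nat \<Rightarrow> (nat \<Rightarrow> complex) \<Rightarrow> nat \<Rightarrow> nat \<Rightarrow> complex" where
  "xi1 N lam g d =
     moebius_mu (g div d) * lam (g div d) /
     (csqrt (r_coeff N lam g) * of_real (sqrt (real (g div d))) * beta_coeff N (g div d))"

definition xi2 :: "nat \<Rightarrow> (nat \<Rightarrow> complex) \<Rightarrow> nat \<Rightarrow> nat \<Rightarrow> complex" where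
  "xi2 N lam g d =
     mu_coeff N lam (g div d) /
     (of_real (sqrt (real (g div d))) * csqrt (r_coeff N lam g * alpha_coeff N g))"

definition squarefree_factor :: "nat \<Rightarrow> nat" where
  "squarefree_factor g = (\<Prod>p | p \<in> prime_factors g \<and> multiplicity p g = 1. p)"

definition squarefull_factor :: "nat \<Rightarrow> nat" where
  "squarefull_factor g = (\<Prod>p | p \<in> prime_factors g \<and> multiplicity p g \<ge> 2. p ^ multiplicity p g)"

definition xi :: "nat \<Rightarrow> (nat \<Rightarrow> complex) \<Rightarrow> nat \<Rightarrow> nat \<Rightarrow> complex" where
  "xi N lam g d =
     xi1 N lam (squarefree_factor g) (gcd (squarefree_factor g) d) *
     xi2 N lam (squarefull_factor g) (gcd (squarefull_factor g) d)"

definition maass_basis_form :: "nat \<Rightarrow> (complex \<Rightarrow> complex) \<Rightarrow> nat \<Rightarrow> complex \<Rightarrow> complex" where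
  "maass_basis_form N f g = (\<lambda>z. \<Sum>d | d dvd g. xi N (hecke_eigenvalue N f) g d * dilate d f z)"


section \<open>Orthonormal bases of spaces of functions\<close>

interpretation cfun: vector_space "\<lambda>(c :: complex) (f :: complex \<Rightarrow> complex) z. c * f z"
  by unfold_locales (auto simp: fun_eq_iff algebra_simps)

definition is_direct_sum_of_lines ::
    "'i set \<Rightarrow> ('i \<Rightarrow> complex \<Rightarrow> complex) \<Rightarrow> (complex \<Rightarrow> complex) set \<Rightarrow> bool" where
  "is_direct_sum_of_lines I v V \<longleftrightarrow>
     inj_on v I \<and> cfun.independent (v ` I) \<and> V = cfun.span (v ` I)"

definition is_orthonormal_basis ::
    "((complex \<Rightarrow> complex) \<Rightarrow> (complex \<Rightarrow> complex) \<Rightarrow> complex) \<Rightarrow>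
     'i set \<Rightarrow> ('i \<Rightarrow> complex \<Rightarrow> complex) \<Rightarrow> (complex \<Rightarrow> complex) set \<Rightarrow> bool" where
  "is_orthonormal_basis ip I b V \<longleftrightarrow>
     (\<forall>i\<in>I. \<forall>j\<in>I. ip (b i) (b j) = (if i = j then 1 else 0)) \<and> cfun.span (b ` I) = V"

end

theory Submission
  imports
    Defs
    "HOL-Number_Theory.Cong"
    "HOL-Complex_Analysis.Cauchy_Integral_Formula"
begin

text \<open>
  For a function \<open>h\<close> on the upper half plane that is invariant under some principal congruence
  subgroup, the mean of \<open>h\<close> over a fundamental domain does not depend on the subgroup, and it is
  invariant under \<open>h \<mapsto> h \<circ> \<beta>\<close> for every integer matrix \<open>\<beta>\<close> of positive determinant. Up to a factor
  the Petersson product of \<open>u\<close> and \<open>v\<close> is the mean of \<open>u * cnj v\<close>.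

  Write \<open>c(a, b)\<close> for the inner product of \<open>f|a\<close> and \<open>f|b\<close>. Invariance under \<open>z \<mapsto> p z + m\<close> turns the
  definition of the Hecke operator at \<open>p\<close> into
  \<open>cnj (\<lambda>(p)) \<surd>p c(a, b) = p c(p a, b) + \<chi>(p) c(a, p b)\<close> for \<open>p\<close> not dividing \<open>b\<close>, and clearly
  \<open>c(p a, p b) = c(a, b)\<close>. Once \<open>\<lambda>(p)\<close> is known to be real, this determines \<open>c\<close> as a product of local
  factors, and the coefficients \<open>\<xi>\<close>, which factor over the primes as well, carry out the
  Gram-Schmidt process at each prime. If \<open>p\<close> does not divide the level, \<open>\<lambda>(p)\<close> is real because
  \<open>c(1, p) = c(p, 1)\<close>. If it does, the trace of \<open>f|W\<^sub>p\<close> to the level divided by \<open>p\<close> is orthogonal to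
  \<open>f\<close> and to \<open>f|W\<^sub>p\<close>, hence zero, and this gives \<open>\<lambda>(p)\<^sup>2 = 1 / p\<close>, or \<open>\<lambda>(p) = 0\<close> if \<open>p\<close> divides the level
  twice. The norms stay positive because \<open>f|p\<close> is not proportional to \<open>f\<close>.

  For the coefficient bound, a Ramanujan-Petersson exponent below \<open>1/2\<close>, applied to the powers of \<open>p\<close>,
  bounds \<open>\<lambda>(p)\<close> by \<open>p\<^sup>\<eta> + p\<^sup>-\<^sup>\<eta>\<close> with \<open>\<eta> < 1/2\<close>. So the local norms are bounded away from zero, and
  the sum of the absolute values of the \<open>\<xi>\<close> at \<open>g\<close> is at most \<open>K\<close> to the number of primes dividing \<open>g\<close>.
\<close>

text \<open>Such inner products are usually computed by the Rankin-Selberg method from Fourier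
  coefficients. The first half of the theorem assumes no Fourier expansion, so everything there is
  drawn from the definition of the Hecke operators, the orthogonality to lower levels and the
  integral form of cuspidality. In particular the multiplicativity of \<open>lam\<close>, which the
  factorization of \<open>xi\<close> requires, is recovered from the Gram matrix, and only on
  squarefree arguments; the Moebius factors remove the others. The obstacle in forming inner
  products is that \<open>f\<close>, its dilates, its shifts by fractions and its image under an
  Atkin-Lehner matrix are invariant under different groups. Means against the probability measures
  \<open>nu M\<close> avoid computing any index or volume: with total mass 1 on both sides the
  unknown constants cancel. Fourier series enter only in the second half, where the recursion of
  \<open>lam\<close> at prime powers is read off the coefficients and therefore uses
  \<open>\<rho> 1 \<noteq> 0\<close>. The case \<open>\<rho> 1 = 0\<close> is not excluded but
  treated apart.\<close>

no_notation fps_nth (infixl "$" 75)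

section \<open>Arithmetic of integer 2 x 2 matrices\<close>

definition mk2 :: "int \<Rightarrow> int \<Rightarrow> int \<Rightarrow> int \<Rightarrow> int ^ 2 ^ 2" where
  "mk2 a b c d = vector [vector [a, b], vector [c, d]]"

lemma mk2_nth [simp]:
  "mk2 a b c d $ 1 $ 1 = a" "mk2 a b c d $ 1 $ 2 = b"
  "mk2 a b c d $ 2 $ 1 = c" "mk2 a b c d $ 2 $ 2 = d"
  by (simp_all add: mk2_def vector_2)

lemma mat2_eq_iff:
  fixes A B :: "int ^ 2 ^ 2"
  shows "A = B \<longleftrightarrow> A$1$1 = B$1$1 \<and> A$1$2 = B$1$2 \<and> A$2$1 = B$2$1 \<and> A$2$2 = B$2$2"
  unfolding vec_eq_iff forall_2 by blast

lemma mat2_mult_nth: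
  fixes A B :: "int ^ 2 ^ 2"
  shows "(A ** B) $ i $ j = A$i$1 * B$1$j + A$i$2 * B$2$j"
  by (simp add: matrix_matrix_mult_def sum_2)

lemma mk2_mult [simp]:
  "mk2 a b c d ** mk2 a' b' c' d' = mk2 (a*a'+b*c') (a*b'+b*d') (c*a'+d*c') (c*b'+d*d')"
  by (simp add: mat2_eq_iff mat2_mult_nth)

lemma mk2_eta: "mk2 (A$1$1) (A$1$2) (A$2$1) (A$2$2) = A"
  by (simp add: mat2_eq_iff)

lemma det_mk2 [simp]: "det (mk2 a b c d) = a * d - b * c"
  by (simp add: det_2)

text \<open>The adjugate is the inverse in determinant 1, and for positive determinant the inverse
  up to a scalar, which \<open>moebius\<close> does not see. All computations thus stay with integer
  entries.\<close>

definition adj2 :: "int ^ 2 ^ 2 \<Rightarrow> int ^ 2 ^ 2" where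
  "adj2 A = mk2 (A$2$2) (- (A$1$2)) (- (A$2$1)) (A$1$1)"

lemma adj2_nth [simp]:
  "adj2 A $ 1 $ 1 = A$2$2" "adj2 A $ 1 $ 2 = - A$1$2"
  "adj2 A $ 2 $ 1 = - A$2$1" "adj2 A $ 2 $ 2 = A$1$1"
  by (simp_all add: adj2_def)

lemma det_adj2 [simp]: "det (adj2 A) = det A"
  by (simp add: det_2 algebra_simps)

lemma adj2_adj2 [simp]: "adj2 (adj2 A) = A"
  by (simp add: mat2_eq_iff)

lemma mat1_nth2 [simp]:
  "(mat 1 :: int ^ 2 ^ 2) $ 1 $ 1 = 1" "(mat 1 :: int ^ 2 ^ 2) $ 1 $ 2 = 0"
  "(mat 1 :: int ^ 2 ^ 2) $ 2 $ 1 = 0" "(mat 1 :: int ^ 2 ^ 2) $ 2 $ 2 = 1"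
  by (simp_all add: mat_def)

lemma adj2_mult: "det A = 1 \<Longrightarrow> adj2 A ** A = mat 1" "det A = 1 \<Longrightarrow> A ** adj2 A = mat 1"
  by (auto simp: mat2_eq_iff mat2_mult_nth det_2 algebra_simps)

lemma det_mult2: "det (A ** B) = det A * det (B :: int ^ 2 ^ 2)"
  by (rule det_mul)

section \<open>Action on the upper half plane\<close>

definition mden :: "int ^ 2 ^ 2 \<Rightarrow> complex \<Rightarrow> complex" where
  "mden A z = of_int (A$2$1) * z + of_int (A$2$2)"

lemma mden_nonzero:
  assumes "det A > 0" "z \<in> uhp" shows "mden A z \<noteq> 0"
proof
  assume 0: "mden A z = 0"
  then have "Im (mden A z) = 0" "Re (mden A z) = 0" by auto
  then have "real_of_int (A$2$1) * Im z = 0" and r: "of_int (A$2$1) * Re z + of_int (A$2$2) = 0"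
    by (auto simp: mden_def)
  then have "A$2$1 = 0" using assms by (auto simp: uhp_def)
  with r have "A$2$2 = 0" by simp
  with \<open>A$2$1 = 0\<close> assms show False by (simp add: det_2)
qed

lemma Im_moebius:
  "Im (moebius A z) = of_int (det A) * Im z / (cmod (mden A z))\<^sup>2"
proof -
  have "Im (moebius A z) = Im ((of_int (A$1$1) * z + of_int (A$1$2)) * cnj (mden A z)) / (cmod (mden A z))\<^sup>2"
    unfolding moebius_def mden_def[symmetric] by (subst complex_div_cnj) (simp add: Im_divide_of_real flip: of_real_power)
  also have "Im ((of_int (A$1$1) * z + of_int (A$1$2)) * cnj (mden A z)) = of_int (det A) * Im z"
    by (simp add: mden_def det_2 algebra_simps)
  finally show ?thesis .
qed

text \<open>Where the denominator vanishes, the convention \<open>x / 0 = 0\<close> makes both sides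
  false. Hence a function that vanishes off \<open>uhp\<close> still does so after composition with
  \<open>moebius A\<close>.\<close>

lemma Im_moebius_sgn: "det A > 0 \<Longrightarrow> Im (moebius A z) > 0 \<longleftrightarrow> Im z > 0"
  by (cases "mden A z = 0")
     (auto simp: Im_moebius zero_less_divide_iff zero_less_mult_iff dest: mden_nonzero[of A z] simp: uhp_def)

lemma moebius_uhp_iff [simp]: "det A > 0 \<Longrightarrow> moebius A z \<in> uhp \<longleftrightarrow> z \<in> uhp"
  using Im_moebius_sgn by (auto simp: uhp_def)

lemma moebius_mult:
  assumes "det B > 0" "det A > 0" "z \<in> uhp"
  shows "moebius (A ** B) z = moebius A (moebius B z)"
proof -
  define n where "n = of_int (B$1$1) * z + of_int (B$1$2)"
  define d where "d = mden B z"
  have d: "d \<noteq> 0" using mden_nonzero assms unfolding d_def by blast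
  have w: "moebius B z = n / d" by (simp add: moebius_def n_def d_def mden_def)
  have "mden A (moebius B z) \<noteq> 0" using mden_nonzero assms by simp
  then have e: "of_int (A$2$1) * n + of_int (A$2$2) * d \<noteq> 0"
    using d by (simp add: mden_def w field_simps)
  have "moebius (A ** B) z = (of_int (A$1$1) * n + of_int (A$1$2) * d) / (of_int (A$2$1) * n + of_int (A$2$2) * d)"
    by (simp add: moebius_def mat2_mult_nth n_def d_def mden_def algebra_simps)
  also have "\<dots> = moebius A (n / d)"
    using d e unfolding moebius_def by (simp add: divide_simps)
  finally show ?thesis using w by simp
qed

lemma moebius_mat1 [simp]: "moebius (mat 1) z = z"
  by (simp add: moebius_def)

lemma moebius_scalar:
  assumes "B$1$1 = k * A$1$1" "B$1$2 = k * A$1$2" "B$2$1 = k * A$2$1" "B$2$2 = k * A$2$2" "k \<noteq> 0"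
  shows "moebius B z = moebius A z"
proof -
  have "moebius B z = (of_int k * (of_int (A$1$1) * z + of_int (A$1$2))) / (of_int k * (of_int (A$2$1) * z + of_int (A$2$2)))"
    unfolding moebius_def assms by (simp add: algebra_simps)
  then show ?thesis using assms(5) by (simp add: moebius_def)
qed

lemma moebius_adj2:
  assumes "det A > 0" "z \<in> uhp"
  shows "moebius (adj2 A) (moebius A z) = z" "moebius A (moebius (adj2 A) z) = z"
proof -
  have "moebius (adj2 A ** A) z = moebius (mat 1) z"
    by (rule moebius_scalar[where k = "det A"]) (use assms in \<open>auto simp: mat2_mult_nth det_2 algebra_simps\<close>)
  moreover have "moebius (A ** adj2 A) z = moebius (mat 1) z"
    by (rule moebius_scalar[where k = "det A"]) (use assms in \<open>auto simp: mat2_mult_nth det_2 algebra_simps\<close>)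
  ultimately have "moebius (adj2 A ** A) z = moebius (mat 1) z" "moebius (A ** adj2 A) z = moebius (mat 1) z"
    by blast+
  then show "moebius (adj2 A) (moebius A z) = z" "moebius A (moebius (adj2 A) z) = z"
    using assms by (simp_all add: moebius_mult)
qed

lemma moebius_measurable [measurable]: "moebius A \<in> borel_measurable borel"
  unfolding moebius_def by measurable

lemma moebius_has_field_derivative:
  assumes "det A > 0" "z \<in> uhp"
  shows "(moebius A has_field_derivative of_int (det A) / (mden A z)\<^sup>2) (at z)"
  using mden_nonzero[OF assms] unfolding moebius_def mden_def
  by (auto intro!: derivative_eq_intros simp: det_2 power2_eq_square field_simps)

lemma uhp_open [simp]: "open uhp"
  unfolding uhp_def by (rule open_halfspace_Im_gt)

lemma uhp_borel [measurable]: "uhp \<in> sets borel"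
  by simp

section \<open>The hyperbolic measure\<close>

text \<open>The measure lives on all of \<open>complex\<close> with density zero off
  \<open>uhp\<close>, so that measurability refers to \<open>borel\<close> throughout.\<close>

definition hyp :: "complex measure" where
  "hyp = density lborel (\<lambda>z. ennreal (indicator uhp z / (Im z)\<^sup>2))"

lemma sets_hyp [simp, measurable_cong]: "sets hyp = sets borel"
  by (simp add: hyp_def)

lemma space_hyp [simp]: "space hyp = UNIV"
  by (simp add: hyp_def)

lemma borel_measurable_hyp: "borel_measurable hyp = borel_measurable borel"
  by (simp add: measurable_def)

text \<open>The change of variables theorem is stated for \<open>real ^ n\<close>; these two maps
  carry it over to the complex plane.\<close>

definition complex_of_vec :: "real ^ 2 \<Rightarrow> complex" where "complex_of_vec v = Complex (v$1) (v$2)"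
definition vec_of_complex :: "complex \<Rightarrow> real ^ 2" where "vec_of_complex z = vector [Re z, Im z]"

lemma complex_of_vec_of_complex [simp]: "complex_of_vec (vec_of_complex z) = z" and vec_of_complex_of_vec [simp]: "vec_of_complex (complex_of_vec v) = v"
  by (auto simp: complex_of_vec_def vec_of_complex_def vector_2 vec_eq_iff forall_2)

lemma linear_complex_of_vec: "linear complex_of_vec" and linear_vec_of_complex: "linear vec_of_complex"
  by (auto intro!: linearI simp: complex_of_vec_def vec_of_complex_def complex_eq_iff vec_eq_iff forall_2 vector_2)

lemma measurable_complex_of_vec [measurable]: "complex_of_vec \<in> borel_measurable borel"
  and measurable_vec_of_complex [measurable]: "vec_of_complex \<in> borel_measurable borel"
  by (auto intro!: borel_measurable_continuous_onI linear_continuous_on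
        simp: linear_linear linear_complex_of_vec linear_vec_of_complex linear_conv_bounded_linear[symmetric])

lemma lborel_distr_complex_of_vec: "distr lborel borel complex_of_vec = lborel"
proof (rule lborel_eqI[symmetric])
  fix l u :: complex assume lu: "\<And>b. b \<in> Basis \<Longrightarrow> l \<bullet> b \<le> u \<bullet> b"
  have B: "(Basis :: (real^2) set) = {axis 1 1, axis 2 1}"
    unfolding Basis_vec_def by (auto, metis exhaust_2)
  have "complex_of_vec -` box l u = box (vec_of_complex l) (vec_of_complex u)"
    unfolding box_def B by (auto simp: complex_of_vec_def vec_of_complex_def Basis_complex_def inner_axis vector_2)
  moreover have "vec_of_complex l \<bullet> b \<le> vec_of_complex u \<bullet> b" if "b \<in> Basis" for b
    using that lu[of 1] lu[of "\<i>"] unfolding B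
    by (auto simp: vec_of_complex_def inner_axis vector_2 Basis_complex_def)
  moreover have "(\<Prod>b\<in>Basis. (vec_of_complex u - vec_of_complex l) \<bullet> b) = (Re u - Re l) * (Im u - Im l)"
    unfolding B by (subst prod.insert) (auto simp: axis_eq_axis inner_axis vec_of_complex_def vector_2)
  moreover have "(\<Prod>b\<in>Basis. (u - l) \<bullet> b) = (Re u - Re l) * (Im u - Im l)"
    by (simp add: Basis_complex_def)
  ultimately show "emeasure (distr lborel borel complex_of_vec) (box l u) = ennreal (\<Prod>b\<in>Basis. (u - l) \<bullet> b)"
    by (simp add: emeasure_distr emeasure_lborel_box_eq)
qed simp

text \<open>This is the real Jacobian of a holomorphic map with derivative \<open>c\<close>.\<close>

lemma det_matrix_mult: "det (matrix (\<lambda>h. vec_of_complex (c * complex_of_vec h))) = (cmod c)\<^sup>2"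
  unfolding cmod_power2
  by (simp add: det_2 matrix_def complex_of_vec_def vec_of_complex_def vector_2 axis_def complex_eq_iff power2_eq_square)

lemma emeasure_hyp: "T \<in> sets borel \<Longrightarrow> emeasure hyp T = (\<integral>\<^sup>+v. indicator (complex_of_vec -` (T \<inter> uhp)) v * ennreal (1 / (v$2)\<^sup>2) \<partial>lborel)"
proof -
  assume [measurable]: "T \<in> sets borel"
  have "emeasure hyp T = (\<integral>\<^sup>+z. ennreal (indicator uhp z / (Im z)\<^sup>2) * indicator T z \<partial>lborel)"
    unfolding hyp_def by (rule emeasure_density) measurable
  also have "\<dots> = (\<integral>\<^sup>+z. ennreal (indicator uhp z / (Im z)\<^sup>2) * indicator T z \<partial>distr lborel borel complex_of_vec)"
    by (simp add: lborel_distr_complex_of_vec)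
  also have "\<dots> = (\<integral>\<^sup>+v. ennreal (indicator uhp (complex_of_vec v) / (Im (complex_of_vec v))\<^sup>2) * indicator T (complex_of_vec v) \<partial>lborel)"
    by (rule nn_integral_distr) measurable
  also have "\<dots> = (\<integral>\<^sup>+v. indicator (complex_of_vec -` (T \<inter> uhp)) v * ennreal (1 / (v$2)\<^sup>2) \<partial>lborel)"
    by (intro nn_integral_cong) (auto simp: indicator_def complex_of_vec_def)
  finally show ?thesis .
qed

lemma moebius_image_vimage:
  assumes "det A > 0" "S \<subseteq> uhp"
  shows "moebius A ` S = moebius (adj2 A) -` S \<inter> uhp"
proof (intro equalityI subsetI)
  fix z assume "z \<in> moebius A ` S"
  then show "z \<in> moebius (adj2 A) -` S \<inter> uhp"
    using assms by (auto simp: moebius_adj2 subset_iff)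
next
  fix z assume "z \<in> moebius (adj2 A) -` S \<inter> uhp"
  then show "z \<in> moebius A ` S"
    using assms by (auto intro!: image_eqI[where x = "moebius (adj2 A) z"] simp: moebius_adj2)
qed

lemma moebius_image_borel:
  assumes "det A > 0" "S \<subseteq> uhp" "S \<in> sets borel"
  shows "moebius A ` S \<in> sets borel"
proof -
  have [measurable]: "S \<in> sets borel" by fact
  have "moebius (adj2 A) -` S \<inter> space borel \<in> sets borel"
    by (rule measurable_sets[OF moebius_measurable]) fact
  then show ?thesis
    unfolding moebius_image_vimage[OF assms(1,2)] by (simp add: sets.Int)
qed

text \<open>The Jacobian of \<open>moebius A\<close> is the square of the factor
  \<open>det A / |mden A z|^2\<close> by which the imaginary part changes, so it cancels in dx dy /
  y^2. The bounds on \<open>S\<close> and on the density make the density absolutely integrable, as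
  the change of variables theorem demands.\<close>

lemma emeasure_hyp_moebius_image_bounded:
  assumes A: "det A > 0" and S: "S \<subseteq> uhp" "S \<in> sets borel" "bounded S"
    and B: "\<And>z. z \<in> S \<Longrightarrow> 1 / (Im z)\<^sup>2 \<le> B"
  shows "emeasure hyp (moebius A ` S) = emeasure hyp S"
proof -
  define V where "V = complex_of_vec -` S"
  define G where "G = (\<lambda>v. vec_of_complex (moebius A (complex_of_vec v)))"
  define q :: "real^2 \<Rightarrow> real" where "q = (\<lambda>v. 1 / (v$2)\<^sup>2)"
  have [measurable]: "q \<in> borel_measurable borel" unfolding q_def by measurable
  have Veq: "V = vec_of_complex ` S" unfolding V_def by (auto intro: image_eqI[where x = "complex_of_vec _"])
  have Vb: "V \<in> sets borel"
    using measurable_sets[OF measurable_complex_of_vec S(2)] by (simp add: V_def)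
  have bV: "bounded V" unfolding Veq
    using S(3) linear_vec_of_complex bounded_linear_image linear_conv_bounded_linear by blast
  have cmV: "V \<in> lmeasurable"
    using bV Vb by (intro bounded_set_imp_lmeasurable) auto
  have qint: "q absolutely_integrable_on V"
  proof (rule measurable_bounded_by_integrable_imp_absolutely_integrable[where g = "\<lambda>_. B"])
    show "q \<in> borel_measurable (lebesgue_on V)"
      by (intro measurable_restrict_space1 measurable_completion) simp
    show "(\<lambda>_. B) integrable_on V" using cmV by (rule integrable_on_const)
    show "norm (q v) \<le> B" if "v \<in> V" for v
      using B[of "complex_of_vec v"] that by (simp add: V_def q_def complex_of_vec_def)
  qed (use Vb in auto)
  have GV: "G ` V = complex_of_vec -` (moebius A ` S)"
  proof -
    have "G ` V = vec_of_complex ` moebius A ` S" unfolding Veq G_def by (simp add: image_image)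
    also have "\<dots> = complex_of_vec -` (moebius A ` S)" by (auto intro: image_eqI[where x = "complex_of_vec _"])
    finally show ?thesis .
  qed
  define c where "c = (\<lambda>v. of_int (det A) / (mden A (complex_of_vec v))\<^sup>2)"
  have der: "(G has_derivative (\<lambda>h. vec_of_complex (c v * complex_of_vec h))) (at v within V)" if "v \<in> V" for v
  proof -
    have "complex_of_vec v \<in> uhp" using that S by (auto simp: V_def)
    from moebius_has_field_derivative[OF A this]
    have "(moebius A has_derivative (*) (c v)) (at (complex_of_vec v))"
      by (simp add: has_field_derivative_def c_def)
    moreover have "(complex_of_vec has_derivative complex_of_vec) (at v within V)"
      using linear_complex_of_vec by (simp add: bounded_linear_imp_has_derivative linear_conv_bounded_linear)
    ultimately have "((moebius A \<circ> complex_of_vec) has_derivative ((*) (c v) \<circ> complex_of_vec)) (at v within V)"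
      by (rule diff_chain_within[rotated, OF has_derivative_at_withinI])
    moreover have "(vec_of_complex has_derivative vec_of_complex) (at ((moebius A \<circ> complex_of_vec) v) within (moebius A \<circ> complex_of_vec) ` V)"
      using linear_vec_of_complex by (simp add: bounded_linear_imp_has_derivative linear_conv_bounded_linear)
    ultimately have "((vec_of_complex \<circ> (moebius A \<circ> complex_of_vec)) has_derivative (vec_of_complex \<circ> ((*) (c v) \<circ> complex_of_vec))) (at v within V)"
      by (rule diff_chain_within)
    then show ?thesis by (simp add: G_def o_def)
  qed
  have inj: "inj_on G V"
  proof (rule inj_onI)
    fix v w assume vw: "v \<in> V" "w \<in> V" "G v = G w"
    then have "moebius A (complex_of_vec v) = moebius A (complex_of_vec w)"
      unfolding G_def by (metis complex_of_vec_of_complex)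
    then have "complex_of_vec v = complex_of_vec w"
      using vw S moebius_adj2(1)[OF A] unfolding V_def by (metis vimage_eq subsetD)
    then show "v = w" by (metis vec_of_complex_of_vec)
  qed
  have jac: "(cmod (c v))\<^sup>2 * q (G v) = q v" if "v \<in> V" for v
  proof -
    have u: "complex_of_vec v \<in> uhp" using that S by (auto simp: V_def)
    then have m: "cmod (mden A (complex_of_vec v)) \<noteq> 0" "v $ 2 > 0" using A mden_nonzero by (auto simp: uhp_def complex_of_vec_def)
    have G2: "G v $ 2 = of_int (det A) * v $ 2 / (cmod (mden A (complex_of_vec v)))\<^sup>2"
      by (simp add: G_def vec_of_complex_def vector_2 Im_moebius complex_of_vec_def)
    have c2: "(cmod (c v))\<^sup>2 = (of_int (det A) / (cmod (mden A (complex_of_vec v)))\<^sup>2)\<^sup>2"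
      using A by (simp add: c_def norm_divide norm_power)
    show ?thesis using A m unfolding q_def G2 c2
      by (simp add: field_simps)
  qed
  have Vleb: "V \<in> sets lebesgue" using Vb by simp
  \<comment> \<open>The change of variables theorem concerns vector-valued functions, so the scalar
    density is viewed as a map into \<open>real ^ 1\<close>.\<close>
  define f :: "real^2 \<Rightarrow> real^1" where "f = (\<lambda>v. vec (q v))"
  have cov: "f absolutely_integrable_on (G ` V) \<and> integral (G ` V) f = vec (integral V q)"
  proof -
    have 1: "(\<lambda>v. \<bar>det (matrix (\<lambda>h. vec_of_complex (c v * complex_of_vec h)))\<bar> *\<^sub>R f (G v)) absolutely_integrable_on V
        \<longleftrightarrow> f absolutely_integrable_on V"
      by (rule absolutely_integrable_spike_eq[where S = "{}"])
         (auto simp: det_matrix_mult f_def vec_eq_iff jac)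
    have 2: "integral V (\<lambda>v. \<bar>det (matrix (\<lambda>h. vec_of_complex (c v * complex_of_vec h)))\<bar> *\<^sub>R f (G v)) = integral V f"
      by (rule integral_cong) (auto simp: det_matrix_mult f_def vec_eq_iff jac)
    have 3: "f absolutely_integrable_on V"
      unfolding absolutely_integrable_on_1_iff using qint by (simp add: f_def)
    have 4: "integral V f = vec (integral V q)"
      using integral_on_1_eq[of V f] by (simp add: f_def)
    show ?thesis
      using has_absolute_integral_change_of_variables[OF Vleb der inj, of f "vec (integral V q)"] 1 2 3 4 by simp
  qed
  have hq1: "(q has_integral integral V q) V"
    using qint by (simp add: absolutely_integrable_on_def has_integral_integral)
  have hq2: "(q has_integral integral V q) (G ` V)"
  proof -
    have "q absolutely_integrable_on (G ` V)"
      using cov unfolding absolutely_integrable_on_1_iff by (simp add: f_def)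
    moreover have "vec (integral (G ` V) q) = (vec (integral V q) :: real^1)"
      using cov integral_on_1_eq[of "G ` V" f] by (simp add: f_def)
    then have "integral (G ` V) q = integral V q" by (simp add: vec_eq_iff)
    ultimately show ?thesis by (metis absolutely_integrable_on_def has_integral_integral)
  qed
  have "emeasure hyp S = (\<integral>\<^sup>+v. indicator V v * ennreal (q v) \<partial>lborel)"
    using S by (simp add: emeasure_hyp V_def q_def Int_absorb2)
  also have "\<dots> = (\<integral>\<^sup>+v. ennreal (indicator V v * q v) \<partial>lborel)"
    by (intro nn_integral_cong) (auto simp: indicator_def)
  also have "\<dots> = ennreal (integral V q)"
    by (rule nn_integral_has_integral_lebesgue[OF _ hq1]) (simp add: q_def)
  also have "\<dots> = (\<integral>\<^sup>+v. ennreal (indicator (G ` V) v * q v) \<partial>lborel)"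
    by (rule nn_integral_has_integral_lebesgue[OF _ hq2, symmetric]) (simp add: q_def)
  also have "\<dots> = (\<integral>\<^sup>+v. indicator (G ` V) v * ennreal (q v) \<partial>lborel)"
    by (intro nn_integral_cong) (auto simp: indicator_def)
  also have "\<dots> = emeasure hyp (moebius A ` S)"
  proof -
    have "moebius A ` S \<subseteq> uhp" using A S by auto
    then show ?thesis using moebius_image_borel[OF A S(1,2)]
      by (simp add: emeasure_hyp GV q_def Int_absorb2)
  qed
  finally show ?thesis by simp
qed

lemma emeasure_hyp_moebius_image:
  assumes A: "det A > 0" and S: "S \<subseteq> uhp" "S \<in> sets borel"
  shows "emeasure hyp (moebius A ` S) = emeasure hyp S"
proof -
  \<comment> \<open>Exhaustion of \<open>S\<close> by bounded sets that keep away from the real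
    axis: on \<open>T n\<close> the density is at most \<open>n\<close>.\<close>
  define T where "T = (\<lambda>n::nat. S \<inter> {z. cmod z \<le> real n} \<inter> {z. real n * (Im z)\<^sup>2 \<ge> 1})"
  have [measurable]: "S \<in> sets borel" by fact
  have Tb [measurable]: "T n \<in> sets borel" for n unfolding T_def by measurable
  have mono: "incseq T"
    by (rule incseq_SucI) (auto simp: T_def algebra_simps intro: add_increasing)
  have un: "(\<Union>n. T n) = S"
  proof (intro equalityI subsetI)
    fix z assume z: "z \<in> S"
    then have "Im z > 0" using S by (auto simp: uhp_def)
    obtain n :: nat where n: "real n \<ge> max (cmod z) (1 / (Im z)\<^sup>2)"
      using real_arch_simple by blast
    then have "real n * (Im z)\<^sup>2 \<ge> 1" using \<open>Im z > 0\<close> by (simp add: field_simps)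
    with n z show "z \<in> (\<Union>n. T n)" by (auto simp: T_def)
  qed (auto simp: T_def)
  have Tu: "T n \<subseteq> uhp" for n using S by (auto simp: T_def)
  have eq: "emeasure hyp (moebius A ` T n) = emeasure hyp (T n)" for n
  proof (rule emeasure_hyp_moebius_image_bounded[OF A Tu Tb, where B = "real n"])
    show "bounded (T n)" by (rule bounded_subset[of "cball 0 (real n)"]) (auto simp: T_def)
    fix z assume "z \<in> T n"
    moreover then have "Im z > 0" using Tu by (auto simp: uhp_def)
    ultimately show "1 / (Im z)\<^sup>2 \<le> real n" by (auto simp: T_def field_simps)
  qed
  have "emeasure hyp (moebius A ` S) = emeasure hyp (\<Union>n. moebius A ` T n)"
    by (simp add: un[symmetric] image_UN)
  also have "\<dots> = (SUP n. emeasure hyp (moebius A ` T n))"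
  proof (rule SUP_emeasure_incseq[symmetric])
    show "range (\<lambda>i. moebius A ` T i) \<subseteq> sets hyp"
      using moebius_image_borel[OF A Tu Tb] by auto
    show "incseq (\<lambda>i. moebius A ` T i)"
      using mono by (auto simp: incseq_def)
  qed
  also have "\<dots> = (SUP n. emeasure hyp (T n))" by (simp add: eq)
  also have "\<dots> = emeasure hyp S"
    using SUP_emeasure_incseq[of T hyp] mono by (simp add: un image_subset_iff)
  finally show ?thesis .
qed

lemma AE_hyp_uhp: "AE z in hyp. z \<in> uhp"
  unfolding hyp_def by (subst AE_density) (auto simp: indicator_def)

lemma emeasure_hyp_Int_uhp: "T \<in> sets borel \<Longrightarrow> emeasure hyp (T \<inter> uhp) = emeasure hyp T"
  by (rule emeasure_eq_AE) (use AE_hyp_uhp in auto)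

lemma distr_hyp_moebius:
  assumes "det A > 0"
  shows "distr hyp borel (moebius A) = hyp"
proof (rule measure_eqI)
  fix T assume "T \<in> sets (distr hyp borel (moebius A))"
  then have T [measurable]: "T \<in> sets borel" by simp
  have TB: "moebius A -` T \<in> sets borel" using measurable_sets[OF moebius_measurable T] by simp
  have "emeasure (distr hyp borel (moebius A)) T = emeasure hyp (moebius A -` T)"
    by (subst emeasure_distr) (auto simp: borel_measurable_hyp)
  also have "\<dots> = emeasure hyp (moebius A -` (T \<inter> uhp) \<inter> uhp)"
    using assms by (subst emeasure_hyp_Int_uhp[OF TB, symmetric]) (auto intro!: arg_cong[where f = "emeasure hyp"])
  also have "\<dots> = emeasure hyp (moebius (adj2 A) ` (T \<inter> uhp))"
    using assms by (subst moebius_image_vimage) auto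
  also have "\<dots> = emeasure hyp (T \<inter> uhp)"
    using assms by (intro emeasure_hyp_moebius_image) auto
  finally show "emeasure (distr hyp borel (moebius A)) T = emeasure hyp T"
    by (simp add: emeasure_hyp_Int_uhp)
qed simp

lemma nn_integral_hyp_moebius:
  assumes "det A > 0" and [measurable]: "h \<in> borel_measurable borel"
  shows "(\<integral>\<^sup>+z. h (moebius A z) \<partial>hyp) = (\<integral>\<^sup>+z. h z \<partial>hyp)"
proof -
  have "(\<integral>\<^sup>+z. h z \<partial>hyp) = (\<integral>\<^sup>+z. h z \<partial>distr hyp borel (moebius A))"
    by (simp add: distr_hyp_moebius assms)
  also have "\<dots> = (\<integral>\<^sup>+z. h (moebius A z) \<partial>hyp)"
    by (rule nn_integral_distr) (auto simp: borel_measurable_hyp)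
  finally show ?thesis by simp
qed

lemma AE_hyp_moebius:
  assumes "det A > 0" "AE z in hyp. P z"
  shows "AE z in hyp. P (moebius A z)"
  by (rule AE_distrD[of "moebius A" hyp borel])
     (simp_all only: distr_hyp_moebius[OF assms(1)] assms(2) borel_measurable_hyp moebius_measurable)

section \<open>Fundamental domains and unfolding\<close>

definition sl_group :: "(int ^ 2 ^ 2) set \<Rightarrow> bool" where
  "sl_group G \<longleftrightarrow> mat 1 \<in> G \<and> (\<forall>A\<in>G. det A = 1 \<and> adj2 A \<in> G \<and> (\<forall>B\<in>G. A ** B \<in> G))"

lemma sl_groupD:
  assumes "sl_group G"
  shows "mat 1 \<in> G" "A \<in> G \<Longrightarrow> det A = 1" "A \<in> G \<Longrightarrow> adj2 A \<in> G" "A \<in> G \<Longrightarrow> B \<in> G \<Longrightarrow> A ** B \<in> G"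
  using assms by (auto simp: sl_group_def)

definition invariant_under :: "(int ^ 2 ^ 2) set \<Rightarrow> (complex \<Rightarrow> 'a) \<Rightarrow> bool" where
  "invariant_under G h \<longleftrightarrow> (\<forall>A\<in>G. \<forall>z\<in>uhp. h (moebius A z) = h z)"

text \<open>The sum runs over matrices, not over transformations, and only almost everywhere: the sign and
  the elliptic points then merely affect the constant and a null set.\<close>

definition weight :: "(int ^ 2 ^ 2) set \<Rightarrow> (complex \<Rightarrow> ennreal) \<Rightarrow> ennreal \<Rightarrow> bool" where
  "weight G \<phi> c \<longleftrightarrow> \<phi> \<in> borel_measurable borel \<and>
     (AE z in hyp. (\<integral>\<^sup>+A. \<phi> (moebius A z) \<partial>count_space G) = c)"

text \<open>Unfolding twice: insert the constant sum of \<open>\<psi>\<close> over the group into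
  the integral of \<open>\<phi> * h\<close>, move each \<open>A\<close> over to
  \<open>\<phi>\<close> by invariance of the measure and of \<open>h\<close>, and collect the sum of
  \<open>\<phi>\<close>. Integrals of an invariant function against any two weights are therefore
  proportional.\<close>

lemma weight_unfold:
  assumes G: "sl_group G" and w1: "weight G \<phi> c" and w2: "weight G \<psi> d"
    and h [measurable]: "h \<in> borel_measurable borel" and inv: "invariant_under G h"
  shows "d * (\<integral>\<^sup>+z. \<phi> z * h z \<partial>hyp) = c * (\<integral>\<^sup>+z. \<psi> z * h z \<partial>hyp)"
proof -
  have [measurable]: "\<phi> \<in> borel_measurable borel" "\<psi> \<in> borel_measurable borel"
    using w1 w2 by (auto simp: weight_def)
  have cG: "countable G" by (rule countableI_type)
  have mu: "AE z in hyp. z \<in> uhp" by (rule AE_hyp_uhp)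
  have "d * (\<integral>\<^sup>+z. \<phi> z * h z \<partial>hyp) = (\<integral>\<^sup>+z. d * (\<phi> z * h z) \<partial>hyp)"
    by (rule nn_integral_cmult[symmetric]) (simp add: borel_measurable_hyp)
  also have "\<dots> = (\<integral>\<^sup>+z. (\<integral>\<^sup>+A. \<phi> z * h z * \<psi> (moebius A z) \<partial>count_space G) \<partial>hyp)"
  proof (rule nn_integral_cong_AE)
    from w2 have "AE z in hyp. (\<integral>\<^sup>+A. \<psi> (moebius A z) \<partial>count_space G) = d" by (simp add: weight_def)
    then show "AE z in hyp. d * (\<phi> z * h z) = (\<integral>\<^sup>+A. \<phi> z * h z * \<psi> (moebius A z) \<partial>count_space G)"
      by eventually_elim (subst nn_integral_cmult, auto simp: mult.commute)
  qed
  also have "\<dots> = (\<integral>\<^sup>+A. (\<integral>\<^sup>+z. \<phi> z * h z * \<psi> (moebius A z) \<partial>hyp) \<partial>count_space G)"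
    by (rule nn_integral_count_space_nn_integral[OF cG]) (simp add: borel_measurable_hyp)
  also have "\<dots> = (\<integral>\<^sup>+A. (\<integral>\<^sup>+z. \<phi> (moebius (adj2 A) z) * h z * \<psi> z \<partial>hyp) \<partial>count_space G)"
  proof (rule nn_integral_cong)
    fix A assume "A \<in> space (count_space G)"
    then have A: "A \<in> G" by simp
    then have d: "det (adj2 A) > 0" using sl_groupD[OF G] by simp
    have "(\<integral>\<^sup>+z. \<phi> z * h z * \<psi> (moebius A z) \<partial>hyp)
        = (\<integral>\<^sup>+z. \<phi> (moebius (adj2 A) z) * h (moebius (adj2 A) z) * \<psi> (moebius A (moebius (adj2 A) z)) \<partial>hyp)"
      by (rule nn_integral_hyp_moebius[OF d, symmetric]) measurable
    also have "\<dots> = (\<integral>\<^sup>+z. \<phi> (moebius (adj2 A) z) * h z * \<psi> z \<partial>hyp)"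
      using mu sl_groupD(3)[OF G A] inv d
      by (intro nn_integral_cong_AE) (auto simp: moebius_adj2 invariant_under_def elim!: AE_mp)
    finally show "(\<integral>\<^sup>+z. \<phi> z * h z * \<psi> (moebius A z) \<partial>hyp) = (\<integral>\<^sup>+z. \<phi> (moebius (adj2 A) z) * h z * \<psi> z \<partial>hyp)" .
  qed
  also have "\<dots> = (\<integral>\<^sup>+A. (\<integral>\<^sup>+z. \<phi> (moebius A z) * h z * \<psi> z \<partial>hyp) \<partial>count_space G)"
  proof (rule nn_integral_bij_count_space)
    show "bij_betw adj2 G G"
      by (rule bij_betw_byWitness[where f' = adj2]) (use sl_groupD[OF G] in auto)
  qed
  also have "\<dots> = (\<integral>\<^sup>+z. (\<integral>\<^sup>+A. \<phi> (moebius A z) * h z * \<psi> z \<partial>count_space G) \<partial>hyp)"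
    by (rule nn_integral_count_space_nn_integral[OF cG, symmetric]) (simp add: borel_measurable_hyp)
  also have "\<dots> = (\<integral>\<^sup>+z. c * (\<psi> z * h z) \<partial>hyp)"
  proof (rule nn_integral_cong_AE)
    from w1 have "AE z in hyp. (\<integral>\<^sup>+A. \<phi> (moebius A z) \<partial>count_space G) = c" by (simp add: weight_def)
    then show "AE z in hyp. (\<integral>\<^sup>+A. \<phi> (moebius A z) * h z * \<psi> z \<partial>count_space G) = c * (\<psi> z * h z)"
      by eventually_elim (simp only: mult.assoc, subst nn_integral_multc, auto simp: mult_ac)
  qed
  also have "\<dots> = c * (\<integral>\<^sup>+z. \<psi> z * h z \<partial>hyp)"
    by (rule nn_integral_cmult) (simp add: borel_measurable_hyp)
  finally show ?thesis .
qed

lemma moebius_sl: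
  assumes "sl_group G" "A \<in> G" "z \<in> uhp"
  shows "moebius A z \<in> uhp" "moebius (adj2 A) (moebius A z) = z" "moebius A (moebius (adj2 A) z) = z"
    "det B > 0 \<Longrightarrow> moebius (A ** B) z = moebius A (moebius B z)"
    "det B > 0 \<Longrightarrow> moebius (B ** A) z = moebius B (moebius A z)"
  using sl_groupD(2)[OF assms(1,2)] assms(3) by (simp_all add: moebius_adj2 moebius_mult)

lemma mat2_inv_cancel:
  assumes "det A = 1"
  shows "adj2 A ** (A ** B) = B" "A ** (adj2 A ** B) = B" "(B ** A) ** adj2 A = B" "(B ** adj2 A) ** A = B"
proof -
  show "adj2 A ** (A ** B) = B" "A ** (adj2 A ** B) = B"
    unfolding matrix_mul_assoc adj2_mult[OF assms] by simp_all
  show "(B ** A) ** adj2 A = B" "(B ** adj2 A) ** A = B"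
    unfolding matrix_mul_assoc[symmetric] adj2_mult[OF assms] by simp_all
qed

lemma adj2_mult_rev: "adj2 (A ** B) = adj2 B ** adj2 A"
  by (simp add: mat2_eq_iff mat2_mult_nth algebra_simps)

lemma coset_representatives:
  assumes G: "sl_group G" and H: "sl_group H" and "H \<subseteq> G"
  obtains R where "R \<subseteq> G" "\<And>B. B \<in> G \<Longrightarrow> \<exists>!r. r \<in> R \<and> B ** adj2 r \<in> H"
proof -
  define c where "c = (\<lambda>B. SOME r. r \<in> G \<and> B ** adj2 r \<in> H)"
  have c: "c B \<in> G" "B ** adj2 (c B) \<in> H" if "B \<in> G" for B
  proof -
    have "B ** adj2 B \<in> H"
      unfolding adj2_mult(2)[OF sl_groupD(2)[OF G that]] by (rule sl_groupD(1)[OF H])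
    with that have "c B \<in> G \<and> B ** adj2 (c B) \<in> H" unfolding c_def
      by (intro someI[where P = "\<lambda>r. r \<in> G \<and> B ** adj2 r \<in> H" and x = B]) simp
    then show "c B \<in> G" "B ** adj2 (c B) \<in> H" by auto
  qed
  have tr: "A ** adj2 C \<in> H" if "A ** adj2 B \<in> H" "B ** adj2 C \<in> H" "A \<in> G" "B \<in> G" for A B C
  proof -
    have "(A ** adj2 B) ** (B ** adj2 C) = A ** (adj2 B ** (B ** adj2 C))"
      by (simp only: matrix_mul_assoc)
    also have "\<dots> = A ** adj2 C"
      unfolding mat2_inv_cancel(1)[OF sl_groupD(2)[OF G that(4)]] ..
    finally show ?thesis using sl_groupD(4)[OF H that(1,2)] by simp
  qed
  have sy: "B ** adj2 A \<in> H" if "A ** adj2 B \<in> H" for A B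
    using sl_groupD(3)[OF H that] unfolding adj2_mult_rev adj2_adj2 .
  \<comment> \<open>On one coset the predicates under \<open>SOME\<close> coincide, so
    \<open>c\<close> is constant there; this is what makes the representative unique.\<close>
  have cc: "c A = c B" if "A \<in> G" "B \<in> G" "A ** adj2 B \<in> H" for A B
  proof -
    have "(r \<in> G \<and> A ** adj2 r \<in> H) = (r \<in> G \<and> B ** adj2 r \<in> H)" for r
      using tr[of A B r] tr[of B A r] sy[of A B] that by blast
    then show ?thesis by (simp add: c_def)
  qed
  show thesis
  proof (rule that[of "c ` G"])
    fix B assume B: "B \<in> G"
    show "\<exists>!r. r \<in> c ` G \<and> B ** adj2 r \<in> H"
    proof (rule ex1I[of _ "c B"])
      fix r assume r: "r \<in> c ` G \<and> B ** adj2 r \<in> H"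
      then obtain A where A: "A \<in> G" "r = c A" by blast
      have "B ** adj2 A \<in> H" using tr[of B "c A" A] sy c[OF A(1)] A r B by blast
      then show "r = c B" using cc[of A B] sy A B by blast
    qed (use c B in auto)
  qed (use c in auto)
qed

lemma nn_integral_count_space_Int:
  "(\<integral>\<^sup>+x. f x * indicator S x \<partial>count_space G) = (\<integral>\<^sup>+x. f x \<partial>count_space (G \<inter> S))"
proof -
  have "(\<integral>\<^sup>+x. f x * indicator S x \<partial>count_space G) = (\<integral>\<^sup>+x. f x * indicator S x * indicator G x \<partial>count_space UNIV)"
    by (rule nn_integral_count_space_indicator) simp
  also have "\<dots> = (\<integral>\<^sup>+x. f x * indicator (G \<inter> S) x \<partial>count_space UNIV)"
    by (intro nn_integral_cong) (auto simp: indicator_def)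
  also have "\<dots> = (\<integral>\<^sup>+x. f x \<partial>count_space (G \<inter> S))"
    by (rule nn_integral_count_space_indicator[symmetric]) simp
  finally show ?thesis .
qed

text \<open>Each element of \<open>G\<close> is \<open>A ** r\<close> for exactly one representative
  \<open>r\<close> and some \<open>A\<close> in \<open>H\<close>. The sum over \<open>G\<close>
  splits into sums over \<open>H\<close> taken at the points \<open>moebius r z\<close>, and each of
  them is \<open>c\<close> for almost every \<open>z\<close> because \<open>moebius r\<close>
  respects null sets. An infinite index is allowed, hence the counting measure of
  \<open>R\<close>.\<close>

lemma weight_supergroup:
  assumes G: "sl_group G" and H: "sl_group H" and HG: "H \<subseteq> G" and w: "weight H \<phi> c"
    and R: "R \<subseteq> G" "\<And>B. B \<in> G \<Longrightarrow> \<exists>!r. r \<in> R \<and> B ** adj2 r \<in> H"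
  shows "weight G \<phi> (c * emeasure (count_space UNIV) R)"
proof -
  have [measurable]: "\<phi> \<in> borel_measurable borel" using w by (simp add: weight_def)
  define good where "good z \<longleftrightarrow> (\<integral>\<^sup>+A. \<phi> (moebius A z) \<partial>count_space H) = c" for z
  have "AE z in hyp. \<forall>r\<in>R. good (moebius r z)"
    unfolding AE_ball_countable[OF countableI_type]
  proof
    fix r assume "r \<in> R"
    then have "det r > 0" using R(1) sl_groupD(2)[OF G] by (auto dest!: subsetD)
    moreover have "AE z in hyp. good z" using w by (simp add: weight_def good_def)
    ultimately show "AE z in hyp. good (moebius r z)" by (rule AE_hyp_moebius)
  qed
  with AE_hyp_uhp have "AE z in hyp. (\<integral>\<^sup>+A. \<phi> (moebius A z) \<partial>count_space G) = c * emeasure (count_space UNIV) R"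
  proof eventually_elim
    fix z assume z: "z \<in> uhp" "\<forall>r\<in>R. good (moebius r z)"
    have "(\<integral>\<^sup>+B. \<phi> (moebius B z) \<partial>count_space G)
        = (\<integral>\<^sup>+B. \<integral>\<^sup>+r. \<phi> (moebius B z) * indicator {r. B ** adj2 r \<in> H} r \<partial>count_space R \<partial>count_space G)"
    proof (rule nn_integral_cong)
      fix B assume "B \<in> space (count_space G)"
      then obtain r where r: "{r \<in> R. B ** adj2 r \<in> H} = {r}" using R(2)[of B] by auto
      then have "r \<in> R" by auto
      have "(\<integral>\<^sup>+r. \<phi> (moebius B z) * indicator {r. B ** adj2 r \<in> H} r \<partial>count_space R)
          = (\<integral>\<^sup>+r. \<phi> (moebius B z) * indicator {r \<in> R. B ** adj2 r \<in> H} r \<partial>count_space R)"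
        by (intro nn_integral_cong) (auto simp: indicator_def)
      also have "\<dots> = \<phi> (moebius B z)"
        using \<open>r \<in> R\<close> unfolding r by (subst nn_integral_cmult_indicator) auto
      finally show "\<phi> (moebius B z) = (\<integral>\<^sup>+r. \<phi> (moebius B z) * indicator {r. B ** adj2 r \<in> H} r \<partial>count_space R)" ..
    qed
    also have "\<dots> = (\<integral>\<^sup>+r. \<integral>\<^sup>+B. \<phi> (moebius B z) * indicator {r. B ** adj2 r \<in> H} r \<partial>count_space G \<partial>count_space R)"
      by (rule nn_integral_count_space_nn_integral) (auto intro: countableI_type)
    also have "\<dots> = (\<integral>\<^sup>+r. c \<partial>count_space R)"
    proof (rule nn_integral_cong)
      fix r assume "r \<in> space (count_space R)"
      then have r: "r \<in> R" "r \<in> G" using R(1) by auto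
      then have dr: "det r = 1" using sl_groupD(2)[OF G] by blast
      have "(\<integral>\<^sup>+B. \<phi> (moebius B z) * indicator {r. B ** adj2 r \<in> H} r \<partial>count_space G)
          = (\<integral>\<^sup>+B. \<phi> (moebius B z) * indicator {B. B ** adj2 r \<in> H} B \<partial>count_space G)"
        by (intro nn_integral_cong) (auto simp: indicator_def)
      also have "\<dots> = (\<integral>\<^sup>+B. \<phi> (moebius B z) \<partial>count_space {B\<in>G. B ** adj2 r \<in> H})"
        by (subst nn_integral_count_space_Int) (simp add: Collect_conj_eq)
      also have "\<dots> = (\<integral>\<^sup>+A. \<phi> (moebius (A ** r) z) \<partial>count_space H)"
      proof (rule nn_integral_bij_count_space[symmetric])
        show "bij_betw (\<lambda>A. A ** r) H {B\<in>G. B ** adj2 r \<in> H}"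
          by (rule bij_betw_byWitness[where f' = "\<lambda>B. B ** adj2 r"])
             (use mat2_inv_cancel[OF dr] sl_groupD[OF G] HG r in auto)
      qed
      also have "\<dots> = (\<integral>\<^sup>+A. \<phi> (moebius A (moebius r z)) \<partial>count_space H)"
        using dr z sl_groupD(2)[OF H] by (intro nn_integral_cong) (auto simp: moebius_mult)
      also have "\<dots> = c" using z r by (auto simp: good_def)
      finally show "(\<integral>\<^sup>+B. \<phi> (moebius B z) * indicator {r. B ** adj2 r \<in> H} r \<partial>count_space G) = c" .
    qed
    also have "\<dots> = c * emeasure (count_space UNIV) R"
      by (simp add: emeasure_count_space)
    finally show "(\<integral>\<^sup>+A. \<phi> (moebius A z) \<partial>count_space G) = c * emeasure (count_space UNIV) R" .
  qed
  then show ?thesis by (simp add: weight_def)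
qed

subsection \<open>Elliptic points form a null set\<close>

text \<open>A fixed point is a root of \<open>c z^2 + (d - a) z - b\<close>, and this polynomial is
  zero only for plus and minus the identity.\<close>

lemma finite_fixed_points:
  assumes "det A = 1" "A \<noteq> mat 1" "A \<noteq> mk2 (-1) 0 0 (-1)"
  shows "finite {z\<in>uhp. moebius A z = z}"
proof -
  define q :: "complex poly" where
    "q = [:of_int (- A$1$2), of_int (A$2$2 - A$1$1), of_int (A$2$1):]"
  have "q \<noteq> 0"
  proof
    assume "q = 0"
    then have 0: "A$1$2 = 0" "A$2$2 = A$1$1" "A$2$1 = 0" by (auto simp: q_def)
    with assms(1) have "A$1$1 * A$1$1 = 1" by (simp add: det_2)
    then have "A$1$1 = 1 \<or> A$1$1 = -1" by (simp add: zmult_eq_1_iff)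
    with 0 assms show False by (auto simp: mat2_eq_iff)
  qed
  then have "finite {z. poly q z = 0}" by (rule poly_roots_finite)
  moreover have "{z\<in>uhp. moebius A z = z} \<subseteq> {z. poly q z = 0}"
  proof clarify
    fix z assume z: "z \<in> uhp" "moebius A z = z"
    then have "of_int (A$1$1) * z + of_int (A$1$2) = z * mden A z"
      using mden_nonzero[of A z] assms(1) unfolding moebius_def mden_def[symmetric]
      by (simp add: divide_eq_eq)
    moreover have "poly q z = z * mden A z - (of_int (A$1$1) * z + of_int (A$1$2))"
      by (simp add: q_def mden_def algebra_simps)
    ultimately show "poly q z = 0" by simp
  qed
  ultimately show ?thesis by (rule finite_subset[rotated])
qed

lemma finite_null_hyp: "finite S \<Longrightarrow> AE z in hyp. z \<notin> S"
  unfolding hyp_def by (subst AE_density) (auto intro!: AE_I'[of S] simp: finite_imp_null_set_lborel)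

lemma AE_hyp_not_elliptic:
  "AE z in hyp. \<forall>A. det A = 1 \<and> moebius A z = z \<longrightarrow> A = mat 1 \<or> A = mk2 (-1) 0 0 (-1)"
proof -
  have 1: "AE z in hyp. z \<in> uhp \<longrightarrow> (det A = 1 \<and> moebius A z = z \<longrightarrow> A = mat 1 \<or> A = mk2 (-1) 0 0 (-1))" for A
  proof (cases "det A = 1 \<and> A \<noteq> mat 1 \<and> A \<noteq> mk2 (-1) 0 0 (-1)")
    case True
    then have "AE z in hyp. z \<notin> {z\<in>uhp. moebius A z = z}"
      by (intro finite_null_hyp finite_fixed_points) auto
    then show ?thesis by (elim AE_mp) auto
  next
    case False
    then show ?thesis by (intro AE_I2) auto
  qed
  have "AE z in hyp. \<forall>A. z \<in> uhp \<longrightarrow> (det A = 1 \<and> moebius A z = z \<longrightarrow> A = mat 1 \<or> A = mk2 (-1) 0 0 (-1))"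
    unfolding AE_all_countable using 1 by blast
  with AE_hyp_uhp show ?thesis by eventually_elim blast
qed

definition fdomain :: "(int ^ 2 ^ 2) set \<Rightarrow> complex set \<Rightarrow> bool" where
  "fdomain G F \<longleftrightarrow> F \<in> sets borel \<and> F \<subseteq> uhp \<and>
     (\<forall>z\<in>uhp. \<exists>!w. w \<in> F \<and> (\<exists>A\<in>G. w = moebius A z))"

text \<open>The number of matrices in \<open>G\<close> acting trivially, 1 or 2 for a group: the
  factor by which sums over matrices overcount sums over transformations.\<close>

definition centre_card :: "(int ^ 2 ^ 2) set \<Rightarrow> nat" where
  "centre_card G = card (G \<inter> {mat 1, mk2 (-1) 0 0 (-1)})"

lemma centre_card_pos: "sl_group G \<Longrightarrow> centre_card G > 0"
  unfolding centre_card_def by (subst card_gt_0_iff) (use sl_groupD(1) in auto)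

text \<open>For almost every \<open>z\<close> the stabilizer consists of plus and minus the identity
  only. The matrices of \<open>G\<close> that carry \<open>z\<close> into \<open>F\<close> then form
  a single coset \<open>A0 ** e\<close> of the trivially acting ones.\<close>

lemma weight_fdomain:
  assumes G: "sl_group G" and F: "fdomain G F"
  shows "weight G (indicator F) (of_nat (centre_card G))"
proof -
  have "AE z in hyp. (\<integral>\<^sup>+A. indicator F (moebius A z) \<partial>count_space G) = of_nat (centre_card G)"
    using AE_hyp_uhp AE_hyp_not_elliptic
  proof eventually_elim
    fix z assume z: "z \<in> uhp" and ne: "\<forall>A. det A = 1 \<and> moebius A z = z \<longrightarrow> A = mat 1 \<or> A = mk2 (-1) 0 0 (-1)"
    obtain w where w: "w \<in> F" "\<exists>A\<in>G. w = moebius A z" and u: "\<And>w'. w' \<in> F \<Longrightarrow> \<exists>A\<in>G. w' = moebius A z \<Longrightarrow> w' = w"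
    proof -
      have "\<exists>!w. w \<in> F \<and> (\<exists>A\<in>G. w = moebius A z)" using F z by (simp add: fdomain_def)
      then show ?thesis by (rule ex1E) (rule that, blast+)
    qed
    from w(2) obtain A0 where A0: "A0 \<in> G" "w = moebius A0 z" by blast
    have d0: "det A0 = 1" using sl_groupD(2)[OF G A0(1)] .
    have eq: "{A\<in>G. moebius A z \<in> F} = (\<lambda>e. A0 ** e) ` (G \<inter> {mat 1, mk2 (-1) 0 0 (-1)})"
    proof (intro equalityI subsetI)
      fix A assume A: "A \<in> {A\<in>G. moebius A z \<in> F}"
      then have "moebius A z = moebius A0 z" using u[of "moebius A z"] A0 by blast
      then have "moebius (adj2 A0 ** A) z = z"
        using A A0 z by (simp add: moebius_sl[OF G] sl_groupD[OF G])
      moreover have "adj2 A0 ** A \<in> G" using A A0 sl_groupD[OF G] by auto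
      ultimately have "adj2 A0 ** A \<in> G \<inter> {mat 1, mk2 (-1) 0 0 (-1)}" using ne sl_groupD[OF G] by auto
      then show "A \<in> (\<lambda>e. A0 ** e) ` (G \<inter> {mat 1, mk2 (-1) 0 0 (-1)})"
        by (rule image_eqI[rotated]) (simp add: mat2_inv_cancel[OF d0])
    next
      fix A assume "A \<in> (\<lambda>e. A0 ** e) ` (G \<inter> {mat 1, mk2 (-1) 0 0 (-1)})"
      then obtain e where e: "e \<in> G" "e = mat 1 \<or> e = mk2 (-1) 0 0 (-1)" "A = A0 ** e" by auto
      then have "moebius e z = z" by (auto simp: moebius_def)
      then show "A \<in> {A\<in>G. moebius A z \<in> F}"
        using e(3) A0 z w(1) sl_groupD(2)[OF G e(1)] sl_groupD(4)[OF G A0(1) e(1)] by (simp add: moebius_sl[OF G])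
    qed
    have inj: "inj_on (\<lambda>e. A0 ** e) (G \<inter> {mat 1, mk2 (-1) 0 0 (-1)})"
      by (rule inj_on_inverseI[where g = "\<lambda>B. adj2 A0 ** B"]) (simp add: mat2_inv_cancel[OF d0])
    have "(\<integral>\<^sup>+A. indicator F (moebius A z) \<partial>count_space G) = (\<integral>\<^sup>+A. indicator {A\<in>G. moebius A z \<in> F} A \<partial>count_space G)"
      by (intro nn_integral_cong) (auto simp: indicator_def)
    also have "\<dots> = emeasure (count_space G) {A\<in>G. moebius A z \<in> F}"
      by (rule nn_integral_indicator) auto
    also have "\<dots> = of_nat (card {A\<in>G. moebius A z \<in> F})"
    proof (rule emeasure_count_space_finite)
      show "finite {A\<in>G. moebius A z \<in> F}" by (simp add: eq)
    qed auto
    also have "card {A\<in>G. moebius A z \<in> F} = centre_card G"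
      unfolding eq centre_card_def by (rule card_image[OF inj])
    finally show "(\<integral>\<^sup>+A. indicator F (moebius A z) \<partial>count_space G) = of_nat (centre_card G)" .
  qed
  then show ?thesis using F by (auto simp: weight_def fdomain_def)
qed

subsection \<open>Existence and volume of fundamental domains\<close>

text \<open>Orbit representatives are chosen closest to the point $2i$: $\cosh$ of the distance from
  $2i$ to $w$ is \<open>(cmod w)\<^sup>2 + 4\<close> over \<open>4 * Im w\<close>.\<close>

definition dist2i :: "complex \<Rightarrow> real" where
  "dist2i w = ((cmod w)\<^sup>2 + 4) / Im w"

text \<open>Ties in the distance are broken by the coordinates, which gives a total order and hence
  at most one least point in each orbit.\<close>

definition closer :: "complex \<Rightarrow> complex \<Rightarrow> bool" where
  "closer z w \<longleftrightarrow> dist2i z < dist2i w \<or>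
     dist2i z = dist2i w \<and> (Im z < Im w \<or> Im z = Im w \<and> Re z \<le> Re w)"

lemma closer_refl [simp]: "closer z z"
  by (simp add: closer_def)

lemma closer_trans: "closer x y \<Longrightarrow> closer y z \<Longrightarrow> closer x z"
  unfolding closer_def by linarith

lemma closer_antisym: "closer x y \<Longrightarrow> closer y x \<Longrightarrow> x = y"
  unfolding closer_def complex_eq_iff by linarith

lemma closer_linear: "closer x y \<or> closer y x"
  unfolding closer_def by linarith

lemma finite_closer_minimum:
  assumes "finite S" "S \<noteq> {}"
  shows "\<exists>w\<in>S. \<forall>v\<in>S. closer w v"
  using assms
proof (induction S rule: finite_ne_induct)
  case (singleton x)
  then show ?case by simp
next
  case (insert x S)
  then obtain w where w: "w \<in> S" "\<forall>v\<in>S. closer w v" by blast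
  show ?case
  proof (cases "closer x w")
    case True
    then have "\<forall>v\<in>insert x S. closer x v" using w closer_trans[of x w] by auto
    then show ?thesis by blast
  next
    case False
    then have "closer w x" using closer_linear[of x w] by blast
    then show ?thesis using w by blast
  qed
qed

lemma abs_le_of_linear_form:
  fixes a b :: int
  assumes "z \<in> uhp" "cmod (of_int a * z + of_int b) \<le> K"
  shows "\<bar>real_of_int a\<bar> \<le> K / Im z" "\<bar>real_of_int b\<bar> \<le> K + K / Im z * cmod z"
proof -
  have y: "Im z > 0" using assms by (simp add: uhp_def)
  have "\<bar>Im (of_int a * z + of_int b)\<bar> \<le> K"
    using abs_Im_le_cmod[of "of_int a * z + of_int b"] assms(2) by linarith
  then have "\<bar>real_of_int a\<bar> * Im z \<le> K" using y by (simp add: abs_mult)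
  then show a: "\<bar>real_of_int a\<bar> \<le> K / Im z" using y by (simp add: field_simps)
  have "\<bar>real_of_int b\<bar> = cmod ((of_int a * z + of_int b) - of_int a * z)" by simp
  also have "\<dots> \<le> cmod (of_int a * z + of_int b) + cmod (of_int a * z)" by (rule norm_triangle_ineq4)
  also have "cmod (of_int a * z) = \<bar>real_of_int a\<bar> * cmod z" by (simp add: norm_mult)
  also have "cmod (of_int a * z + of_int b) + \<bar>real_of_int a\<bar> * cmod z \<le> K + K / Im z * cmod z"
    using a assms(2) by (intro add_mono mult_right_mono) auto
  finally show "\<bar>real_of_int b\<bar> \<le> K + K / Im z * cmod z" .
qed

text \<open>A bounded distance bounds the image \<open>w\<close> from above and its imaginary part
  from below. This bounds numerator and denominator of \<open>moebius A z\<close>, two linear forms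
  in \<open>z\<close> with integer coefficients.\<close>

lemma finite_dist2i_le:
  assumes z: "z \<in> uhp"
  shows "finite {A. det A = 1 \<and> dist2i (moebius A z) \<le> K}"
proof -
  \<comment> \<open>\<open>B\<close> bounds the denominator, whose square is at most
    \<open>K * Im z / 4\<close>; \<open>K * B\<close> bounds the numerator since the image has
    modulus at most \<open>K\<close>; \<open>D\<close> then bounds all entries by
    \<open>abs_le_of_linear_form\<close>.\<close>
  define B where "B = K * Im z / 4 + 1"
  define C where "C = max (K * B) B"
  define D where "D = \<lceil>max (C / Im z) (C + C / Im z * cmod z)\<rceil>"
  have bd: "\<bar>A$1$1\<bar> \<le> D \<and> \<bar>A$1$2\<bar> \<le> D \<and> \<bar>A$2$1\<bar> \<le> D \<and> \<bar>A$2$2\<bar> \<le> D"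
    if A: "det A = 1" "dist2i (moebius A z) \<le> K" for A
  proof -
    define w where "w = moebius A z"
    have w: "Im w > 0" "w \<in> uhp" using A z unfolding w_def by (auto simp: Im_moebius_sgn uhp_def)
    have n0: "mden A z \<noteq> 0" using mden_nonzero A z by simp
    have k: "(cmod w)\<^sup>2 + 4 \<le> K * Im w"
      using A w unfolding dist2i_def w_def[symmetric] by (simp add: divide_le_eq)
    then have "0 < K * Im w" by (smt (verit) zero_le_power2)
    then have Kpos: "K > 0" using w by (simp add: zero_less_mult_iff)
    have "Im w \<le> cmod w" using abs_Im_le_cmod[of w] by linarith
    then have "K * Im w \<le> K * cmod w" using Kpos by simp
    then have "cmod w * cmod w \<le> K * cmod w" using k by (simp add: power2_eq_square)
    then have wK: "cmod w \<le> K" using w by (cases "w = 0") auto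
    have "4 \<le> K * Im w" using k by (smt (verit) zero_le_power2)
    moreover have iw: "Im w = Im z / (cmod (mden A z))\<^sup>2" by (simp add: w_def Im_moebius A)
    ultimately have "(cmod (mden A z))\<^sup>2 \<le> K * Im z / 4"
      using n0 by (simp add: field_simps)
    also have "\<dots> \<le> B\<^sup>2"
    proof -
      have "K * Im z / 4 \<ge> 0" using Kpos z by (simp add: uhp_def)
      moreover have "x \<le> (x + 1)\<^sup>2" if "x \<ge> 0" for x :: real
        using that zero_le_square[of x] unfolding power2_eq_square distrib_left distrib_right by linarith
      ultimately show ?thesis unfolding B_def by blast
    qed
    finally have dB: "cmod (mden A z) \<le> B"
    proof (rule power2_le_imp_le)
      show "0 \<le> B" using Kpos z by (simp add: B_def uhp_def)
    qed
    have "of_int (A$1$1) * z + of_int (A$1$2) = w * mden A z"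
      using n0 unfolding w_def moebius_def mden_def[symmetric] by simp
    then have "cmod (of_int (A$1$1) * z + of_int (A$1$2)) = cmod w * cmod (mden A z)" by (simp add: norm_mult)
    also have "\<dots> \<le> K * B" using wK dB Kpos by (intro mult_mono) auto
    finally have 1: "cmod (of_int (A$1$1) * z + of_int (A$1$2)) \<le> C" by (simp add: C_def)
    have 2: "cmod (of_int (A$2$1) * z + of_int (A$2$2)) \<le> C"
      using dB by (simp add: C_def mden_def)
    have D: "C / Im z \<le> real_of_int D" "C + C / Im z * cmod z \<le> real_of_int D"
      unfolding D_def by linarith+
    have "\<bar>real_of_int (A$1$1)\<bar> \<le> real_of_int D" "\<bar>real_of_int (A$1$2)\<bar> \<le> real_of_int D"
      "\<bar>real_of_int (A$2$1)\<bar> \<le> real_of_int D" "\<bar>real_of_int (A$2$2)\<bar> \<le> real_of_int D"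
      using abs_le_of_linear_form[OF z 1] abs_le_of_linear_form[OF z 2] D by linarith+
    then show ?thesis by linarith
  qed
  have "{A. det A = 1 \<and> dist2i (moebius A z) \<le> K} \<subseteq>
      (\<lambda>(a, b, c, d). mk2 a b c d) ` ({-D..D} \<times> {-D..D} \<times> {-D..D} \<times> {-D..D})"
  proof
    fix A assume "A \<in> {A. det A = 1 \<and> dist2i (moebius A z) \<le> K}"
    then show "A \<in> (\<lambda>(a, b, c, d). mk2 a b c d) ` ({-D..D} \<times> {-D..D} \<times> {-D..D} \<times> {-D..D})"
      using bd[of A]
      by (intro image_eqI[where x = "(A$1$1, A$1$2, A$2$1, A$2$2)"]) (auto simp: mk2_eta abs_le_iff)
  qed
  then show ?thesis by (rule finite_subset) simp
qed

definition closest_points :: "(int ^ 2 ^ 2) set \<Rightarrow> complex set" where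
  "closest_points G = {z \<in> uhp. \<forall>A\<in>G. closer z (moebius A z)}"

text \<open>The set is cut out by countably many Borel conditions. By
  \<open>finite_dist2i_le\<close> only finitely many translates are at most as far from $2i$ as
  \<open>z\<close> itself, so a least one exists; antisymmetry of \<open>closer\<close> makes it the
  only one.\<close>

lemma fdomain_closest_points:
  assumes G: "sl_group G"
  shows "fdomain G (closest_points G)"
  unfolding fdomain_def
proof (intro conjI ballI)
  have "closest_points G = uhp \<inter> (\<Inter>A\<in>G. {z. closer z (moebius A z)})"
    by (auto simp: closest_points_def)
  moreover have "{z. closer z (moebius A z)} \<in> sets borel" for A
  proof -
    have [measurable]: "dist2i \<in> borel_measurable borel" unfolding dist2i_def by measurable
    show ?thesis unfolding closer_def by measurable
  qed
  moreover have "G \<noteq> {}" using sl_groupD(1)[OF G] by auto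
  ultimately show "closest_points G \<in> sets borel"
    by (auto intro!: sets.Int sets.countable_INT' countableI_type)
  show "closest_points G \<subseteq> uhp" by (auto simp: closest_points_def)
  fix z assume z: "z \<in> uhp"
  define S where "S = {A\<in>G. dist2i (moebius A z) \<le> dist2i z}"
  have "S \<subseteq> {A. det A = 1 \<and> dist2i (moebius A z) \<le> dist2i z}" using sl_groupD(2)[OF G] by (auto simp: S_def)
  then have "finite S" using finite_dist2i_le[OF z] by (rule finite_subset)
  moreover have "mat 1 \<in> S" using sl_groupD(1)[OF G] by (simp add: S_def)
  ultimately obtain A where A: "A \<in> S" "\<forall>B\<in>S. closer (moebius A z) (moebius B z)"
    using finite_closer_minimum[of "(\<lambda>A. moebius A z) ` S"] by auto
  have AG: "A \<in> G" using A(1) by (simp add: S_def)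
  have cl: "closer (moebius A z) (moebius B z)" if "B \<in> G" for B
  proof (cases "B \<in> S")
    case True
    then show ?thesis using A by blast
  next
    case False
    then have "dist2i z < dist2i (moebius B z)" using that by (auto simp: S_def)
    moreover have "dist2i (moebius A z) \<le> dist2i z" using A by (auto simp: S_def)
    ultimately show ?thesis by (simp add: closer_def)
  qed
  show "\<exists>!w. w \<in> closest_points G \<and> (\<exists>A\<in>G. w = moebius A z)"
  proof (rule ex1I[of _ "moebius A z"])
    have "closer (moebius A z) (moebius B (moebius A z))" if "B \<in> G" for B
      using cl[OF sl_groupD(4)[OF G that AG]] moebius_sl(4)[OF G that z, of A] sl_groupD(2)[OF G AG] by simp
    then show "moebius A z \<in> closest_points G \<and> (\<exists>A'\<in>G. moebius A z = moebius A' z)"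
      using AG moebius_sl(1)[OF G AG z] by (auto simp: closest_points_def)
  next
    fix w assume "w \<in> closest_points G \<and> (\<exists>A\<in>G. w = moebius A z)"
    then obtain B where w: "w \<in> closest_points G" "B \<in> G" "w = moebius B z" by blast
    have "closer w (moebius (A ** adj2 B) w)"
      using w(1) sl_groupD(4)[OF G AG sl_groupD(3)[OF G w(2)]] by (simp add: closest_points_def)
    also have "moebius (A ** adj2 B) w = moebius A (moebius (adj2 B) w)"
      using moebius_sl(4)[OF G AG, of w "adj2 B"] moebius_sl(1)[OF G w(2) z] w(3) sl_groupD(2)[OF G w(2)] by simp
    also have "moebius (adj2 B) w = z" using moebius_sl(2)[OF G w(2) z] w(3) by simp
    finally show "w = moebius A z" using cl[OF w(2)] w(3) closer_antisym by blast
  qed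
qed

abbreviation "SL2Z \<equiv> {A :: int ^ 2 ^ 2. det A = 1}"

lemma sl_group_SL2Z: "sl_group SL2Z"
  by (simp add: sl_group_def det_mult2)

text \<open>Comparison with \<open>z + 1\<close> and \<open>z - 1\<close> bounds the real part,
  comparison with \<open>- 1 / z\<close> gives modulus at least 1. The bound 1/2 for the imaginary
  part is cruder than sqrt 3 / 2, but fits the dyadic strips of the volume estimate.\<close>

lemma closest_points_SL2Z_bounds:
  assumes "z \<in> closest_points SL2Z"
  shows "\<bar>Re z\<bar> \<le> 1 / 2" "Im z \<ge> 1 / 2"
proof -
  have z: "Im z > 0" "z \<in> uhp" and cl: "\<And>A. det A = 1 \<Longrightarrow> dist2i z \<le> dist2i (moebius A z)"
    using assms unfolding closest_points_def closer_def by (auto simp: uhp_def less_imp_le)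
  have "dist2i z \<le> dist2i (z + 1)" "dist2i z \<le> dist2i (z - 1)" "dist2i z \<le> dist2i (- 1 / z)"
    using cl[of "mk2 1 1 0 1"] cl[of "mk2 1 (-1) 0 1"] cl[of "mk2 0 (-1) 1 0"] by (simp_all add: moebius_def)
  note d = this
  have "(cmod z)\<^sup>2 \<le> (cmod (z + 1))\<^sup>2" "(cmod z)\<^sup>2 \<le> (cmod (z - 1))\<^sup>2"
    using d(1,2) z by (simp_all add: dist2i_def divide_le_cancel)
  then have "0 \<le> 1 + 2 * Re z" "0 \<le> 1 - 2 * Re z"
    unfolding cmod_power2 by (simp_all add: power2_eq_square algebra_simps)
  then show r: "\<bar>Re z\<bar> \<le> 1 / 2" by linarith
  have z0: "cmod z > 0" using z by auto
  have im: "Im (- 1 / z) = Im z / (cmod z)\<^sup>2"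
    using Im_moebius[of "mk2 0 (-1) 1 0" z] by (simp add: moebius_def mden_def)
  have "dist2i (- 1 / z) = (1 / (cmod z)\<^sup>2 + 4) * (cmod z)\<^sup>2 / Im z"
    unfolding dist2i_def im by (simp add: norm_divide power_divide)
  also have "\<dots> = (1 + 4 * (cmod z)\<^sup>2) / Im z" using z0 by (simp add: distrib_right)
  finally have "(cmod z)\<^sup>2 + 4 \<le> 1 + 4 * (cmod z)\<^sup>2"
    using d(3) z by (simp add: dist2i_def divide_le_cancel)
  then have "1 \<le> (Re z)\<^sup>2 + (Im z)\<^sup>2" by (simp add: cmod_power2)
  moreover have "(Re z)\<^sup>2 \<le> (1 / 2)\<^sup>2" using power_mono[OF r, of 2] by simp
  ultimately have "(Im z)\<^sup>2 \<ge> (1 / 2)\<^sup>2" by (simp add: power2_eq_square)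
  then show "Im z \<ge> 1 / 2" by (rule power2_le_imp_le) (use z in simp)
qed

lemma emeasure_hyp_box:
  assumes "h > 0"
  shows "emeasure hyp (cbox (Complex (-1/2) h) (Complex (1/2) (2 * h))) \<le> ennreal (1 / h)"
proof -
  let ?B = "cbox (Complex (-1/2) h) (Complex (1/2) (2 * h))"
  have "emeasure hyp ?B = (\<integral>\<^sup>+z. ennreal (indicator uhp z / (Im z)\<^sup>2) * indicator ?B z \<partial>lborel)"
    unfolding hyp_def by (rule emeasure_density) measurable
  also have "\<dots> \<le> (\<integral>\<^sup>+z. ennreal (1 / h\<^sup>2) * indicator ?B z \<partial>lborel)"
    using assms
    by (intro nn_integral_mono)
       (auto simp: indicator_def in_cbox_complex_iff intro!: ennreal_leI divide_left_mono power_mono mult_pos_pos)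
  also have "\<dots> = ennreal (1 / h\<^sup>2) * emeasure lborel ?B"
    by (rule nn_integral_cmult_indicator) simp
  also have "emeasure lborel ?B = ennreal h"
    using assms by (subst emeasure_lborel_cbox) (auto simp: Basis_complex_def)
  also have "ennreal (1 / h\<^sup>2) * ennreal h = ennreal (1 / h)"
    using assms by (simp add: power2_eq_square flip: ennreal_mult)
  finally show ?thesis .
qed

text \<open>The domain is covered by the dyadic boxes of height \<open>2 ^ n / 2\<close> to
  \<open>2 ^ n\<close>, whose measures are at most \<open>2 / 2 ^ n\<close> and form a convergent
  geometric series.\<close>

lemma emeasure_hyp_closest_points_SL2Z: "emeasure hyp (closest_points SL2Z) < \<infinity>"
proof -
  let ?B = "\<lambda>n::nat. cbox (Complex (-1/2) (2 ^ n / 2)) (Complex (1/2) (2 * (2 ^ n / 2)))"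
  have "closest_points SL2Z \<subseteq> (\<Union>n. ?B n)"
  proof
    fix z assume z: "z \<in> closest_points SL2Z"
    note b = closest_points_SL2Z_bounds[OF z]
    define n where "n = (LEAST n::nat. Im z \<le> 2 ^ n)"
    have ex: "\<exists>n::nat. Im z \<le> 2 ^ n" using real_arch_pow[of 2 "Im z"] by (auto intro: less_imp_le)
    then have n: "Im z \<le> 2 ^ n" unfolding n_def by (rule LeastI_ex)
    have "2 ^ n / 2 \<le> Im z"
    proof (cases n)
      case 0
      then show ?thesis using b by simp
    next
      case (Suc m)
      then have "\<not> Im z \<le> 2 ^ m" using not_less_Least[of m "\<lambda>n. Im z \<le> 2 ^ n"] by (simp add: n_def)
      then show ?thesis using Suc by simp
    qed
    then have "z \<in> ?B n" using b n by (auto simp: in_cbox_complex_iff)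
    then show "z \<in> (\<Union>n. ?B n)" by blast
  qed
  then have "emeasure hyp (closest_points SL2Z) \<le> emeasure hyp (\<Union>n. ?B n)"
    by (rule emeasure_mono) auto
  also have "\<dots> \<le> (\<Sum>n. emeasure hyp (?B n))"
    by (rule emeasure_subadditive_countably) auto
  also have "\<dots> \<le> (\<Sum>n. ennreal (1 / (2 ^ n / 2)))"
    by (intro suminf_le emeasure_hyp_box) auto
  also have "\<dots> = ennreal (\<Sum>n. 1 / (2 ^ n / 2))"
  proof (rule suminf_ennreal2)
    have "summable (\<lambda>n. 2 * (1 / 2) ^ n :: real)" by (intro summable_mult summable_geometric) auto
    then show "summable (\<lambda>n. 1 / (2 ^ n / 2) :: real)" by (simp add: power_divide)
  qed auto
  also have "\<dots> < \<infinity>" by simp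
  finally show ?thesis .
qed

lemma AE_hyp_open:
  assumes "AE z in hyp. z \<notin> S" "open S" "S \<subseteq> uhp"
  shows "S = {}"
proof (rule ccontr)
  assume "S \<noteq> {}"
  have "AE z in lborel. ennreal (indicator uhp z / (Im z)\<^sup>2) > 0 \<longrightarrow> z \<notin> S"
    using assms(1) unfolding hyp_def by (subst (asm) AE_density) auto
  then have "AE z in lborel. z \<notin> S"
    by eventually_elim (use assms(3) in \<open>auto simp: uhp_def\<close>)
  then have "S \<in> null_sets lborel"
    using assms(2) by (subst (asm) AE_iff_null) (auto simp: null_sets_def)
  then have "negligible S"
    by (simp add: negligible_iff_null_sets null_sets_completionI)
  with open_not_negligible[OF assms(2) \<open>S \<noteq> {}\<close>] show False by blast
qed

lemma not_AE_hyp_False: "\<not> (AE z in hyp. False)"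
proof
  assume "AE z in hyp. False"
  then have "AE z in hyp. z \<notin> uhp" by eventually_elim simp
  then have "uhp = {}" by (rule AE_hyp_open) auto
  moreover have "\<i> \<in> uhp" by (simp add: uhp_def)
  ultimately show False by blast
qed

section \<open>Invariant means\<close>

definition Gamma_pr :: "nat \<Rightarrow> (int ^ 2 ^ 2) set" where
  "Gamma_pr M = {A. det A = 1 \<and> int M dvd A$1$1 - 1 \<and> int M dvd A$1$2 \<and> int M dvd A$2$1 \<and> int M dvd A$2$2 - 1}"

lemma Gamma_pr_iff:
  "A \<in> Gamma_pr M \<longleftrightarrow> det A = 1 \<and> [A$1$1 = 1] (mod int M) \<and> [A$1$2 = 0] (mod int M) \<and>
     [A$2$1 = 0] (mod int M) \<and> [A$2$2 = 1] (mod int M)"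
  by (simp add: Gamma_pr_def cong_iff_dvd_diff)

lemma cong_lin: "[a = a'] (mod m) \<Longrightarrow> [b = b'] (mod m) \<Longrightarrow> [c = c'] (mod m) \<Longrightarrow> [d = d'] (mod m) \<Longrightarrow>
    [a * b + c * d = a' * b' + c' * d'] (mod (m :: int))"
  by (intro cong_add cong_mult)

lemma sl_group_Gamma_pr: "sl_group (Gamma_pr M)"
  unfolding sl_group_def
proof (intro conjI ballI)
  fix A assume A: "A \<in> Gamma_pr M"
  show "det A = 1" using A by (simp add: Gamma_pr_def)
  show "adj2 A \<in> Gamma_pr M" using A by (simp add: Gamma_pr_def)
  fix B assume B: "B \<in> Gamma_pr M"
  show "A ** B \<in> Gamma_pr M"
    using A B cong_lin[of "A$1$1" 1 "int M" "B$1$1" 1 "A$1$2" 0 "B$2$1" 0]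
      cong_lin[of "A$1$1" 1 "int M" "B$1$2" 0 "A$1$2" 0 "B$2$2" 1]
      cong_lin[of "A$2$1" 0 "int M" "B$1$1" 1 "A$2$2" 1 "B$2$1" 0]
      cong_lin[of "A$2$1" 0 "int M" "B$1$2" 0 "A$2$2" 1 "B$2$2" 1]
    by (simp add: Gamma_pr_iff mat2_mult_nth det_mult2)
qed (simp add: Gamma_pr_def)

lemma Gamma_pr_mono: "M dvd N \<Longrightarrow> Gamma_pr N \<subseteq> Gamma_pr M"
  unfolding Gamma_pr_def by (auto intro: dvd_trans[of "int M" "int N"])

lemma Gamma_pr_subset_SL2Z: "Gamma_pr M \<subseteq> SL2Z"
  by (auto simp: Gamma_pr_def)

text \<open>If \<open>\<phi>\<close> were null, so would be its countably many translates and their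
  sum.\<close>

lemma weight_nonzero:
  assumes G: "sl_group G" and w: "weight G \<phi> c" "c \<noteq> 0"
  shows "(\<integral>\<^sup>+z. \<phi> z \<partial>hyp) \<noteq> 0"
proof
  assume "(\<integral>\<^sup>+z. \<phi> z \<partial>hyp) = 0"
  then have 0: "AE z in hyp. \<phi> z = 0"
    using w(1) by (subst (asm) nn_integral_0_iff_AE) (auto simp: weight_def borel_measurable_hyp)
  have "AE z in hyp. \<forall>A\<in>G. \<phi> (moebius A z) = 0"
    unfolding AE_ball_countable[OF countableI_type]
  proof
    fix A assume "A \<in> G"
    then have "det A > 0" using sl_groupD(2)[OF G] by simp
    then show "AE z in hyp. \<phi> (moebius A z) = 0" using 0 by (rule AE_hyp_moebius)
  qed
  moreover have "AE z in hyp. (\<integral>\<^sup>+A. \<phi> (moebius A z) \<partial>count_space G) = c" using w by (simp add: weight_def)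
  ultimately have "AE z in hyp. False"
  proof eventually_elim
    fix z assume "\<forall>A\<in>G. \<phi> (moebius A z) = 0" and c: "(\<integral>\<^sup>+A. \<phi> (moebius A z) \<partial>count_space G) = c"
    then have "(\<integral>\<^sup>+A. \<phi> (moebius A z) \<partial>count_space G) = (\<integral>\<^sup>+A. 0 \<partial>count_space G)"
      by (intro nn_integral_cong) auto
    then show False using c w(2) by simp
  qed
  then show False using not_AE_hyp_False by blast
qed

lemma invariant_under_one: "invariant_under G (\<lambda>_. c)"
  by (simp add: invariant_under_def)

text \<open>A weight for \<open>H\<close> is also one for \<open>G\<close>, so unfolding applies
  inside \<open>G\<close>. The finite mass of \<open>\<psi>\<close> keeps the new constant finite,
  and with it the index of \<open>H\<close>.\<close>

lemma weight_proportional: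
  assumes G: "sl_group G" and H: "sl_group H" and HG: "H \<subseteq> G"
    and wH: "weight H \<psi> d" and wG: "weight G \<phi> c" and c: "c \<noteq> 0" "c \<noteq> \<infinity>" and d: "d \<noteq> 0"
    and fin: "(\<integral>\<^sup>+z. \<psi> z \<partial>hyp) \<noteq> \<infinity>"
  obtains k where "k \<noteq> 0" "k \<noteq> \<infinity>"
    "\<And>h. h \<in> borel_measurable borel \<Longrightarrow> invariant_under G h \<Longrightarrow>
      (\<integral>\<^sup>+z. \<psi> z * h z \<partial>hyp) = k * (\<integral>\<^sup>+z. \<phi> z * h z \<partial>hyp)"
proof -
  obtain R where R: "R \<subseteq> G" "\<And>B. B \<in> G \<Longrightarrow> \<exists>!r. r \<in> R \<and> B ** adj2 r \<in> H"
    using coset_representatives[OF G H HG] by blast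
  define e where "e = d * emeasure (count_space UNIV) R"
  have we: "weight G \<psi> e"
    unfolding e_def by (rule weight_supergroup[OF G H HG wH R])
  have eq: "c * (\<integral>\<^sup>+z. \<psi> z * h z \<partial>hyp) = e * (\<integral>\<^sup>+z. \<phi> z * h z \<partial>hyp)"
    if "h \<in> borel_measurable borel" "invariant_under G h" for h
    by (rule weight_unfold[OF G we wG that])
  have "R \<noteq> {}" using R(2)[OF sl_groupD(1)[OF G]] by blast
  then have e0: "e \<noteq> 0" using d by (auto simp: e_def emeasure_count_space)
  have "e * (\<integral>\<^sup>+z. \<phi> z \<partial>hyp) \<noteq> \<infinity>"
    using eq[of "\<lambda>_. 1"] fin c by (simp add: invariant_under_one ennreal_mult_eq_top_iff flip: infinity_ennreal_def)
       (metis ennreal_mult_eq_top_iff infinity_ennreal_def)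
  then have ei: "e \<noteq> \<infinity>"
    using weight_nonzero[OF G wG c(1)] by (auto simp: ennreal_mult_eq_top_iff)
  show thesis
  proof (rule that[of "e / c"])
    show "e / c \<noteq> 0" using e0 c by (simp add: ennreal_divide_eq_0_iff)
    show "e / c \<noteq> \<infinity>" using ei c by (simp add: ennreal_divide_eq_top_iff)
    fix h :: "complex \<Rightarrow> ennreal" assume h: "h \<in> borel_measurable borel" "invariant_under G h"
    have "(\<integral>\<^sup>+z. \<psi> z * h z \<partial>hyp) = c * (\<integral>\<^sup>+z. \<psi> z * h z \<partial>hyp) / c"
      using c mult_divide_eq_ennreal[of c "\<integral>\<^sup>+z. \<psi> z * h z \<partial>hyp"] by (simp add: mult.commute[of c])
    also have "\<dots> = e / c * (\<integral>\<^sup>+z. \<phi> z * h z \<partial>hyp)"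
      unfolding eq[OF h] by (simp add: divide_ennreal_def mult_ac)
    finally show "(\<integral>\<^sup>+z. \<psi> z * h z \<partial>hyp) = e / c * (\<integral>\<^sup>+z. \<phi> z * h z \<partial>hyp)" .
  qed
qed

lemma nn_integral_uniform_hyp:
  assumes "F \<in> sets borel" "h \<in> borel_measurable borel"
  shows "(\<integral>\<^sup>+z. h z \<partial>uniform_measure hyp F) = (\<integral>\<^sup>+z. indicator F z * h z \<partial>hyp) / emeasure hyp F"
  using assms by (subst nn_integral_uniform_measure) (auto simp: borel_measurable_hyp mult.commute)

lemma fdomain_weight:
  assumes "sl_group G" "fdomain G F"
  shows "weight G (indicator F) (of_nat (centre_card G))" "of_nat (centre_card G) \<noteq> (0 :: ennreal)"
    "of_nat (centre_card G) \<noteq> (\<infinity> :: ennreal)" "(\<integral>\<^sup>+z. indicator F z \<partial>hyp) = emeasure hyp F"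
    "emeasure hyp F \<noteq> 0" "F \<in> sets borel"
proof -
  show w: "weight G (indicator F) (of_nat (centre_card G))" by (rule weight_fdomain[OF assms])
  show 0: "of_nat (centre_card G) \<noteq> (0 :: ennreal)" "of_nat (centre_card G) \<noteq> (\<infinity> :: ennreal)"
    using centre_card_pos[OF assms(1)] by (auto simp: ennreal_of_nat_eq_real_of_nat)
  show F: "F \<in> sets borel" using assms(2) by (simp add: fdomain_def)
  show e: "(\<integral>\<^sup>+z. indicator F z \<partial>hyp) = emeasure hyp F" using F by simp
  show "emeasure hyp F \<noteq> 0" using weight_nonzero[OF assms(1) w 0(1)] e by simp
qed

text \<open>Dividing by the total mass cancels the unknown constant \<open>k\<close>, so that
  neither the index nor the size of the centre has to be known.\<close>

lemma weight_mean_eq: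
  assumes G: "sl_group G" and H: "sl_group H" and HG: "H \<subseteq> G" and F: "fdomain G F"
    and wH: "weight H \<psi> d" and d: "d \<noteq> 0"
    and fin: "(\<integral>\<^sup>+z. \<psi> z \<partial>hyp) \<noteq> \<infinity>"
  shows "emeasure hyp F \<noteq> \<infinity>"
    "h \<in> borel_measurable borel \<Longrightarrow> invariant_under G h \<Longrightarrow>
      (\<integral>\<^sup>+z. \<psi> z * h z \<partial>hyp) / (\<integral>\<^sup>+z. \<psi> z \<partial>hyp) = (\<integral>\<^sup>+z. h z \<partial>uniform_measure hyp F)"
proof -
  note f = fdomain_weight[OF G F]
  obtain k where k: "k \<noteq> 0" "k \<noteq> \<infinity>"
    "\<And>h. h \<in> borel_measurable borel \<Longrightarrow> invariant_under G h \<Longrightarrow>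
      (\<integral>\<^sup>+z. \<psi> z * h z \<partial>hyp) = k * (\<integral>\<^sup>+z. indicator F z * h z \<partial>hyp)"
    using weight_proportional[OF G H HG wH f(1-3) d fin] by blast
  have 1: "(\<integral>\<^sup>+z. \<psi> z \<partial>hyp) = k * emeasure hyp F"
    using k(3)[of "\<lambda>_. 1"] f(4) by (simp add: invariant_under_one)
  show fi: "emeasure hyp F \<noteq> \<infinity>" using 1 fin k by (auto simp: ennreal_mult_eq_top_iff)
  assume h: "h \<in> borel_measurable borel" "invariant_under G h"
  have "k * I / (k * V) = I / V" if "V \<noteq> 0" "V \<noteq> \<infinity>" for I V :: ennreal
  proof -
    have "k * I / (k * V) = (k / k) * (I / V)"
      using k that by (simp add: divide_ennreal_def ennreal_inverse_mult less_top mult_ac)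
    also have "k / k = 1" using k by (simp add: ennreal_divide_self less_top)
    finally show ?thesis by simp
  qed
  then show "(\<integral>\<^sup>+z. \<psi> z * h z \<partial>hyp) / (\<integral>\<^sup>+z. \<psi> z \<partial>hyp) = (\<integral>\<^sup>+z. h z \<partial>uniform_measure hyp F)"
    unfolding 1 k(3)[OF h] nn_integral_uniform_hyp[OF f(6) h(1)] using f(5) fi by simp
qed

text \<open>Matrices of determinant 1 that agree modulo \<open>M\<close> lie in one coset, and there
  are finitely many residues.\<close>

lemma finite_index_Gamma_pr:
  assumes M: "M > 0" and R: "R \<subseteq> SL2Z" "\<And>B. B \<in> SL2Z \<Longrightarrow> \<exists>!r. r \<in> R \<and> B ** adj2 r \<in> Gamma_pr M"
  shows "finite R"
proof -
  define q where "q = (\<lambda>A :: int ^ 2 ^ 2. (A$1$1 mod int M, A$1$2 mod int M, A$2$1 mod int M, A$2$2 mod int M))"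
  have "inj_on q R"
  proof (rule inj_onI)
    fix A B assume AB: "A \<in> R" "B \<in> R" "q A = q B"
    have det: "det A = 1" "det B = 1" using AB R(1) by auto
    have c: "[A$1$1 = B$1$1] (mod int M)" "[A$1$2 = B$1$2] (mod int M)" "[A$2$1 = B$2$1] (mod int M)" "[A$2$2 = B$2$2] (mod int M)"
      using AB(3) by (auto simp: q_def cong_def)
    have dB: "B$1$1 * B$2$2 - B$1$2 * B$2$1 = 1" using det by (simp add: det_2)
    have "A ** adj2 B \<in> Gamma_pr M"
      using cong_lin[OF c(1) cong_refl[of "B$2$2"] c(2) cong_refl[of "- B$2$1"]]
        cong_lin[OF c(1) cong_refl[of "- B$1$2"] c(2) cong_refl[of "B$1$1"]]
        cong_lin[OF c(3) cong_refl[of "B$2$2"] c(4) cong_refl[of "- B$2$1"]]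
        cong_lin[OF c(3) cong_refl[of "- B$1$2"] c(4) cong_refl[of "B$1$1"]] dB det
      by (simp add: Gamma_pr_iff mat2_mult_nth det_mult2 algebra_simps)
    moreover have "A ** adj2 A \<in> Gamma_pr M"
      using adj2_mult[OF det(1)] sl_groupD(1)[OF sl_group_Gamma_pr] by simp
    moreover have "A \<in> SL2Z" using det by simp
    ultimately show "A = B" using R(2)[of A] AB(1,2) by blast
  qed
  moreover have "q ` R \<subseteq> {0..<int M} \<times> {0..<int M} \<times> {0..<int M} \<times> {0..<int M}"
    using M by (auto simp: q_def)
  then have "finite (q ` R)" by (rule finite_subset) auto
  ultimately show ?thesis using finite_imageD by blast
qed

definition Gdom :: "nat \<Rightarrow> complex set" where
  "Gdom M = closest_points (Gamma_pr M)"

lemma fdomain_Gdom: "fdomain (Gamma_pr M) (Gdom M)"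
  unfolding Gdom_def by (rule fdomain_closest_points[OF sl_group_Gamma_pr])

lemma emeasure_Gdom:
  assumes "M > 0"
  shows "emeasure hyp (Gdom M) \<noteq> \<infinity>" "emeasure hyp (Gdom M) \<noteq> 0"
proof -
  note f = fdomain_weight[OF sl_group_Gamma_pr fdomain_Gdom[of M]]
  note f1 = fdomain_weight[OF sl_group_SL2Z fdomain_closest_points[OF sl_group_SL2Z]]
  obtain R where R: "R \<subseteq> SL2Z" "\<And>B. B \<in> SL2Z \<Longrightarrow> \<exists>!r. r \<in> R \<and> B ** adj2 r \<in> Gamma_pr M"
    using coset_representatives[OF sl_group_SL2Z sl_group_Gamma_pr Gamma_pr_subset_SL2Z] by blast
  have "finite R" using finite_index_Gamma_pr[OF assms R] .
  define k where "k = of_nat (centre_card (Gamma_pr M)) * emeasure (count_space UNIV) R"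
  have k: "k \<noteq> \<infinity>"
    using \<open>finite R\<close> unfolding k_def
    by (simp add: emeasure_count_space ennreal_of_nat_eq_real_of_nat flip: ennreal_mult)
  have w: "weight SL2Z (indicator (Gdom M)) k"
    unfolding k_def by (rule weight_supergroup[OF sl_group_SL2Z sl_group_Gamma_pr Gamma_pr_subset_SL2Z f(1) R])
  have "of_nat (centre_card SL2Z) * (\<integral>\<^sup>+z. indicator (Gdom M) z * 1 \<partial>hyp)
      = k * (\<integral>\<^sup>+z. indicator (closest_points SL2Z) z * 1 \<partial>hyp)"
    by (rule weight_unfold[OF sl_group_SL2Z w f1(1)]) (auto simp: invariant_under_one)
  then have "of_nat (centre_card SL2Z) * emeasure hyp (Gdom M) = k * emeasure hyp (closest_points SL2Z)"
    using f(4) f1(4) by simp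
  also have "\<dots> \<noteq> \<infinity>"
    using k emeasure_hyp_closest_points_SL2Z by (simp add: ennreal_mult_eq_top_iff less_top[symmetric])
  finally show "emeasure hyp (Gdom M) \<noteq> \<infinity>"
    using f1(2) by (auto simp: ennreal_mult_eq_top_iff)
  show "emeasure hyp (Gdom M) \<noteq> 0" by (rule f(5))
qed

definition nu :: "nat \<Rightarrow> complex measure" where
  "nu M = uniform_measure hyp (Gdom M)"

lemma sets_nu [simp, measurable_cong]: "sets (nu M) = sets borel"
  by (simp add: nu_def)

lemma space_nu [simp]: "space (nu M) = UNIV"
  by (simp add: nu_def)

lemma borel_measurable_nu: "borel_measurable (nu M) = borel_measurable borel"
  by (simp add: measurable_def)

lemma emeasure_nu: "M > 0 \<Longrightarrow> emeasure (nu M) UNIV = 1"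
  unfolding nu_def using emeasure_Gdom[of M] fdomain_weight(6)[OF sl_group_Gamma_pr fdomain_Gdom[of M]]
  by (subst emeasure_uniform_measure) (auto simp: less_top)

lemma nn_integral_nu_eq:
  assumes G: "sl_group G" and HG: "Gamma_pr M \<subseteq> G" and F: "fdomain G F" and M: "M > 0"
  shows "emeasure hyp F \<noteq> \<infinity>" "emeasure hyp F \<noteq> 0"
    "h \<in> borel_measurable borel \<Longrightarrow> invariant_under G h \<Longrightarrow>
      (\<integral>\<^sup>+z. h z \<partial>nu M) = (\<integral>\<^sup>+z. h z \<partial>uniform_measure hyp F)"
proof -
  note f = fdomain_weight[OF sl_group_Gamma_pr fdomain_Gdom[of M]]
  have fi: "(\<integral>\<^sup>+z. indicator (Gdom M) z \<partial>hyp) \<noteq> \<infinity>"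
    using emeasure_Gdom[OF M] f(4) by simp
  note w = weight_mean_eq[OF G sl_group_Gamma_pr HG F f(1) f(2) fi]
  show "emeasure hyp F \<noteq> \<infinity>" by (rule w(1))
  show "emeasure hyp F \<noteq> 0" by (rule fdomain_weight(5)[OF G F])
  assume h: "h \<in> borel_measurable borel" "invariant_under G h"
  show "(\<integral>\<^sup>+z. h z \<partial>nu M) = (\<integral>\<^sup>+z. h z \<partial>uniform_measure hyp F)"
    using w(2)[OF h] unfolding nu_def nn_integral_uniform_hyp[OF f(6) h(1)] f(4) .
qed

lemma nn_integral_nu_dvd:
  assumes "M dvd N" "N > 0" "h \<in> borel_measurable borel" "invariant_under (Gamma_pr M) h"
  shows "(\<integral>\<^sup>+z. h z \<partial>nu M) = (\<integral>\<^sup>+z. h z \<partial>nu N)"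
  using nn_integral_nu_eq(3)[OF sl_group_Gamma_pr Gamma_pr_mono[OF assms(1)] fdomain_Gdom assms(2-4)]
  by (simp add: nu_def)

text \<open>\<open>conj2 \<beta> B\<close> is \<open>\<beta> B \<beta>\<inverse>\<close>. The divisions are exact only if \<open>B\<close> is congruent to the identity
  modulo \<open>det \<beta>\<close>.\<close>

definition conj2 :: "int ^ 2 ^ 2 \<Rightarrow> int ^ 2 ^ 2 \<Rightarrow> int ^ 2 ^ 2" where
  "conj2 \<beta> B = (let X = \<beta> ** B ** adj2 \<beta>; n = det \<beta>
     in mk2 (X$1$1 div n) (X$1$2 div n) (X$2$1 div n) (X$2$2 div n))"

text \<open>Write \<open>B = 1 + n M E\<close>. Since \<open>\<beta> ** adj2 \<beta>\<close> is
  \<open>n\<close> times the identity, the conjugate is \<open>1 + M \<beta> E adj2 \<beta>\<close>,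
  which explains both the integrality and the congruence modulo \<open>M\<close>.\<close>

lemma conj2_Gamma_pr:
  assumes n: "det \<beta> = int n" "n > 0" and B: "B \<in> Gamma_pr (M * n)"
  shows "conj2 \<beta> B ** \<beta> = \<beta> ** B" "conj2 \<beta> B \<in> Gamma_pr M"
proof -
  obtain a b c d where e: "B$1$1 = 1 + int n * int M * a" "B$1$2 = int n * int M * b" "B$2$1 = int n * int M * c" "B$2$2 = 1 + int n * int M * d"
  proof -
    have "int n * int M dvd B$1$1 - 1" "int n * int M dvd B$1$2" "int n * int M dvd B$2$1" "int n * int M dvd B$2$2 - 1"
      using B by (simp_all add: Gamma_pr_def mult.commute)
    then obtain a b c d where "B$1$1 - 1 = int n * int M * a" "B$1$2 = int n * int M * b" "B$2$1 = int n * int M * c" "B$2$2 - 1 = int n * int M * d"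
      by (elim dvdE)
    then show ?thesis by (intro that[of a b c d]) linarith+
  qed
  define x y z w where "x = \<beta>$1$1" and "y = \<beta>$1$2" and "z = \<beta>$2$1" and "w = \<beta>$2$2"
  note xyzw = x_def[symmetric] y_def[symmetric] z_def[symmetric] w_def[symmetric]
  have dn: "x * w - y * z = int n" using n(1) by (simp add: det_2 xyzw)
  define X where "X = \<beta> ** B ** adj2 \<beta>"
  have X: "X$1$1 = int n * (1 + int M * ((x * a + y * c) * w - (x * b + y * d) * z))"
    "X$1$2 = int n * (int M * (- (x * a + y * c) * y + (x * b + y * d) * x))"
    "X$2$1 = int n * (int M * ((z * a + w * c) * w - (z * b + w * d) * z))"
    "X$2$2 = int n * (1 + int M * (- (z * a + w * c) * y + (z * b + w * d) * x))"
  proof -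
    have "X$1$1 = (x * w - y * z) + int n * (int M * ((x * a + y * c) * w - (x * b + y * d) * z))"
      "X$1$2 = int n * (int M * (- (x * a + y * c) * y + (x * b + y * d) * x))"
      "X$2$1 = int n * (int M * ((z * a + w * c) * w - (z * b + w * d) * z))"
      "X$2$2 = (x * w - y * z) + int n * (int M * (- (z * a + w * c) * y + (z * b + w * d) * x))"
      unfolding X_def mat2_mult_nth adj2_nth xyzw e by algebra+
    then show "X$1$1 = int n * (1 + int M * ((x * a + y * c) * w - (x * b + y * d) * z))"
      "X$1$2 = int n * (int M * (- (x * a + y * c) * y + (x * b + y * d) * x))"
      "X$2$1 = int n * (int M * ((z * a + w * c) * w - (z * b + w * d) * z))"
      "X$2$2 = int n * (1 + int M * (- (z * a + w * c) * y + (z * b + w * d) * x))"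
      unfolding dn distrib_left by simp_all
  qed
  have C: "conj2 \<beta> B $1$1 = 1 + int M * ((x * a + y * c) * w - (x * b + y * d) * z)"
    "conj2 \<beta> B $1$2 = int M * (- (x * a + y * c) * y + (x * b + y * d) * x)"
    "conj2 \<beta> B $2$1 = int M * ((z * a + w * c) * w - (z * b + w * d) * z)"
    "conj2 \<beta> B $2$2 = 1 + int M * (- (z * a + w * c) * y + (z * b + w * d) * x)"
    using n unfolding conj2_def Let_def X_def[symmetric] mk2_nth X n(1) by simp_all
  show eq: "conj2 \<beta> B ** \<beta> = \<beta> ** B"
    unfolding mat2_eq_iff mat2_mult_nth C e xyzw using dn[symmetric] by algebra
  have "det (conj2 \<beta> B) * det \<beta> = det \<beta> * det B"
    using arg_cong[OF eq, of det] by (simp add: det_mult2)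
  then have "det (conj2 \<beta> B) = 1" using n B by (simp add: Gamma_pr_def)
  then show "conj2 \<beta> B \<in> Gamma_pr M"
    by (simp add: Gamma_pr_def C)
qed

lemma cancel_right2:
  fixes A B \<beta> :: "int ^ 2 ^ 2"
  assumes "det \<beta> \<noteq> 0" "A ** \<beta> = B ** (\<beta> :: int ^ 2 ^ 2)"
  shows "A = B"
proof -
  have s: "\<beta> ** adj2 \<beta> = mk2 (det \<beta>) 0 0 (det \<beta>)"
    by (simp add: mat2_eq_iff mat2_mult_nth det_2 algebra_simps)
  have "A ** mk2 (det \<beta>) 0 0 (det \<beta>) = B ** mk2 (det \<beta>) 0 0 (det \<beta>)"
    using arg_cong[OF assms(2), of "\<lambda>X. X ** adj2 \<beta>"] unfolding matrix_mul_assoc[symmetric] s .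
  then show ?thesis using assms(1) by (auto simp: mat2_eq_iff mat2_mult_nth)
qed

lemma cancel_left2:
  fixes A B \<beta> :: "int ^ 2 ^ 2"
  assumes "det \<beta> \<noteq> 0" "\<beta> ** A = (\<beta> :: int ^ 2 ^ 2) ** B"
  shows "A = B"
proof -
  have "adj2 A ** adj2 \<beta> = adj2 B ** adj2 \<beta>" using assms(2) by (metis adj2_mult_rev)
  then have "adj2 A = adj2 B" by (rule cancel_right2[rotated]) (use assms(1) in simp)
  then show ?thesis by (metis adj2_adj2)
qed

text \<open>The conjugate \<open>H\<close> of \<open>Gamma_pr L\<close> by \<open>\<beta>\<close> is
  a subgroup of \<open>Gamma_pr M\<close>, and the translate of \<open>Gdom L\<close> by
  \<open>\<beta>\<close> is a weight for it. Its normalized integral is thus the mean at level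
  \<open>M\<close>, and pulling back by \<open>\<beta>\<close> turns it into the mean at level
  \<open>L\<close>.\<close>

lemma nn_integral_nu_moebius:
  assumes M: "M > 0" and n: "det \<beta> = int n" "n > 0"
    and h [measurable]: "h \<in> borel_measurable borel" and inv: "invariant_under (Gamma_pr M) h"
  shows "(\<integral>\<^sup>+z. h (moebius \<beta> z) \<partial>nu (M * n)) = (\<integral>\<^sup>+z. h z \<partial>nu M)"
proof -
  define L where "L = M * n"
  have L: "L > 0" using M n by (simp add: L_def)
  define H where "H = conj2 \<beta> ` Gamma_pr L"
  note c = conj2_Gamma_pr[OF n, of _ M, folded L_def]
  have d0: "det \<beta> \<noteq> 0" using n by simp
  have HI: "A \<in> H" if "B \<in> Gamma_pr L" "A ** \<beta> = \<beta> ** B" for A B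
  proof -
    have "A = conj2 \<beta> B" by (rule cancel_right2[OF d0]) (simp only: that(2) c(1)[OF that(1)])
    then show ?thesis using that(1) by (simp add: H_def)
  qed
  have HE: "\<exists>B \<in> Gamma_pr L. A ** \<beta> = \<beta> ** B" if "A \<in> H" for A
    using that c(1) by (auto simp: H_def)
  note gL = sl_groupD[OF sl_group_Gamma_pr[of L]]
  have HG: "H \<subseteq> Gamma_pr M" using c(2) by (auto simp: H_def)
  have H: "sl_group H"
    unfolding sl_group_def
  proof (intro conjI ballI)
    show "mat 1 \<in> H" by (rule HI[OF gL(1)]) simp
    fix A assume A: "A \<in> H"
    show dA: "det A = 1" using HG A by (auto simp: Gamma_pr_def)
    obtain B where B: "B \<in> Gamma_pr L" "A ** \<beta> = \<beta> ** B" using HE[OF A] by blast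
    show "adj2 A \<in> H"
    proof (rule HI[OF gL(3)[OF B(1)]])
      have "A ** (\<beta> ** adj2 B) = \<beta> ** B ** adj2 B" unfolding matrix_mul_assoc B(2) ..
      also have "\<dots> = \<beta>" by (rule mat2_inv_cancel(3)[OF gL(2)[OF B(1)]])
      finally have "adj2 A ** (A ** (\<beta> ** adj2 B)) = adj2 A ** \<beta>" by simp
      then show "adj2 A ** \<beta> = \<beta> ** adj2 B" unfolding mat2_inv_cancel(1)[OF dA] ..
    qed
    fix A' assume "A' \<in> H"
    then obtain B' where B': "B' \<in> Gamma_pr L" "A' ** \<beta> = \<beta> ** B'" using HE by blast
    show "A ** A' \<in> H"
    proof (rule HI[OF gL(4)[OF B(1) B'(1)]])
      show "(A ** A') ** \<beta> = \<beta> ** (B ** B')"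
        unfolding matrix_mul_assoc[symmetric] B' unfolding matrix_mul_assoc B ..
    qed
  qed
  note f = fdomain_weight[OF sl_group_Gamma_pr fdomain_Gdom[of L]]
  have [measurable]: "Gdom L \<in> sets borel" by (rule f(6))
  \<comment> \<open>On \<open>uhp\<close> this is the indicator of the image of
    \<open>Gdom L\<close> under \<open>moebius \<beta>\<close>.\<close>
  define \<psi> :: "complex \<Rightarrow> ennreal" where "\<psi> = (\<lambda>z. indicator (Gdom L) (moebius (adj2 \<beta>) z))"
  have db: "det \<beta> > 0" "det (adj2 \<beta>) > 0" using n by simp_all
  have bij: "bij_betw (conj2 \<beta>) (Gamma_pr L) H"
    unfolding bij_betw_def H_def
  proof (intro conjI inj_onI refl)
    fix A B assume "A \<in> Gamma_pr L" "B \<in> Gamma_pr L" "conj2 \<beta> A = conj2 \<beta> B"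
    then have "\<beta> ** A = \<beta> ** B" using c(1) by metis
    then show "A = B" by (rule cancel_left2[OF d0])
  qed
  have w: "weight H \<psi> (of_nat (centre_card (Gamma_pr L)))"
    unfolding weight_def
  proof
    show "\<psi> \<in> borel_measurable borel" unfolding \<psi>_def by measurable
    have "AE z in hyp. (\<integral>\<^sup>+A. indicator (Gdom L) (moebius A z) \<partial>count_space (Gamma_pr L)) = of_nat (centre_card (Gamma_pr L))"
      using f(1) by (simp add: weight_def)
    from AE_hyp_moebius[OF db(2) this] AE_hyp_uhp
    show "AE z in hyp. (\<integral>\<^sup>+A. \<psi> (moebius A z) \<partial>count_space H) = of_nat (centre_card (Gamma_pr L))"
    proof eventually_elim
      fix z assume e: "(\<integral>\<^sup>+A. indicator (Gdom L) (moebius A (moebius (adj2 \<beta>) z)) \<partial>count_space (Gamma_pr L)) = of_nat (centre_card (Gamma_pr L))"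
        and z: "z \<in> uhp"
      have "(\<integral>\<^sup>+A. \<psi> (moebius A z) \<partial>count_space H) = (\<integral>\<^sup>+B. \<psi> (moebius (conj2 \<beta> B) z) \<partial>count_space (Gamma_pr L))"
        by (rule nn_integral_bij_count_space[OF bij, symmetric])
      also have "\<dots> = (\<integral>\<^sup>+B. indicator (Gdom L) (moebius B (moebius (adj2 \<beta>) z)) \<partial>count_space (Gamma_pr L))"
      proof (rule nn_integral_cong)
        fix B assume "B \<in> space (count_space (Gamma_pr L))"
        then have B: "B \<in> Gamma_pr L" by simp
        have dB: "det B > 0" "det (conj2 \<beta> B) > 0" using gL(2)[OF B] c(2)[OF B] by (auto simp: Gamma_pr_def)
        define v where "v = moebius (adj2 \<beta>) z"
        have v: "v \<in> uhp" "moebius \<beta> v = z" using z db by (auto simp: v_def moebius_adj2)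
        have "moebius (conj2 \<beta> B) z = moebius (conj2 \<beta> B ** \<beta>) v"
          using v db dB by (simp add: moebius_mult)
        also have "\<dots> = moebius \<beta> (moebius B v)"
          unfolding c(1)[OF B] using v db dB by (simp add: moebius_mult)
        finally have "moebius (adj2 \<beta>) (moebius (conj2 \<beta> B) z) = moebius B v"
          using v db dB by (simp add: moebius_adj2)
        then show "\<psi> (moebius (conj2 \<beta> B) z) = indicator (Gdom L) (moebius B (moebius (adj2 \<beta>) z))"
          by (simp add: \<psi>_def v_def)
      qed
      finally show "(\<integral>\<^sup>+A. \<psi> (moebius A z) \<partial>count_space H) = of_nat (centre_card (Gamma_pr L))"
        using e by simp
    qed
  qed
  have i\<psi>: "(\<integral>\<^sup>+z. \<psi> z \<partial>hyp) = emeasure hyp (Gdom L)"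
    unfolding \<psi>_def using nn_integral_hyp_moebius[OF db(2), of "indicator (Gdom L)"] f(4) by simp
  have "(\<integral>\<^sup>+z. h z \<partial>nu M) = (\<integral>\<^sup>+z. \<psi> z * h z \<partial>hyp) / (\<integral>\<^sup>+z. \<psi> z \<partial>hyp)"
    unfolding nu_def
    by (rule weight_mean_eq(2)[OF sl_group_Gamma_pr H HG fdomain_Gdom w f(2) _ h inv, symmetric])
       (use i\<psi> emeasure_Gdom[OF L] in simp)
  also have "(\<integral>\<^sup>+z. \<psi> z * h z \<partial>hyp) = (\<integral>\<^sup>+z. \<psi> (moebius \<beta> z) * h (moebius \<beta> z) \<partial>hyp)"
    by (rule nn_integral_hyp_moebius[OF db(1), symmetric]) (auto simp: \<psi>_def)
  also have "\<dots> = (\<integral>\<^sup>+z. indicator (Gdom L) z * h (moebius \<beta> z) \<partial>hyp)"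
    by (rule nn_integral_cong_AE)
       (use AE_hyp_uhp in eventually_elim, simp add: \<psi>_def moebius_adj2[OF db(1)])
  also have "\<dots> / (\<integral>\<^sup>+z. \<psi> z \<partial>hyp) = (\<integral>\<^sup>+z. h (moebius \<beta> z) \<partial>nu L)"
    unfolding i\<psi> nu_def by (rule nn_integral_uniform_hyp[symmetric]) (auto intro: f(6))
  finally show ?thesis by (simp add: L_def)
qed

subsection \<open>Means of complex-valued functions\<close>

definition level :: "nat \<Rightarrow> (complex \<Rightarrow> 'a) \<Rightarrow> bool" where
  "level M h \<longleftrightarrow> M > 0 \<and> invariant_under (Gamma_pr M) h"

lemma level_dvd: "level M h \<Longrightarrow> M dvd N \<Longrightarrow> N > 0 \<Longrightarrow> level N h"
  using Gamma_pr_mono[of M N] by (auto simp: level_def invariant_under_def)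

lemma level_compose: "level M h \<Longrightarrow> level M (\<lambda>z. u (h z))"
  by (auto simp: level_def invariant_under_def)

lemma level_binop: "level M h \<Longrightarrow> level M k \<Longrightarrow> level M (\<lambda>z. u (h z) (k z))"
  by (auto simp: level_def invariant_under_def)

lemma level_moebius:
  assumes "level M h" "det \<beta> = int n" "n > 0"
  shows "level (M * n) (\<lambda>z. h (moebius \<beta> z))"
  unfolding level_def invariant_under_def
proof (intro conjI ballI)
  show "0 < M * n" using assms by (simp add: level_def)
  fix B z assume B: "B \<in> Gamma_pr (M * n)" and z: "z \<in> uhp"
  note c = conj2_Gamma_pr[OF assms(2,3) B]
  have d: "det B > 0" "det (conj2 \<beta> B) > 0" "det \<beta> > 0" using B c(2) assms by (auto simp: Gamma_pr_def)
  have "moebius \<beta> (moebius B z) = moebius (conj2 \<beta> B) (moebius \<beta> z)"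
    using d z c(1) by (metis moebius_mult)
  then show "h (moebius \<beta> (moebius B z)) = h (moebius \<beta> z)"
    using assms(1) c(2) d z by (simp add: level_def invariant_under_def)
qed

text \<open>The invariance results concern nonnegative integrands. Applied to indicators of sets of
  values they identify the distributions of complex functions, which settles integrability and the
  integral at once.\<close>

lemma distr_eqI_nn:
  fixes h :: "'a \<Rightarrow> 'c :: topological_space"
  assumes [measurable]: "h \<in> borel_measurable M" "k \<in> borel_measurable N"
    and "\<And>B. B \<in> sets borel \<Longrightarrow> (\<integral>\<^sup>+z. indicator B (h z) \<partial>M) = (\<integral>\<^sup>+z. indicator B (k z) \<partial>N)"
  shows "distr M borel h = distr N borel k"
proof (rule measure_eqI)
  fix B :: "'c set" assume "B \<in> sets (distr M borel h)"
  then have B [measurable]: "B \<in> sets borel" by simp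
  have "emeasure (distr M borel h) B = (\<integral>\<^sup>+z. indicator B z \<partial>distr M borel h)" by simp
  also have "\<dots> = (\<integral>\<^sup>+z. indicator B (h z) \<partial>M)" by (rule nn_integral_distr) auto
  also have "\<dots> = (\<integral>\<^sup>+z. indicator B z \<partial>distr N borel k)"
    using assms(3)[OF B] by (subst nn_integral_distr) auto
  also have "\<dots> = emeasure (distr N borel k) B" by simp
  finally show "emeasure (distr M borel h) B = emeasure (distr N borel k) B" .
qed simp

lemma integral_distr_cong:
  fixes h k :: "_ \<Rightarrow> complex"
  assumes [measurable]: "h \<in> borel_measurable M" "k \<in> borel_measurable N"
    and "distr M borel h = distr N borel k"
  shows "integral\<^sup>L M h = integral\<^sup>L N k" "integrable M h \<longleftrightarrow> integrable N k"
proof -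
  have "integral\<^sup>L M h = integral\<^sup>L (distr M borel h) (\<lambda>x. x)" by (rule integral_distr[symmetric]) auto
  also have "\<dots> = integral\<^sup>L N k" unfolding assms(3) by (rule integral_distr) auto
  finally show "integral\<^sup>L M h = integral\<^sup>L N k" .
  have "integrable M h \<longleftrightarrow> integrable (distr M borel h) (\<lambda>x. x)" by (rule integrable_distr_eq[symmetric]) auto
  also have "\<dots> \<longleftrightarrow> integrable N k" unfolding assms(3) by (rule integrable_distr_eq) auto
  finally show "integrable M h \<longleftrightarrow> integrable N k" .
qed

text \<open>By \<open>mean_eq\<close> the level chosen is immaterial; a measurable function without
  a level just gets an unspecified value.\<close>

definition mean :: "(complex \<Rightarrow> complex) \<Rightarrow> complex" where
  "mean h = integral\<^sup>L (nu (SOME M. level M h)) h"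

definition has_mean :: "(complex \<Rightarrow> complex) \<Rightarrow> bool" where
  "has_mean h \<longleftrightarrow> h \<in> borel_measurable borel \<and> (\<exists>M. level M h \<and> integrable (nu M) h)"

lemma distr_nu_eq:
  fixes h :: "complex \<Rightarrow> complex"
  assumes "level M h" "level N h" and [measurable]: "h \<in> borel_measurable borel"
  shows "distr (nu M) borel h = distr (nu N) borel h"
proof (rule distr_eqI_nn)
  show "h \<in> borel_measurable (nu M)" "h \<in> borel_measurable (nu N)" by (simp_all add: borel_measurable_nu)
  fix B :: "complex set" assume [measurable]: "B \<in> sets borel"
  define k :: "complex \<Rightarrow> ennreal" where "k = (\<lambda>z. indicator B (h z))"
  have l: "level M k" "level N k" unfolding k_def
    by (rule level_compose[OF assms(1), of "indicator B"], rule level_compose[OF assms(2), of "indicator B"])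
  have k: "k \<in> borel_measurable borel" unfolding k_def by measurable
  have "(\<integral>\<^sup>+z. k z \<partial>nu M) = (\<integral>\<^sup>+z. k z \<partial>nu (M * N))" "(\<integral>\<^sup>+z. k z \<partial>nu N) = (\<integral>\<^sup>+z. k z \<partial>nu (M * N))"
    using l k by (auto intro!: nn_integral_nu_dvd simp: level_def)
  then show "(\<integral>\<^sup>+z. indicator B (h z) \<partial>nu M) = (\<integral>\<^sup>+z. indicator B (h z) \<partial>nu N)" by (simp add: k_def)
qed

lemma mean_eq:
  assumes "level M h" "h \<in> borel_measurable borel"
  shows "mean h = integral\<^sup>L (nu M) h" "has_mean h \<longleftrightarrow> integrable (nu M) h"
proof -
  have m: "h \<in> borel_measurable (nu N)" for N using assms(2) by (simp add: borel_measurable_nu)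
  note c = integral_distr_cong[OF m m distr_nu_eq[OF _ assms]]
  have "level (SOME M. level M h) h" using assms(1) by (rule someI)
  then show "mean h = integral\<^sup>L (nu M) h"
    unfolding mean_def by (rule c(1))
  show "has_mean h \<longleftrightarrow> integrable (nu M) h"
  proof
    assume "has_mean h"
    then obtain N where "level N h" "integrable (nu N) h" by (auto simp: has_mean_def)
    then show "integrable (nu M) h" using c(2) by blast
  next
    assume "integrable (nu M) h"
    then show "has_mean h" using assms unfolding has_mean_def by blast
  qed
qed

lemma mean_moebius:
  assumes "level M h" and [measurable]: "h \<in> borel_measurable borel" and n: "det \<beta> = int n" "n > 0"
  shows "mean (\<lambda>z. h (moebius \<beta> z)) = mean h" "has_mean (\<lambda>z. h (moebius \<beta> z)) \<longleftrightarrow> has_mean h"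
proof -
  have l: "level (M * n) (\<lambda>z. h (moebius \<beta> z))" by (rule level_moebius[OF assms(1) n])
  have [measurable]: "(\<lambda>z. h (moebius \<beta> z)) \<in> borel_measurable borel" by measurable
  have m: "h \<in> borel_measurable (nu M)" "(\<lambda>z. h (moebius \<beta> z)) \<in> borel_measurable (nu (M * n))"
    by (simp_all add: borel_measurable_nu)
  have d: "distr (nu (M * n)) borel (\<lambda>z. h (moebius \<beta> z)) = distr (nu M) borel h"
  proof (rule distr_eqI_nn[OF m(2,1)])
    fix B :: "complex set" assume [measurable]: "B \<in> sets borel"
    have "level M (\<lambda>z. indicator B (h z) :: ennreal)" by (rule level_compose[OF assms(1), of "indicator B"])
    then show "(\<integral>\<^sup>+z. indicator B (h (moebius \<beta> z)) \<partial>nu (M * n)) = (\<integral>\<^sup>+z. indicator B (h z) \<partial>nu M)"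
      using n by (intro nn_integral_nu_moebius[of M \<beta> n "\<lambda>z. indicator B (h z)"]) (auto simp: level_def)
  qed
  show "mean (\<lambda>z. h (moebius \<beta> z)) = mean h"
    using integral_distr_cong(1)[OF m(2,1) d] mean_eq(1)[OF l] mean_eq(1)[OF assms(1)] by simp
  show "has_mean (\<lambda>z. h (moebius \<beta> z)) \<longleftrightarrow> has_mean h"
    using integral_distr_cong(2)[OF m(2,1) d] mean_eq(2)[OF l] mean_eq(2)[OF assms(1)] by simp
qed

lemma uniform_hyp_density:
  assumes F [measurable]: "F \<in> sets borel" and Fu: "F \<subseteq> uhp" and V: "emeasure hyp F = ennreal V" "V > 0"
  shows "uniform_measure hyp F = density lborel (\<lambda>z. ennreal (indicator F z / (Im z)\<^sup>2 / V))"
proof -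
  have "uniform_measure hyp F = density lborel (\<lambda>z. ennreal (indicator uhp z / (Im z)\<^sup>2) * (indicator F z / ennreal V))"
    unfolding uniform_measure_def V unfolding hyp_def by (rule density_density_eq) measurable
  also have "\<dots> = density lborel (\<lambda>z. ennreal (indicator F z / (Im z)\<^sup>2 / V))"
    using V Fu by (intro density_cong AE_I2) (auto simp: indicator_def divide_ennreal ennreal_mult[symmetric] simp flip: ennreal_1)
  finally show ?thesis .
qed

lemma integrable_mult_right_iff_complex:
  fixes c :: complex
  assumes "c \<noteq> 0"
  shows "integrable M (\<lambda>x. c * f x) \<longleftrightarrow> integrable M f"
  using integrable_mult_right[of "1 / c" M "\<lambda>x. c * f x"] integrable_mult_right[of c M f] assms by auto

text \<open>This links means to the set integrals behind \<open>petersson\<close>: the uniform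
  measure on \<open>F\<close> has density \<open>1 / (V y^2)\<close> with \<open>V\<close> the
  volume, and it gives an invariant function the same distribution as \<open>nu M\<close>.\<close>

lemma mean_fdomain:
  assumes G: "sl_group G" and HG: "Gamma_pr M \<subseteq> G" and F: "fdomain G F" and M: "M > 0"
    and h [measurable]: "h \<in> borel_measurable borel" and inv: "invariant_under G h"
  shows "measure hyp F > 0" "(LINT z:F|lborel. h z / of_real ((Im z)\<^sup>2)) = of_real (measure hyp F) * mean h"
    "set_integrable lborel F (\<lambda>z. h z / of_real ((Im z)\<^sup>2)) \<longleftrightarrow> has_mean h"
proof -
  note fw = nn_integral_nu_eq[OF G HG F M]
  have Fb [measurable]: "F \<in> sets borel" and Fu: "F \<subseteq> uhp" using F by (auto simp: fdomain_def)
  define V where "V = measure hyp F"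
  have V: "emeasure hyp F = ennreal V" using fw(1) by (simp add: V_def emeasure_eq_ennreal_measure)
  then show Vp: "measure hyp F > 0" using fw(2) by (simp add: V_def zero_less_measure_iff)
  then have Vpos: "V > 0" by (simp add: V_def)
  have lev: "level M h" using M inv HG by (auto simp: level_def invariant_under_def)
  have m: "h \<in> borel_measurable (nu M)" "h \<in> borel_measurable (uniform_measure hyp F)"
    using h by (simp_all add: borel_measurable_nu cong: measurable_cong_sets)
  have d: "distr (nu M) borel h = distr (uniform_measure hyp F) borel h"
  proof (rule distr_eqI_nn[OF m])
    fix B :: "complex set" assume [measurable]: "B \<in> sets borel"
    show "(\<integral>\<^sup>+z. indicator B (h z) \<partial>nu M) = (\<integral>\<^sup>+z. indicator B (h z) \<partial>uniform_measure hyp F)"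
      by (rule fw(3)) (use inv in \<open>auto simp: invariant_under_def\<close>)
  qed
  have u: "uniform_measure hyp F = density lborel (\<lambda>z. ennreal (indicator F z / (Im z)\<^sup>2 / V))"
    by (rule uniform_hyp_density[OF Fb Fu V Vpos])
  have nn: "AE z in lborel. 0 \<le> indicator F z / (Im z)\<^sup>2 / V" using Vpos by (auto simp: indicator_def)
  have "mean h = integral\<^sup>L (uniform_measure hyp F) h"
    using integral_distr_cong(1)[OF m d] mean_eq(1)[OF lev h] by simp
  also have "\<dots> = (\<integral>z. (indicator F z / (Im z)\<^sup>2 / V) *\<^sub>R h z \<partial>lborel)"
    unfolding u using nn by (intro integral_density) auto
  also have "\<dots> = (\<integral>z. (1 / of_real V) * (indicator F z *\<^sub>R (h z / of_real ((Im z)\<^sup>2))) \<partial>lborel)"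
    by (intro Bochner_Integration.integral_cong) (auto simp: indicator_def scaleR_conv_of_real)
  also have "\<dots> = (1 / of_real V) * (LINT z:F|lborel. h z / of_real ((Im z)\<^sup>2))"
    unfolding set_lebesgue_integral_def by (rule integral_mult_right_zero)
  finally show "(LINT z:F|lborel. h z / of_real ((Im z)\<^sup>2)) = of_real (measure hyp F) * mean h"
    using Vpos by (simp add: V_def[symmetric])
  have "has_mean h \<longleftrightarrow> integrable (uniform_measure hyp F) h"
    using integral_distr_cong(2)[OF m d] mean_eq(2)[OF lev h] by simp
  also have "\<dots> \<longleftrightarrow> integrable lborel (\<lambda>z. (indicator F z / (Im z)\<^sup>2 / V) *\<^sub>R h z)"
    unfolding u using nn by (intro integrable_density) auto
  also have "(\<lambda>z. (indicator F z / (Im z)\<^sup>2 / V) *\<^sub>R h z) = (\<lambda>z. (1 / of_real V) * (indicator F z *\<^sub>R (h z / of_real ((Im z)\<^sup>2))))"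
    by (auto simp: indicator_def scaleR_conv_of_real)
  also have "integrable lborel \<dots> \<longleftrightarrow> set_integrable lborel F (\<lambda>z. h z / of_real ((Im z)\<^sup>2))"
    unfolding set_integrable_def using Vpos by (intro integrable_mult_right_iff_complex) simp
  finally show "set_integrable lborel F (\<lambda>z. h z / of_real ((Im z)\<^sup>2)) \<longleftrightarrow> has_mean h" by simp
qed

section \<open>The inner product on square-integrable automorphic functions\<close>

lemma cnj_measurable [measurable]: "cnj \<in> borel_measurable borel"
  by (intro borel_measurable_continuous_onI continuous_intros)

definition aut_level :: "nat \<Rightarrow> (complex \<Rightarrow> complex) \<Rightarrow> bool" where
  "aut_level M u \<longleftrightarrow> level M u \<and> u \<in> borel_measurable borel \<and> integrable (nu M) (\<lambda>z. (cmod (u z))\<^sup>2)"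

text \<open>The level stays open so that the class is closed under sums and under composition with
  any integer matrix of positive determinant.\<close>

definition aut :: "(complex \<Rightarrow> complex) \<Rightarrow> bool" where
  "aut u \<longleftrightarrow> (\<exists>M. aut_level M u)"

definition ip :: "(complex \<Rightarrow> complex) \<Rightarrow> (complex \<Rightarrow> complex) \<Rightarrow> complex" where
  "ip u v = mean (\<lambda>z. u z * cnj (v z))"

lemma integrable_of_real_iff: "integrable M (\<lambda>x. complex_of_real (f x)) \<longleftrightarrow> integrable M f"
  using integrable_Re[of M "\<lambda>x. complex_of_real (f x)"] by (auto intro: integrable_of_real)

lemma aut_level_iff_has_mean:
  assumes "level M u" "u \<in> borel_measurable borel"
  shows "aut_level M u \<longleftrightarrow> has_mean (\<lambda>z. of_real ((cmod (u z))\<^sup>2))"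
proof -
  have "has_mean (\<lambda>z. of_real ((cmod (u z))\<^sup>2)) \<longleftrightarrow> integrable (nu M) (\<lambda>z. complex_of_real ((cmod (u z))\<^sup>2))"
    using assms(2) by (intro mean_eq(2) level_compose[OF assms(1), of "\<lambda>x. complex_of_real ((cmod x)\<^sup>2)"]) measurable
  then show ?thesis unfolding integrable_of_real_iff using assms by (simp add: aut_level_def)
qed

lemma aut_level_dvd:
  assumes "aut_level M u" "M dvd N" "N > 0"
  shows "aut_level N u"
proof -
  have "level M u" "u \<in> borel_measurable borel" using assms by (auto simp: aut_level_def)
  moreover have "level N u" using level_dvd[OF calculation(1) assms(2,3)] .
  ultimately show ?thesis using assms(1) aut_level_iff_has_mean by metis
qed

lemma aut_common:
  assumes "aut u" "aut v"
  obtains M where "aut_level M u" "aut_level M v"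
proof -
  obtain M N where MN: "aut_level M u" "aut_level N v" using assms by (auto simp: aut_def)
  then have "M * N > 0" by (simp add: aut_level_def level_def)
  then show thesis using MN aut_level_dvd[of M u "M * N"] aut_level_dvd[of N v "M * N"] that by auto
qed

lemma aut_measurable: "aut u \<Longrightarrow> u \<in> borel_measurable borel"
  by (auto simp: aut_def aut_level_def)

lemma cmod_add_sq_le: "(cmod (a + b))\<^sup>2 \<le> 2 * (cmod a)\<^sup>2 + 2 * (cmod b)\<^sup>2"
proof -
  have "(cmod (a + b))\<^sup>2 \<le> (cmod a + cmod b)\<^sup>2" by (intro power_mono norm_triangle_ineq) auto
  also have "\<dots> \<le> 2 * (cmod a)\<^sup>2 + 2 * (cmod b)\<^sup>2"
    using zero_le_power2[of "cmod a - cmod b"] by (simp add: power2_eq_square algebra_simps)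
  finally show ?thesis .
qed

lemma cmod_mult_cnj_le: "cmod (a * cnj b) \<le> (cmod a)\<^sup>2 + (cmod b)\<^sup>2"
proof -
  have "0 \<le> (cmod a - cmod b)\<^sup>2 + (cmod a)\<^sup>2 + (cmod b)\<^sup>2" by simp
  then show ?thesis by (simp add: norm_mult power2_eq_square algebra_simps)
qed

lemma aut_add:
  assumes "aut u" "aut v"
  shows "aut (\<lambda>z. u z + v z)"
proof -
  obtain M where M: "aut_level M u" "aut_level M v" using aut_common assms by blast
  have [measurable]: "u \<in> borel_measurable borel" "v \<in> borel_measurable borel"
    using M by (auto simp: aut_level_def)
  have "integrable (nu M) (\<lambda>z. 2 * (cmod (u z))\<^sup>2 + 2 * (cmod (v z))\<^sup>2)"
    using M by (simp add: aut_level_def)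
  then have "integrable (nu M) (\<lambda>z. (cmod (u z + v z))\<^sup>2)"
    by (rule Bochner_Integration.integrable_bound) (auto simp: borel_measurable_nu cmod_add_sq_le)
  moreover have "level M (\<lambda>z. u z + v z)"
    using M level_binop[of M u v "(+)"] by (simp add: aut_level_def)
  ultimately show ?thesis using M unfolding aut_def by (intro exI[of _ M]) (simp add: aut_level_def)
qed

lemma aut_scale:
  assumes "aut u"
  shows "aut (\<lambda>z. c * u z)"
proof -
  obtain M where M: "aut_level M u" using assms by (auto simp: aut_def)
  then show ?thesis unfolding aut_def
    using level_compose[of M u "\<lambda>x. c * x"] by (intro exI[of _ M]) (auto simp: aut_level_def norm_mult power_mult_distrib)
qed

lemma aut_zero: "aut (\<lambda>z. 0)"
  unfolding aut_def by (intro exI[of _ 1]) (auto simp: aut_level_def level_def invariant_under_def)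

lemma aut_sum:
  assumes "\<And>i. i \<in> I \<Longrightarrow> aut (u i)"
  shows "aut (\<lambda>z. \<Sum>i\<in>I. u i z)"
  using assms by (induction I rule: infinite_finite_induct) (auto intro: aut_zero aut_add)

lemma aut_moebius:
  assumes "aut u" "det \<beta> > 0"
  shows "aut (\<lambda>z. u (moebius \<beta> z))"
proof -
  obtain M where M: "aut_level M u" using assms by (auto simp: aut_def)
  obtain n where n: "det \<beta> = int n" "n > 0" using assms(2) by (metis pos_int_cases)
  have lu: "level M u" and [measurable]: "u \<in> borel_measurable borel" using M by (auto simp: aut_level_def)
  have lv: "level (M * n) (\<lambda>z. u (moebius \<beta> z))" by (rule level_moebius[OF lu n])
  have "has_mean (\<lambda>z. of_real ((cmod (u z))\<^sup>2))" using M lu aut_level_iff_has_mean[of M u] by simp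
  then have "has_mean (\<lambda>z. of_real ((cmod (u (moebius \<beta> z)))\<^sup>2))"
    using mean_moebius(2)[OF level_compose[OF lu, of "\<lambda>x. complex_of_real ((cmod x)\<^sup>2)"] _ n] by simp
  then have "aut_level (M * n) (\<lambda>z. u (moebius \<beta> z))"
    using aut_level_iff_has_mean[OF lv] by simp
  then show ?thesis by (auto simp: aut_def)
qed

lemma ip_integrable:
  assumes "aut_level M u" "aut_level M v"
  shows "level M (\<lambda>z. u z * cnj (v z))" "integrable (nu M) (\<lambda>z. u z * cnj (v z))"
    "ip u v = (\<integral>z. u z * cnj (v z) \<partial>nu M)"
proof -
  have [measurable]: "u \<in> borel_measurable borel" "v \<in> borel_measurable borel"
    using assms by (auto simp: aut_level_def)
  show l: "level M (\<lambda>z. u z * cnj (v z))"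
    using assms level_binop[of M u v "\<lambda>x y. x * cnj y"] by (simp add: aut_level_def)
  have "integrable (nu M) (\<lambda>z. (cmod (u z))\<^sup>2 + (cmod (v z))\<^sup>2)" using assms by (simp add: aut_level_def)
  then show "integrable (nu M) (\<lambda>z. u z * cnj (v z))"
    by (rule Bochner_Integration.integrable_bound) (use cmod_mult_cnj_le in \<open>auto simp: borel_measurable_nu\<close>)
  show "ip u v = (\<integral>z. u z * cnj (v z) \<partial>nu M)"
    unfolding ip_def by (rule mean_eq(1)[OF l]) simp
qed

lemma ip_cnj: "aut u \<Longrightarrow> aut v \<Longrightarrow> ip v u = cnj (ip u v)"
proof -
  assume "aut u" "aut v"
  then obtain M where M: "aut_level M u" "aut_level M v" using aut_common by blast
  have "ip v u = (\<integral>z. cnj (u z * cnj (v z)) \<partial>nu M)"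
    unfolding ip_integrable(3)[OF M(2,1)] by (simp add: mult.commute)
  also have "\<dots> = cnj (\<integral>z. u z * cnj (v z) \<partial>nu M)" by (rule Bochner_Integration.integral_cnj)
  finally show ?thesis by (simp add: ip_integrable(3)[OF M])
qed

lemma ip_add_left:
  assumes "aut u" "aut v" "aut w"
  shows "ip (\<lambda>z. u z + v z) w = ip u w + ip v w"
proof -
  obtain M where M: "aut_level M (\<lambda>z. u z + v z)" "aut_level M u" "aut_level M v" "aut_level M w"
  proof -
    obtain M1 M2 where "aut_level M1 u" "aut_level M1 v" "aut_level M2 w" "aut_level M2 (\<lambda>z. u z + v z)"
      using assms aut_add aut_common by metis
    moreover then have "M1 * M2 > 0" by (auto simp: aut_level_def level_def)
    ultimately show ?thesis using aut_level_dvd[of _ _ "M1 * M2"] by (intro that[of "M1 * M2"]) auto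
  qed
  show ?thesis
    unfolding ip_integrable(3)[OF M(1,4)] ip_integrable(3)[OF M(2,4)] ip_integrable(3)[OF M(3,4)]
    using ip_integrable(2)[OF M(2,4)] ip_integrable(2)[OF M(3,4)]
    by (simp add: distrib_right)
qed

lemma ip_scale_left:
  assumes "aut u" "aut w"
  shows "ip (\<lambda>z. c * u z) w = c * ip u w"
proof -
  obtain M where M: "aut_level M u" "aut_level M w" using aut_common assms by blast
  then have M': "aut_level M (\<lambda>z. c * u z)"
    using level_compose[of M u "\<lambda>x. c * x"] by (auto simp: aut_level_def norm_mult power_mult_distrib)
  show ?thesis
    unfolding ip_integrable(3)[OF M] ip_integrable(3)[OF M' M(2)] by (simp add: mult.assoc)
qed

lemma ip_zero_left: "ip (\<lambda>z. 0) w = 0"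
proof -
  have "mean (\<lambda>_. 0) = 0" using mean_eq(1)[of 1 "\<lambda>_. 0"] by (simp add: level_def invariant_under_def)
  then show ?thesis by (simp add: ip_def)
qed

lemma ip_sum_left:
  assumes "\<And>i. i \<in> I \<Longrightarrow> aut (u i)" "aut w"
  shows "ip (\<lambda>z. \<Sum>i\<in>I. c i * u i z) w = (\<Sum>i\<in>I. c i * ip (u i) w)"
  using assms
proof (induction I rule: infinite_finite_induct)
  case (insert x F)
  then have "ip (\<lambda>z. c x * u x z + (\<Sum>i\<in>F. c i * u i z)) w = ip (\<lambda>z. c x * u x z) w + ip (\<lambda>z. \<Sum>i\<in>F. c i * u i z) w"
    by (intro ip_add_left aut_scale aut_sum) auto
  then show ?case using insert by (simp add: ip_scale_left)
qed (auto simp: ip_zero_left)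

lemma ip_sum_right:
  assumes "\<And>i. i \<in> I \<Longrightarrow> aut (u i)" "aut w"
  shows "ip w (\<lambda>z. \<Sum>i\<in>I. c i * u i z) = (\<Sum>i\<in>I. cnj (c i) * ip w (u i))"
proof -
  have "ip w (\<lambda>z. \<Sum>i\<in>I. c i * u i z) = cnj (ip (\<lambda>z. \<Sum>i\<in>I. c i * u i z) w)"
    using assms by (intro ip_cnj aut_sum aut_scale) auto
  also have "\<dots> = cnj (\<Sum>i\<in>I. c i * ip (u i) w)" using assms by (simp add: ip_sum_left)
  also have "\<dots> = (\<Sum>i\<in>I. cnj (c i) * ip w (u i))"
    using assms by (simp add: cnj_sum ip_cnj[of w] cong: sum.cong)
  finally show ?thesis .
qed

lemma ip_add_right:
  assumes "aut u" "aut v" "aut w"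
  shows "ip w (\<lambda>z. u z + v z) = ip w u + ip w v"
  using assms ip_cnj[of "\<lambda>z. u z + v z" w] ip_cnj[of u w] ip_cnj[of v w] by (simp add: ip_add_left aut_add)

lemma ip_scale_right:
  assumes "aut u" "aut w"
  shows "ip w (\<lambda>z. c * u z) = cnj c * ip w u"
  using assms ip_cnj[of "\<lambda>z. c * u z" w] ip_cnj[of u w] by (simp add: ip_scale_left aut_scale)

lemma ip_moebius:
  assumes "aut u" "aut v" "det \<beta> > 0"
  shows "ip (\<lambda>z. u (moebius \<beta> z)) (\<lambda>z. v (moebius \<beta> z)) = ip u v"
proof -
  obtain n where n: "det \<beta> = int n" "n > 0" using assms(3) by (metis pos_int_cases)
  obtain M where M: "aut_level M u" "aut_level M v" using aut_common assms by blast
  then show ?thesis unfolding ip_def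
    by (intro mean_moebius(1)[OF ip_integrable(1)[OF M] _ n]) (auto simp: aut_level_def)
qed

lemma AE_nu_uhp: "M > 0 \<Longrightarrow> AE z in nu M. z \<in> uhp"
  using fdomain_weight(6)[OF sl_group_Gamma_pr fdomain_Gdom[of M]] emeasure_Gdom[of M] AE_hyp_uhp
  unfolding nu_def by (subst AE_uniform_measure) (auto simp: less_top)

lemma mean_cong:
  assumes "\<And>z. z \<in> uhp \<Longrightarrow> h z = k z" "h \<in> borel_measurable borel" "k \<in> borel_measurable borel"
    and M: "level M h"
  shows "mean h = mean k"
proof -
  have M': "level M k"
    using M assms(1) by (auto simp: level_def invariant_under_def Gamma_pr_def)
  have "integral\<^sup>L (nu M) h = integral\<^sup>L (nu M) k"
  proof (rule integral_cong_AE)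
    have "AE z in nu M. z \<in> uhp" using M by (intro AE_nu_uhp) (simp add: level_def)
    then show "AE z in nu M. h z = k z" by eventually_elim (rule assms(1))
  qed (use assms in \<open>auto simp: borel_measurable_nu\<close>)
  then show ?thesis using mean_eq(1)[OF M assms(2)] mean_eq(1)[OF M' assms(3)] by simp
qed

lemma ip_cong:
  assumes "\<And>z. z \<in> uhp \<Longrightarrow> u z = u' z" "\<And>z. z \<in> uhp \<Longrightarrow> v z = v' z"
    "aut u" "aut v" "aut u'" "aut v'"
  shows "ip u v = ip u' v'"
proof -
  have [measurable]: "u \<in> borel_measurable borel" "v \<in> borel_measurable borel"
    "u' \<in> borel_measurable borel" "v' \<in> borel_measurable borel"
    using assms by (auto intro: aut_measurable)
  obtain M where M: "aut_level M u" "aut_level M v" using aut_common assms by blast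
  show ?thesis unfolding ip_def
    by (rule mean_cong[OF _ _ _ ip_integrable(1)[OF M]]) (simp_all add: assms(1,2))

qed

lemma ip_self_real:
  assumes "aut u"
  shows "ip u u = of_real (Re (ip u u))" "Re (ip u u) \<ge> 0"
proof -
  obtain M where M: "aut_level M u" using assms by (auto simp: aut_def)
  have e: "ip u u = of_real (\<integral>z. (cmod (u z))\<^sup>2 \<partial>nu M)"
    unfolding ip_integrable(3)[OF M M] by (simp add: complex_norm_square[symmetric] flip: of_real_power)
  show "ip u u = of_real (Re (ip u u))" by (simp add: e)
  show "Re (ip u u) \<ge> 0" by (simp add: e)
qed

text \<open>The integral shows that \<open>u\<close> vanishes almost everywhere on
  \<open>Gdom M\<close>; invariance spreads this to almost all of \<open>uhp\<close>, and a nonempty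
  open set is not null.\<close>

lemma ip_self_eq_0:
  assumes "aut u" "continuous_on uhp u" "ip u u = 0" "z \<in> uhp"
  shows "u z = 0"
proof -
  obtain M where M: "aut_level M u" using assms by (auto simp: aut_def)
  then have Mp: "M > 0" and inv: "invariant_under (Gamma_pr M) u"
    and int: "integrable (nu M) (\<lambda>z. (cmod (u z))\<^sup>2)" by (auto simp: aut_level_def level_def)
  have "(\<integral>z. (cmod (u z))\<^sup>2 \<partial>nu M) = 0"
    using assms(3) unfolding ip_integrable(3)[OF M M]
    by (simp add: complex_norm_square[symmetric] flip: of_real_power)
  then have "AE z in nu M. (cmod (u z))\<^sup>2 = 0"
    using int by (subst (asm) integral_nonneg_eq_0_iff_AE) auto
  then have "AE z in hyp. z \<in> Gdom M \<longrightarrow> u z = 0"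
    using fdomain_weight(6)[OF sl_group_Gamma_pr fdomain_Gdom[of M]] emeasure_Gdom[OF Mp]
    unfolding nu_def by (subst (asm) AE_uniform_measure) (auto simp: less_top)
  then have a: "AE z in hyp. moebius A z \<in> Gdom M \<longrightarrow> u (moebius A z) = 0" if "A \<in> Gamma_pr M" for A
    using that by (intro AE_hyp_moebius) (auto simp: Gamma_pr_def)
  have "AE z in hyp. \<forall>A\<in>Gamma_pr M. moebius A z \<in> Gdom M \<longrightarrow> u (moebius A z) = 0"
    unfolding AE_ball_countable[OF countableI_type] using a by blast
  with AE_hyp_uhp have "AE z in hyp. z \<notin> {z\<in>uhp. u z \<noteq> 0}"
  proof eventually_elim
    fix z assume z: "z \<in> uhp" and 0: "\<forall>A\<in>Gamma_pr M. moebius A z \<in> Gdom M \<longrightarrow> u (moebius A z) = 0"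
    obtain A where "A \<in> Gamma_pr M" "moebius A z \<in> Gdom M"
      using fdomain_Gdom[of M] z unfolding fdomain_def by metis
    then show "z \<notin> {z\<in>uhp. u z \<noteq> 0}" using 0 inv z by (auto simp: invariant_under_def)
  qed
  moreover have "open {z\<in>uhp. u z \<noteq> 0}"
  proof -
    have "open (uhp \<inter> u -` (- {0}))"
      using assms(2) by (intro continuous_open_preimage) auto
    also have "uhp \<inter> u -` (- {0}) = {z\<in>uhp. u z \<noteq> 0}" by auto
    finally show ?thesis .
  qed
  ultimately have "{z\<in>uhp. u z \<noteq> 0} = {}" by (rule AE_hyp_open) auto
  then show ?thesis using assms(4) by blast
qed

section \<open>Real smoothness and the Laplacian under holomorphic substitutions\<close>

lemma has_derivative_cong_open:
  assumes "open S" "z \<in> S" "\<And>w. w \<in> S \<Longrightarrow> f w = g w"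
  shows "(f has_derivative f') (at z) \<longleftrightarrow> (g has_derivative f') (at z)"
  using has_derivative_transform_within_open[of f f' z UNIV S g] has_derivative_transform_within_open[of g f' z UNIV S f] assms
  by auto

lemma dir_deriv_cong:
  assumes "open S" "z \<in> S" "\<And>w. w \<in> S \<Longrightarrow> f w = g w"
  shows "dir_deriv v f z = dir_deriv v g z"
  unfolding dir_deriv_def frechet_derivative_def using has_derivative_cong_open[OF assms] by simp

lemma differentiable_cong_open:
  assumes "open S" "z \<in> S" "\<And>w. w \<in> S \<Longrightarrow> f w = g w"
  shows "f differentiable (at z) \<longleftrightarrow> g differentiable (at z)"
  unfolding differentiable_def using has_derivative_cong_open[OF assms] by simp

lemma foldr_dir_deriv_cong:
  assumes "open S" "\<And>w. w \<in> S \<Longrightarrow> f w = g w" "z \<in> S"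
  shows "foldr dir_deriv vs f z = foldr dir_deriv vs g z"
  using assms(3) by (induction vs arbitrary: z) (auto simp: assms(2) intro: dir_deriv_cong[OF assms(1)])

text \<open>A coinduction principle: a class of differentiable functions closed under directional
  derivatives on \<open>S\<close> consists of smooth functions. \<open>foldr\<close> applies the
  last direction first, hence the induction from the end of the list.\<close>

lemma real_smooth_onI:
  assumes S: "open S" and K: "\<And>h z. h \<in> K \<Longrightarrow> z \<in> S \<Longrightarrow> h differentiable (at z)"
    and D: "\<And>h v. h \<in> K \<Longrightarrow> \<exists>k\<in>K. \<forall>z\<in>S. dir_deriv v h z = k z" and h: "h \<in> K"
  shows "real_smooth_on S h"
proof -
  have "foldr dir_deriv vs h differentiable (at z)" if "z \<in> S" for vs z
    using h
  proof (induction vs arbitrary: h rule: rev_induct)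
    case Nil
    then show ?case using K that by simp
  next
    case (snoc v vs)
    obtain k where k: "k \<in> K" "\<forall>z\<in>S. dir_deriv v h z = k z" using D[OF snoc.prems] by blast
    have "foldr dir_deriv vs k differentiable (at z)" using snoc.IH[OF k(1)] .
    moreover have "foldr dir_deriv vs (dir_deriv v h) w = foldr dir_deriv vs k w" if "w \<in> S" for w
      by (rule foldr_dir_deriv_cong[OF S _ that]) (use k in blast)
    ultimately show ?case
      using differentiable_cong_open[OF S \<open>z \<in> S\<close>, of "foldr dir_deriv vs (dir_deriv v h)" "foldr dir_deriv vs k"] by simp
  qed
  then show ?thesis by (simp add: real_smooth_on_def)
qed

lemma real_smooth_on_dir_deriv: "real_smooth_on S f \<Longrightarrow> real_smooth_on S (dir_deriv v f)"
  unfolding real_smooth_on_def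
proof (intro allI ballI)
  fix vs z assume "\<forall>vs. \<forall>z\<in>S. foldr dir_deriv vs f differentiable (at z)" "z \<in> S"
  then have "foldr dir_deriv (vs @ [v]) f differentiable (at z)" by blast
  then show "foldr dir_deriv vs (dir_deriv v f) differentiable (at z)" by simp
qed

lemma real_smooth_on_differentiable: "real_smooth_on S f \<Longrightarrow> z \<in> S \<Longrightarrow> f differentiable (at z)"
  unfolding real_smooth_on_def by (metis foldr_Nil id_apply)

lemma real_smooth_on_continuous: "real_smooth_on S f \<Longrightarrow> continuous_on S f"
  by (auto intro!: continuous_at_imp_continuous_on differentiable_imp_continuous_within real_smooth_on_differentiable)

lemma dir_deriv_has_derivative:
  assumes "f differentiable (at z)"
  shows "(f has_derivative (\<lambda>v. dir_deriv v f z)) (at z)"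
  using assms unfolding frechet_derivative_works by (simp add: dir_deriv_def)

lemma dir_derivI: "(f has_derivative f') (at z) \<Longrightarrow> dir_deriv v f z = f' v"
  unfolding dir_deriv_def using frechet_derivative_at by metis

lemma dir_deriv_components:
  assumes "f differentiable (at z)"
  shows "dir_deriv v f z = dir_deriv 1 f z * of_real (Re v) + dir_deriv \<i> f z * of_real (Im v)"
proof -
  note d = dir_deriv_has_derivative[OF assms]
  then have l: "linear (\<lambda>v. dir_deriv v f z)" by (rule has_derivative_linear)
  have "v = Re v *\<^sub>R 1 + Im v *\<^sub>R \<i>" by (simp add: complex_eq_iff)
  then have "dir_deriv v f z = dir_deriv (Re v *\<^sub>R 1 + Im v *\<^sub>R \<i>) f z" by simp
  also have "\<dots> = Re v *\<^sub>R dir_deriv 1 f z + Im v *\<^sub>R dir_deriv \<i> f z"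
    using linear_add[OF l] linear_scale[OF l] by simp
  finally show ?thesis by (simp add: scaleR_conv_of_real mult.commute)
qed

lemma dir_deriv_add:
  assumes "f differentiable (at z)" "g differentiable (at z)"
  shows "dir_deriv v (\<lambda>z. f z + g z) z = dir_deriv v f z + dir_deriv v g z"
  by (rule dir_derivI[OF has_derivative_add[OF dir_deriv_has_derivative[OF assms(1)] dir_deriv_has_derivative[OF assms(2)]]])

lemma dir_deriv_mult:
  assumes "f differentiable (at z)" "g differentiable (at z)"
  shows "dir_deriv v (\<lambda>z. f z * g z) z = f z * dir_deriv v g z + dir_deriv v f z * g z"
  by (rule dir_derivI[OF has_derivative_mult[OF dir_deriv_has_derivative[OF assms(1)] dir_deriv_has_derivative[OF assms(2)]]])

lemma dir_deriv_cmult: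
  assumes "f differentiable (at z)"
  shows "dir_deriv v (\<lambda>z. c * f z) z = c * dir_deriv v f z"
  by (rule dir_derivI[OF has_derivative_mult_right[OF dir_deriv_has_derivative[OF assms]]])

lemma dir_deriv_field:
  assumes "(f has_field_derivative f') (at z)"
  shows "dir_deriv v f z = f' * v" "f differentiable (at z)"
  using assms unfolding has_field_derivative_def by (auto intro: dir_derivI differentiableI)

lemma dir_deriv_Re:
  assumes "(f has_field_derivative f') (at z)"
  shows "dir_deriv v (\<lambda>z. of_real (Re (f z))) z = of_real (Re (f' * v))"
    "(\<lambda>z. complex_of_real (Re (f z))) differentiable (at z)"
proof -
  have "((\<lambda>z. complex_of_real (Re (f z))) has_derivative (\<lambda>v. of_real (Re (f' * v)))) (at z)"
    using assms unfolding has_field_derivative_def by (intro has_derivative_of_real has_derivative_Re)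
  then show "dir_deriv v (\<lambda>z. of_real (Re (f z))) z = of_real (Re (f' * v))"
    "(\<lambda>z. complex_of_real (Re (f z))) differentiable (at z)"
    by (auto intro: dir_derivI differentiableI)
qed

lemma dir_deriv_compose:
  assumes "(g has_field_derivative g') (at z)" "h differentiable (at (g z))"
  shows "dir_deriv v (\<lambda>z. h (g z)) z = dir_deriv 1 h (g z) * of_real (Re (g' * v)) + dir_deriv \<i> h (g z) * of_real (Im (g' * v))"
    "(\<lambda>z. h (g z)) differentiable (at z)"
proof -
  have "((\<lambda>z. h (g z)) has_derivative (\<lambda>v. dir_deriv (g' * v) h (g z))) (at z)"
    using has_derivative_compose[of g "(*) g'" z UNIV h "\<lambda>v. dir_deriv v h (g z)"]
      assms(1) dir_deriv_has_derivative[OF assms(2)] unfolding has_field_derivative_def by simp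
  then show "dir_deriv v (\<lambda>z. h (g z)) z = dir_deriv 1 h (g z) * of_real (Re (g' * v)) + dir_deriv \<i> h (g z) * of_real (Im (g' * v))"
    "(\<lambda>z. h (g z)) differentiable (at z)"
    using dir_deriv_components[OF assms(2), of "g' * v"] by (auto dest: dir_derivI[of _ _ _ v] intro: differentiableI)
qed

text \<open>A class containing \<open>h\<close> composed with \<open>g\<close> and closed under
  directional derivatives. The chain rule produces real and imaginary parts of holomorphic functions
  as coefficients; imaginary parts are covered by \<open>re\<close> through the factor
  \<open>- \<i>\<close>.\<close>

inductive_set smooth_combs :: "complex set \<Rightarrow> complex set \<Rightarrow> (complex \<Rightarrow> complex) \<Rightarrow> (complex \<Rightarrow> complex) set"
  for S T g where
  comp: "real_smooth_on T h \<Longrightarrow> (\<lambda>z. h (g z)) \<in> smooth_combs S T g"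
| hol: "c holomorphic_on S \<Longrightarrow> c \<in> smooth_combs S T g"
| re: "c holomorphic_on S \<Longrightarrow> (\<lambda>z. of_real (Re (c z))) \<in> smooth_combs S T g"
| add: "h \<in> smooth_combs S T g \<Longrightarrow> k \<in> smooth_combs S T g \<Longrightarrow> (\<lambda>z. h z + k z) \<in> smooth_combs S T g"
| mult: "h \<in> smooth_combs S T g \<Longrightarrow> k \<in> smooth_combs S T g \<Longrightarrow> (\<lambda>z. h z * k z) \<in> smooth_combs S T g"

lemma smooth_combs_smooth:
  assumes S: "open S" and T: "g ` S \<subseteq> T" and g: "g holomorphic_on S" and h: "h \<in> smooth_combs S T g"
  shows "real_smooth_on S h"
proof (rule real_smooth_onI[OF S _ _ h])
  have dg: "(c has_field_derivative deriv c z) (at z)" if "z \<in> S" "c holomorphic_on S" for c z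
    using that S by (simp add: holomorphic_derivI)
  have dh: "deriv c holomorphic_on S" if "c holomorphic_on S" for c
    using that S by (rule holomorphic_deriv)
  have diff: "h differentiable (at z)" if "h \<in> smooth_combs S T g" "z \<in> S" for h z
    using that
  proof induction
    case (comp h)
    then show ?case using T by (intro dir_deriv_compose(2)[OF dg[OF _ g]] real_smooth_on_differentiable) auto
  next
    case (hol c)
    then show ?case using dir_deriv_field(2)[OF dg] by blast
  next
    case (re c)
    then show ?case using dir_deriv_Re(2)[OF dg] by blast
  qed (auto intro: differentiable_add differentiable_mult)
  then show "\<And>h z. h \<in> smooth_combs S T g \<Longrightarrow> z \<in> S \<Longrightarrow> h differentiable (at z)" .
  fix h v assume "h \<in> smooth_combs S T g"
  then show "\<exists>k\<in>smooth_combs S T g. \<forall>z\<in>S. dir_deriv v h z = k z"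
  proof induction
    case (comp h)
    let ?k = "\<lambda>z. dir_deriv 1 h (g z) * of_real (Re (deriv g z * v)) + dir_deriv \<i> h (g z) * of_real (Re (- \<i> * (deriv g z * v)))"
    have "(\<lambda>z. deriv g z * v) holomorphic_on S" "(\<lambda>z. - \<i> * (deriv g z * v)) holomorphic_on S"
      by (intro holomorphic_intros dh g)+
    from this[THEN smooth_combs.re[where T = T and g = g]]
    have "(\<lambda>z. of_real (Re (deriv g z * v))) \<in> smooth_combs S T g"
      "(\<lambda>z. of_real (Re (- \<i> * (deriv g z * v)))) \<in> smooth_combs S T g" .
    moreover have "(\<lambda>z. dir_deriv w h (g z)) \<in> smooth_combs S T g" for w
      using real_smooth_on_dir_deriv[OF comp] by (rule smooth_combs.comp)
    ultimately have "?k \<in> smooth_combs S T g"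
      by (intro smooth_combs.add smooth_combs.mult)
    moreover have "dir_deriv v (\<lambda>z. h (g z)) z = ?k z" if "z \<in> S" for z
    proof -
      have "g z \<in> T" using that T by blast
      from dir_deriv_compose(1)[OF dg[OF that g] real_smooth_on_differentiable[OF comp this], of v]
      show ?thesis by simp
    qed
    ultimately show ?case by (intro bexI[of _ ?k]) simp_all
  next
    case (hol c)
    have "(\<lambda>z. deriv c z * v) holomorphic_on S" by (intro holomorphic_intros dh hol)
    then have "(\<lambda>z. deriv c z * v) \<in> smooth_combs S T g" by (rule smooth_combs.hol)
    then show ?case
      by (intro bexI[of _ "\<lambda>z. deriv c z * v"] ballI dir_deriv_field(1)[OF dg[OF _ hol]])
  next
    case (re c)
    have "(\<lambda>z. deriv c z * v) holomorphic_on S" by (intro holomorphic_intros dh re)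
    then have "(\<lambda>z. of_real (Re (deriv c z * v))) \<in> smooth_combs S T g" by (rule smooth_combs.re)
    then show ?case
      by (intro bexI[of _ "\<lambda>z. of_real (Re (deriv c z * v))"] ballI dir_deriv_Re(1)[OF dg[OF _ re]])
  next
    case (add h k)
    then obtain h' k' where hk: "h' \<in> smooth_combs S T g" "\<forall>z\<in>S. dir_deriv v h z = h' z"
      "k' \<in> smooth_combs S T g" "\<forall>z\<in>S. dir_deriv v k z = k' z" by blast
    then have "(\<lambda>z. h' z + k' z) \<in> smooth_combs S T g" by (intro smooth_combs.add)
    moreover have "\<forall>z\<in>S. dir_deriv v (\<lambda>z. h z + k z) z = h' z + k' z"
      using hk diff add by (simp add: dir_deriv_add)
    ultimately show ?case by (intro bexI[of _ "\<lambda>z. h' z + k' z"])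
  next
    case (mult h k)
    then obtain h' k' where hk: "h' \<in> smooth_combs S T g" "\<forall>z\<in>S. dir_deriv v h z = h' z"
      "k' \<in> smooth_combs S T g" "\<forall>z\<in>S. dir_deriv v k z = k' z" by blast
    then have "(\<lambda>z. h z * k' z + h' z * k z) \<in> smooth_combs S T g"
      using mult by (intro smooth_combs.add smooth_combs.mult)
    moreover have "\<forall>z\<in>S. dir_deriv v (\<lambda>z. h z * k z) z = h z * k' z + h' z * k z"
      using hk diff mult by (simp add: dir_deriv_mult)
    ultimately show ?case by (intro bexI[of _ "\<lambda>z. h z * k' z + h' z * k z"])
  qed
qed

lemma real_smooth_on_compose:
  assumes "open S" "g ` S \<subseteq> T" "g holomorphic_on S" "real_smooth_on T h"
  shows "real_smooth_on S (\<lambda>z. h (g z))"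
  by (rule smooth_combs_smooth[OF assms(1-3) smooth_combs.comp[OF assms(4)]])

lemma real_smooth_on_lincomb:
  assumes "open S" "real_smooth_on S h" "real_smooth_on S k"
  shows "real_smooth_on S (\<lambda>z. h z + c * k z)"
proof (rule smooth_combs_smooth[of S "\<lambda>z. z" S])
  show "(\<lambda>z. h z + c * k z) \<in> smooth_combs S S (\<lambda>z. z)"
    using smooth_combs.comp[where T = S and h = h and S = S and g = "\<lambda>z. z"]
      smooth_combs.comp[where T = S and h = k and S = S and g = "\<lambda>z. z"]
      smooth_combs.hol[where c = "\<lambda>_. c" and S = S and T = S and g = "\<lambda>z. z"] assms
    by (intro smooth_combs.add smooth_combs.mult) auto
qed (use assms in auto)

text \<open>Passing from direction \<open>1\<close> to \<open>\<i>\<close> changes the sign of the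
  first-order terms, which carry \<open>v * v\<close>, and of the mixed terms, which carry the
  product of real and imaginary part of \<open>deriv g z * v\<close>. Both cancel in the sum, while
  the squares add up to \<open>|deriv g z|^2\<close>.\<close>

lemma laplacian_compose:
  assumes S: "open S" and T: "g ` S \<subseteq> T" and g: "g holomorphic_on S" and h: "real_smooth_on T h" and z: "z \<in> S"
  shows "dir_deriv 1 (dir_deriv 1 (\<lambda>z. h (g z))) z + dir_deriv \<i> (dir_deriv \<i> (\<lambda>z. h (g z))) z =
    of_real ((cmod (deriv g z))\<^sup>2) * (dir_deriv 1 (dir_deriv 1 h) (g z) + dir_deriv \<i> (dir_deriv \<i> h) (g z))"
proof -
  have dg: "(c has_field_derivative deriv c w) (at w)" if "w \<in> S" "c holomorphic_on S" for c w
    using that S by (simp add: holomorphic_derivI)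
  have dgh: "deriv g holomorphic_on S" using g S by (rule holomorphic_deriv)
  define a b where "a = dir_deriv 1 h" and "b = dir_deriv \<i> h"
  have ab: "real_smooth_on T a" "real_smooth_on T b"
    unfolding a_def b_def by (intro real_smooth_on_dir_deriv h)+
  have dT: "u differentiable (at (g w))" if "real_smooth_on T u" "w \<in> S" for u w
    using real_smooth_on_differentiable[OF that(1)] that(2) T by auto
  have second: "dir_deriv v (dir_deriv v (\<lambda>z. h (g z))) z =
      a (g z) * of_real (Re (deriv (deriv g) z * v * v)) +
      (dir_deriv 1 a (g z) * of_real (Re (deriv g z * v)) + dir_deriv \<i> a (g z) * of_real (Im (deriv g z * v))) * of_real (Re (deriv g z * v)) +
      (b (g z) * of_real (Im (deriv (deriv g) z * v * v)) +
      (dir_deriv 1 b (g z) * of_real (Re (deriv g z * v)) + dir_deriv \<i> b (g z) * of_real (Im (deriv g z * v))) * of_real (Im (deriv g z * v)))" for v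
  proof -
    have "dir_deriv v (dir_deriv v (\<lambda>z. h (g z))) z =
        dir_deriv v (\<lambda>z. a (g z) * of_real (Re (deriv g z * v)) + b (g z) * of_real (Re (- \<i> * (deriv g z * v)))) z"
      using dir_deriv_compose(1)[OF dg[OF _ g] dT[OF h]]
      by (intro dir_deriv_cong[OF S z]) (simp add: a_def b_def)
    also have "\<dots> = dir_deriv v (\<lambda>z. a (g z) * of_real (Re (deriv g z * v))) z + dir_deriv v (\<lambda>z. b (g z) * of_real (Re (- \<i> * (deriv g z * v)))) z"
    proof (rule dir_deriv_add; rule differentiable_mult)
      show "(\<lambda>z. a (g z)) differentiable (at z)" "(\<lambda>z. b (g z)) differentiable (at z)"
        using dir_deriv_compose(2)[OF dg[OF z g] dT[OF _ z]] ab by blast+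
      show "(\<lambda>z. complex_of_real (Re (deriv g z * v))) differentiable (at z)"
        by (rule dir_deriv_Re(2)[OF dg[OF z]]) (intro holomorphic_intros dgh)
      show "(\<lambda>z. complex_of_real (Re (- \<i> * (deriv g z * v)))) differentiable (at z)"
        by (rule dir_deriv_Re(2)[OF dg[OF z]]) (intro holomorphic_intros dgh)
    qed
    also have "dir_deriv v (\<lambda>z. a (g z) * of_real (Re (deriv g z * v))) z =
        a (g z) * of_real (Re (deriv (deriv g) z * v * v)) +
        (dir_deriv 1 a (g z) * of_real (Re (deriv g z * v)) + dir_deriv \<i> a (g z) * of_real (Im (deriv g z * v))) * of_real (Re (deriv g z * v))"
    proof -
      have d: "((\<lambda>z. deriv g z * v) has_field_derivative deriv (deriv g) z * v) (at z)"
        using dg[OF z dgh] by (auto intro!: derivative_eq_intros)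
      show ?thesis
        using dir_deriv_compose[OF dg[OF z g] dT[OF ab(1) z]] dir_deriv_Re[OF d]
        by (subst dir_deriv_mult) auto
    qed
    also have "dir_deriv v (\<lambda>z. b (g z) * of_real (Re (- \<i> * (deriv g z * v)))) z =
        b (g z) * of_real (Re (- \<i> * (deriv (deriv g) z * v) * v)) +
        (dir_deriv 1 b (g z) * of_real (Re (deriv g z * v)) + dir_deriv \<i> b (g z) * of_real (Im (deriv g z * v))) * of_real (Re (- \<i> * (deriv g z * v)))"
    proof -
      have d: "((\<lambda>z. - \<i> * (deriv g z * v)) has_field_derivative - \<i> * (deriv (deriv g) z * v)) (at z)"
        using dg[OF z dgh] by (auto intro!: derivative_eq_intros)
      show ?thesis
        using dir_deriv_compose[OF dg[OF z g] dT[OF ab(2) z]] dir_deriv_Re[OF d]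
        by (subst dir_deriv_mult) auto
    qed
    moreover have "- \<i> * (deriv (deriv g) z * v) * v = - \<i> * (deriv (deriv g) z * v * v)" by simp
    moreover have "Re (- \<i> * x) = Im x" for x by simp
    ultimately show ?thesis by (simp only:)
  qed
  show ?thesis
    unfolding second a_def[symmetric] b_def[symmetric] cmod_power2
    by (simp add: complex_eq_iff algebra_simps power2_eq_square)
qed

lemma moebius_holomorphic: "det A > 0 \<Longrightarrow> moebius A holomorphic_on uhp"
  by (rule holomorphic_onI)
     (metis field_differentiable_def field_differentiable_at_within moebius_has_field_derivative)

text \<open>The imaginary part is multiplied by the modulus of the derivative, which is exactly what
  the factor in \<open>laplacian_compose\<close> requires.\<close>

lemma hyp_laplacian_moebius:
  assumes A: "det A > 0" and h: "real_smooth_on uhp h" and z: "z \<in> uhp"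
  shows "hyp_laplacian (\<lambda>z. h (moebius A z)) z = hyp_laplacian h (moebius A z)"
proof -
  have im: "moebius A ` uhp \<subseteq> uhp" using A by auto
  have d: "deriv (moebius A) z = of_int (det A) / (mden A z)\<^sup>2"
    using moebius_has_field_derivative[OF A z] by (rule DERIV_imp_deriv)
  have "Im (moebius A z) = Im z * cmod (deriv (moebius A) z)"
    using A by (simp add: d Im_moebius norm_divide norm_power)
  then have "(Im (moebius A z))\<^sup>2 = (Im z)\<^sup>2 * (cmod (deriv (moebius A) z))\<^sup>2"
    by (simp add: power_mult_distrib)
  then show ?thesis
    using laplacian_compose[OF uhp_open im moebius_holomorphic[OF A] h z]
    unfolding hyp_laplacian_def by simp
qed

lemma hyp_laplacian_lincomb:
  assumes S: "open S" and h: "real_smooth_on S h" and k: "real_smooth_on S k" and z: "z \<in> S"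
  shows "hyp_laplacian (\<lambda>z. h z + c * k z) z = hyp_laplacian h z + c * hyp_laplacian k z"
proof -
  have d: "dir_deriv v (\<lambda>z. h z + c * k z) z = dir_deriv v h z + c * dir_deriv v k z"
    if "real_smooth_on S h" "real_smooth_on S k" "z \<in> S" for h k v z
    using real_smooth_on_differentiable[OF that(1,3)] real_smooth_on_differentiable[OF that(2,3)]
    by (subst dir_deriv_add) (auto simp: dir_deriv_cmult intro!: differentiable_mult)
  have "dir_deriv v (dir_deriv v (\<lambda>z. h z + c * k z)) z = dir_deriv v (dir_deriv v h) z + c * dir_deriv v (dir_deriv v k) z" for v
  proof -
    have "dir_deriv v (dir_deriv v (\<lambda>z. h z + c * k z)) z = dir_deriv v (\<lambda>z. dir_deriv v h z + c * dir_deriv v k z) z"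
      by (rule dir_deriv_cong[OF S z]) (rule d[OF h k])
    then show ?thesis using d[OF real_smooth_on_dir_deriv[OF h] real_smooth_on_dir_deriv[OF k] z] by simp
  qed
  then show ?thesis unfolding hyp_laplacian_def by (simp add: algebra_simps)
qed

section \<open>The inner products of the dilates of a newform\<close>

lemma Gamma0_1: "Gamma0 1 = SL2Z"
  by (auto simp: Gamma0_def)

lemma sl_group_Gamma0: "sl_group (Gamma0 N)"
  unfolding sl_group_def Gamma0_def by (auto simp: mat2_mult_nth det_mult2)

lemma Gamma_pr_subset_Gamma0: "N dvd M \<Longrightarrow> Gamma_pr M \<subseteq> Gamma0 N"
  by (auto simp: Gamma_pr_def Gamma0_def intro: dvd_trans[of "int N" "int M"])

lemma fdomain_fundamental_domain: "fdomain (Gamma0 N) (fundamental_domain N)"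
proof -
  have "is_fundamental_domain N (closest_points (Gamma0 N))"
    using fdomain_closest_points[OF sl_group_Gamma0[of N]] by (simp add: is_fundamental_domain_def fdomain_def)
  then have "is_fundamental_domain N (fundamental_domain N)"
    unfolding fundamental_domain_def by (rule someI)
  then show ?thesis by (simp add: is_fundamental_domain_def fdomain_def)
qed

definition covolume :: "nat \<Rightarrow> real" where
  "covolume N = measure hyp (fundamental_domain N)"

lemmas mean_fundamental_domain =
  mean_fdomain[OF sl_group_Gamma0 Gamma_pr_subset_Gamma0[OF dvd_refl] fdomain_fundamental_domain]

lemma covolume_pos: "N > 0 \<Longrightarrow> covolume N > 0"
  unfolding covolume_def
  by (rule mean_fundamental_domain(1)[where h = "\<lambda>_. 0"]) (auto simp: invariant_under_def)

lemma petersson_eq_ip: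
  assumes "N > 0" "aut u" "aut v" "invariant_under (Gamma0 N) u" "invariant_under (Gamma0 N) v"
  shows "petersson N u v = of_real (covolume N) * ip u v"
proof -
  have [measurable]: "u \<in> borel_measurable borel" "v \<in> borel_measurable borel" using assms aut_measurable by auto
  have "(LINT z:fundamental_domain N|lborel. (u z * cnj (v z)) / of_real ((Im z)\<^sup>2)) = of_real (covolume N) * mean (\<lambda>z. u z * cnj (v z))"
    unfolding covolume_def
    by (rule mean_fundamental_domain(2)[OF assms(1)]) (use assms(4,5) in \<open>auto simp: invariant_under_def\<close>)
  then show ?thesis by (simp add: petersson_def ip_def)
qed

lemma square_integrable_iff:
  assumes "N > 0" "u \<in> borel_measurable borel" "invariant_under (Gamma0 N) u"
  shows "set_integrable lborel (fundamental_domain N) (\<lambda>z. (cmod (u z))\<^sup>2 / (Im z)\<^sup>2) \<longleftrightarrow> aut u"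
proof -
  have [measurable]: "u \<in> borel_measurable borel" by fact
  have lev: "level N u" using assms Gamma_pr_subset_Gamma0[of N N] by (auto simp: level_def invariant_under_def)
  have "set_integrable lborel (fundamental_domain N) (\<lambda>z. (cmod (u z))\<^sup>2 / (Im z)\<^sup>2) \<longleftrightarrow>
      set_integrable lborel (fundamental_domain N) (\<lambda>z. complex_of_real ((cmod (u z))\<^sup>2) / of_real ((Im z)\<^sup>2))"
    unfolding set_integrable_def
    by (subst integrable_of_real_iff[symmetric]) (simp add: scaleR_conv_of_real)
  also have "\<dots> \<longleftrightarrow> has_mean (\<lambda>z. complex_of_real ((cmod (u z))\<^sup>2))"
    by (rule mean_fundamental_domain(3)[OF assms(1)]) (use assms(3) in \<open>auto simp: invariant_under_def\<close>)
  also have "\<dots> \<longleftrightarrow> aut_level N u" using aut_level_iff_has_mean[OF lev] by simp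
  also have "\<dots> \<longleftrightarrow> aut u"
  proof
    assume "aut u"
    then obtain M where M: "aut_level M u" by (auto simp: aut_def)
    then have "has_mean (\<lambda>z. complex_of_real ((cmod (u z))\<^sup>2))"
      using aut_level_iff_has_mean[of M u] by (simp add: aut_level_def)
    then show "aut_level N u" using aut_level_iff_has_mean[OF lev] by simp
  qed (auto simp: aut_def)
  finally show ?thesis .
qed

lemma borel_measurable_continuous_uhp:
  assumes "continuous_on uhp f" "\<And>z. z \<notin> uhp \<Longrightarrow> f z = (0 :: complex)"
  shows "f \<in> borel_measurable borel"
proof -
  have "(\<lambda>z. indicator uhp z *\<^sub>R f z) \<in> borel_measurable borel"
    by (rule borel_measurable_continuous_on_indicator) (use assms in auto)
  also have "(\<lambda>z. indicator uhp z *\<^sub>R f z) = f" using assms(2) by (auto simp: indicator_def)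
  finally show ?thesis .
qed

lemma moebius_mk2_upper: "moebius (mk2 a b 0 d) z = (of_int a * z + of_int b) / of_int d"
  by (simp add: moebius_def)

lemma dilate_eq_moebius: "dilate d f = (\<lambda>z. f (moebius (mk2 (int d) 0 0 1) z))"
  by (simp add: fun_eq_iff dilate_def moebius_mk2_upper)

locale maass_form =
  fixes N :: nat and t :: complex and f :: "complex \<Rightarrow> complex"
  assumes N: "N > 0" and cusp: "maass_cusp_form N t f"
begin

lemma f_0: "z \<notin> uhp \<Longrightarrow> f z = 0"
  and f_smooth: "real_smooth_on uhp f"
  and f_laplacian: "z \<in> uhp \<Longrightarrow> hyp_laplacian f z = (1 / 4 + t\<^sup>2) * f z"
  and f_invariant: "A \<in> Gamma0 N \<Longrightarrow> z \<in> uhp \<Longrightarrow> f (moebius A z) = f z"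
  and f_cuspidal: "A \<in> Gamma0 1 \<Longrightarrow> y > 0 \<Longrightarrow> (LINT x:{0..real N}|lborel. f (moebius A (Complex x y))) = 0"
  using cusp by (auto simp: maass_cusp_form_def)

lemma f_invariant_under: "invariant_under (Gamma0 N) f"
  using f_invariant by (auto simp: invariant_under_def)

lemma f_cont: "continuous_on uhp f"
  by (rule real_smooth_on_continuous[OF f_smooth])

lemma f_measurable: "f \<in> borel_measurable borel"
  by (rule borel_measurable_continuous_uhp[OF f_cont f_0])

lemma f_aut: "aut f"
  using cusp square_integrable_iff[OF N f_measurable f_invariant_under] by (simp add: maass_cusp_form_def)

lemma f_moebius_aut: "det \<beta> > 0 \<Longrightarrow> aut (\<lambda>z. f (moebius \<beta> z))"
  by (rule aut_moebius[OF f_aut])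

lemma f_moebius_invariant:
  assumes "A \<in> Gamma0 N" "det \<beta> > 0"
  shows "f (moebius (A ** \<beta>) z) = f (moebius \<beta> z)"
proof (cases "z \<in> uhp")
  case True
  then have "moebius (A ** \<beta>) z = moebius A (moebius \<beta> z)"
    using assms by (intro moebius_mult) (auto simp: Gamma0_def)
  then show ?thesis using True assms f_invariant by simp
next
  case False
  then show ?thesis using assms f_0 by (simp add: Gamma0_def det_mult2)
qed

lemma f_plus_int: "f (z + of_int m) = f z"
proof (cases "z \<in> uhp")
  case True
  have "f (moebius (mk2 1 m 0 1) z) = f z" by (rule f_invariant) (use True in \<open>auto simp: Gamma0_def\<close>)
  then show ?thesis by (simp add: moebius_mk2_upper)
next
  case False
  then show ?thesis using f_0 by (simp add: uhp_def)
qed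

lemma dilate_aut: "d > 0 \<Longrightarrow> aut (dilate d f)"
  unfolding dilate_eq_moebius by (rule f_moebius_aut) simp

lemma dilate_cont: "d > 0 \<Longrightarrow> continuous_on uhp (dilate d f)"
proof -
  assume "d > 0"
  then have "(\<lambda>z. of_nat d * z) ` uhp \<subseteq> uhp" by (auto simp: uhp_def)
  then show ?thesis unfolding dilate_def
    by (intro continuous_on_compose2[OF f_cont] continuous_intros)
qed

lemma dilate_invariant:
  assumes "d > 0" "N * d dvd l"
  shows "invariant_under (Gamma0 l) (dilate d f)"
  unfolding invariant_under_def dilate_eq_moebius
proof (intro ballI)
  fix A z assume A: "A \<in> Gamma0 l" and z: "z \<in> uhp"
  then have dA: "det A = 1" "int l dvd A$2$1" by (auto simp: Gamma0_def)
  then have "int (N * d) dvd A$2$1" using assms(2) dvd_trans by (metis int_dvd_int_iff)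
  then obtain c where c: "A$2$1 = int N * int d * c" by (auto elim: dvdE)
  define B where "B = mk2 (A$1$1) (int d * A$1$2) (int N * c) (A$2$2)"
  have e: "mk2 (int d) 0 0 1 ** A = B ** mk2 (int d) 0 0 1"
    by (simp add: mat2_eq_iff mat2_mult_nth B_def c algebra_simps)
  have "det B = 1" using dA(1) by (simp add: B_def det_2 c algebra_simps)
  then have B: "B \<in> Gamma0 N" by (simp add: Gamma0_def B_def)
  have "moebius (mk2 (int d) 0 0 1) (moebius A z) = moebius (mk2 (int d) 0 0 1 ** A) z"
    using dA z assms by (simp add: moebius_mult)
  then show "f (moebius (mk2 (int d) 0 0 1) (moebius A z)) = f (moebius (mk2 (int d) 0 0 1) z)"
    unfolding e using f_moebius_invariant[OF B] assms by simp
qed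

definition gram :: "nat \<Rightarrow> nat \<Rightarrow> complex" where
  "gram a b = ip (dilate a f) (dilate b f)"

lemma gram_cnj: "a > 0 \<Longrightarrow> b > 0 \<Longrightarrow> gram b a = cnj (gram a b)"
  unfolding gram_def by (rule ip_cnj) (auto intro: dilate_aut)

lemma gram_scale:
  assumes "p > 0" "a > 0" "b > 0"
  shows "gram (p * a) (p * b) = gram a b"
proof -
  have "dilate (p * d) f = (\<lambda>z. dilate d f (moebius (mk2 (int p) 0 0 1) z))" for d
    by (simp add: fun_eq_iff dilate_def moebius_mk2_upper mult_ac)
  then show ?thesis unfolding gram_def using assms by (simp add: ip_moebius dilate_aut)
qed

lemma shifted_aut: "p > 0 \<Longrightarrow> b > 0 \<Longrightarrow> aut (\<lambda>z. f ((of_nat b * z + of_nat j) / of_nat p))"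
  using f_moebius_aut[of "mk2 (int b) (int j) 0 (int p)"] by (simp add: moebius_mk2_upper)

text \<open>The right-hand side is free of \<open>j\<close>: since \<open>b\<close> is invertible
  modulo \<open>p\<close>, a suitable translation absorbs the shift. All terms of a Hecke sum with
  the same determinant split therefore have the same inner product with
  \<open>dilate a f\<close>.\<close>

lemma ip_shifted:
  assumes p: "p > 0" and ab: "a > 0" "b > 0" and cop: "coprime b p"
  shows "ip (dilate a f) (\<lambda>z. f ((of_nat b * z + of_nat j) / of_nat p)) = gram (p * a) b"
proof -
  \<comment> \<open>With this \<open>m\<close> the substitution of \<open>p z + m\<close> for
    \<open>z\<close> turns \<open>(b z + j) / p\<close> into \<open>b z\<close> plus the integer
    \<open>k\<close>, and \<open>a z\<close> into \<open>p a z\<close> plus an integer.\<close>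
  obtain m where m: "[int b * m = - int j] (mod int p)"
    using cong_solve_coprime_int[of "int b" "int p"] cop
    by (metis (no_types, lifting) coprime_int_iff cong_scalar_right mult.assoc mult_1)
  then obtain k where k: "int b * m + int j = int p * k"
    by (auto simp: cong_iff_dvd_diff elim: dvdE)
  have 1: "dilate a f (moebius (mk2 (int p) m 0 1) z) = dilate (p * a) f z" for z
    using f_plus_int[of "of_nat (p * a) * z" "int a * m"]
    by (simp add: dilate_def moebius_mk2_upper algebra_simps)
  have 2: "f ((of_nat b * moebius (mk2 (int p) m 0 1) z + of_nat j) / of_nat p) = dilate b f z" for z
  proof -
    have "of_int (int b * m + int j) = (of_int (int p * k) :: complex)" using k by simp
    then have "(of_nat b * moebius (mk2 (int p) m 0 1) z + of_nat j) / of_nat p = of_nat b * z + of_int k"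
      using p by (simp add: moebius_mk2_upper field_simps)
    then show ?thesis by (simp add: f_plus_int dilate_def)
  qed
  have "ip (dilate a f) (\<lambda>z. f ((of_nat b * z + of_nat j) / of_nat p)) =
      ip (\<lambda>z. dilate a f (moebius (mk2 (int p) m 0 1) z)) (\<lambda>z. f ((of_nat b * moebius (mk2 (int p) m 0 1) z + of_nat j) / of_nat p))"
    using assms by (intro ip_moebius[symmetric] dilate_aut shifted_aut) auto
  then show ?thesis unfolding 1 2 gram_def .
qed

end

locale newform =
  fixes N :: nat and t :: complex and f :: "complex \<Rightarrow> complex"
  assumes N: "N > 0" and newform: "maass_newform N t f"

sublocale newform \<subseteq> maass_form
  using N newform by unfold_locales (auto simp: maass_newform_def)

context newform
begin

lemma f_nonzero: "\<exists>z\<in>uhp. f z \<noteq> 0"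
  using newform f_0 by (auto simp: maass_newform_def fun_eq_iff)

abbreviation "lam \<equiv> hecke_eigenvalue N f"

lemma hecke_eq:
  assumes "n > 0"
  shows "hecke_op N n f z = lam n * f z"
proof -
  have "\<exists>c. hecke_op N n f = (\<lambda>z. c * f z)"
    using newform assms unfolding maass_newform_def by simp
  then obtain c where c: "hecke_op N n f = (\<lambda>z. c * f z)" ..
  have "lam n = c"
    unfolding hecke_eigenvalue_def
  proof (rule the_equality[where P = "\<lambda>c. hecke_op N n f = (\<lambda>z. c * f z)", OF c])
    fix d assume "hecke_op N n f = (\<lambda>z. d * f z)"
    then have "\<forall>z. d * f z = c * f z" using c by metis
    then show "d = c" using f_nonzero by auto
  qed
  then show ?thesis using c by simp
qed

lemma hecke_sum:
  assumes "n > 0"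
  shows "(\<Sum>a | a dvd n \<and> coprime a N. \<Sum>b<n div a. f ((of_nat a * z + of_nat b) / of_nat (n div a))) =
    of_real (sqrt (real n)) * lam n * f z"
  using hecke_eq[OF assms, of z] assms by (simp add: hecke_op_def field_simps)

definition chi :: "nat \<Rightarrow> complex" where "chi p = chi0 N p"

lemma hecke_prime:
  assumes "prime p"
  shows "of_real (sqrt (real p)) * lam p * f z =
    (\<Sum>j<p. f ((z + of_nat j) / of_nat p)) + chi p * f (of_nat p * z)"
proof -
  have p: "p > 0" "p \<noteq> 1" using assms prime_gt_0_nat prime_gt_1_nat by (auto simp: less_irrefl)
  show ?thesis
  proof (cases "coprime p N")
    case True
    have "{a. a dvd p \<and> coprime a N} = {1, p}"
      using True assms by (auto simp: prime_nat_iff)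
    then show ?thesis using hecke_sum[OF p(1), of z] p True by (simp add: chi_def chi0_def)
  next
    case False
    have "{a. a dvd p \<and> coprime a N} = {1}"
      using False assms by (auto simp: prime_nat_iff)
    then show ?thesis using hecke_sum[OF p(1), of z] p False by (simp add: chi_def chi0_def)
  qed
qed

lemma lam_1: "lam 1 = 1"
proof -
  have "{a. a dvd 1 \<and> coprime a N} = {1}" by auto
  then have "f z = lam 1 * f z" for z using hecke_sum[of 1 z] by simp
  then show ?thesis using f_nonzero by (metis mult_cancel_right2)
qed

lemma gram_hecke:
  assumes p: "prime p" and a: "a > 0" and b: "b > 0" "\<not> p dvd b"
  shows "cnj (lam p) * of_real (sqrt (real p)) * gram a b =
    of_nat p * gram (p * a) b + chi p * gram a (p * b)"
proof -
  have p0: "p > 0" using p prime_gt_0_nat by blast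
  have cop: "coprime b p" using p b by (metis coprime_commute prime_imp_coprime)
  let ?w = "\<lambda>j z. f ((of_nat b * z + of_nat j) / of_nat p)"
  have "cnj (lam p * of_real (sqrt (real p))) * gram a b = ip (dilate a f) (\<lambda>z. (lam p * of_real (sqrt (real p))) * dilate b f z)"
    unfolding gram_def using a b by (intro ip_scale_right[symmetric] dilate_aut)
  also have "(\<lambda>z. (lam p * of_real (sqrt (real p))) * dilate b f z) = (\<lambda>z. (\<Sum>j<p. 1 * ?w j z) + chi p * dilate (p * b) f z)"
  proof
    fix z
    show "lam p * of_real (sqrt (real p)) * dilate b f z = (\<Sum>j<p. 1 * ?w j z) + chi p * dilate (p * b) f z"
      using hecke_prime[OF p, of "of_nat b * z"] by (simp add: dilate_def mult.commute[of "lam p"] mult.assoc)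
  qed
  also have "ip (dilate a f) \<dots> = ip (dilate a f) (\<lambda>z. \<Sum>j<p. 1 * ?w j z) + ip (dilate a f) (\<lambda>z. chi p * dilate (p * b) f z)"
    using a b p0 by (intro ip_add_right aut_sum aut_scale shifted_aut dilate_aut) auto
  also have "ip (dilate a f) (\<lambda>z. \<Sum>j<p. 1 * ?w j z) = (\<Sum>j<p. cnj 1 * ip (dilate a f) (?w j))"
    using a b p0 by (intro ip_sum_right dilate_aut shifted_aut) auto
  also have "\<dots> = of_nat p * gram (p * a) b"
    using ip_shifted[OF p0 a b(1) cop] by simp
  also have "ip (dilate a f) (\<lambda>z. chi p * dilate (p * b) f z) = cnj (chi p) * gram a (p * b)"
    unfolding gram_def using a b p0 by (intro ip_scale_right dilate_aut) auto
  also have "cnj (chi p) = chi p" by (simp add: chi_def chi0_def)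
  finally show ?thesis by simp
qed

lemma gram_1_1: "gram 1 1 = of_real (Re (gram 1 1))" "Re (gram 1 1) > 0"
proof -
  have d: "dilate 1 f = f" by (simp add: fun_eq_iff dilate_def)
  show "gram 1 1 = of_real (Re (gram 1 1))"
    unfolding gram_def by (rule ip_self_real(1)) (rule dilate_aut, simp)
  moreover have "gram 1 1 \<noteq> 0"
    unfolding gram_def d using ip_self_eq_0[OF f_aut f_cont] f_nonzero by blast
  moreover have "Re (gram 1 1) \<ge> 0"
    unfolding gram_def by (rule ip_self_real(2)) (rule dilate_aut, simp)
  ultimately show "Re (gram 1 1) > 0" by (metis less_eq_real_def of_real_0)
qed

text \<open>For \<open>p\<close> not dividing \<open>N\<close> the matrices (1 1; 0 p) and (p 0; 0
  1) lie in one double coset of \<open>Gamma0 N\<close>. Moving the inner product by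
  \<open>A\<close>, which fixes \<open>f\<close>, turns \<open>f((z + 1) / p)\<close> into
  \<open>f(p z)\<close>.\<close>

lemma gram_swap_prime:
  assumes p: "prime p" and cop: "\<not> p dvd N"
  shows "gram 1 p = gram p 1"
proof -
  have p0: "p > 0" using p prime_gt_0_nat by blast
  have d: "dilate 1 f = f" by (simp add: fun_eq_iff dilate_def)
  have "coprime (int N) (int p)" using p cop by (metis coprime_commute coprime_int_iff prime_imp_coprime)
  \<comment> \<open>The requirement \<open>det B = 1\<close> reads \<open>p s = 1 + N m\<close>, so
    \<open>m\<close> has to be an inverse of \<open>- N\<close> modulo \<open>p\<close>.\<close>
  then obtain m where m: "[int N * m = - 1] (mod int p)"
    using cong_solve_coprime_int[of "int N" "int p"]
    by (metis (no_types, opaque_lifting) cong_minus_minus_iff mult_minus_right)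
  then obtain s where s: "1 + int N * m = int p * s"
    by (auto simp: cong_iff_dvd_diff add.commute elim: dvdE)
  define A where "A = mk2 1 0 (int N * m) 1"
  define B where "B = mk2 s 1 (int N * m) (int p)"
  have A: "A \<in> Gamma0 N" "det A > 0" by (auto simp: A_def Gamma0_def)
  have B: "B \<in> Gamma0 N" using s by (auto simp: B_def Gamma0_def algebra_simps)
  have e: "mk2 1 1 0 (int p) ** A = B ** mk2 (int p) 0 0 1"
    using s by (simp add: A_def B_def mult.commute add.commute)
  have w: "aut (\<lambda>z. f (moebius (mk2 1 1 0 (int p)) z))" using p0 by (intro f_moebius_aut) simp
  have "gram p 1 = ip (dilate 1 f) (\<lambda>z. f (moebius (mk2 1 1 0 (int p)) z))"
    using ip_shifted[OF p0, of 1 1 1] by (simp add: moebius_mk2_upper)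
  also have "\<dots> = ip (\<lambda>z. f (moebius A z)) (\<lambda>z. f (moebius (mk2 1 1 0 (int p)) (moebius A z)))"
    unfolding d by (rule ip_moebius[OF f_aut w A(2), symmetric])
  also have "\<dots> = ip (dilate 1 f) (dilate p f)"
  proof (rule ip_cong)
    fix z assume z: "z \<in> uhp"
    show "f (moebius A z) = dilate 1 f z" unfolding d using f_invariant[OF A(1) z] .
    have "moebius (mk2 1 1 0 (int p)) (moebius A z) = moebius (mk2 1 1 0 (int p) ** A) z"
      using A z p0 by (simp add: moebius_mult)
    then show "f (moebius (mk2 1 1 0 (int p)) (moebius A z)) = dilate p f z"
      unfolding e dilate_eq_moebius using f_moebius_invariant[OF B] p0 by simp
  qed (use p0 A aut_moebius[OF w A(2)] f_moebius_aut dilate_aut in auto)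
  finally show ?thesis by (simp add: gram_def)
qed

lemma lam_real_unramified:
  assumes p: "prime p" and cop: "\<not> p dvd N"
  shows "cnj (lam p) = lam p"
proof -
  have p0: "p > 0" using p prime_gt_0_nat by blast
  have chi: "chi p = 1" using p cop by (simp add: chi_def chi0_def prime_imp_coprime)
  have 1: "cnj (lam p) * of_real (sqrt (real p)) * gram 1 1 = of_nat (p + 1) * gram p 1"
  proof -
    have "\<not> p dvd 1" using p not_prime_unit by blast
    from gram_hecke[OF p zero_less_one zero_less_one this]
    show ?thesis using chi gram_swap_prime[OF p cop] by (simp add: algebra_simps)
  qed
  have 2: "cnj (gram p 1) = gram p 1"
    using gram_cnj[of 1 p] gram_swap_prime[OF p cop] p0 by simp
  have "cnj (gram 1 1) = gram 1 1" using gram_1_1(1) by (metis complex_cnj_complex_of_real)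
  then have "lam p * of_real (sqrt (real p)) * gram 1 1 = of_nat (p + 1) * gram p 1"
    using arg_cong[OF 1, of cnj] 2 by simp
  then have "lam p * of_real (sqrt (real p)) * gram 1 1 = cnj (lam p) * of_real (sqrt (real p)) * gram 1 1"
    using 1 by simp
  moreover have "gram 1 1 \<noteq> 0" using gram_1_1(2) by auto
  ultimately show ?thesis using p0 by simp
qed

end

section \<open>Hecke eigenvalues at primes dividing the level\<close>

subsection \<open>Integrals of periodic functions\<close>

lemma continuous_antiderivative:
  fixes \<phi> :: "real \<Rightarrow> complex"
  assumes "continuous_on UNIV \<phi>"
  obtains P where "\<And>x. (P has_vector_derivative \<phi> x) (at x)"
proof -
  have "\<exists>F. \<forall>x :: real. -\<infinity> < ereal x \<longrightarrow> ereal x < \<infinity> \<longrightarrow> (F has_vector_derivative \<phi> x) (at x)"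
    by (rule einterval_antiderivative) (use assms in \<open>auto simp: continuous_on_eq_continuous_at\<close>)
  then show thesis using that by auto
qed

lemma LINT_eq_antiderivative:
  fixes \<phi> :: "real \<Rightarrow> complex"
  assumes "continuous_on UNIV \<phi>" "\<And>x. (P has_vector_derivative \<phi> x) (at x)" "a \<le> b"
  shows "(LINT x:{a..b}|lborel. \<phi> x) = P b - P a"
  unfolding set_lebesgue_integral_def
  by (rule integral_FTC_atLeastAtMost)
     (use assms in \<open>auto intro: has_vector_derivative_at_within continuous_on_subset\<close>)

text \<open>The difference of \<open>P\<close> and its shift has derivative zero by periodicity.
  Statements about integrals over different numbers of periods become identities for
  \<open>P\<close>.\<close>

lemma periodic_antiderivative:
  fixes \<phi> :: "real \<Rightarrow> complex"
  assumes P: "\<And>x. (P has_vector_derivative \<phi> x) (at x)" and per: "\<And>x. \<phi> (x + T) = \<phi> x"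
  shows "P (x + T) = P x + (P T - P 0)"
proof -
  have "((\<lambda>x. P (x + T) - P x) has_vector_derivative 0) (at x within UNIV)" for x
  proof -
    have "(P \<circ> (\<lambda>x. x + T) has_vector_derivative 1 *\<^sub>R \<phi> (x + T)) (at x)"
      by (rule vector_diff_chain_at[OF _ P]) (auto intro!: derivative_eq_intros)
    from has_vector_derivative_diff[OF this P[of x]] show ?thesis by (simp add: per o_def)
  qed
  then obtain c where "\<And>x. x \<in> UNIV \<Longrightarrow> P (x + T) - P x = c"
    using has_vector_derivative_zero_constant[of UNIV "\<lambda>x. P (x + T) - P x"] by auto
  from this[of x] this[of 0] have "P (x + T) - P x = P (0 + T) - P 0" by simp
  then show ?thesis by (simp add: algebra_simps)
qed

lemma periodic_antiderivative_multiple: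
  fixes \<phi> :: "real \<Rightarrow> complex"
  assumes P: "\<And>x. (P has_vector_derivative \<phi> x) (at x)" and per: "\<And>x. \<phi> (x + T) = \<phi> x"
  shows "P (x + real m * T) = P x + of_nat m * (P T - P 0)"
proof (induction m)
  case (Suc m)
  have "P (x + real (Suc m) * T) = P ((x + real m * T) + T)" by (simp add: algebra_simps)
  also have "\<dots> = P (x + real m * T) + (P T - P 0)" by (rule periodic_antiderivative[OF P per])
  finally have e: "P (x + real (Suc m) * T) = P (x + real m * T) + (P T - P 0)" .
  show ?case unfolding e Suc by (simp add: algebra_simps)
qed simp

text \<open>The first column of \<open>B\<close> divided by its gcd is completed by Bezout to a
  matrix of determinant 1, which clears the lower left entry.\<close>

lemma hermite_form:
  assumes "det B > 0"
  obtains A a b d where "A \<in> SL2Z" "B = A ** mk2 a b 0 d" "a > 0" "d > 0" "a * d = det B"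
proof -
  define g where "g = gcd (B$1$1) (B$2$1)"
  have g: "g > 0" using assms by (auto simp: g_def det_2)
  define r s where "r = B$1$1 div g" and "s = B$2$1 div g"
  have rs: "B$1$1 = g * r" "B$2$1 = g * s" by (simp_all add: r_def s_def g_def)
  obtain u v where uv: "u * B$1$1 + v * B$2$1 = g" using bezout_int[of "B$1$1" "B$2$1"] unfolding g_def by blast
  then have "g * (u * r + v * s) = g * 1" by (simp add: rs algebra_simps)
  then have 1: "u * r + v * s = 1" using g by (metis mult_cancel_left less_irrefl)
  define A where "A = mk2 r (- v) s u"
  have dA: "det A = 1" using 1 by (simp add: A_def algebra_simps)
  define b d where "b = u * B$1$2 + v * B$2$2" and "d = r * B$2$2 - s * B$1$2"
  have "adj2 A ** B = mk2 g b 0 d"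
    using uv by (simp add: mat2_eq_iff mat2_mult_nth A_def b_def d_def rs algebra_simps)
  then have B: "B = A ** mk2 g b 0 d" using mat2_inv_cancel(2)[OF dA] by metis
  have "det B = g * d" unfolding B det_mult2 by (simp add: dA)
  moreover from this have "d > 0" using assms g by (simp add: zero_less_mult_iff)
  ultimately show thesis using that[of A g b d] dA B g by simp
qed

lemma Complex_in_uhp [simp]: "Complex x y \<in> uhp \<longleftrightarrow> y > 0"
  by (simp add: uhp_def)

lemma moebius_horizontal_continuous:
  assumes "continuous_on uhp h" "det B > 0" "y > 0"
  shows "continuous_on UNIV (\<lambda>x. h (moebius B (Complex x y)))"
proof -
  have "continuous_on uhp (moebius B)"
    using moebius_holomorphic[OF assms(2)] by (rule holomorphic_on_imp_continuous_on)
  moreover have "continuous_on UNIV (\<lambda>x. Complex x y)"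
    by (simp add: Complex_eq) (intro continuous_intros)
  ultimately have "continuous_on UNIV (\<lambda>x. moebius B (Complex x y))"
    by (rule continuous_on_compose2) (use assms in auto)
  with assms(1) show ?thesis by (rule continuous_on_compose2) (use assms in auto)
qed

text \<open>The conjugate by \<open>A\<close> of the translation by \<open>K\<close> lies in the
  principal congruence subgroup of level \<open>M\<close>, which is normal in SL2(Z).\<close>

lemma horizontal_period:
  assumes "M dvd K" "invariant_under (Gamma0 M) h" "det A = 1" "y > 0"
  shows "h (moebius A (Complex (x + real K) y)) = h (moebius A (Complex x y))"
proof -
  define T where "T = mk2 1 (int K) 0 1"
  have T: "T \<in> Gamma_pr K" by (simp add: T_def Gamma_pr_def)
  have "A ** T ** adj2 A \<in> Gamma_pr M"
  proof -
    have n: "det (A ** T ** adj2 A) = 1" using assms by (simp add: det_mult2 T_def)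
    obtain k where k: "int K = int M * k" using assms(1) by (metis int_dvd_int_iff dvdE)
    have d: "A$1$1 * A$2$2 - A$1$2 * A$2$1 = 1" using assms by (simp add: det_2)
    define a b c e where "a = A$1$1" and "b = A$1$2" and "c = A$2$1" and "e = A$2$2"
    have "A = mk2 a b c e" by (simp add: mat2_eq_iff a_def b_def c_def e_def)
    then have X: "A ** T ** adj2 A = mk2 (a * e - (a * int K + b) * c) (- a * b + (a * int K + b) * a)
        (c * e - (c * int K + e) * c) (- c * b + (c * int K + e) * a)"
      by (simp add: T_def adj2_def algebra_simps)
    have "a * e - (a * int K + b) * c - 1 = int M * (- k * a * c)" "- a * b + (a * int K + b) * a = int M * (k * a * a)"
      "c * e - (c * int K + e) * c = int M * (- k * c * c)" "- c * b + (c * int K + e) * a - 1 = int M * (k * a * c)"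
      using d unfolding k a_def[symmetric] b_def[symmetric] c_def[symmetric] e_def[symmetric] by algebra+
    then show ?thesis using n unfolding Gamma_pr_def mem_Collect_eq X mk2_nth by simp
  qed
  then have C: "A ** T ** adj2 A \<in> Gamma0 M" using Gamma_pr_subset_Gamma0[OF dvd_refl] by blast
  have z: "Complex x y \<in> uhp" using assms by simp
  have "moebius T (Complex x y) = Complex (x + real K) y"
    by (simp add: T_def moebius_mk2_upper complex_eq_iff)
  then have "moebius A (Complex (x + real K) y) = moebius (A ** T) (Complex x y)"
    using z assms by (simp add: moebius_mult T_def)
  also have "A ** T = (A ** T ** adj2 A) ** A"
    using mat2_inv_cancel(4)[OF assms(3)] by simp
  also have "moebius \<dots> (Complex x y) = moebius (A ** T ** adj2 A) (moebius A (Complex x y))"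
    using z C assms(3) by (intro moebius_mult) (auto simp: Gamma0_def)
  finally show ?thesis
    using assms C z by (auto simp: invariant_under_def)
qed

context maass_form
begin

text \<open>By \<open>hermite_form\<close> an upper triangular matrix first carries the horizontal
  line to another one, and then a matrix of SL2(Z) acts, for which cuspidality is assumed.\<close>

lemma cuspidal_moebius:
  assumes B: "det B = int n" "n > 0" and y: "y > 0"
  shows "(LINT x:{0..real (N * n * m)}|lborel. f (moebius B (Complex x y))) = 0"
proof -
  have "det B > 0" using B by simp
  then obtain A a b d where h0: "A \<in> SL2Z" "B = A ** mk2 a b 0 d" "a > 0" "d > 0" "a * d = det B"
    by (rule hermite_form)
  have "a * d = int n" using h0(5) B by simp
  note h = h0(1-4) this
  have dA: "det A = 1" using h by simp
  define y' where "y' = real_of_int a * y / real_of_int d"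
  have y': "y' > 0" using h y by (simp add: y'_def)
  define \<phi> where "\<phi> = (\<lambda>x. f (moebius A (Complex x y')))"
  have c\<phi>: "continuous_on UNIV \<phi>" unfolding \<phi>_def using dA y' by (intro moebius_horizontal_continuous f_cont) auto
  obtain P where P: "\<And>x. (P has_vector_derivative \<phi> x) (at x)" using continuous_antiderivative[OF c\<phi>] by blast
  have per: "\<phi> (x + real N) = \<phi> x" for x
    unfolding \<phi>_def by (rule horizontal_period[OF dvd_refl f_invariant_under dA y'])
  have "(LINT x:{0..real N}|lborel. \<phi> x) = 0"
    using f_cuspidal[of A y'] h y' unfolding \<phi>_def Gamma0_1 by simp
  then have P0: "P (real N) - P 0 = 0" using LINT_eq_antiderivative[OF c\<phi> P, of 0 "real N"] by simp
  have eq: "f (moebius B (Complex x y)) = \<phi> ((real_of_int a * x + real_of_int b) / real_of_int d)" for x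
  proof -
    have "moebius (mk2 a b 0 d) (Complex x y) = Complex ((real_of_int a * x + real_of_int b) / real_of_int d) y'"
      using h by (simp add: moebius_mk2_upper complex_eq_iff y'_def Re_divide Im_divide power2_eq_square field_simps)
    then show ?thesis unfolding h(2) \<phi>_def using y h B(2) by (subst moebius_mult) auto
  qed
  define L where "L = (\<lambda>x. (real_of_int a * x + real_of_int b) / real_of_int d)"
  define Q where "Q = (\<lambda>x. (real_of_int d / real_of_int a) *\<^sub>R P (L x))"
  have Q: "(Q has_vector_derivative f (moebius B (Complex x y))) (at x)" for x
  proof -
    have "(P \<circ> L has_vector_derivative (real_of_int a / real_of_int d) *\<^sub>R \<phi> (L x)) (at x)"
      unfolding L_def by (rule vector_diff_chain_at[OF _ P]) (auto intro!: derivative_eq_intros)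
    from bounded_linear.has_vector_derivative[OF bounded_linear_scaleR_right this, of "real_of_int d / real_of_int a"]
    show ?thesis unfolding Q_def eq using h by (simp add: o_def L_def)
  qed
  have "(LINT x:{0..real (N * n * m)}|lborel. f (moebius B (Complex x y))) = Q (real (N * n * m)) - Q 0"
    by (rule LINT_eq_antiderivative[OF moebius_horizontal_continuous[OF f_cont] Q]) (use B y in auto)
  \<comment> \<open>Since \<open>n = a * d\<close>, the slope \<open>a / d\<close> maps an interval
    of length \<open>N * n * m\<close> to exactly \<open>a * a * m\<close> periods of length
    \<open>N\<close>.\<close>
  also have "L (real (N * n * m)) = L 0 + real (nat a * nat a * m) * real N"
  proof -
    have "real n = real_of_int a * real_of_int d" using arg_cong[OF h(5), of real_of_int] by simp
    then show ?thesis using h unfolding L_def by (simp add: field_simps)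
  qed
  then have "P (L (real (N * n * m))) = P (L 0)"
    using periodic_antiderivative_multiple[OF P per, of "L 0" "nat a * nat a * m"] P0 by simp
  then have "Q (real (N * n * m)) - Q 0 = 0" by (simp add: Q_def)
  finally show ?thesis .
qed

end

text \<open>Smoothness, the eigenvalue and square integrability pass through
  \<open>moebius W\<close>. The delicate point is cuspidality: the definition integrates over one
  period \<open>M\<close>, while the two parts of \<open>G\<close> are known to integrate to zero
  over the longer interval \<open>N * p\<close>.\<close>

lemma cusp_form_lower_level:
  assumes f: "maass_form N t f" and W: "det W = int p" "p > 0" and M: "N = M * k" "M > 0"
    and G: "G = (\<lambda>z. e * f (moebius W z) + c * f z)" and inv: "invariant_under (Gamma0 M) G"
  shows "maass_cusp_form M t G"
proof -
  interpret f: maass_form N t f by fact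
  have Wp: "det W > 0" using W by simp
  have k: "k > 0" using f.N M by (cases k) auto
  have sW: "real_smooth_on uhp (\<lambda>z. f (moebius W z))"
    by (rule real_smooth_on_compose[OF uhp_open _ moebius_holomorphic[OF Wp] f.f_smooth]) (use Wp in auto)
  have s0: "real_smooth_on uhp (\<lambda>z. 0)"
    using real_smooth_on_lincomb[OF uhp_open f.f_smooth f.f_smooth, of "-1"] by simp
  have seW: "real_smooth_on uhp (\<lambda>z. e * f (moebius W z))"
    using real_smooth_on_lincomb[OF uhp_open s0 sW, of e] by simp
  have smooth: "real_smooth_on uhp G"
    unfolding G by (rule real_smooth_on_lincomb[OF uhp_open seW f.f_smooth])
  have off: "G z = 0" if "z \<notin> uhp" for z
    using that Wp f.f_0 unfolding G by simp
  have lap: "hyp_laplacian G z = (1 / 4 + t\<^sup>2) * G z" if z: "z \<in> uhp" for z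
  proof -
    have "hyp_laplacian (\<lambda>z. 0 + e * f (moebius W z)) z = hyp_laplacian (\<lambda>z. 0) z + e * hyp_laplacian (\<lambda>z. f (moebius W z)) z"
      by (rule hyp_laplacian_lincomb[OF uhp_open s0 sW z])
    moreover have "hyp_laplacian (\<lambda>z. 0) z = 0"
      using hyp_laplacian_lincomb[OF uhp_open f.f_smooth f.f_smooth z, of "-1"] by simp
    ultimately have "hyp_laplacian (\<lambda>z. e * f (moebius W z)) z = e * ((1 / 4 + t\<^sup>2) * f (moebius W z))"
      using hyp_laplacian_moebius[OF Wp f.f_smooth z] f.f_laplacian z Wp by simp
    then show ?thesis
      unfolding G hyp_laplacian_lincomb[OF uhp_open seW f.f_smooth z] f.f_laplacian[OF z]
      by (simp add: algebra_simps)
  qed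
  have aut: "aut G"
    unfolding G by (intro aut_add aut_scale f.f_moebius_aut f.f_aut Wp)
  have int: "set_integrable lborel (fundamental_domain M) (\<lambda>z. (cmod (G z))\<^sup>2 / (Im z)\<^sup>2)"
    using square_integrable_iff[OF M(2) aut_measurable[OF aut] inv] aut by simp
  have cG: "continuous_on uhp G" by (rule real_smooth_on_continuous[OF smooth])
  have cusp: "(LINT x:{0..real M}|lborel. G (moebius A (Complex x y))) = 0" if A: "A \<in> Gamma0 1" "y > 0" for A y
  proof -
    have dA: "det A = 1" using A(1) unfolding Gamma0_1 by simp
    have cont: "continuous_on UNIV (\<lambda>x. G (moebius A (Complex x y)))"
      using dA A(2) by (intro moebius_horizontal_continuous cG) auto
    obtain P where P: "\<And>x. (P has_vector_derivative G (moebius A (Complex x y))) (at x)"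
      using continuous_antiderivative[OF cont] by blast
    have per: "G (moebius A (Complex (x + real M) y)) = G (moebius A (Complex x y))" for x
      by (rule horizontal_period[OF dvd_refl inv dA A(2)])
    have c1: "continuous_on UNIV (\<lambda>x. f (moebius A (Complex x y)))"
      "continuous_on UNIV (\<lambda>x. f (moebius (W ** A) (Complex x y)))"
      using dA A(2) Wp by (auto intro!: moebius_horizontal_continuous f.f_cont simp: det_mult2)
    have i: "set_integrable lborel {0..b} (\<lambda>x. f (moebius A (Complex x y)))"
      "set_integrable lborel {0..b} (\<lambda>x. f (moebius (W ** A) (Complex x y)))" for b :: real
      using c1 by (auto intro!: borel_integrable_atLeastAtMost' intro: continuous_on_subset)
    have "(LINT x:{0..real (N * p)}|lborel. G (moebius A (Complex x y))) =
        (LINT x:{0..real (N * p)}|lborel. e * f (moebius (W ** A) (Complex x y)) + c * f (moebius A (Complex x y)))"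
      unfolding G using dA A(2) Wp by (simp add: moebius_mult)
    also have "\<dots> = e * (LINT x:{0..real (N * p)}|lborel. f (moebius (W ** A) (Complex x y))) +
        c * (LINT x:{0..real (N * p)}|lborel. f (moebius A (Complex x y)))"
      using i by (subst set_integral_add) (auto simp: set_integral_mult_right)
    also have "(LINT x:{0..real (N * p)}|lborel. f (moebius (W ** A) (Complex x y))) = 0"
      using f.cuspidal_moebius[of "W ** A" p y 1] W dA A(2) by (simp add: det_mult2)
    also have "(LINT x:{0..real (N * p)}|lborel. f (moebius A (Complex x y))) = 0"
      using f.cuspidal_moebius[of A 1 y p] dA A(2) by simp
    finally have "P (real (N * p)) - P 0 = 0"
      using LINT_eq_antiderivative[OF cont P, of 0 "real (N * p)"] by simp
    \<comment> \<open>The interval consists of \<open>k * p\<close> periods of \<open>G\<close>,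
      each contributing the same amount, so a single period contributes zero.\<close>
    moreover have e: "real (N * p) = real (k * p) * real M" by (simp add: M mult_ac)
    have "P (real (N * p)) = P 0 + of_nat (k * p) * (P (real M) - P 0)"
      using periodic_antiderivative_multiple[OF P per, of 0 "k * p"] unfolding e[symmetric] add_0 .
    ultimately have "of_nat (k * p) * (P (real M) - P 0) = 0" by simp
    then have "P (real M) - P 0 = 0" using k W by simp
    then show ?thesis using LINT_eq_antiderivative[OF cont P, of 0 "real M"] by simp
  qed
  show ?thesis
    unfolding maass_cusp_form_def
    using off smooth lap inv int cusp by (auto simp: invariant_under_def)
qed

context newform
begin

lemma oldform_orthogonal:
  assumes M: "N = M * p" "M > 0" "p > 1" and G: "maass_cusp_form M t G" and d: "d = 1 \<or> d = p"
  shows "ip f (dilate d G) = 0"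
proof -
  interpret G: maass_form M t G using M G by unfold_locales auto
  have dN: "d dvd N div M" "d > 0" "M * d dvd N" using M d by auto
  have "M dvd N" "M \<noteq> N" using M by auto
  then have "petersson N f (dilate d G) = 0"
    using newform G dN unfolding maass_newform_def by blast
  moreover have "petersson N f (dilate d G) = of_real (covolume N) * ip f (dilate d G)"
    by (rule petersson_eq_ip[OF N f_aut G.dilate_aut f_invariant_under G.dilate_invariant]) (use dN in auto)
  ultimately show ?thesis using covolume_pos[OF N] by simp
qed

end

section \<open>The trace to the level divided by p\<close>

text \<open>The integer matrices of determinant \<open>p\<close> whose left cosets modulo \<open>Gamma0 N\<close> are
  parametrized by the projective line over the field with \<open>p\<close> elements (or by the affine line, if
  \<open>p\<close> divides \<open>N div p\<close>).\<close>

definition Uset :: "nat \<Rightarrow> nat \<Rightarrow> (int ^ 2 ^ 2) set" where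
  "Uset N p = {A. det A = int p \<and> int N dvd A$2$1 \<and> int p dvd A$2$2}"

lemma Uset_mult:
  assumes "N = M * p" "A \<in> Uset N p" "C \<in> Gamma0 M"
  shows "A ** C \<in> Uset N p"
proof -
  obtain c where c: "A$2$1 = int N * c" using assms(2) by (auto simp: Uset_def elim: dvdE)
  obtain d where d: "A$2$2 = int p * d" using assms(2) by (auto simp: Uset_def elim: dvdE)
  obtain e where e: "C$2$1 = int M * e" using assms(3) by (auto simp: Gamma0_def elim: dvdE)
  have "(A ** C)$2$1 = int N * (c * C$1$1 + d * e)" "(A ** C)$2$2 = int p * (int M * c * C$1$2 + d * C$2$2)"
    by (simp_all add: mat2_mult_nth c d e assms(1) algebra_simps)
  then show ?thesis using assms by (simp add: Uset_def det_mult2 Gamma0_def)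
qed

text \<open>The top row modulo \<open>p\<close> determines the coset: the quotient of
  \<open>B\<close> by \<open>A\<close> has denominator \<open>p\<close>, and for matrices in
  \<open>Uset\<close> only its upper right entry, the determinant of the two top rows, can fail to
  be integral.\<close>

lemma Uset_same_coset:
  assumes p: "p > 0" and N: "N = M * p" and A: "A \<in> Uset N p" and B: "B \<in> Uset N p"
    and dir: "int p dvd A$1$1 * B$1$2 - A$1$2 * B$1$1"
  obtains C where "C \<in> Gamma0 N" "B = C ** A"
proof -
  obtain a b where A2: "A$2$1 = int N * a" "A$2$2 = int p * b" using A by (auto simp: Uset_def elim!: dvdE)
  obtain c d where B2: "B$2$1 = int N * c" "B$2$2 = int p * d" using B by (auto simp: Uset_def elim!: dvdE)
  define x y u v where "x = A$1$1" and "y = A$1$2" and "u = B$1$1" and "v = B$1$2"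
  note xy = x_def[symmetric] y_def[symmetric] u_def[symmetric] v_def[symmetric]
  obtain k where k: "x * v - y * u = int p * k" using dir unfolding xy by (auto elim: dvdE)
  have "int p * (x * b - y * int M * a) = int p * 1" "int p * (u * d - v * int M * c) = int p * 1"
    using A B by (simp_all add: Uset_def det_2 A2 B2 xy N algebra_simps)
  then have dA: "x * b - y * int M * a = 1" and dB: "u * d - v * int M * c = 1"
    using p by simp_all
  \<comment> \<open>\<open>C\<close> is \<open>B ** adj2 A\<close> divided by
    \<open>p\<close>.\<close>
  define C where "C = mk2 (u * b - v * int M * a) k (int N * (c * b - d * a)) (d * x - int M * c * y)"
  have e: "C ** A = B"
    unfolding mat2_eq_iff mat2_mult_nth C_def mk2_nth A2 B2 xy N of_nat_mult
    using dA dB k by algebra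
  have "det C * int p = int p" using arg_cong[OF e, of det] A B by (simp add: det_mult2 Uset_def)
  then have "det C = 1" using p by simp
  then have "C \<in> Gamma0 N" by (simp add: Gamma0_def C_def)
  then show thesis using that e by blast
qed

lemma Gamma0_mult_direction:
  assumes "C \<in> Gamma0 N" "A \<in> Uset N p" "B = C ** A" "p dvd N"
  shows "int p dvd A$1$1 * B$1$2 - A$1$2 * B$1$1"
proof -
  have "A$1$1 * B$1$2 - A$1$2 * B$1$1 = C$1$2 * det A"
    by (simp add: assms(3) mat2_mult_nth det_2 algebra_simps)
  then show ?thesis using assms by (simp add: Uset_def)
qed

context newform
begin

lemma chi_ramified: "prime p \<Longrightarrow> p dvd N \<Longrightarrow> chi p = 0"
  using coprime_absorb_left[of p N] prime_gt_1_nat[of p] by (simp add: chi_def chi0_def)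

lemma chi_unramified: "prime p \<Longrightarrow> \<not> p dvd N \<Longrightarrow> chi p = 1"
  by (simp add: chi_def chi0_def prime_imp_coprime)

text \<open>The premises \<open>ex\<close> and \<open>un\<close> say that \<open>R\<close> meets
  every coset of \<open>Gamma0 N\<close> in \<open>Uset N p\<close> exactly once. Right
  multiplication by an element of \<open>Gamma0 M\<close> permutes these cosets, and the left
  factors in \<open>Gamma0 N\<close> are absorbed by \<open>f\<close>.\<close>

lemma sum_Uset_invariant:
  assumes p: "prime p" and N': "N = M * p"
    and R: "finite I" "\<And>i. i \<in> I \<Longrightarrow> R i \<in> Uset N p"
    and ex: "\<And>A. A \<in> Uset N p \<Longrightarrow> \<exists>i\<in>I. int p dvd (R i)$1$1 * A$1$2 - (R i)$1$2 * A$1$1"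
    and un: "\<And>i j. i \<in> I \<Longrightarrow> j \<in> I \<Longrightarrow> int p dvd (R i)$1$1 * (R j)$1$2 - (R i)$1$2 * (R j)$1$1 \<Longrightarrow> i = j"
  shows "invariant_under (Gamma0 M) (\<lambda>z. \<Sum>i\<in>I. f (moebius (R i) z))"
  unfolding invariant_under_def
proof (intro ballI)
  fix C z assume C: "C \<in> Gamma0 M" and z: "z \<in> uhp"
  have p0: "p > 0" using p prime_gt_0_nat by blast
  have pN: "p dvd N" using N' by simp
  have dC: "det C = 1" using C by (simp add: Gamma0_def)
  have dR: "det (R i) > 0" if "i \<in> I" for i using R(2)[OF that] p0 by (simp add: Uset_def)
  have RC: "R i ** C \<in> Uset N p" if "i \<in> I" for i by (rule Uset_mult[OF N' R(2)[OF that] C])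
  have "\<exists>j D. j \<in> I \<and> D \<in> Gamma0 N \<and> R i ** C = D ** R j" if i: "i \<in> I" for i
  proof -
    obtain j where j: "j \<in> I" "int p dvd (R j)$1$1 * (R i ** C)$1$2 - (R j)$1$2 * (R i ** C)$1$1"
      using ex[OF RC[OF i]] by blast
    obtain D where "D \<in> Gamma0 N" "R i ** C = D ** R j"
      using Uset_same_coset[OF p0 N' R(2)[OF j(1)] RC[OF i] j(2)] by blast
    then show ?thesis using j by blast
  qed
  then obtain \<pi> D where \<pi>: "\<And>i. i \<in> I \<Longrightarrow> \<pi> i \<in> I" and D: "\<And>i. i \<in> I \<Longrightarrow> D i \<in> Gamma0 N"
    and e: "\<And>i. i \<in> I \<Longrightarrow> R i ** C = D i ** R (\<pi> i)" by metis
  have inj: "inj_on \<pi> I"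
  proof (rule inj_onI)
    fix i j assume ij: "i \<in> I" "j \<in> I" "\<pi> i = \<pi> j"
    have dD: "det (D i) = 1" using D[OF ij(1)] by (simp add: Gamma0_def)
    have "R (\<pi> i) = adj2 (D i) ** (R i ** C)" unfolding e[OF ij(1)] mat2_inv_cancel(1)[OF dD] ..
    then have "R j ** C = D j ** (adj2 (D i) ** (R i ** C))" using e[OF ij(2)] ij(3) by simp
    then have "(R j ** C) ** adj2 C = (D j ** adj2 (D i)) ** ((R i ** C) ** adj2 C)"
      by (simp only: matrix_mul_assoc)
    then have "R j = (D j ** adj2 (D i)) ** R i" unfolding mat2_inv_cancel(3)[OF dC] .
    moreover have "D j ** adj2 (D i) \<in> Gamma0 N"
      using sl_groupD(3,4)[OF sl_group_Gamma0] D ij by blast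
    ultimately show "i = j"
      using un[OF ij(1,2)] Gamma0_mult_direction[OF _ R(2)[OF ij(1)] _ pN] by blast
  qed
  moreover have "\<pi> ` I = I" by (rule endo_inj_surj[OF R(1) _ inj]) (use \<pi> in auto)
  ultimately have "bij_betw \<pi> I I" by (simp add: bij_betw_def)
  have "(\<Sum>i\<in>I. f (moebius (R i) (moebius C z))) = (\<Sum>i\<in>I. f (moebius (R (\<pi> i)) z))"
  proof (rule sum.cong[OF refl])
    fix i assume i: "i \<in> I"
    have "moebius (R i) (moebius C z) = moebius (R i ** C) z"
      using z dC dR[OF i] by (simp add: moebius_mult)
    then show "f (moebius (R i) (moebius C z)) = f (moebius (R (\<pi> i)) z)"
      unfolding e[OF i] using f_moebius_invariant[OF D[OF i] dR[OF \<pi>[OF i]]] by simp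
  qed
  also have "\<dots> = (\<Sum>i\<in>I. f (moebius (R i) z))"
    by (rule sum.reindex_bij_betw[OF \<open>bij_betw \<pi> I I\<close>])
  finally show "(\<Sum>i\<in>I. f (moebius (R i) (moebius C z))) = (\<Sum>i\<in>I. f (moebius (R i) z))" .
qed

text \<open>A top row whose first entry is a unit modulo \<open>p\<close> is proportional to
  \<open>(1, j)\<close>, the top row of an upper triangular representative.\<close>

lemma affine_direction:
  assumes "prime p" "\<not> int p dvd a"
  obtains j where "j < p" "int p dvd b - int j * a"
proof -
  have "coprime a (int p)" using prime_imp_coprime[of "int p" a] assms by (simp add: coprime_commute)
  then obtain m where m: "[a * m = 1] (mod int p)" using cong_solve_coprime_int by blast
  define j where "j = nat ((m * b) mod int p)"
  have p0: "p > 0" using assms prime_gt_0_nat by blast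
  have j: "int j = (m * b) mod int p" "j < p" using p0 by (auto simp: j_def nat_less_iff)
  have "[int j * a = m * b * a] (mod int p)" unfolding j by (intro cong_mult) (auto simp: cong_def)
  moreover have "[m * b * a = 1 * b] (mod int p)" using cong_mult[OF m cong_refl[of b]] by (simp add: mult_ac)
  ultimately have "[b = int j * a] (mod int p)" by (metis cong_sym cong_trans mult_1)
  then show thesis using that j(2) by (simp add: cong_iff_dvd_diff)
qed

lemma upper_in_Uset: "p > 0 \<Longrightarrow> mk2 1 j 0 (int p) \<in> Uset N p"
  by (simp add: Uset_def)

lemma upper_direction_unique:
  assumes "i < p" "j < p" "int p dvd int i - int j"
  shows "i = j"
  using assms by (metis cong_iff_dvd_diff cong_int_iff cong_less_modulus_unique_nat)

text \<open>If \<open>p\<close> also divides \<open>M\<close>, the determinant forbids a top left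
  entry divisible by \<open>p\<close>, so the upper triangular matrices already represent all
  cosets. The Hecke sum is then itself a trace: \<open>lam p * f\<close> has level \<open>M\<close>.
  For \<open>lam p \<noteq> 0\<close> so has \<open>f\<close>, which would make \<open>f\<close>
  orthogonal to itself.\<close>

lemma lam_square_dvd_square:
  assumes p: "prime p" and N': "N = M * p" and pM: "p dvd M"
  shows "lam p = 0"
proof (rule ccontr)
  assume l0: "lam p \<noteq> 0"
  have p0: "p > 0" "p > 1" using p prime_gt_0_nat prime_gt_1_nat by auto
  have M0: "M > 0" using N N' by (cases M) auto
  have chi: "chi p = 0" using chi_ramified[OF p] N' by simp
  have "invariant_under (Gamma0 M) (\<lambda>z. \<Sum>j\<in>{..<p}. f (moebius (mk2 1 (int j) 0 (int p)) z))"
  proof (rule sum_Uset_invariant[OF p N'])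
    fix A assume A: "A \<in> Uset N p"
    have "\<not> int p dvd A$1$1"
    proof
      assume "int p dvd A$1$1"
      then obtain a where a: "A$1$1 = int p * a" by (auto elim: dvdE)
      obtain c where c: "A$2$1 = int N * c" using A by (auto simp: Uset_def elim: dvdE)
      obtain d where d: "A$2$2 = int p * d" using A by (auto simp: Uset_def elim: dvdE)
      obtain k where k: "int M = int p * k" using pM by (metis int_dvd_int_iff dvdE)
      have "int p * 1 = int p * (int p * (a * d - A$1$2 * k * c))"
        using A by (simp add: Uset_def det_2 a c d N' k algebra_simps)
      then have "1 = int p * (a * d - A$1$2 * k * c)" using p0 by (metis mult_cancel_left of_nat_0_less_iff less_irrefl)
      then have "int p dvd 1" by (metis dvd_triv_left)
      then show False using p0 by simp
    qed
    then obtain j where "j < p" "int p dvd A$1$2 - int j * A$1$1" using affine_direction[OF p] by blast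
    then show "\<exists>i\<in>{..<p}. int p dvd mk2 1 (int i) 0 (int p) $ 1 $ 1 * A$1$2 - mk2 1 (int i) 0 (int p) $ 1 $ 2 * A$1$1"
      by (intro bexI[of _ j]) auto
  next
    fix i j assume "i \<in> {..<p}" "j \<in> {..<p}"
      "int p dvd mk2 1 (int i) 0 (int p) $ 1 $ 1 * mk2 1 (int j) 0 (int p) $ 1 $ 2 - mk2 1 (int i) 0 (int p) $ 1 $ 2 * mk2 1 (int j) 0 (int p) $ 1 $ 1"
    then show "i = j" using upper_direction_unique[of j p i] by simp
  qed (use p0 upper_in_Uset in auto)
  also have "(\<lambda>z. \<Sum>j\<in>{..<p}. f (moebius (mk2 1 (int j) 0 (int p)) z)) = (\<lambda>z. (of_real (sqrt (real p)) * lam p) * f z)"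
    using hecke_prime[OF p] chi by (simp add: fun_eq_iff moebius_mk2_upper)
  finally have "invariant_under (Gamma0 M) (\<lambda>z. (of_real (sqrt (real p)) * lam p) * f z)" .
  then have inv: "invariant_under (Gamma0 M) f"
    using l0 p0 by (auto simp: invariant_under_def)
  have "maass_cusp_form M t (\<lambda>z. 0 * f (moebius (mk2 1 0 0 1) z) + 1 * f z)"
    by (rule cusp_form_lower_level[where p = 1, OF maass_form_axioms _ _ N' M0 refl]) (use inv in auto)
  then have "maass_cusp_form M t f" by simp
  from oldform_orthogonal[OF N' M0 p0(2) this, of 1] have "ip f (dilate 1 f) = 0" by simp
  moreover have "dilate 1 f = f" by (simp add: fun_eq_iff dilate_def)
  ultimately show False using ip_self_eq_0[OF f_aut f_cont] f_nonzero by metis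
qed

text \<open>Here one direction is missed by the upper triangular matrices and supplied by the
  Atkin-Lehner matrix \<open>W\<close>. The trace becomes \<open>G\<close>, the sum of
  \<open>f\<close> composed with \<open>moebius W\<close> and \<open>e * f\<close>, where
  \<open>e\<close> is the unnormalized Hecke eigenvalue.\<close>

lemma lam_square_exact:
  assumes p: "prime p" and N': "N = M * p" and pM: "\<not> p dvd M"
  shows "(lam p)\<^sup>2 * of_nat p = 1"
proof -
  have p0: "p > 0" "p > 1" using p prime_gt_0_nat prime_gt_1_nat by auto
  have M0: "M > 0" using N N' by (cases M) auto
  have chi: "chi p = 0" using chi_ramified[OF p] N' by simp
  have "coprime (int p) (int M)" using p pM by (simp add: prime_imp_coprime)
  then obtain u w where uw: "int p * u + int M * w = 1"
    using bezout_int[of "int p" "int M"] by (metis coprime_iff_gcd_eq_1 mult.commute)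
  define v where "v = - w"
  have uv: "int p * u - int M * v = 1" using uw by (simp add: v_def)
  \<comment> \<open>The Bezout relation \<open>p u - M v = 1\<close> gives \<open>W\<close>
    determinant \<open>p\<close>; its top left entry is divisible by \<open>p\<close>, so it
    represents the direction at infinity.\<close>
  define W where "W = mk2 (int p * u) v (int N) (int p)"
  have dW: "det W = int p"
  proof -
    have "det W = int p * (int p * u - int M * v)" by (simp add: W_def N' algebra_simps)
    then show ?thesis using uv by simp
  qed
  have dWp: "det W > 0" using dW p0 by simp
  have WU: "W \<in> Uset N p" using dW by (simp add: Uset_def W_def)
  have pv: "\<not> int p dvd v"
  proof
    assume "int p dvd v"
    then have "int p dvd int p * u - int M * v" by simp
    then show False using uv p0 by simp
  qed
  define R where "R = (\<lambda>j. if j < p then mk2 1 (int j) 0 (int p) else W)"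
  define F where "F = (\<lambda>z. f (moebius W z))"
  define e where "e = of_real (sqrt (real p)) * lam p"
  define G where "G = (\<lambda>z. 1 * f (moebius W z) + e * f z)"
  have "invariant_under (Gamma0 M) (\<lambda>z. \<Sum>j\<in>{..p}. f (moebius (R j) z))"
  proof (rule sum_Uset_invariant[OF p N'])
    show "R i \<in> Uset N p" for i using WU upper_in_Uset p0 by (simp add: R_def)
  next
    fix A assume A: "A \<in> Uset N p"
    show "\<exists>i\<in>{..p}. int p dvd (R i) $ 1 $ 1 * A$1$2 - (R i) $ 1 $ 2 * A$1$1"
    proof (cases "int p dvd A$1$1")
      case True
      then show ?thesis by (intro bexI[of _ p]) (auto simp: R_def W_def)
    next
      case False
      then obtain j where "j < p" "int p dvd A$1$2 - int j * A$1$1" using affine_direction[OF p] by blast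
      then show ?thesis by (intro bexI[of _ j]) (auto simp: R_def)
    qed
  next
    fix i j assume ij: "i \<in> {..p}" "j \<in> {..p}" "int p dvd (R i) $ 1 $ 1 * (R j) $ 1 $ 2 - (R i) $ 1 $ 2 * (R j) $ 1 $ 1"
    have nd: "\<not> int p dvd v - x * (int p * u)" "\<not> int p dvd int p * u * x - v" for x
    proof -
      show "\<not> int p dvd v - x * (int p * u)"
        using pv by (metis dvd_diff_right_iff dvd_triv_left dvd_mult dvd_mult2 dvd_diff_commute dvd_diff_left_iff)
      show "\<not> int p dvd int p * u * x - v"
        using pv by (metis dvd_triv_left dvd_mult2 dvd_diff_right_iff)
    qed
    show "i = j"
    proof (cases "i < p"; cases "j < p")
      assume "i < p" "j < p"
      then show ?thesis using ij upper_direction_unique[of j p i] by (simp add: R_def)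
    next
      assume "i < p" "\<not> j < p"
      then have "int p dvd v - int i * (int p * u)" using ij(3) by (simp add: R_def W_def)
      then show ?thesis using nd(1) by blast
    next
      assume "\<not> i < p" "j < p"
      then have "int p dvd int p * u * int j - v" using ij(3) by (simp add: R_def W_def)
      then show ?thesis using nd(2) by blast
    next
      assume "\<not> i < p" "\<not> j < p"
      then show ?thesis using ij by simp
    qed
  qed simp
  also have "(\<lambda>z. \<Sum>j\<in>{..p}. f (moebius (R j) z)) = G"
  proof
    fix z
    have "{..p} = insert p {..<p}" by auto
    then have "(\<Sum>j\<in>{..p}. f (moebius (R j) z)) = f (moebius W z) + (\<Sum>j<p. f (moebius (mk2 1 (int j) 0 (int p)) z))"
      by (simp add: R_def)
    then show "(\<Sum>j\<in>{..p}. f (moebius (R j) z)) = G z"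
      using hecke_prime[OF p, of z] chi by (simp add: G_def e_def moebius_mk2_upper)
  qed
  finally have inv: "invariant_under (Gamma0 M) G" .
  have cusp: "maass_cusp_form M t G"
    by (rule cusp_form_lower_level[OF maass_form_axioms dW p0(1) N' M0 G_def inv])
  interpret G: maass_form M t G using cusp M0 by unfold_locales auto
  have aF: "aut F" unfolding F_def by (rule f_moebius_aut[OF dWp])
  have d1: "dilate 1 G = G" by (simp add: fun_eq_iff dilate_def)
  have fG: "ip f G = 0" using oldform_orthogonal[OF N' M0 p0(2) cusp, of 1] d1 by simp
  have fGp: "ip f (dilate p G) = 0" using oldform_orthogonal[OF N' M0 p0(2) cusp, of p] by simp
  \<comment> \<open>\<open>W ** W\<close> is \<open>p\<close> times \<open>S\<close>, and
    \<open>S\<close> lies in \<open>Gamma0 N\<close>: \<open>W\<close> acts on \<open>f\<close> as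
    an involution.\<close>
  define S where "S = mk2 (int p * u * u + int M * v) (u * v + v) (int N * (u + 1)) (int M * v + int p)"
  have WW: "moebius (W ** W) z = moebius S z" for z
    by (rule moebius_scalar[where k = "int p"]) (use p0 in \<open>simp_all add: W_def S_def N' algebra_simps\<close>)
  have "S \<in> Gamma0 N"
  proof -
    have "det S = (int p * u - int M * v)\<^sup>2"
      by (simp add: S_def N' power2_eq_square) algebra
    then show ?thesis using uv by (simp add: Gamma0_def S_def)
  qed
  then have FW: "F (moebius W z) = f z" if "z \<in> uhp" for z
    using that dWp f_invariant[of S z] WW by (simp add: F_def flip: moebius_mult)
  \<comment> \<open>Seen from level \<open>M\<close>, \<open>W\<close> is a dilation by
    \<open>p\<close> up to an element of \<open>Gamma0 M\<close>. Hence \<open>G\<close> composed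
    with \<open>W\<close> is \<open>dilate p G\<close>, and orthogonality of \<open>F\<close> and
    \<open>G\<close> reduces to that of \<open>f\<close> and \<open>dilate p G\<close>.\<close>
  define B where "B = mk2 u v (int M) (int p)"
  have B: "B \<in> Gamma0 M" using uv by (simp add: B_def Gamma0_def algebra_simps)
  have WB: "W = B ** mk2 (int p) 0 0 1" by (simp add: W_def B_def N' mult.commute)
  have GW: "G (moebius W z) = dilate p G z" for z
    unfolding WB dilate_eq_moebius using G.f_moebius_invariant[OF B] p0 by simp
  have FG: "ip F G = 0"
  proof -
    have "ip F G = ip (\<lambda>z. F (moebius W z)) (\<lambda>z. G (moebius W z))"
      by (rule ip_moebius[OF aF G.f_aut dWp, symmetric])
    also have "\<dots> = ip f (dilate p G)"
      by (rule ip_cong) (use FW GW p0 aut_moebius[OF aF dWp] aut_moebius[OF G.f_aut dWp] f_aut G.dilate_aut in auto)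
    finally show ?thesis using fGp by simp
  qed
  have "ip G G = ip (\<lambda>z. F z + e * f z) G" by (simp add: G_def F_def)
  also have "\<dots> = 0"
    using FG fG by (simp add: ip_add_left ip_scale_left aF f_aut aut_scale G.f_aut)
  finally have G0: "G z = 0" if "z \<in> uhp" for z using ip_self_eq_0[OF G.f_aut G.f_cont] that by blast
  then have Fe: "F z = - e * f z" if "z \<in> uhp" for z
    using G0[OF that] by (simp add: G_def F_def eq_neg_iff_add_eq_0)
  \<comment> \<open>Vanishing of \<open>G\<close> says that \<open>W\<close> multiplies
    \<open>f\<close> by \<open>- e\<close>; applying the involution twice gives
    \<open>e * e = 1\<close>.\<close>
  obtain z where z: "z \<in> uhp" "f z \<noteq> 0" using f_nonzero by blast
  have "f z = - e * f (moebius W z)" using FW[OF z(1)] Fe[of "moebius W z"] z dWp by simp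
  also have "f (moebius W z) = - e * f z" using Fe[OF z(1)] by (simp add: F_def)
  finally have "e * e = 1" using z by simp
  moreover have "e * e = of_nat p * (lam p)\<^sup>2"
  proof -
    have "complex_of_real (sqrt (real p)) * of_real (sqrt (real p)) = of_nat p"
      using real_sqrt_mult_self[of "real p"] by (metis abs_of_nat of_real_mult of_real_of_nat_eq)
    then show ?thesis by (simp add: e_def power2_eq_square mult_ac)
  qed
  ultimately show ?thesis by (simp add: mult.commute)
qed

lemma lam_ramified:
  assumes p: "prime p" "p dvd N"
  shows "lam p = 0 \<or> (lam p)\<^sup>2 * of_nat p = 1"
proof -
  obtain M where "N = M * p" using p(2) by (metis dvdE mult.commute)
  then show ?thesis using lam_square_dvd_square[OF p(1)] lam_square_exact[OF p(1)] by blast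
qed

lemma lam_real:
  assumes p: "prime p"
  shows "lam p = of_real (Re (lam p))"
proof -
  have "cnj (lam p) = lam p"
  proof (cases "p dvd N")
    case True
    have p0: "p > 0" using p prime_gt_0_nat by blast
    from lam_ramified[OF p True] show ?thesis
    proof
      assume 1: "(lam p)\<^sup>2 * of_nat p = 1"
      then have "(lam p)\<^sup>2 = of_real ((1 / sqrt (real p))\<^sup>2)" using p0 by (simp add: field_simps power_divide)
      then have "lam p = of_real (1 / sqrt (real p)) \<or> lam p = - of_real (1 / sqrt (real p))"
        unfolding of_real_power by (rule power2_eq_iff[THEN iffD1])
      then show ?thesis by (auto simp del: of_real_divide)
    qed simp
  next
    case False
    then show ?thesis by (rule lam_real_unramified[OF p])
  qed
  then show ?thesis by (simp add: complex_eq_iff)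
qed

end

section \<open>The Gram matrix at one prime\<close>

lemma csqrt_of_nat_sq: "complex_of_real (sqrt (real p)) * complex_of_real (sqrt (real p)) = of_nat p"
  by (simp flip: of_real_mult)

lemma ip_combination:
  assumes "aut u" "aut v"
  shows "ip (\<lambda>z. u z + c * v z) (\<lambda>z. u z + c * v z) =
    ip u u + cnj c * ip u v + c * ip v u + c * cnj c * ip v v"
proof -
  have 1: "ip w (\<lambda>z. u z + c * v z) = ip w u + cnj c * ip w v" if "aut w" for w
    using assms that by (simp add: ip_add_right ip_scale_right aut_scale)
  have "ip (\<lambda>z. u z + c * v z) (\<lambda>z. u z + c * v z) =
      ip u (\<lambda>z. u z + c * v z) + c * ip v (\<lambda>z. u z + c * v z)"
    using assms by (simp add: ip_add_left ip_scale_left aut_scale aut_add)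
  then show ?thesis by (simp add: 1 assms algebra_simps)
qed

context newform
begin

definition rlam :: "nat \<Rightarrow> real" where "rlam p = Re (lam p)"

definition rchi :: "nat \<Rightarrow> real" where "rchi p = (if p dvd N then 0 else 1)"

lemma lam_eq_rlam: "prime p \<Longrightarrow> lam p = of_real (rlam p)"
  using lam_real by (simp add: rlam_def)

lemma chi_eq_rchi: "prime p \<Longrightarrow> chi p = of_real (rchi p)"
  using chi_ramified chi_unramified by (simp add: rchi_def)

lemma rchi_cases: "rchi p = 0 \<or> rchi p = 1"
  by (simp add: rchi_def)

text \<open>The normalized inner product of \<open>dilate (p ^ k) f\<close> and \<open>f\<close>.\<close>

fun kap :: "nat \<Rightarrow> nat \<Rightarrow> real" where
  "kap p 0 = 1"
| "kap p (Suc 0) = sqrt (real p) * rlam p / (real p + rchi p)"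
| "kap p (Suc (Suc k)) = (sqrt (real p) * rlam p * kap p (Suc k) - rchi p * kap p k) / real p"

text \<open>The Hecke relation at \<open>(a, b)\<close> and the conjugate of the one at
  \<open>(b, a)\<close> are two linear equations for \<open>x\<close> and \<open>y\<close> with
  matrix (q r; r q), where \<open>q = p\<close> exceeds \<open>r = \<chi>(p)\<close>. Realness of
  \<open>lam p\<close> makes their left-hand sides equal, so \<open>x = y\<close>.\<close>

lemma gram_prime:
  assumes p: "prime p" and a: "a > 0" "\<not> p dvd a" and b: "b > 0" "\<not> p dvd b"
  shows "gram (p * a) b = of_real (kap p 1) * gram a b"
proof -
  have p0: "real p > 1" "p > 0" using p prime_gt_1_nat prime_gt_0_nat by auto
  define s where "s = complex_of_real (rlam p) * of_real (sqrt (real p))"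
  define x y c where "x = gram (p * a) b" and "y = gram a (p * b)" and "c = gram a b"
  define q r where "q = real p" and "r = rchi p"
  have 1: "s * c = of_real q * x + of_real r * y"
    using gram_hecke[OF p a(1) b] by (simp add: s_def x_def y_def c_def q_def r_def lam_eq_rlam[OF p] chi_eq_rchi[OF p])
  have "s * gram b a = of_real q * gram (p * b) a + of_real r * gram b (p * a)"
    using gram_hecke[OF p b(1) a] by (simp add: s_def q_def r_def lam_eq_rlam[OF p] chi_eq_rchi[OF p])
  then have "cnj (s * gram b a) = cnj (of_real q * gram (p * b) a + of_real r * gram b (p * a))" by simp
  moreover have "cnj (gram b a) = c" "cnj (gram (p * b) a) = y" "cnj (gram b (p * a)) = x"
    using gram_cnj[of b a] gram_cnj[of "p * b" a] gram_cnj[of b "p * a"] a b p0 by (simp_all add: c_def x_def y_def)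
  ultimately have 2: "s * c = of_real q * y + of_real r * x" by (simp add: s_def)
  have "(of_real q - of_real r) * (x - y) = 0" using 1 2 by (simp add: algebra_simps)
  moreover have qr: "q - r \<noteq> 0" "q + r \<noteq> 0" using p0 rchi_cases[of p] by (auto simp: q_def r_def)
  moreover have "complex_of_real q - of_real r \<noteq> 0" using qr(1) by (simp flip: of_real_diff)
  ultimately have "x = y" by simp
  then have "s * c = of_real (q + r) * x" using 1 by (simp add: algebra_simps)
  moreover have "complex_of_real (q + r) \<noteq> 0" using qr(2) by (simp only: of_real_eq_0_iff not_False_eq_True)
  ultimately have "x = s * c / of_real (q + r)" by (simp add: eq_divide_eq mult.commute)
  moreover have "s = of_real (sqrt (real p) * rlam p)" by (simp add: s_def)
  ultimately have "x = of_real (sqrt (real p) * rlam p) / of_real (q + r) * c" by simp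
  also have "complex_of_real (sqrt (real p) * rlam p) / of_real (q + r) = of_real (kap p 1)"
    by (simp add: q_def r_def)
  finally show ?thesis by (simp add: x_def c_def)
qed

lemma gram_prime_power_left:
  assumes p: "prime p" and a: "a > 0" "\<not> p dvd a" and b: "b > 0" "\<not> p dvd b"
  shows "gram (p ^ k * a) b = of_real (kap p k) * gram a b"
proof -
  have p0: "real p > 1" "p > 0" using p prime_gt_1_nat prime_gt_0_nat by auto
  have "gram (p ^ k * a) b = of_real (kap p k) * gram a b \<and> gram (p ^ Suc k * a) b = of_real (kap p (Suc k)) * gram a b"
  proof (induction k)
    case 0
    then show ?case using gram_prime[OF assms] by simp
  next
    case (Suc k)
    have "cnj (lam p) * of_real (sqrt (real p)) * gram (p ^ Suc k * a) b =
        of_nat p * gram (p * (p ^ Suc k * a)) b + chi p * gram (p ^ Suc k * a) (p * b)"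
      by (rule gram_hecke[OF p _ b]) (use a p0 in simp)
    moreover have "gram (p ^ Suc k * a) (p * b) = gram (p ^ k * a) b"
      using gram_scale[of p "p ^ k * a" b] a b p0 by (simp add: mult_ac)
    moreover have "p * (p ^ Suc k * a) = p ^ Suc (Suc k) * a" by simp
    ultimately have e: "of_real (rlam p * sqrt (real p)) * (of_real (kap p (Suc k)) * gram a b) =
        of_nat p * gram (p ^ Suc (Suc k) * a) b + of_real (rchi p) * (of_real (kap p k) * gram a b)"
      using Suc by (simp add: lam_eq_rlam[OF p] chi_eq_rchi[OF p] mult.assoc)
    have "of_nat p * gram (p ^ Suc (Suc k) * a) b =
        of_real (rlam p * sqrt (real p) * kap p (Suc k) - rchi p * kap p k) * gram a b"
      using e by (simp add: algebra_simps)
    then have "gram (p ^ Suc (Suc k) * a) b = of_real ((rlam p * sqrt (real p) * kap p (Suc k) - rchi p * kap p k) / real p) * gram a b"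
      using p0 by (simp add: field_simps)
    then show ?case using Suc by (simp add: mult.commute[of "rlam p"])
  qed
  then show ?thesis by blast
qed

lemma gram_prime_power_right:
  assumes p: "prime p" and a: "a > 0" "\<not> p dvd a" and b: "b > 0" "\<not> p dvd b"
  shows "gram a (p ^ k * b) = of_real (kap p k) * gram a b"
proof -
  have p0: "p > 0" using p prime_gt_0_nat by auto
  have "gram a (p ^ k * b) = cnj (gram (p ^ k * b) a)" by (rule gram_cnj) (use a b p0 in auto)
  also have "\<dots> = of_real (kap p k) * cnj (gram b a)" using gram_prime_power_left[OF p b a] by simp
  also have "cnj (gram b a) = gram a b" using gram_cnj[of b a] a b by simp
  finally show ?thesis .
qed

definition kapd :: "nat \<Rightarrow> nat \<Rightarrow> nat \<Rightarrow> real" where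
  "kapd p i j = kap p (if j \<le> i then i - j else j - i)"

lemma kapd_commute: "kapd p i j = kapd p j i"
  by (auto simp: kapd_def)

lemma gram_prime_powers:
  assumes p: "prime p" and a: "a > 0" "\<not> p dvd a" and b: "b > 0" "\<not> p dvd b"
  shows "gram (p ^ i * a) (p ^ j * b) = of_real (kapd p i j) * gram a b"
proof -
  have p0: "p > 0" using p prime_gt_0_nat by auto
  show ?thesis
  proof (cases "j \<le> i")
    case True
    then have "p ^ i = p ^ j * p ^ (i - j)" by (metis le_add_diff_inverse power_add)
    then have e: "p ^ i * a = p ^ j * (p ^ (i - j) * a)" by (simp only: mult.assoc)
    have "gram (p ^ i * a) (p ^ j * b) = gram (p ^ (i - j) * a) b"
      unfolding e by (rule gram_scale) (use p0 a b in auto)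
    then show ?thesis using True gram_prime_power_left[OF assms] by (simp add: kapd_def)
  next
    case False
    then have "p ^ j = p ^ i * p ^ (j - i)" by (metis le_add_diff_inverse nle_le power_add)
    then have e: "p ^ j * b = p ^ i * (p ^ (j - i) * b)" by (simp only: mult.assoc)
    have "gram (p ^ i * a) (p ^ j * b) = gram a (p ^ (j - i) * b)"
      unfolding e by (rule gram_scale) (use p0 a b in auto)
    then show ?thesis using False gram_prime_power_right[OF assms] by (simp add: kapd_def)
  qed
qed

text \<open>A proportionality between \<open>f\<close> and \<open>dilate p f\<close> would make \<open>f\<close> invariant under the
  translations by \<open>p powr - k\<close>, hence independent of the real part, and \<open>f\<close> is cuspidal.\<close>

lemma kap_less_1:
  assumes p: "prime p"
  shows "(kap p 1)\<^sup>2 < 1"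
proof (rule ccontr)
  assume ge: "\<not> (kap p 1)\<^sup>2 < 1"
  have p0: "real p > 1" "p > 0" using p prime_gt_1_nat prime_gt_0_nat by auto
  define c where "c = kap p 1"
  \<comment> \<open>The component of \<open>dilate p f\<close> orthogonal to \<open>f\<close>; its
    squared norm is \<open>1 - c^2\<close> times that of \<open>f\<close>, so the assumption forces
    \<open>c^2 = 1\<close> and \<open>u = 0\<close>.\<close>
  define u where "u = (\<lambda>z. dilate p f z + of_real (- c) * dilate 1 f z)"
  have a: "aut (dilate p f)" "aut (dilate 1 f)" using p0 by (auto intro: dilate_aut)
  have au: "aut u" unfolding u_def by (intro aut_add aut_scale a)
  have np: "\<not> p dvd 1" using p not_prime_unit by blast
  have g: "gram p 1 = of_real c * gram 1 1" "gram 1 p = of_real c * gram 1 1" "gram p p = gram 1 1"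
    using gram_prime_power_left[OF p _ np _ np, of 1] gram_prime_power_right[OF p _ np _ np, of 1]
      gram_scale[of p 1 1] p0 by (simp_all add: c_def)
  have "ip u u = gram p p + cnj (of_real (- c)) * gram p 1 + of_real (- c) * gram 1 p + of_real (- c) * cnj (of_real (- c)) * gram 1 1"
    unfolding u_def gram_def by (rule ip_combination[OF a])
  then have "ip u u = of_real (1 - c\<^sup>2) * gram 1 1"
    unfolding g by (simp add: algebra_simps power2_eq_square)
  then have e: "ip u u = of_real ((1 - c\<^sup>2) * Re (gram 1 1))" using gram_1_1(1) by (metis of_real_mult)
  have "(1 - c\<^sup>2) * Re (gram 1 1) \<ge> 0" using ip_self_real(2)[OF au] e by simp
  then have c2: "c\<^sup>2 = 1" using ge gram_1_1(2) by (auto simp: c_def zero_le_mult_iff)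
  then have "ip u u = 0" using e by simp
  moreover have "continuous_on uhp u"
    unfolding u_def using p0 by (intro continuous_intros dilate_cont) auto
  ultimately have u0: "u z = 0" if "z \<in> uhp" for z using ip_self_eq_0[OF au] that by blast
  have fp: "f (of_nat p * z) = of_real c * f z" if "z \<in> uhp" for z
    using u0[OF that] by (simp add: u_def dilate_def)
  have fpk: "f (of_nat (p ^ k) * z) = of_real c ^ k * f z" if "z \<in> uhp" for k z
  proof (induction k)
    case (Suc k)
    have "of_nat (p ^ k) * z \<in> uhp" using that p0 by (auto simp: uhp_def)
    from fp[OF this] Suc show ?case by (simp add: mult.assoc)
  qed simp
  have c0: "c \<noteq> 0" using c2 by auto
  have f0: "f (Complex x y) = 0" if y: "y > 0" for x y
  proof -
    define \<phi> where "\<phi> = (\<lambda>x. f (Complex x y))"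
    define T where "T = (\<lambda>k. (1 / real p) ^ k)"
    have T0: "T k > 0" for k using p0 by (simp add: T_def)
    have per: "\<phi> (x + T k) = \<phi> x" for x k
    proof -
      have "of_nat (p ^ k) * Complex (x + T k) y = of_nat (p ^ k) * Complex x y + of_int 1"
        using p0 by (simp add: complex_eq_iff T_def power_divide distrib_left)
      then have "f (of_nat (p ^ k) * Complex (x + T k) y) = f (of_nat (p ^ k) * Complex x y)"
        using f_plus_int[of "of_nat (p ^ k) * Complex x y" 1] by simp
      then have "of_real c ^ k * f (Complex (x + T k) y) = of_real c ^ k * f (Complex x y)"
        using fpk[of "Complex (x + T k) y" k] fpk[of "Complex x y" k] y by simp
      then show ?thesis using c0 by (simp add: \<phi>_def)
    qed
    have cont: "continuous_on UNIV \<phi>"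
      unfolding \<phi>_def using moebius_horizontal_continuous[OF f_cont, of "mat 1" y] y by simp
    obtain P where P: "\<And>x. (P has_vector_derivative \<phi> x) (at x)" using continuous_antiderivative[OF cont] by blast
    have "mat 1 \<in> Gamma0 1" unfolding Gamma0_1 by simp
    from f_cuspidal[OF this y] have "P (real N) - P 0 = 0"
      using LINT_eq_antiderivative[OF cont P, of 0 "real N"] by (simp add: \<phi>_def)
    have PT: "P (T k) = P 0" for k
    proof -
      have e: "real (N * p ^ k) * T k = real N" using p0 by (simp add: T_def power_divide)
      have "P (real N) = P 0 + of_nat (N * p ^ k) * (P (T k) - P 0)"
        using periodic_antiderivative_multiple[OF P per, of 0 "N * p ^ k" k] unfolding e add_0 .
      then have "of_nat (N * p ^ k) * (P (T k) - P 0) = 0"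
        using \<open>P (real N) - P 0 = 0\<close> by simp
      then show ?thesis using N p0 by simp
    qed
    have PxT: "P (x + T k) = P x" for k using periodic_antiderivative[OF P per, of x k] PT by simp
    \<comment> \<open>\<open>P\<close> does not change along the steps \<open>T k\<close>, which
      tend to zero, so its derivative \<open>\<phi> x\<close> vanishes.\<close>
    have "((\<lambda>h. norm (P (x + h) - P x - h *\<^sub>R \<phi> x) / norm h) \<longlongrightarrow> 0) (at 0)"
      using P[of x] unfolding has_vector_derivative_def has_derivative_at by blast
    moreover have "filterlim T (at 0) sequentially"
      unfolding filterlim_at
    proof
      show "\<forall>\<^sub>F k in sequentially. T k \<in> UNIV \<and> T k \<noteq> 0" using T0 by (simp add: less_imp_neq[symmetric])
      show "T \<longlonglongrightarrow> 0" unfolding T_def using p0 by (intro LIMSEQ_realpow_zero) auto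
    qed
    ultimately have "(\<lambda>k. norm (P (x + T k) - P x - T k *\<^sub>R \<phi> x) / norm (T k)) \<longlonglongrightarrow> 0"
      by (rule filterlim_compose)
    moreover have "norm (P (x + T k) - P x - T k *\<^sub>R \<phi> x) / norm (T k) = norm (\<phi> x)" for k
      using T0[of k] by (simp add: PxT)
    ultimately have "(\<lambda>k::nat. norm (\<phi> x)) \<longlonglongrightarrow> 0" by simp
    then have "norm (\<phi> x) = 0" using LIMSEQ_unique tendsto_const by blast
    then show ?thesis by (simp add: \<phi>_def)
  qed
  obtain z where "z \<in> uhp" "f z \<noteq> 0" using f_nonzero by blast
  then show False using f0[of "Im z" "Re z"] by (simp add: uhp_def complex_surj)
qed

subsection \<open>Orthonormalization at one prime\<close>

text \<open>\<open>xloc p k i\<close> is the coefficient of \<open>dilate (p ^ i) f\<close> in the basis form at \<open>p ^ k\<close>; \<open>rloc p\<close> and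
  \<open>aloc p\<close> are the values of \<open>r_coeff\<close> and \<open>alpha_coeff\<close> at the positive powers of \<open>p\<close>.\<close>

definition rloc :: "nat \<Rightarrow> real" where "rloc p = 1 - (kap p 1)\<^sup>2"

definition aloc :: "nat \<Rightarrow> real" where "aloc p = 1 - rchi p / (real p)\<^sup>2"

definition xloc :: "nat \<Rightarrow> nat \<Rightarrow> nat \<Rightarrow> real" where
  "xloc p k i =
     (if k = 0 then 1
      else if k = 1 then (if i = 1 then 1 else - kap p 1) / sqrt (rloc p)
      else (if i = k then 1 else if i + 1 = k then - rlam p / sqrt (real p)
            else if i + 2 = k then rchi p / real p else 0) / sqrt (rloc p * aloc p))"

lemma rloc_pos: "prime p \<Longrightarrow> rloc p > 0"
  using kap_less_1 by (simp add: rloc_def)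

lemma aloc_ge: "prime p \<Longrightarrow> aloc p \<ge> 3 / 4"
proof -
  assume "prime p"
  then have "real p \<ge> 2" using prime_ge_2_nat by auto
  then have "(real p)\<^sup>2 \<ge> 2\<^sup>2" by (intro power_mono) auto
  then have "1 / (real p)\<^sup>2 \<le> 1 / 4" by (intro divide_left_mono) (use \<open>real p \<ge> 2\<close> in auto)
  then show ?thesis using rchi_cases[of p] by (auto simp: aloc_def)
qed

lemma kap_recursion:
  assumes "prime p" "k > 0"
  shows "kap p (k + 1) - rlam p / sqrt (real p) * kap p k + rchi p / real p * kap p (k - 1) = 0"
proof -
  obtain m where k: "k = Suc m" using assms by (cases k) auto
  have "real p > 0" using assms prime_gt_0_nat by simp
  moreover have "rlam p / sqrt (real p) = sqrt (real p) * rlam p / real p"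
    using \<open>real p > 0\<close> by (simp add: field_simps)
  ultimately show ?thesis unfolding k by (simp add: field_simps)
qed

lemma kap_1_eq:
  assumes "prime p"
  shows "kap p 1 * (1 + rchi p / real p) = rlam p / sqrt (real p)"
proof -
  have p: "real p > 0" using assms prime_gt_0_nat by simp
  then have "real p + rchi p > 0" using rchi_cases[of p] by auto
  moreover have "1 + rchi p / real p = (real p + rchi p) / real p" using p by (simp add: field_simps)
  ultimately have "kap p 1 * (1 + rchi p / real p) = sqrt (real p) * rlam p / real p" by simp
  also have "\<dots> = rlam p / sqrt (real p)" using p by (simp add: field_simps)
  finally show ?thesis .
qed

text \<open>For \<open>k \<ge> 2\<close> the coefficients 1, -L, e are those of the recursion of
  \<open>kap\<close>, which annihilates the inner products with \<open>j \<le> k - 2\<close>; the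
  case \<open>j = k - 1\<close> is the relation \<open>x * (1 + e) = L\<close> defining
  \<open>kap p 1\<close>. By orthogonality to the lower dilates the second statement is a
  norm.\<close>

lemma sum_xloc:
  assumes p: "prime p"
  shows "j < k \<Longrightarrow> (\<Sum>i\<le>k. xloc p k i * kapd p i j) = 0"
    "xloc p k k * (\<Sum>i\<le>k. xloc p k i * kapd p i k) = 1"
proof -
  define x where "x = kap p 1"
  define L where "L = rlam p / sqrt (real p)"
  define e where "e = rchi p / real p"
  have r: "rloc p = 1 - x\<^sup>2" "rloc p > 0" using rloc_pos[OF p] by (auto simp: rloc_def x_def)
  have al: "aloc p > 0" using aloc_ge[OF p] by simp
  have xe: "x * (1 + e) = L" unfolding x_def L_def e_def by (rule kap_1_eq[OF p])
  have p0: "real p > 0" using p prime_gt_0_nat by simp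
  have ae: "aloc p = 1 - e\<^sup>2"
    using rchi_cases[of p] by (auto simp: aloc_def e_def power_divide)
  have k2: "kap p 2 = L * x - e"
    using kap_recursion[OF p, of 1] by (simp add: numeral_2_eq_2 L_def e_def x_def)
  have one: "(\<Sum>i\<le>1. xloc p 1 i * kapd p i j) = (kapd p 1 j - x * kapd p 0 j) / sqrt (rloc p)" for j
    by (simp add: xloc_def x_def diff_divide_distrib)
  have big: "(\<Sum>i\<le>k. xloc p k i * kapd p i j) = (kapd p k j - L * kapd p (k - 1) j + e * kapd p (k - 2) j) / sqrt (rloc p * aloc p)"
    if k: "k \<ge> 2" for k j
  proof -
    have "(\<Sum>i\<le>k. xloc p k i * kapd p i j) = (\<Sum>i\<in>{k, k - 1, k - 2}. xloc p k i * kapd p i j)"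
      using k by (intro sum.mono_neutral_right) (auto simp: xloc_def)
    also have "\<dots> = xloc p k k * kapd p k j + (xloc p k (k - 1) * kapd p (k - 1) j + xloc p k (k - 2) * kapd p (k - 2) j)"
      using k by (subst sum.insert; (subst sum.insert)?) auto
    also have "\<dots> = (kapd p k j - L * kapd p (k - 1) j + e * kapd p (k - 2) j) / sqrt (rloc p * aloc p)"
    proof -
      obtain m where "k = Suc (Suc m)" using k by (metis add_2_eq_Suc le_Suc_ex)
      then show ?thesis by (simp add: xloc_def L_def e_def add_divide_distrib diff_divide_distrib)
    qed
    finally show ?thesis .
  qed
  show "(\<Sum>i\<le>k. xloc p k i * kapd p i j) = 0" if j: "j < k"
  proof (cases "k = 1")
    case True
    then show ?thesis using one[of 0] j by (simp add: kapd_def x_def)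
  next
    case False
    then have k: "k \<ge> 2" using j by simp
    have "kapd p k j - L * kapd p (k - 1) j + e * kapd p (k - 2) j = 0"
    proof (cases "j = k - 1")
      case True
      then have "kapd p k j = x" "kapd p (k - 1) j = 1" "kapd p (k - 2) j = x"
        using k by (auto simp: kapd_def x_def)
      then show ?thesis using xe by (simp add: algebra_simps)
    next
      case False
      define m where "m = k - 1 - j"
      have m: "m > 0" "k - j = m + 1" "k - 1 - j = m" "k - 2 - j = m - 1" "j \<le> k - 2" using False j k by (auto simp: m_def)
      then have "kapd p k j = kap p (m + 1)" "kapd p (k - 1) j = kap p m" "kapd p (k - 2) j = kap p (m - 1)"
        using k by (auto simp: kapd_def)
      then show ?thesis using kap_recursion[OF p m(1)] by (simp add: L_def e_def)
    qed
    then show ?thesis by (simp add: big[OF k])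
  qed
  show "xloc p k k * (\<Sum>i\<le>k. xloc p k i * kapd p i k) = 1"
  proof -
    consider "k = 0" | "k = 1" | "k \<ge> 2" by linarith
    then show ?thesis
    proof cases
      case 1
      then show ?thesis by (simp add: xloc_def kapd_def)
    next
      case 2
      have "(\<Sum>i\<le>1. xloc p 1 i * kapd p i 1) = (1 - x * x) / sqrt (rloc p)"
        unfolding one by (simp add: kapd_def x_def)
      also have "\<dots> = rloc p / sqrt (rloc p)" by (simp add: r power2_eq_square)
      finally show ?thesis using 2 r by (simp add: xloc_def)
    next
      case 3
      have "kapd p k k = 1" by (simp add: kapd_def)
      moreover have "kapd p (k - 1) k = x"
      proof -
        have "\<not> k \<le> k - 1" "k - (k - 1) = 1" using 3 by auto
        then show ?thesis by (simp only: kapd_def x_def if_False)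
      qed
      moreover have "kapd p (k - 2) k = kap p 2"
      proof -
        have "\<not> k \<le> k - 2" "k - (k - 2) = 2" using 3 by auto
        then show ?thesis by (simp only: kapd_def if_False)
      qed
      ultimately have "kapd p k k - L * kapd p (k - 1) k + e * kapd p (k - 2) k = 1 - L * x + e * kap p 2"
        by simp
      also have "\<dots> = 1 - L * x + e * (L * x - e)" by (simp add: k2)
      \<comment> \<open>This factorization is the origin of the normalizing factor
        \<open>rloc p * aloc p\<close>.\<close>
      also have "\<dots> = (1 - x\<^sup>2) * (1 - e\<^sup>2)" unfolding xe[symmetric] by (simp add: power2_eq_square algebra_simps)
      finally have "(\<Sum>i\<le>k. xloc p k i * kapd p i k) = rloc p * aloc p / sqrt (rloc p * aloc p)"
        unfolding big[OF 3] r ae by simp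
      moreover have "xloc p k k = 1 / sqrt (rloc p * aloc p)" using 3 by (simp add: xloc_def)
      moreover have "1 / sqrt X * (X / sqrt X) = 1" if "X > 0" for X :: real
        using that by simp
      moreover have "rloc p * aloc p > 0" using r(2) al by simp
      ultimately show ?thesis by (simp only:)
    qed
  qed
qed

text \<open>With the larger index summed first, \<open>sum_xloc\<close> leaves only the term
  \<open>j = k\<close>, which occurs only for equal indices.\<close>

lemma sum_xloc_orthonormal:
  assumes p: "prime p"
  shows "(\<Sum>i\<le>k. \<Sum>j\<le>m. xloc p k i * xloc p m j * kapd p i j) = (if k = m then 1 else 0)"
proof -
  have le: "(\<Sum>i\<le>k. \<Sum>j\<le>m. xloc p k i * xloc p m j * kapd p i j) = (if k = m then 1 else 0)" if "m \<le> k" for k m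
  proof -
    have "(\<Sum>i\<le>k. \<Sum>j\<le>m. xloc p k i * xloc p m j * kapd p i j) = (\<Sum>j\<le>m. xloc p m j * (\<Sum>i\<le>k. xloc p k i * kapd p i j))"
      by (subst sum.swap) (simp add: sum_distrib_left mult_ac)
    also have "\<dots> = (if k = m then 1 else 0)"
    proof (cases "k = m")
      case True
      have "(\<Sum>j\<le>k. xloc p k j * (\<Sum>i\<le>k. xloc p k i * kapd p i j)) = (\<Sum>j\<in>{k}. xloc p k j * (\<Sum>i\<le>k. xloc p k i * kapd p i j))"
        by (rule sum.mono_neutral_right) (use sum_xloc(1)[OF p] in auto)
      then show ?thesis using True sum_xloc(2)[OF p, of k] by simp
    next
      case False
      then show ?thesis using that sum_xloc(1)[OF p] by (simp add: sum.neutral)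
    qed
    finally show ?thesis .
  qed
  show ?thesis
  proof (cases "m \<le> k")
    case True
    then show ?thesis by (rule le)
  next
    case False
    have "(\<Sum>i\<le>k. \<Sum>j\<le>m. xloc p k i * xloc p m j * kapd p i j) = (\<Sum>j\<le>m. \<Sum>i\<le>k. xloc p m j * xloc p k i * kapd p j i)"
      by (subst sum.swap) (simp add: kapd_commute[of p] mult_ac)
    then show ?thesis using le[of k m] False by simp
  qed
qed

end

section \<open>Factorization of the coefficients over the primes\<close>

lemma prime_power_decomp:
  fixes n p :: nat
  assumes "prime p" "n > 0"
  obtains k a where "n = p ^ k * a" "\<not> p dvd a" "a > 0"
proof -
  have "p \<noteq> 1" using assms prime_gt_1_nat by auto
  with assms(2) obtain a where "n = p ^ multiplicity p n * a" "\<not> p dvd a"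
    using multiplicity_decompose'[of n p] by auto
  moreover from this have "a > 0" using assms(2) by (cases a) auto
  ultimately show thesis using that by blast
qed

text \<open>The whole \<open>p\<close>-part is split off at once, because the coefficients treated
  below are known at full prime powers and multiplicative across coprime factors.\<close>

lemma prime_power_induct [consumes 1, case_names one step]:
  fixes n :: nat
  assumes "n > 0" and one: "P 1"
    and step: "\<And>p k a. prime p \<Longrightarrow> k > 0 \<Longrightarrow> a > 0 \<Longrightarrow> \<not> p dvd a \<Longrightarrow> P a \<Longrightarrow> P (p ^ k * a)"
  shows "P n"
  using assms(1)
proof (induction n rule: less_induct)
  case (less n)
  show ?case
  proof (cases "n = 1")
    case True
    then show ?thesis using one by simp
  next
    case False
    then obtain p where p: "prime p" "p dvd n" using prime_factor_nat by blast
    obtain k a where ka: "n = p ^ k * a" "\<not> p dvd a" "a > 0" using prime_power_decomp[OF p(1) less.prems] by blast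
    have k: "k > 0" using p(2) ka by (cases k) auto
    have "p ^ k > 1" using prime_gt_1_nat[OF p(1)] k by (rule one_less_power)
    then have "a < n" using ka by simp
    then show ?thesis using step[OF p(1) k ka(3,2) less.IH] ka by simp
  qed
qed

lemma multiplicity_prime_power_mult:
  fixes p a :: nat
  assumes "prime p" "\<not> p dvd a" "a > 0"
  shows "multiplicity p (p ^ k * a) = k"
proof -
  have "prime_elem p" "p \<noteq> 0" using assms by auto
  then have "multiplicity p (p ^ k * a) = multiplicity p (p ^ k) + multiplicity p a"
    using assms by (intro prime_elem_multiplicity_mult_distrib) auto
  moreover have "multiplicity p a = 0" using assms by (simp add: not_dvd_imp_multiplicity_0)
  moreover have "multiplicity p (p ^ k) = k" using assms by simp
  ultimately show ?thesis by simp
qed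

lemma multiplicity_prime_power_mult_other:
  fixes p q a :: nat
  assumes "prime p" "prime q" "p \<noteq> q" "a > 0"
  shows "multiplicity q (p ^ k * a) = multiplicity q a"
proof -
  have "multiplicity q (p ^ k * a) = multiplicity q (p ^ k) + multiplicity q a"
    using assms by (intro prime_elem_multiplicity_mult_distrib) auto
  also have "multiplicity q (p ^ k) = 0"
    using assms by (intro not_dvd_imp_multiplicity_0) (metis prime_dvd_power primes_dvd_imp_eq)
  finally show ?thesis by simp
qed

lemma prime_factors_prime_power_mult:
  fixes p a :: nat
  assumes "prime p" "k > 0" "a > 0"
  shows "prime_factors (p ^ k * a) = insert p (prime_factors a)"
  using assms by (subst prime_factors_product) (auto simp: prime_factorization_prime_power)

lemma prime_power_mult_inj:
  fixes p :: nat
  assumes "prime p" "\<not> p dvd d" "\<not> p dvd e" "p ^ i * d = p ^ j * e" "d > 0" "e > 0"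
  shows "i = j \<and> d = e"
proof -
  have "i = j" using assms multiplicity_prime_power_mult[of p d i] multiplicity_prime_power_mult[of p e j] by simp
  then show ?thesis using assms prime_gt_0_nat[of p] by simp
qed

lemma bij_betw_divisors:
  fixes p a :: nat
  assumes p: "prime p" and a: "a > 0" "\<not> p dvd a"
  shows "bij_betw (\<lambda>(i, d). p ^ i * d) ({..k} \<times> {d. d dvd a}) {d. d dvd p ^ k * a}"
  unfolding bij_betw_def
proof
  have nd: "\<not> p dvd d \<and> d > 0" if "d dvd a" for d using that a by (auto intro: dvd_trans gr0I)
  show "inj_on (\<lambda>(i, d). p ^ i * d) ({..k} \<times> {d. d dvd a})"
  proof (rule inj_onI, clarify)
    fix i d j e assume "d dvd a" "e dvd a" "p ^ i * d = p ^ j * e"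
    then show "i = j \<and> d = e" using prime_power_mult_inj[OF p, of d e i j] nd by blast
  qed
  show "(\<lambda>(i, d). p ^ i * d) ` ({..k} \<times> {d. d dvd a}) = {d. d dvd p ^ k * a}"
  proof (intro equalityI subsetI)
    fix x assume "x \<in> (\<lambda>(i, d). p ^ i * d) ` ({..k} \<times> {d. d dvd a})"
    then show "x \<in> {d. d dvd p ^ k * a}" by (auto intro!: mult_dvd_mono le_imp_power_dvd)
  next
    fix x assume x: "x \<in> {d. d dvd p ^ k * a}"
    have "p ^ k * a > 0" using p a prime_gt_0_nat by simp
    then have "x > 0" using x by (auto intro: gr0I)
    then obtain i d where id: "x = p ^ i * d" "\<not> p dvd d" "d > 0" using prime_power_decomp[OF p] by blast
    have "coprime (p ^ k) d" using prime_imp_coprime[OF p id(2)] by simp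
    then have "coprime d (p ^ k)" by (rule coprime_commute[THEN iffD1])
    moreover have "d dvd p ^ k * a" using x id by (metis dvd_mult_right mem_Collect_eq)
    ultimately have "d dvd a" by (simp add: coprime_dvd_mult_right_iff)
    moreover have "p ^ i dvd p ^ k * a" using x id by (metis dvd_mult_left mem_Collect_eq)
    then have "p ^ i dvd p ^ k"
      using a(2) p by (simp add: coprime_dvd_mult_left_iff prime_imp_coprime)
    then have "i \<le> k" using prime_gt_1_nat[OF p] by (simp add: power_dvd_imp_le)
    ultimately show "x \<in> (\<lambda>(i, d). p ^ i * d) ` ({..k} \<times> {d. d dvd a})"
      using id by (intro image_eqI[of _ _ "(i, d)"]) auto
  qed
qed

lemma sum_divisors_prime_power:
  fixes p a :: nat
  assumes "prime p" "a > 0" "\<not> p dvd a"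
  shows "(\<Sum>d | d dvd p ^ k * a. g d) = (\<Sum>i\<le>k. \<Sum>d | d dvd a. g (p ^ i * d))"
proof -
  have "(\<Sum>i\<le>k. \<Sum>d | d dvd a. g (p ^ i * d)) = (\<Sum>x\<in>{..k} \<times> {d. d dvd a}. g ((\<lambda>(i, d). p ^ i * d) x))"
    by (simp add: sum.cartesian_product split_beta)
  also have "\<dots> = (\<Sum>d | d dvd p ^ k * a. g d)"
    by (rule sum.reindex_bij_betw[OF bij_betw_divisors[OF assms]])
  finally show ?thesis ..
qed

text \<open>For summands with a Moebius factor only the exponents 0 and 1 of \<open>p\<close>
  survive, so the local factor is the same for all \<open>k > 0\<close>.\<close>

lemma sum_divisors_prime_power_two:
  fixes p a :: nat and g :: "nat \<Rightarrow> complex"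
  assumes p: "prime p" and a: "a > 0" "\<not> p dvd a" and k: "k > 0"
    and 0: "\<And>i d. d dvd a \<Longrightarrow> i \<ge> 2 \<Longrightarrow> g (p ^ i * d) = 0"
    and 1: "\<And>d. d dvd a \<Longrightarrow> g (p * d) = c * g d"
  shows "(\<Sum>d | d dvd p ^ k * a. g d) = (1 + c) * (\<Sum>d | d dvd a. g d)"
proof -
  have "(\<Sum>d | d dvd p ^ k * a. g d) = (\<Sum>i\<le>k. \<Sum>d | d dvd a. g (p ^ i * d))"
    by (rule sum_divisors_prime_power[OF p a])
  also have "\<dots> = (\<Sum>i\<in>{0, 1}. \<Sum>d | d dvd a. g (p ^ i * d))"
    using k 0 by (intro sum.mono_neutral_right) (auto intro!: sum.neutral simp: not_less_eq_eq numeral_2_eq_2)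
  also have "\<dots> = (\<Sum>d | d dvd a. g d) + (\<Sum>d | d dvd a. c * g d)"
    using 1 by simp
  finally show ?thesis by (simp add: sum_distrib_left distrib_right sum.distrib)
qed

lemma chi0_mult: "chi0 N (a * b) = chi0 N a * chi0 N b"
  by (simp add: chi0_def coprime_mult_left_iff)

lemma chi0_1 [simp]: "chi0 N (Suc 0) = 1"
  by (simp add: chi0_def)

lemma moebius_mu_1 [simp]: "moebius_mu (Suc 0) = 1"
  by (simp add: moebius_mu_def)

lemma moebius_mu_prime_mult:
  assumes p: "prime p" and d: "d > 0" "\<not> p dvd d"
  shows "moebius_mu (p * d) = - moebius_mu d"
proof -
  have cop: "coprime p d" using p d by (simp add: prime_imp_coprime)
  have sq: "squarefree (p * d) \<longleftrightarrow> squarefree d"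
    using squarefree_mult_coprime[OF cop squarefree_prime[OF p]] squarefree_multD(2)[of p d] by blast
  have "prime_factors (p * d) = insert p (prime_factors d)"
    using prime_factors_prime_power_mult[OF p, of 1 d] d by simp
  moreover have "p \<notin> prime_factors d" using d by auto
  ultimately show ?thesis by (simp add: moebius_mu_def sq)
qed

lemma moebius_mu_prime_power_mult:
  assumes p: "prime p" and i: "i \<ge> 2"
  shows "moebius_mu (p ^ i * d) = 0"
proof -
  have "p ^ 2 dvd p ^ i * d" using i by (simp add: le_imp_power_dvd)
  moreover have "\<not> is_unit p" using p not_prime_unit by blast
  ultimately have "\<not> squarefree (p ^ i * d)" using squarefreeD by blast
  then show ?thesis by (simp add: moebius_mu_def)
qed

lemma squarefree_mult_coprimeD:
  fixes a b :: nat
  assumes "squarefree (a * b)"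
  shows "coprime a b"
proof (rule coprimeI)
  fix c assume "c dvd a" "c dvd b"
  then have "c\<^sup>2 dvd a * b" by (simp add: power2_eq_square mult_dvd_mono)
  then show "is_unit c" using assms squarefreeD by blast
qed

lemma prime_mult_div:
  fixes p :: nat
  assumes "prime p" "e dvd s" "s > 0" "i \<le> k"
  shows "(p ^ k * s) div (p ^ i * e) = p ^ (k - i) * (s div e)"
proof -
  obtain q where q: "s = e * q" using assms by (auto elim: dvdE)
  have "p ^ k = p ^ i * p ^ (k - i)" using assms by (simp add: power_add[symmetric])
  then have e: "p ^ k * s = (p ^ i * e) * (p ^ (k - i) * q)" by (simp only: q mult_ac)
  have "e > 0" using assms q by (cases "e = 0") auto
  moreover have "p ^ i > 0" using prime_gt_0_nat[OF assms(1)] by simp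
  ultimately have "p ^ i * e \<noteq> 0" by simp
  then have "(p ^ k * s) div (p ^ i * e) = p ^ (k - i) * q" unfolding e by (rule nonzero_mult_div_cancel_left)
  moreover have "s div e = q" using \<open>e > 0\<close> q by simp
  ultimately show ?thesis by simp
qed

lemma gcd_prime_power_mult:
  fixes p :: nat
  assumes p: "prime p" and "\<not> p dvd d" "i \<le> k"
  shows "gcd (p ^ k * s) (p ^ i * d) = p ^ i * gcd s d"
proof -
  have "p ^ k = p ^ i * p ^ (k - i)" using assms by (simp add: power_add[symmetric])
  then have e: "p ^ k * s = p ^ i * (p ^ (k - i) * s)" by (simp only: mult.assoc)
  have "coprime d (p ^ (k - i))"
    using prime_imp_coprime[OF p assms(2)] by (simp add: coprime_commute[of d])
  then have "gcd (p ^ (k - i) * s) d = gcd s d"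
    by (simp add: gcd.commute[of _ d] gcd_mult_right_left_cancel)
  then show ?thesis unfolding e gcd_mult_distrib_nat[symmetric] by simp
qed

lemma gcd_prime_power_mult_right:
  fixes p :: nat
  assumes p: "prime p" and "\<not> p dvd s"
  shows "gcd s (p ^ i * d) = gcd s d"
proof -
  have "coprime s (p ^ i)"
    using prime_imp_coprime[OF assms] by (simp add: coprime_commute[of s])
  then show ?thesis by (simp add: gcd_mult_right_left_cancel)
qed

lemma squarefree_factor_1 [simp]: "squarefree_factor (Suc 0) = 1"
  and squarefull_factor_1 [simp]: "squarefull_factor (Suc 0) = 1"
  by (simp_all add: squarefree_factor_def squarefull_factor_def)

lemma squarefree_factor_prime_power_mult:
  assumes p: "prime p" and a: "a > 0" "\<not> p dvd a" and k: "k > 0"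
  shows "squarefree_factor (p ^ k * a) = (if k = 1 then p else 1) * squarefree_factor a"
proof -
  let ?S = "{q. q \<in> prime_factors a \<and> multiplicity q a = 1}"
  have mo: "multiplicity x (p ^ k * a) = multiplicity x a" if "x \<in> prime_factors a" for x
    using that a by (intro multiplicity_prime_power_mult_other[OF p _ _ a(1)]) auto
  have "p \<notin> prime_factors a" using a by auto
  then have "{q. q \<in> prime_factors (p ^ k * a) \<and> multiplicity q (p ^ k * a) = 1} = (if k = 1 then insert p ?S else ?S)"
    using multiplicity_prime_power_mult[OF p a(2,1), of k] mo
    by (auto simp: prime_factors_prime_power_mult[OF p k a(1)])
  moreover have "p \<notin> ?S" "finite ?S" using a by auto
  ultimately show ?thesis by (simp add: squarefree_factor_def)
qed

lemma squarefull_factor_prime_power_mult: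
  assumes p: "prime p" and a: "a > 0" "\<not> p dvd a" and k: "k > 0"
  shows "squarefull_factor (p ^ k * a) = (if k = 1 then 1 else p ^ k) * squarefull_factor a"
proof -
  let ?S = "{q. q \<in> prime_factors a \<and> multiplicity q a \<ge> 2}"
  have mo: "multiplicity x (p ^ k * a) = multiplicity x a" if "x \<in> prime_factors a" for x
    using that a by (intro multiplicity_prime_power_mult_other[OF p _ _ a(1)]) auto
  have "p \<notin> prime_factors a" using a by auto
  then have "{q. q \<in> prime_factors (p ^ k * a) \<and> multiplicity q (p ^ k * a) \<ge> 2} = (if k = 1 then ?S else insert p ?S)"
    using multiplicity_prime_power_mult[OF p a(2,1), of k] mo k
    by (auto simp: prime_factors_prime_power_mult[OF p k a(1)])
  moreover have "p \<notin> ?S" "finite ?S" using a by auto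
  moreover have "(\<Prod>q\<in>?S. q ^ multiplicity q (p ^ k * a)) = (\<Prod>q\<in>?S. q ^ multiplicity q a)"
    using mo by (intro prod.cong) auto
  ultimately show ?thesis
    using multiplicity_prime_power_mult[OF p a(2,1), of k]
    by (cases "k = 1") (simp_all add: squarefull_factor_def)
qed

lemma squarefree_factor_props:
  assumes "n > 0"
  shows "squarefree_factor n dvd n" "squarefull_factor n dvd n" "squarefree (squarefree_factor n)"
    "squarefree_factor n > 0" "squarefull_factor n > 0"
proof -
  have "squarefree_factor n dvd n \<and> squarefull_factor n dvd n \<and> squarefree (squarefree_factor n)"
    using assms
  proof (induction rule: prime_power_induct)
    case (step p k a)
    have "\<not> p dvd squarefree_factor a" using step by (meson dvd_trans)
    then have "coprime p (squarefree_factor a)" using step by (simp add: prime_imp_coprime)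
    then show ?case
      using step squarefree_mult_coprime[of p "squarefree_factor a"] squarefree_prime[of p]
      by (auto simp: squarefree_factor_prime_power_mult squarefull_factor_prime_power_mult intro: mult_dvd_mono dvd_mult)
  qed simp
  then show "squarefree_factor n dvd n" "squarefull_factor n dvd n" "squarefree (squarefree_factor n)" by auto
  then show "squarefree_factor n > 0" "squarefull_factor n > 0" using assms by (auto intro: gr0I)
qed

lemma mu_coeff_1 [simp]: "mu_coeff N lam (Suc 0) = 1"
  by (simp add: mu_coeff_def)

lemma mu_coeff_prime_power_mult:
  assumes p: "prime p" and q: "q > 0" "\<not> p dvd q"
  shows "mu_coeff N lam (p ^ m * q) =
    (if m = 0 then 1 else if m = 1 then - lam p else if m = 2 then chi0 N p else 0) * mu_coeff N lam q"
proof (cases "m = 0")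
  case False
  let ?g = "\<lambda>n p. if multiplicity p n = 1 then - lam p else if multiplicity p n = 2 then chi0 N p else 0"
  have pq: "p \<notin> prime_factors q" using q by auto
  have "(\<Prod>r\<in>prime_factors q. ?g (p ^ m * q) r) = (\<Prod>r\<in>prime_factors q. ?g q r)"
  proof (rule prod.cong[OF refl])
    fix r assume "r \<in> prime_factors q"
    then have "multiplicity r (p ^ m * q) = multiplicity r q"
      using pq by (intro multiplicity_prime_power_mult_other[OF p _ _ q(1)]) auto
    then show "?g (p ^ m * q) r = ?g q r" by simp
  qed
  then show ?thesis
    using False pq unfolding mu_coeff_def
    by (simp add: prime_factors_prime_power_mult[OF p _ q(1)] multiplicity_prime_power_mult[OF p q(2,1)])
qed simp

context newform
begin

text \<open>Only squarefree arguments are needed; there \<open>lam\<close> is determined by the multiplicative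
  function \<open>gram\<close>.\<close>

lemma lam_eq_gram_sum:
  assumes m: "m > 0" "squarefree m"
  shows "of_real (sqrt (real m)) * cnj (lam m) * gram 1 1 =
    (\<Sum>a | a dvd m. of_nat (m div a) * chi0 N a * gram (m div a) a)"
proof -
  let ?A = "{a. a dvd m \<and> coprime a N}"
  have fin: "finite ?A" "finite {a. a dvd m}" using m by auto
  \<comment> \<open>Squarefreeness enters here: \<open>ip_shifted\<close> requires \<open>a\<close>
    and \<open>m div a\<close> to be coprime.\<close>
  have ad: "a > 0 \<and> m div a > 0 \<and> coprime a (m div a)" if a: "a dvd m" for a
  proof -
    have e: "m = a * (m div a)" using a by simp
    then have "coprime a (m div a)" using m(2) squarefree_mult_coprimeD by metis
    moreover have "a > 0" "m div a > 0" using e m(1) by (metis gr0I mult_0 not_less0, metis gr0I mult_0_right not_less0)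
    ultimately show ?thesis by blast
  qed
  let ?w = "\<lambda>a b z. f ((of_nat a * z + of_nat b) / of_nat (m div a))"
  have aw: "aut (?w a b)" if "a \<in> ?A" for a b using ad[of a] that by (intro shifted_aut) auto
  have a1: "aut (dilate 1 f)" by (rule dilate_aut) simp
  have "cnj (of_real (sqrt (real m)) * lam m) * gram 1 1 = ip (dilate 1 f) (\<lambda>z. (of_real (sqrt (real m)) * lam m) * dilate 1 f z)"
    unfolding gram_def by (rule ip_scale_right[OF a1 a1, symmetric])
  also have "(\<lambda>z. (of_real (sqrt (real m)) * lam m) * dilate 1 f z) = (\<lambda>z. \<Sum>a\<in>?A. 1 * (\<Sum>b<m div a. 1 * ?w a b z))"
    using hecke_sum[OF m(1)] by (simp add: fun_eq_iff dilate_def)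
  also have "ip (dilate 1 f) \<dots> = (\<Sum>a\<in>?A. cnj 1 * ip (dilate 1 f) (\<lambda>z. \<Sum>b<m div a. 1 * ?w a b z))"
    by (rule ip_sum_right[OF _ a1]) (use aw in \<open>auto intro!: aut_sum\<close>)
  also have "\<dots> = (\<Sum>a\<in>?A. of_nat (m div a) * gram (m div a) a)"
  proof (rule sum.cong[OF refl])
    fix a assume a: "a \<in> ?A"
    have "ip (dilate 1 f) (\<lambda>z. \<Sum>b<m div a. 1 * ?w a b z) = (\<Sum>b<m div a. cnj 1 * ip (dilate 1 f) (?w a b))"
      by (rule ip_sum_right[OF aw[OF a] a1])
    also have "\<dots> = (\<Sum>b<m div a. gram (m div a) a)"
      using ip_shifted[of "m div a" 1 a] ad[of a] a by (intro sum.cong) auto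
    finally show "cnj 1 * ip (dilate 1 f) (\<lambda>z. \<Sum>b<m div a. 1 * ?w a b z) = of_nat (m div a) * gram (m div a) a" by simp
  qed
  also have "\<dots> = (\<Sum>a | a dvd m. of_nat (m div a) * chi0 N a * gram (m div a) a)"
    using fin by (intro sum.mono_neutral_cong_left) (auto simp: chi0_def)
  finally show ?thesis by simp
qed

text \<open>The divisors of \<open>p * m\<close> are \<open>d\<close> and \<open>p * d\<close> with
  \<open>d\<close> dividing \<open>m\<close>. In \<open>lam_eq_gram_sum\<close> they contribute
  \<open>p * kap p 1\<close> and \<open>\<chi>(p) * kap p 1\<close> times the term for
  \<open>m\<close>, and these factors add up to \<open>sqrt p * lam p\<close>.\<close>

lemma lam_mult:
  assumes p: "prime p" and m: "m > 0" "squarefree m" "\<not> p dvd m"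
  shows "lam (p * m) = lam p * lam m"
proof -
  have p0: "real p > 1" "p > 0" using p prime_gt_1_nat prime_gt_0_nat by auto
  have cop: "coprime p m" using p m by (simp add: prime_imp_coprime)
  have sq: "squarefree (p * m)" by (rule squarefree_mult_coprime[OF cop squarefree_prime[OF p] m(2)])
  define S where "S = (\<Sum>a | a dvd m. of_nat (m div a) * chi0 N a * gram (m div a) a)"
  let ?F = "\<lambda>n a. of_nat (n div a) * chi0 N a * gram (n div a) a"
  have nd: "\<not> p dvd a \<and> a > 0 \<and> \<not> p dvd m div a \<and> m div a > 0" if a: "a dvd m" for a
  proof -
    have e: "m = a * (m div a)" using a by simp
    then show ?thesis using m by (metis dvd_mult dvd_mult2 gr0I mult_0 mult_0_right not_less0)
  qed
  have "(\<Sum>a | a dvd p * m. ?F (p * m) a) = (\<Sum>i\<le>1. \<Sum>d | d dvd m. ?F (p * m) (p ^ i * d))"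
    using sum_divisors_prime_power[OF p m(1,3), of "?F (p * m)" 1] by simp
  also have "\<dots> = (\<Sum>d | d dvd m. ?F (p * m) d) + (\<Sum>d | d dvd m. ?F (p * m) (p * d))" by simp
  also have "(\<Sum>d | d dvd m. ?F (p * m) d) = (\<Sum>d | d dvd m. of_real (real p * kap p 1) * ?F m d)"
  proof (rule sum.cong[OF refl])
    fix d assume "d \<in> {d. d dvd m}"
    then have d: "d dvd m" by simp
    have "p * m div d = p * (m div d)" using d by (rule div_mult_swap[symmetric])
    then show "?F (p * m) d = of_real (real p * kap p 1) * ?F m d"
      using gram_prime[OF p, of "m div d" d] nd[OF d] by simp
  qed
  also have "(\<Sum>d | d dvd m. ?F (p * m) (p * d)) = (\<Sum>d | d dvd m. of_real (rchi p * kap p 1) * ?F m d)"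
  proof (rule sum.cong[OF refl])
    fix d assume "d \<in> {d. d dvd m}"
    then have d: "d dvd m" by simp
    have "p * m div (p * d) = m div d" using p0 by simp
    then show "?F (p * m) (p * d) = of_real (rchi p * kap p 1) * ?F m d"
      using gram_prime_power_right[OF p, of "m div d" d 1] nd[OF d] chi_eq_rchi[OF p]
      by (simp add: chi0_mult chi_def)
  qed
  also have "(\<Sum>d | d dvd m. of_real (real p * kap p 1) * ?F m d) + (\<Sum>d | d dvd m. of_real (rchi p * kap p 1) * ?F m d)
      = of_real ((real p + rchi p) * kap p 1) * S"
    unfolding sum_distrib_left[symmetric] S_def[symmetric] by (simp only: distrib_right of_real_add)
  also have "(real p + rchi p) * kap p 1 = sqrt (real p) * rlam p"
    using p0 rchi_cases[of p] by auto
  finally have 1: "(\<Sum>a | a dvd p * m. ?F (p * m) a) = of_real (sqrt (real p) * rlam p) * S" .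
  have "of_real (sqrt (real (p * m))) * cnj (lam (p * m)) * gram 1 1 = of_real (sqrt (real p) * rlam p) * S"
    using lam_eq_gram_sum[OF _ sq] p0 m 1 by simp
  also have "S = of_real (sqrt (real m)) * cnj (lam m) * gram 1 1"
    unfolding S_def by (rule lam_eq_gram_sum[OF m(1,2), symmetric])
  finally have "of_real (sqrt (real p)) * of_real (sqrt (real m)) * gram 1 1 * cnj (lam (p * m)) =
      of_real (sqrt (real p)) * of_real (sqrt (real m)) * gram 1 1 * (of_real (rlam p) * cnj (lam m))"
    by (simp add: real_sqrt_mult mult_ac)
  moreover have "complex_of_real (sqrt (real p)) * of_real (sqrt (real m)) * gram 1 1 \<noteq> 0"
    using p0 m gram_1_1(2) by auto
  ultimately have "cnj (lam (p * m)) = of_real (rlam p) * cnj (lam m)" by (metis mult_left_cancel)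
  then have "cnj (cnj (lam (p * m))) = cnj (of_real (rlam p) * cnj (lam m))" by simp
  then show ?thesis by (simp add: lam_eq_rlam[OF p])
qed

end

lemma divisors_prime_power_props:
  fixes p a :: nat
  assumes "\<not> p dvd a" "a > 0" "d dvd a"
  shows "d > 0" "\<not> p dvd d" "a div d > 0" "\<not> p dvd a div d"
proof -
  obtain q where q: "a = d * q" using assms(3) by (auto elim: dvdE)
  show d: "d > 0" using q assms(2) by (cases d) auto
  show "\<not> p dvd d" using q assms(1) by (metis dvd_mult2)
  have "a div d = q" using q d by simp
  then show "a div d > 0" "\<not> p dvd a div d" using q assms by (auto intro: gr0I)
qed

lemma sum_fun_apply:
  fixes F :: "'i \<Rightarrow> 'a \<Rightarrow> 'b :: comm_monoid_add"
  shows "(\<Sum>i\<in>I. F i) z = (\<Sum>i\<in>I. F i z)"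
  by (induction I rule: infinite_finite_induct) auto

text \<open>In general \<open>csqrt\<close> is multiplicative only up to sign; the local factors are
  positive reals, where no sign arises.\<close>

lemma csqrt_of_real_mult:
  assumes "x > 0" "y \<ge> 0"
  shows "csqrt (of_real x * of_real y) = of_real (sqrt x) * csqrt (of_real y)"
proof -
  have "csqrt (of_real (x * y)) = of_real (sqrt (x * y))"
    using assms by (simp del: of_real_mult)
  then show ?thesis using assms by (simp add: real_sqrt_mult csqrt_of_real_nonneg)
qed

context newform
begin

section \<open>Local factors of the coefficients\<close>

lemma sigma_m1_prime_mult:
  assumes p: "prime p" and b: "b > 0" "\<not> p dvd b"
  shows "sigma_m1 N (p * b) = of_real (1 + rchi p / real p) * sigma_m1 N b"
proof -
  have "(\<Sum>d | d dvd p ^ 1 * b. chi0 N d / of_nat d) = (\<Sum>i\<le>1. \<Sum>d | d dvd b. chi0 N (p ^ i * d) / of_nat (p ^ i * d))"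
    by (rule sum_divisors_prime_power[OF p b])
  also have "\<dots> = (\<Sum>d | d dvd b. chi0 N d / of_nat d) + (\<Sum>d | d dvd b. chi0 N p / of_nat p * (chi0 N d / of_nat d))"
    by (simp add: chi0_mult del: sum_distrib_left)
  also have "\<dots> = (1 + chi0 N p / of_nat p) * sigma_m1 N b"
    unfolding sum_distrib_left[symmetric] sigma_m1_def by (simp only: distrib_right mult_1)
  finally show ?thesis using chi_eq_rchi[OF p] by (simp add: sigma_m1_def chi_def)
qed

lemma r_coeff_prime_power_mult:
  assumes p: "prime p" and a: "a > 0" "\<not> p dvd a" and k: "k > 0"
  shows "r_coeff N lam (p ^ k * a) = of_real (rloc p) * r_coeff N lam a"
proof -
  have p0: "real p > 0" using p prime_gt_0_nat by simp
  let ?g = "\<lambda>b. moebius_mu b * (lam b)\<^sup>2 / (of_nat b * (sigma_m1 N b)\<^sup>2)"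
  have "(\<Sum>b | b dvd p ^ k * a. ?g b) = (1 + of_real (- (kap p 1)\<^sup>2)) * (\<Sum>b | b dvd a. ?g b)"
  proof (rule sum_divisors_prime_power_two[OF p a k])
    fix i d assume "d dvd a" "i \<ge> (2 :: nat)"
    then show "?g (p ^ i * d) = 0" using moebius_mu_prime_power_mult[OF p] by simp
  next
    fix d assume "d dvd a"
    note d = divisors_prime_power_props[OF a(2,1) this]
    show "?g (p * d) = of_real (- (kap p 1)\<^sup>2) * ?g d"
    \<comment> \<open>For squarefree \<open>d\<close> the multiplicativity of \<open>lam\<close>
      applies; otherwise the Moebius factor is zero on both sides.\<close>
    proof (cases "squarefree d")
      case True
      define s where "s = 1 + rchi p / real p"
      have s: "s > 0" using rchi_cases[of p] p0 by (auto simp: s_def add_pos_pos)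
      have "kap p 1 = rlam p / sqrt (real p) / s"
        using kap_1_eq[OF p] s unfolding s_def[symmetric] by (simp only: eq_divide_eq) simp
      then have "(kap p 1)\<^sup>2 = (rlam p)\<^sup>2 / (real p * s\<^sup>2)"
        using p0 by (simp only: power_divide) simp
      then have k2: "complex_of_real ((kap p 1)\<^sup>2) = of_real ((rlam p)\<^sup>2) / (of_nat p * of_real (s\<^sup>2))" by simp
      have "?g (p * d) = - (of_real ((rlam p)\<^sup>2) / (of_nat p * of_real (s\<^sup>2)) * ?g d)"
        unfolding moebius_mu_prime_mult[OF p d(1,2)] lam_mult[OF p d(1) True d(2)] sigma_m1_prime_mult[OF p d(1,2)] s_def[symmetric]
          lam_eq_rlam[OF p]
        by (simp add: power_mult_distrib mult_ac)
      then show ?thesis unfolding k2[symmetric] of_real_minus by (simp only: mult_minus_left)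
    next
      case False
      then have "moebius_mu d = 0" by (simp add: moebius_mu_def)
      then show ?thesis using moebius_mu_prime_mult[OF p d(1,2)] by simp
    qed
  qed
  then show ?thesis by (simp add: r_coeff_def rloc_def)
qed

lemma alpha_coeff_prime_power_mult:
  assumes p: "prime p" and a: "a > 0" "\<not> p dvd a" and k: "k > 0"
  shows "alpha_coeff N (p ^ k * a) = of_real (aloc p) * alpha_coeff N a"
proof -
  let ?g = "\<lambda>b. chi0 N b * moebius_mu b / (of_nat b)\<^sup>2"
  have "(\<Sum>b | b dvd p ^ k * a. ?g b) = (1 + of_real (- (rchi p / (real p)\<^sup>2))) * (\<Sum>b | b dvd a. ?g b)"
  proof (rule sum_divisors_prime_power_two[OF p a k])
    fix i d assume "d dvd a" "i \<ge> (2 :: nat)"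
    then show "?g (p ^ i * d) = 0" using moebius_mu_prime_power_mult[OF p] by simp
  next
    fix d assume "d dvd a"
    note d = divisors_prime_power_props[OF a(2,1) this]
    show "?g (p * d) = of_real (- (rchi p / (real p)\<^sup>2)) * ?g d"
      using moebius_mu_prime_mult[OF p d(1,2)] chi_eq_rchi[OF p]
      by (simp add: chi0_mult chi_def power_mult_distrib mult_ac)
  qed
  then show ?thesis by (simp add: alpha_coeff_def aloc_def)
qed

lemma beta_coeff_prime_mult:
  assumes p: "prime p" and a: "a > 0" "\<not> p dvd a"
  shows "beta_coeff N (p * a) = of_real (1 + rchi p / real p) * beta_coeff N a"
proof -
  let ?g = "\<lambda>b. chi0 N b * (moebius_mu b)\<^sup>2 / of_nat b"
  have "(\<Sum>b | b dvd p ^ 1 * a. ?g b) = (1 + of_real (rchi p / real p)) * (\<Sum>b | b dvd a. ?g b)"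
  proof (rule sum_divisors_prime_power_two[OF p a])
    fix i d assume "d dvd a" "i \<ge> (2 :: nat)"
    then show "?g (p ^ i * d) = 0" using moebius_mu_prime_power_mult[OF p] by simp
  next
    fix d assume "d dvd a"
    note d = divisors_prime_power_props[OF a(2,1) this]
    show "?g (p * d) = of_real (rchi p / real p) * ?g d"
      using moebius_mu_prime_mult[OF p d(1,2)] chi_eq_rchi[OF p]
      by (simp add: chi0_mult chi_def)
  qed simp
  then show ?thesis by (simp add: beta_coeff_def)
qed

lemma coeffs_1: "r_coeff N lam (Suc 0) = 1" "alpha_coeff N (Suc 0) = 1" "beta_coeff N (Suc 0) = 1" "sigma_m1 N (Suc 0) = 1"
  using lam_1 by (simp_all add: r_coeff_def alpha_coeff_def beta_coeff_def sigma_m1_def)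

text \<open>Positivity is what permits splitting the \<open>csqrt\<close> in \<open>xi1\<close> and
  \<open>xi2\<close> into local factors.\<close>

lemma r_coeff_real_pos: "a > 0 \<Longrightarrow> \<exists>x>0. r_coeff N lam a = of_real x"
proof (induction a rule: prime_power_induct)
  case one
  show ?case using coeffs_1 by (intro exI[of _ 1]) simp
next
  case (step p k a)
  then obtain x where "x > 0" "r_coeff N lam a = of_real x" by blast
  then show ?case
    using step rloc_pos[of p] r_coeff_prime_power_mult[of p a k] by (intro exI[of _ "rloc p * x"]) simp
qed

lemma alpha_coeff_real_pos: "a > 0 \<Longrightarrow> \<exists>x>0. alpha_coeff N a = of_real x"
proof (induction a rule: prime_power_induct)
  case one
  show ?case using coeffs_1 by (intro exI[of _ 1]) simp
next
  case (step p k a)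
  then obtain x where "x > 0" "alpha_coeff N a = of_real x" by blast
  then show ?case
    using step aloc_ge[of p] alpha_coeff_prime_power_mult[of p a k] by (intro exI[of _ "aloc p * x"]) simp
qed

text \<open>For \<open>i = 1\<close> the quotient is free of \<open>p\<close> and only the norm
  changes; for \<open>i = 0\<close> it gains the factor \<open>p\<close>, whose \<open>lam\<close>
  and \<open>beta_coeff\<close> combine to \<open>kap p 1\<close>.\<close>

lemma xi1_prime_mult:
  assumes p: "prime p" and s: "s > 0" "\<not> p dvd s" "squarefree s" and e: "e dvd s" and i: "i \<le> 1"
  shows "xi1 N lam (p * s) (p ^ i * e) = of_real (xloc p 1 i) * xi1 N lam s e"
proof -
  define q where "q = s div e"
  note q = divisors_prime_power_props(3,4)[OF s(2,1) e, folded q_def]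
  have sq: "squarefree q"
    using s(3) e unfolding q_def by (metis dvd_div_mult_self squarefree_multD(1))
  have p0: "real p > 0" using p prime_gt_0_nat by simp
  have dv: "(p * s) div (p ^ i * e) = p ^ (1 - i) * q"
    using prime_mult_div[OF p e s(1) i] by (simp add: q_def)
  obtain x where x: "x > 0" "r_coeff N lam s = of_real x" using r_coeff_real_pos[OF s(1)] by blast
  have r: "csqrt (r_coeff N lam (p * s)) = of_real (sqrt (rloc p)) * csqrt (r_coeff N lam s)"
    using r_coeff_prime_power_mult[OF p s(1,2), of 1] csqrt_of_real_mult[OF rloc_pos[OF p], of x] x by simp
  show ?thesis
  proof (cases "i = 1")
    case True
    have "xi1 N lam (p * s) (p ^ i * e) = moebius_mu q * lam q / (csqrt (r_coeff N lam (p * s)) * of_real (sqrt (real q)) * beta_coeff N q)"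
      unfolding xi1_def dv using True by simp
    also have "\<dots> = of_real (1 / sqrt (rloc p)) * xi1 N lam s e"
      unfolding r xi1_def q_def[symmetric] by (simp add: mult_ac)
    finally show ?thesis using True by (simp add: xloc_def)
  next
    case False
    then have i0: "i = 0" using i by simp
    define u where "u = 1 + rchi p / real p"
    have u: "u > 0" using rchi_cases[of p] p0 by (auto simp: u_def add_pos_pos)
    have k: "kap p 1 = rlam p / sqrt (real p) / u"
      using kap_1_eq[OF p] u unfolding u_def[symmetric] by (simp only: eq_divide_eq) simp
    have "xi1 N lam (p * s) (p ^ i * e) = moebius_mu (p * q) * lam (p * q) /
        (csqrt (r_coeff N lam (p * s)) * of_real (sqrt (real (p * q))) * beta_coeff N (p * q))"
      unfolding xi1_def dv using i0 by simp
    also have "\<dots> = - (of_real (rlam p / sqrt (real p) / u / sqrt (rloc p)) * xi1 N lam s e)"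
      unfolding r xi1_def q_def[symmetric] moebius_mu_prime_mult[OF p q] lam_mult[OF p q(1) sq q(2)]
        beta_coeff_prime_mult[OF p q] u_def[symmetric] lam_eq_rlam[OF p]
      by (simp add: real_sqrt_mult mult_ac)
    also have "\<dots> = of_real (xloc p 1 i) * xi1 N lam s e"
      unfolding k[symmetric] using i0 by (simp add: xloc_def del: kap.simps)
    finally show ?thesis .
  qed
qed

lemma xi2_prime_power_mult:
  assumes p: "prime p" and s: "s > 0" "\<not> p dvd s" and e: "e dvd s" and k: "k \<ge> 2" and i: "i \<le> k"
  shows "xi2 N lam (p ^ k * s) (p ^ i * e) = of_real (xloc p k i) * xi2 N lam s e"
proof -
  define q where "q = s div e"
  note q = divisors_prime_power_props(3,4)[OF s(2,1) e, folded q_def]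
  have p0: "real p > 0" using p prime_gt_0_nat by simp
  have k0: "k > 0" using k by simp
  have dv: "(p ^ k * s) div (p ^ i * e) = p ^ (k - i) * q"
    using prime_mult_div[OF p e s(1) i] by (simp add: q_def)
  obtain x where x: "x > 0" "r_coeff N lam s = of_real x" using r_coeff_real_pos[OF s(1)] by blast
  obtain y where y: "y > 0" "alpha_coeff N s = of_real y" using alpha_coeff_real_pos[OF s(1)] by blast
  define R where "R = sqrt (rloc p * aloc p)"
  have ra: "rloc p * aloc p > 0" using rloc_pos[OF p] aloc_ge[OF p] by simp
  have r: "csqrt (r_coeff N lam (p ^ k * s) * alpha_coeff N (p ^ k * s)) = of_real R * csqrt (r_coeff N lam s * alpha_coeff N s)"
    using r_coeff_prime_power_mult[OF p s k0] alpha_coeff_prime_power_mult[OF p s k0]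
      csqrt_of_real_mult[OF ra, of "x * y"] x y by (simp add: R_def mult_ac)
  define m where "m = k - i"
  define c where "c = (if m = 0 then 1 else if m = 1 then - lam p else if m = 2 then chi0 N p else 0)"
  have "xi2 N lam (p ^ k * s) (p ^ i * e) = c * mu_coeff N lam q /
      (of_real (sqrt (real (p ^ m * q))) * (of_real R * csqrt (r_coeff N lam s * alpha_coeff N s)))"
    unfolding xi2_def dv r m_def[symmetric] mu_coeff_prime_power_mult[OF p q] c_def ..
  also have "\<dots> = c / (of_real (sqrt (real (p ^ m))) * of_real R) * xi2 N lam s e"
    unfolding xi2_def q_def[symmetric] by (simp add: real_sqrt_mult mult_ac)
  also have "c / (of_real (sqrt (real (p ^ m))) * of_real R) = of_real (xloc p k i)"
  proof -
    have xl: "xloc p k i = (if i = k then 1 else if i + 1 = k then - rlam p / sqrt (real p)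
            else if i + 2 = k then rchi p / real p else 0) / R"
      using k by (simp add: xloc_def R_def)
    consider "m = 0" | "m = 1" | "m = 2" | "m > 2" by linarith
    then show ?thesis
    proof cases
      case 1
      then have "i = k" using i by (simp add: m_def)
      then show ?thesis using 1 unfolding xl c_def by simp
    next
      case 2
      then have "i + 1 = k" "i \<noteq> k" using i by (auto simp: m_def)
      then show ?thesis using 2 lam_eq_rlam[OF p] unfolding xl c_def by simp
    next
      case 3
      then have "i + 2 = k" "i \<noteq> k" "i + 1 \<noteq> k" using i by (auto simp: m_def)
      moreover have "sqrt (real (p ^ 2)) = real p" by simp
      ultimately show ?thesis using 3 chi_eq_rchi[OF p] unfolding xl c_def chi_def by simp
    next
      case 4
      then have "i + 2 \<noteq> k" "i \<noteq> k" "i + 1 \<noteq> k" using i by (auto simp: m_def)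
      then show ?thesis using 4 unfolding xl c_def by simp
    qed
  qed
  finally show ?thesis .
qed

lemma xi_1: "xi N lam (Suc 0) (Suc 0) = 1"
  using lam_1 by (simp add: xi_def xi1_def xi2_def coeffs_1)

text \<open>The exponent decides which half of \<open>xi\<close> sees \<open>p\<close>: the
  squarefree factor for \<open>k = 1\<close>, the squarefull factor for \<open>k \<ge> 2\<close>.
  The gcd in the other half is unaffected by \<open>p ^ i\<close>.\<close>

lemma xi_prime_power_mult:
  assumes p: "prime p" and a: "a > 0" "\<not> p dvd a" and d: "d dvd a" and i: "i \<le> k"
  shows "xi N lam (p ^ k * a) (p ^ i * d) = of_real (xloc p k i) * xi N lam a d"
proof (cases "k = 0")
  case True
  then show ?thesis using i by (simp add: xloc_def)
next
  case False
  then have k: "k > 0" by simp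
  define s t where "s = squarefree_factor a" and "t = squarefull_factor a"
  note st = squarefree_factor_props[OF a(1), folded s_def t_def]
  have ps: "\<not> p dvd s" and pt: "\<not> p dvd t" using st a by (meson dvd_trans)+
  have pd: "\<not> p dvd d" using d a by (meson dvd_trans)
  have gs: "gcd s (p ^ i * d) = gcd s d" "gcd t (p ^ i * d) = gcd t d"
    using gcd_prime_power_mult_right[OF p ps] gcd_prime_power_mult_right[OF p pt] by auto
  show ?thesis
  proof (cases "k = 1")
    case True
    have "gcd (p * s) (p ^ i * d) = p ^ i * gcd s d"
      using gcd_prime_power_mult[OF p pd i, of s] True by simp
    then have "xi N lam (p ^ k * a) (p ^ i * d) = xi1 N lam (p * s) (p ^ i * gcd s d) * xi2 N lam t (gcd t d)"
      using True squarefree_factor_prime_power_mult[OF p a k] squarefull_factor_prime_power_mult[OF p a k] gs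
      by (simp add: xi_def s_def t_def)
    also have "xi1 N lam (p * s) (p ^ i * gcd s d) = of_real (xloc p 1 i) * xi1 N lam s (gcd s d)"
      using i True by (intro xi1_prime_mult[OF p st(4) ps st(3)]) auto
    finally show ?thesis using True by (simp add: xi_def s_def t_def)
  next
    case False
    then have k2: "k \<ge> 2" using k by simp
    have "gcd (p ^ k * t) (p ^ i * d) = p ^ i * gcd t d"
      by (rule gcd_prime_power_mult[OF p pd i])
    then have "xi N lam (p ^ k * a) (p ^ i * d) = xi1 N lam s (gcd s d) * xi2 N lam (p ^ k * t) (p ^ i * gcd t d)"
      using False squarefree_factor_prime_power_mult[OF p a k] squarefull_factor_prime_power_mult[OF p a k] gs
      by (simp add: xi_def s_def t_def)
    also have "xi2 N lam (p ^ k * t) (p ^ i * gcd t d) = of_real (xloc p k i) * xi2 N lam t (gcd t d)"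
      by (intro xi2_prime_power_mult[OF p st(5) pt _ k2 i]) auto
    finally show ?thesis by (simp add: xi_def s_def t_def)
  qed
qed

section \<open>Orthonormality\<close>

abbreviation "bform \<equiv> maass_basis_form N f"

lemma bform_aut: "g > 0 \<Longrightarrow> aut (bform g)"
  unfolding maass_basis_form_def by (intro aut_sum aut_scale dilate_aut) (auto intro: gr0I)

lemma ip_bform:
  assumes "g > 0" "h > 0"
  shows "ip (bform g) (bform h) =
    (\<Sum>d | d dvd g. \<Sum>e | e dvd h. xi N lam g d * cnj (xi N lam h e) * gram d e)"
proof -
  have a: "aut (dilate d f)" if "d dvd g" for d using that assms by (intro dilate_aut) (auto intro: gr0I)
  have b: "aut (dilate d f)" if "d dvd h" for d using that assms by (intro dilate_aut) (auto intro: gr0I)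
  have "ip (bform g) (bform h) = (\<Sum>d | d dvd g. xi N lam g d * ip (dilate d f) (bform h))"
    unfolding maass_basis_form_def[of N f g] using a bform_aut[OF assms(2)] by (intro ip_sum_left) auto
  also have "\<dots> = (\<Sum>d | d dvd g. xi N lam g d * (\<Sum>e | e dvd h. cnj (xi N lam h e) * ip (dilate d f) (dilate e f)))"
  proof (rule sum.cong[OF refl])
    fix d assume "d \<in> {d. d dvd g}"
    then have "aut (dilate d f)" using a by simp
    then have "ip (dilate d f) (bform h) = (\<Sum>e | e dvd h. cnj (xi N lam h e) * ip (dilate d f) (dilate e f))"
      unfolding maass_basis_form_def using b by (intro ip_sum_right) auto
    then show "xi N lam g d * ip (dilate d f) (bform h) = xi N lam g d * (\<Sum>e | e dvd h. cnj (xi N lam h e) * ip (dilate d f) (dilate e f))"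
      by simp
  qed
  also have "\<dots> = (\<Sum>d | d dvd g. \<Sum>e | e dvd h. xi N lam g d * cnj (xi N lam h e) * gram d e)"
    by (simp add: sum_distrib_left gram_def mult.assoc)
  finally show ?thesis .
qed

text \<open>Coefficients and Gram matrix both factor at \<open>p\<close>, so the fourfold sum is the
  local sum of \<open>sum_xloc_orthonormal\<close> times the inner product of the parts prime to
  \<open>p\<close>.\<close>

lemma ip_bform_prime_power:
  assumes p: "prime p" and a: "a > 0" "\<not> p dvd a" and b: "b > 0" "\<not> p dvd b"
  shows "ip (bform (p ^ k * a)) (bform (p ^ m * b)) = (if k = m then ip (bform a) (bform b) else 0)"
proof -
  have p0: "p > 0" using p prime_gt_0_nat by blast
  let ?x = "xi N lam"
  let ?F = "\<lambda>d e. ?x (p ^ k * a) d * cnj (?x (p ^ m * b) e) * gram d e"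
  have F: "?F (p ^ i * d) (p ^ j * e) = of_real (xloc p k i * xloc p m j * kapd p i j) * (?x a d * cnj (?x b e) * gram d e)"
    if "i \<le> k" "j \<le> m" "d dvd a" "e dvd b" for i j d e
    unfolding xi_prime_power_mult[OF p a that(3,1)] xi_prime_power_mult[OF p b that(4,2)]
      gram_prime_powers[OF p divisors_prime_power_props(1,2)[OF a(2,1) that(3)] divisors_prime_power_props(1,2)[OF b(2,1) that(4)]]
    by simp
  have "ip (bform (p ^ k * a)) (bform (p ^ m * b)) = (\<Sum>d | d dvd p ^ k * a. \<Sum>e | e dvd p ^ m * b. ?F d e)"
    using p0 a b by (intro ip_bform) auto
  also have "\<dots> = (\<Sum>d | d dvd p ^ k * a. \<Sum>j\<le>m. \<Sum>e | e dvd b. ?F d (p ^ j * e))"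
    by (intro sum.cong refl sum_divisors_prime_power[OF p b])
  also have "\<dots> = (\<Sum>i\<le>k. \<Sum>d | d dvd a. \<Sum>j\<le>m. \<Sum>e | e dvd b. ?F (p ^ i * d) (p ^ j * e))"
    by (rule sum_divisors_prime_power[OF p a])
  also have "\<dots> = (\<Sum>i\<le>k. \<Sum>d | d dvd a. \<Sum>j\<le>m. \<Sum>e | e dvd b.
      of_real (xloc p k i * xloc p m j * kapd p i j) * (?x a d * cnj (?x b e) * gram d e))"
    by (intro sum.cong refl F) auto
  also have "\<dots> = (\<Sum>i\<le>k. \<Sum>j\<le>m. \<Sum>d | d dvd a. \<Sum>e | e dvd b.
      of_real (xloc p k i * xloc p m j * kapd p i j) * (?x a d * cnj (?x b e) * gram d e))"
    by (intro sum.cong[OF refl] sum.swap)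
  also have "\<dots> = (\<Sum>i\<le>k. \<Sum>j\<le>m. of_real (xloc p k i * xloc p m j * kapd p i j) * ip (bform a) (bform b))"
    unfolding ip_bform[OF a(1) b(1)] by (simp only: sum_distrib_left)
  also have "\<dots> = (\<Sum>i\<le>k. \<Sum>j\<le>m. of_real (xloc p k i * xloc p m j * kapd p i j)) * ip (bform a) (bform b)"
    by (simp only: sum_distrib_right)
  also have "(\<Sum>i\<le>k. \<Sum>j\<le>m. complex_of_real (xloc p k i * xloc p m j * kapd p i j)) = of_real (if k = m then 1 else 0)"
    unfolding sum_xloc_orthonormal[OF p, symmetric] of_real_sum ..
  finally show ?thesis by simp
qed

text \<open>The induction runs over \<open>g + h\<close> because the prime that is removed need only
  divide one of them; in that case the exponents differ and both sides vanish.\<close>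

lemma ip_bform_eq:
  assumes "g > 0" "h > 0"
  shows "ip (bform g) (bform h) = (if g = h then gram 1 1 else 0)"
  using assms
proof (induction "g + h" arbitrary: g h rule: less_induct)
  case less
  show ?case
  proof (cases "g = 1 \<and> h = 1")
    case True
    have "{d. d dvd Suc 0} = {Suc 0}" by auto
    then have "ip (bform 1) (bform 1) = gram 1 1"
      using ip_bform[of 1 1] by (simp add: xi_1)
    then show ?thesis using True by simp
  next
    case False
    then have "g * h \<noteq> 1" by simp
    then obtain p where p: "prime p" "p dvd g * h" using prime_factor_nat by blast
    obtain k a where a: "g = p ^ k * a" "\<not> p dvd a" "a > 0" using prime_power_decomp[OF p(1) less.prems(1)] by blast
    obtain m b where b: "h = p ^ m * b" "\<not> p dvd b" "b > 0" using prime_power_decomp[OF p(1) less.prems(2)] by blast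
    have p1: "p > 1" using p prime_gt_1_nat by blast
    have "k > 0 \<or> m > 0"
      using p a b by (cases k; cases m) (auto simp: prime_dvd_mult_iff)
    moreover have "p ^ k \<ge> 1" "p ^ m \<ge> 1" "k > 0 \<Longrightarrow> p ^ k > 1" "m > 0 \<Longrightarrow> p ^ m > 1"
      using p1 one_less_power[of p] by auto
    moreover have "x \<ge> 1 \<Longrightarrow> a \<le> x * a" "x > 1 \<Longrightarrow> a < x * a" "x \<ge> 1 \<Longrightarrow> b \<le> x * b" "x > 1 \<Longrightarrow> b < x * b" for x
      using a(3) b(3) by auto
    ultimately have "a + b < g + h" unfolding a(1) b(1) by (metis add_le_less_mono add_less_le_mono)
    from less.hyps[OF this a(3) b(3)] have IH: "ip (bform a) (bform b) = (if a = b then gram 1 1 else 0)" .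
    have "g = h \<longleftrightarrow> k = m \<and> a = b"
      using prime_power_mult_inj[OF p(1) a(2) b(2) _ a(3) b(3), of k m] unfolding a(1) b(1) by auto
    then show ?thesis
      using ip_bform_prime_power[OF p(1) a(3,2) b(3,2), of k m] IH unfolding a(1) b(1) by auto
  qed
qed

lemma xi_self_nonzero: "g > 0 \<Longrightarrow> xi N lam g g \<noteq> 0"
proof (induction g rule: prime_power_induct)
  case one
  show ?case by (simp add: xi_1)
next
  case (step p k a)
  have "xloc p k k \<noteq> 0" using sum_xloc(2)[OF step(1), of k] by auto
  then show ?case using xi_prime_power_mult[OF step(1,3,4) dvd_refl order_refl] step by simp
qed

lemma bform_invariant:
  assumes "N dvd l" "l > 0" "g dvd l div N"
  shows "invariant_under (Gamma0 l) (bform g)"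
proof -
  have "invariant_under (Gamma0 l) (dilate d f)" if d: "d dvd g" for d
  proof (rule dilate_invariant)
    have "d dvd l div N" using d assms by (meson dvd_trans)
    moreover have "l div N > 0" using assms N by (auto elim!: dvdE)
    ultimately show "d > 0" by (auto intro: gr0I)
    show "N * d dvd l" using \<open>d dvd l div N\<close> assms(1) N by (metis dvd_mult_div_cancel mult_dvd_mono dvd_refl)
  qed
  then show ?thesis unfolding maass_basis_form_def invariant_under_def by (auto intro!: sum.cong)
qed

theorem basis_forms_orthonormal:
  assumes l: "l > 0" "N dvd l" and norm: "petersson l f f = 1"
  shows "\<exists>V. is_direct_sum_of_lines {d. d dvd l div N} (\<lambda>d. dilate d f) V \<and>
    is_orthonormal_basis (petersson l) {g. g dvd l div N} bform V"
proof -
  define L where "L = l div N"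
  have L: "L > 0" using l N by (auto simp: L_def elim!: dvdE)
  define D where "D = {d. d dvd L}"
  have finD: "finite D" using L by (simp add: D_def)
  have pos: "d > 0" if "d \<in> D" for d using that L by (auto simp: D_def intro: gr0I)
  have d1: "dilate 1 f = f" by (simp add: fun_eq_iff dilate_def)
  have b1: "invariant_under (Gamma0 l) f"
    using dilate_invariant[of 1 l] l d1 by simp
  have "of_real (covolume l) * gram 1 1 = 1"
    using petersson_eq_ip[OF l(1) f_aut f_aut b1 b1] norm unfolding gram_def d1 by simp
  then have on: "petersson l (bform g) (bform h) = (if g = h then 1 else 0)" if "g \<in> D" "h \<in> D" for g h
    using petersson_eq_ip[OF l(1) bform_aut[OF pos[OF that(1)]] bform_aut[OF pos[OF that(2)]]]
      bform_invariant[OF l(2,1)] that ip_bform_eq[OF pos[OF that(1)] pos[OF that(2)]]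
    by (simp add: D_def L_def)
  define V where "V = cfun.span ((\<lambda>d. dilate d f) ` D)"
  have in_span: "bform g \<in> V" if "g \<in> D" for g
  proof -
    have "bform g = (\<Sum>d | d dvd g. (\<lambda>z. xi N lam g d * dilate d f z))"
      by (simp add: maass_basis_form_def fun_eq_iff sum_fun_apply)
    also have "\<dots> \<in> V" unfolding V_def
      using that by (intro cfun.span_sum cfun.span_scale cfun.span_base) (auto simp: D_def intro: dvd_trans)
    finally show ?thesis .
  qed
  \<comment> \<open>Triangularity: \<open>bform g\<close> involves \<open>dilate g f\<close> with
    the nonzero coefficient \<open>xi N lam g g\<close>, and otherwise only dilates by smaller
    divisors.\<close>
  have dil: "dilate g f \<in> cfun.span (bform ` D)" if "g \<in> D" for g
    using that
  proof (induction g rule: less_induct)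
    case (less g)
    have g0: "g > 0" using pos less.prems by blast
    have fin: "finite {d. d dvd g}" using g0 by simp
    have "bform g = (\<lambda>z. xi N lam g g * dilate g f z + (\<Sum>d\<in>{d. d dvd g} - {g}. xi N lam g d * dilate d f z))"
      using fin by (simp add: maass_basis_form_def sum.remove[of _ g])
    then have "dilate g f = (\<lambda>z. (1 / xi N lam g g) * (bform g z - (\<Sum>d\<in>{d. d dvd g} - {g}. xi N lam g d * dilate d f z)))"
      using xi_self_nonzero[OF g0] by (simp add: fun_eq_iff)
    also have "\<dots> = (\<lambda>z. (1 / xi N lam g g) * ((bform g - (\<Sum>d\<in>{d. d dvd g} - {g}. (\<lambda>z. xi N lam g d * dilate d f z))) z))"
      by (simp add: fun_eq_iff sum_fun_apply)
    also have "\<dots> \<in> cfun.span (bform ` D)"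
    proof (intro cfun.span_scale cfun.span_diff cfun.span_sum)
      show "bform g \<in> cfun.span (bform ` D)" using less.prems by (intro cfun.span_base) auto
      fix d assume d: "d \<in> {d. d dvd g} - {g}"
      then have "d < g" using g0 by (auto simp: dvd_imp_le le_neq_implies_less)
      moreover have "d \<in> D" using d less.prems by (auto simp: D_def intro: dvd_trans)
      ultimately show "dilate d f \<in> cfun.span (bform ` D)" by (rule less.IH)
    qed
    finally show ?case .
  qed
  have spans: "cfun.span (bform ` D) = V"
  proof
    show "cfun.span (bform ` D) \<subseteq> V"
      unfolding V_def by (rule cfun.span_minimal) (use in_span in \<open>auto simp: V_def\<close>)
    show "V \<subseteq> cfun.span (bform ` D)"
      unfolding V_def by (rule cfun.span_minimal) (use dil in auto)
  qed
  have injb: "inj_on bform D"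
    by (rule inj_onI) (metis on zero_neq_one)
  have indb: "cfun.independent (bform ` D)"
  proof (rule cfun.independent_if_scalars_zero)
    show "finite (bform ` D)" using finD by simp
    fix u x assume s: "(\<Sum>x\<in>bform ` D. (\<lambda>z. u x * x z)) = 0" and "x \<in> bform ` D"
    then obtain h where h: "h \<in> D" "x = bform h" by blast
    have z: "(\<lambda>z. \<Sum>g\<in>D. u (bform g) * bform g z) = (\<lambda>z. 0)"
      using s unfolding sum.reindex[OF injb] o_def by (simp add: fun_eq_iff sum_fun_apply)
    have "0 = ip (\<lambda>z. 0) (bform h)" by (simp add: ip_zero_left)
    also have "\<dots> = (\<Sum>g\<in>D. u (bform g) * ip (bform g) (bform h))"
      unfolding z[symmetric] using pos bform_aut h by (intro ip_sum_left) auto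
    also have "\<dots> = (\<Sum>g\<in>D. if g = h then u (bform h) * gram 1 1 else 0)"
      using ip_bform_eq[OF pos pos[OF h(1)]] by (intro sum.cong) auto
    also have "\<dots> = u (bform h) * gram 1 1" using finD h by simp
    finally show "u x = 0" using h gram_1_1(2) by auto
  qed
  \<comment> \<open>The orthogonal family gives \<open>card D\<close> independent elements in the
    span of the dilates. So the dilates, at most that many, must be pairwise distinct.\<close>
  have le: "card D \<le> card ((\<lambda>d. dilate d f) ` D)"
  proof -
    have "card (bform ` D) = cfun.dim V" 
      by (rule cfun.dim_eq_card[symmetric, OF _ indb]) (simp add: spans[symmetric] cfun.span_span)
    also have "\<dots> \<le> card ((\<lambda>d. dilate d f) ` D)"
      by (rule cfun.dim_le_card) (use finD in \<open>auto simp: V_def\<close>)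
    finally show ?thesis using card_image[OF injb] by simp
  qed
  then have injd: "inj_on (\<lambda>d. dilate d f) D"
    using finD by (intro eq_card_imp_inj_on) (auto intro: antisym card_image_le)
  have "cfun.dim V = card D"
    using cfun.dim_eq_card[OF _ indb, of V] card_image[OF injb] by (simp add: spans[symmetric] cfun.span_span)
  \<comment> \<open>A basis picked among the dilates has \<open>card D\<close> elements as well,
    hence contains all of them, and they are independent.\<close>
  moreover obtain B where B: "B \<subseteq> (\<lambda>d. dilate d f) ` D" "cfun.independent B" "(\<lambda>d. dilate d f) ` D \<subseteq> cfun.span B"
    using cfun.maximal_independent_subset by blast
  have sB: "cfun.span B = V"
    unfolding V_def using B(1,3) by (intro subset_antisym cfun.span_mono cfun.span_minimal) auto
  then have "cfun.dim V = card B"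
    by (intro cfun.dim_eq_card[OF _ B(2)]) (simp add: V_def cfun.span_span)
  ultimately have "B = (\<lambda>d. dilate d f) ` D"
    using card_image[OF injd] finD by (intro card_subset_eq[OF _ B(1)]) auto
  then have indd: "cfun.independent ((\<lambda>d. dilate d f) ` D)" using B(2) by simp
  show ?thesis
    unfolding is_direct_sum_of_lines_def is_orthonormal_basis_def L_def[symmetric] D_def[symmetric]
    using injd indd spans on by (intro exI[of _ V]) (auto simp: V_def)
qed

end

section \<open>Fourier coefficients\<close>

lemma cis_eq_1_iff: "cis (2 * pi * x) = 1 \<longleftrightarrow> x \<in> \<int>"
proof
  assume "cis (2 * pi * x) = 1"
  then have "cos (2 * pi * x) = 1" by (simp add: complex_eq_iff)
  then obtain n :: int where "2 * pi * x = real_of_int n * 2 * pi" unfolding cos_one_2pi_int by blast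
  then have "x = real_of_int n" by simp
  then show "x \<in> \<int>" by simp
next
  assume "x \<in> \<int>"
  then show "cis (2 * pi * x) = 1" by (rule cis_multiple_2pi)
qed

lemma sum_roots_of_unity:
  assumes Q: "Q > 0"
  shows "(\<Sum>j<Q. cis (2 * pi * real_of_int k * (real j / real Q))) = (if int Q dvd k then of_nat Q else 0)"
proof -
  define x where "x = cis (2 * pi * (real_of_int k / real Q))"
  have pow: "cis (2 * pi * real_of_int k * (real j / real Q)) = x ^ j" for j
    unfolding x_def by (subst Complex.DeMoivre) (rule arg_cong[where f = cis], simp)
  have iff: "x = 1 \<longleftrightarrow> int Q dvd k"
  proof -
    have "x = 1 \<longleftrightarrow> real_of_int k / real Q \<in> \<int>" unfolding x_def by (rule cis_eq_1_iff)
    also have "\<dots> \<longleftrightarrow> int Q dvd k"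
    proof
      assume "real_of_int k / real Q \<in> \<int>"
      then obtain m where "real_of_int k / real Q = real_of_int m" by (auto elim: Ints_cases)
      then have "real_of_int k = real_of_int (int Q * m)" using Q by (simp add: field_simps)
      then have "k = int Q * m" by (simp only: of_int_eq_iff)
      then show "int Q dvd k" by simp
    next
      assume "int Q dvd k"
      then obtain m where "k = int Q * m" by (auto elim: dvdE)
      then show "real_of_int k / real Q \<in> \<int>" using Q by simp
    qed
    finally show ?thesis .
  qed
  have xQ: "x ^ Q = 1"
  proof -
    have "x ^ Q = cis (2 * pi * real_of_int k)" unfolding pow[symmetric] using Q by simp
    then show ?thesis by (simp add: cis_eq_1_iff)
  qed
  show ?thesis
  proof (cases "x = 1")
    case True
    then show ?thesis unfolding pow using iff by simp
  next
    case False
    then have "(\<Sum>j<Q. x ^ j) = 0" using xQ by (simp add: sum_gp_strict)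
    then show ?thesis unfolding pow using iff False by simp
  qed
qed

lemma has_sum_sum_finite:
  fixes F :: "'i \<Rightarrow> 'a \<Rightarrow> complex"
  assumes "finite I" "\<And>i. i \<in> I \<Longrightarrow> (F i has_sum s i) A"
  shows "((\<lambda>x. \<Sum>i\<in>I. F i x) has_sum (\<Sum>i\<in>I. s i)) A"
  using assms by (induction I rule: finite_induct) (auto intro: has_sum_add)

text \<open>Averaging over the shifts by \<open>j / Q\<close> leaves only the frequencies congruent to \<open>m\<close> modulo \<open>Q\<close>.\<close>

lemma fourier_series_unique_0:
  fixes c :: "int \<Rightarrow> complex"
  assumes sum: "\<And>x. ((\<lambda>n. c n * cis (2 * pi * real_of_int n * x)) has_sum 0) S" and m: "m \<in> S"
  shows "c m = 0"
proof -
  have part: "((\<lambda>n. if int Q dvd n - m then c n else 0) has_sum 0) S" if Q: "Q > 0" for Q :: nat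
  proof -
    have "((\<lambda>n. \<Sum>j<Q. cis (- 2 * pi * real_of_int m * (real j / real Q)) * (c n * cis (2 * pi * real_of_int n * (real j / real Q))))
        has_sum (\<Sum>j<Q. cis (- 2 * pi * real_of_int m * (real j / real Q)) * 0)) S"
      by (intro has_sum_sum_finite has_sum_cmult_right sum) auto
    then have "((\<lambda>n. (1 / of_nat Q) * (\<Sum>j<Q. cis (- 2 * pi * real_of_int m * (real j / real Q)) * (c n * cis (2 * pi * real_of_int n * (real j / real Q)))))
        has_sum (1 / of_nat Q) * 0) S"
      by (intro has_sum_cmult_right) simp
    moreover have "(1 / of_nat Q) * (\<Sum>j<Q. cis (- 2 * pi * real_of_int m * (real j / real Q)) * (c n * cis (2 * pi * real_of_int n * (real j / real Q))))
        = (if int Q dvd n - m then c n else 0)" for n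
    proof -
      have "(\<Sum>j<Q. cis (- 2 * pi * real_of_int m * (real j / real Q)) * (c n * cis (2 * pi * real_of_int n * (real j / real Q))))
          = c n * (\<Sum>j<Q. cis (2 * pi * real_of_int (n - m) * (real j / real Q)))"
        unfolding sum_distrib_left
      proof (rule sum.cong[OF refl])
        fix j
        have "cis (- 2 * pi * real_of_int m * (real j / real Q)) * cis (2 * pi * real_of_int n * (real j / real Q))
            = cis (2 * pi * real_of_int (n - m) * (real j / real Q))"
          unfolding cis_mult
          by (rule arg_cong[where f = cis]) (simp add: left_diff_distrib right_diff_distrib diff_divide_distrib)
        then show "cis (- 2 * pi * real_of_int m * (real j / real Q)) * (c n * cis (2 * pi * real_of_int n * (real j / real Q)))
            = c n * cis (2 * pi * real_of_int (n - m) * (real j / real Q))"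
          by (simp only: mult.left_commute)
      qed
      then show ?thesis unfolding sum_roots_of_unity[OF Q] using Q by simp
    qed
    ultimately show ?thesis by simp
  qed
  have "(c has_sum 0) S" using sum[of 0] by simp
  then have "c summable_on S" by (rule has_sum_imp_summable)
  then have abs: "(\<lambda>n. norm (c n)) summable_on S" using summable_on_iff_abs_summable_on_complex by blast
  define T where "T = infsum (\<lambda>n. norm (c n)) S"
  have hT: "((\<lambda>n. norm (c n)) has_sum T) S" unfolding T_def using abs by (rule has_sum_infsum)
  have "norm (c m) \<le> \<epsilon>" if e: "\<epsilon> > 0" for \<epsilon>
  proof -
    obtain F where F: "finite F" "F \<subseteq> S" "dist (sum (\<lambda>n. norm (c n)) F) T \<le> \<epsilon>"
      using has_sum_finite_approximation[OF hT e] by blast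
    define G where "G = insert m F"
    have G: "finite G" "G \<subseteq> S" using F m by (auto simp: G_def)
    have "sum (\<lambda>n. norm (c n)) F \<le> sum (\<lambda>n. norm (c n)) G"
      using F by (intro sum_mono2) (auto simp: G_def)
    then have tail: "T - sum (\<lambda>n. norm (c n)) G \<le> \<epsilon>" using F(3) by (simp add: dist_real_def)
    have hG: "((\<lambda>n. norm (c n)) has_sum (T - sum (\<lambda>n. norm (c n)) G)) (S - G)"
      by (rule has_sum_Diff[OF hT has_sum_finite[OF G(1)] G(2)])
    \<comment> \<open>\<open>Q\<close> exceeds every distance from \<open>m\<close> inside
      \<open>G\<close>, so that only \<open>n = m\<close> survives the averaging there; the
      contribution from outside \<open>G\<close> is at most \<epsilon>.\<close>
    define Q where "Q = nat (Max ((\<lambda>n. \<bar>n - m\<bar>) ` G)) + 1"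
    have Qb: "\<bar>n - m\<bar> < int Q" if "n \<in> G" for n
    proof -
      have "\<bar>n - m\<bar> \<le> Max ((\<lambda>n. \<bar>n - m\<bar>) ` G)" using that G(1) by (intro Max_ge) auto
      then show ?thesis using abs_ge_zero[of "n - m"] unfolding Q_def by linarith
    qed
    define d where "d = (\<lambda>n. if int Q dvd n - m then c n else 0)"
    have dG: "d n = (if n = m then c m else 0)" if "n \<in> G" for n
      using Qb[OF that] zdvd_imp_le[of "int Q" "\<bar>n - m\<bar>"] by (auto simp: d_def)
    have "(d has_sum 0) S" unfolding d_def by (rule part) (simp add: Q_def)
    moreover have "(d has_sum c m) G"
    proof -
      have "sum d G = (\<Sum>n\<in>G. if n = m then c m else 0)" by (rule sum.cong[OF refl dG])
      then have "sum d G = c m" using G(1) by (simp add: G_def)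
      then show ?thesis using has_sum_finite[OF G(1), of d] by simp
    qed
    ultimately have "(d has_sum (0 - c m)) (S - G)" using G(2) by (rule has_sum_Diff)
    then have dsum: "d summable_on (S - G)" "infsum d (S - G) = - c m"
      by (auto dest: has_sum_imp_summable infsumI)
    have dabs: "(\<lambda>n. norm (d n)) summable_on (S - G)"
      using dsum(1) summable_on_iff_abs_summable_on_complex by blast
    have "norm (c m) = norm (infsum d (S - G))" using dsum by simp
    also have "\<dots> \<le> infsum (\<lambda>n. norm (d n)) (S - G)" by (rule norm_infsum_bound[OF dabs])
    also have "\<dots> \<le> T - sum (\<lambda>n. norm (c n)) G"
      by (rule has_sum_mono[OF has_sum_infsum[OF dabs] hG]) (simp add: d_def)
    finally show ?thesis using tail by simp
  qed
  then have "norm (c m) \<le> 0" by (metis dense_ge)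
  then show ?thesis by simp
qed

lemma fourier_coeffs_unique:
  assumes A: "is_fourier_coeffs t F A" and B: "is_fourier_coeffs t F B"
    and W: "y > 0" "whittaker_W t y \<noteq> 0" and m: "m \<noteq> 0"
  shows "A m = B m"
proof -
  \<comment> \<open>At this height the Whittaker factor of the frequency \<open>m\<close> takes the
    nonzero value \<open>whittaker_W t y\<close>.\<close>
  define v where "v = y / (4 * pi * \<bar>real_of_int m\<bar>)"
  have v: "v > 0" "4 * pi * \<bar>real_of_int m\<bar> * v = y" using W m by (simp_all add: v_def)
  let ?c = "\<lambda>n. (A n - B n) * whittaker_W t (4 * pi * \<bar>real_of_int n\<bar> * v)"
  have "((\<lambda>n. ?c n * cis (2 * pi * real_of_int n * x)) has_sum 0) (UNIV - {0})" for x
  proof -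
    have u: "Complex x v \<in> uhp" using v by (simp add: uhp_def)
    have "((\<lambda>n. A n * whittaker_W t (4 * pi * \<bar>real_of_int n\<bar> * v) * cis (2 * pi * real_of_int n * x)
        + - (B n * whittaker_W t (4 * pi * \<bar>real_of_int n\<bar> * v) * cis (2 * pi * real_of_int n * x))) has_sum F (Complex x v) + - F (Complex x v)) (UNIV - {0})"
      using A[unfolded is_fourier_coeffs_def, THEN bspec, OF u] B[unfolded is_fourier_coeffs_def, THEN bspec, OF u]
      by (intro has_sum_add has_sum_uminusI) simp_all
    then show ?thesis by (simp add: left_diff_distrib)
  qed
  then have "?c m = 0" by (rule fourier_series_unique_0) (use m in simp)
  then show ?thesis using W v by simp
qed

lemma fourier_coeffs_scale: "is_fourier_coeffs t F A \<Longrightarrow> is_fourier_coeffs t (\<lambda>z. c * F z) (\<lambda>n. c * A n)"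
  unfolding is_fourier_coeffs_def using has_sum_cmult_right[of _ _ _ c] by (fastforce simp: mult.assoc)

lemma fourier_coeffs_sum:
  assumes "finite I" "\<And>i. i \<in> I \<Longrightarrow> is_fourier_coeffs t (F i) (A i)"
  shows "is_fourier_coeffs t (\<lambda>z. \<Sum>i\<in>I. F i z) (\<lambda>n. \<Sum>i\<in>I. A i n)"
  unfolding is_fourier_coeffs_def sum_distrib_right
  using assms by (intro ballI has_sum_sum_finite) (auto simp: is_fourier_coeffs_def)

text \<open>Coefficients of the sum of \<open>F((a z + b) / d)\<close> over \<open>b < d\<close>:
  the sum over \<open>b\<close> keeps the frequencies \<open>d * k\<close> of \<open>F\<close> with
  a factor \<open>d\<close>, and these reappear as frequencies \<open>a * k\<close>.\<close>

definition hecke_coeff :: "nat \<Rightarrow> nat \<Rightarrow> (int \<Rightarrow> complex) \<Rightarrow> int \<Rightarrow> complex" where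
  "hecke_coeff a d \<rho> m = (if int a dvd m then of_nat d * \<rho> (int d * (m div int a)) else 0)"

lemma fourier_coeffs_hecke:
  assumes F: "is_fourier_coeffs t F \<rho>" and ad: "a > 0" "d > 0"
  shows "is_fourier_coeffs t (\<lambda>z. \<Sum>b<d. F ((of_nat a * z + of_nat b) / of_nat d)) (hecke_coeff a d \<rho>)"
  unfolding is_fourier_coeffs_def
proof
  fix z assume z: "z \<in> uhp"
  define x y where "x = Re z" and "y = Im z"
  have y: "y > 0" using z by (simp add: uhp_def y_def)
  let ?S = "UNIV - {0 :: int}"
  let ?w = "\<lambda>n. whittaker_W t (4 * pi * \<bar>real_of_int n\<bar> * (real a * y / real d))"
  have im: "Im ((of_nat a * z + of_nat b) / of_nat d) = real a * y / real d"
    and re: "Re ((of_nat a * z + of_nat b) / of_nat d) = (real a * x + real b) / real d" for b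
  proof -
    have e: "(of_nat a * z + of_nat b) / of_nat d = (of_nat a * z + of_nat b) / complex_of_real (real d)" by simp
    show "Im ((of_nat a * z + of_nat b) / of_nat d) = real a * y / real d"
      unfolding e Im_divide_of_real by (simp add: y_def)
    show "Re ((of_nat a * z + of_nat b) / of_nat d) = (real a * x + real b) / real d"
      unfolding e Re_divide_of_real by (simp add: x_def)
  qed
  have "((\<lambda>n. \<rho> n * ?w n * cis (2 * pi * real_of_int n * ((real a * x + real b) / real d)))
      has_sum F ((of_nat a * z + of_nat b) / of_nat d)) ?S" for b
  proof -
    have "(of_nat a * z + of_nat b) / of_nat d \<in> uhp" using y ad im[of b] by (simp add: uhp_def)
    from F[unfolded is_fourier_coeffs_def, THEN bspec, OF this] show ?thesis unfolding im re .
  qed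
  then have "((\<lambda>n. \<Sum>b<d. \<rho> n * ?w n * cis (2 * pi * real_of_int n * ((real a * x + real b) / real d)))
      has_sum (\<Sum>b<d. F ((of_nat a * z + of_nat b) / of_nat d))) ?S"
    by (intro has_sum_sum_finite) auto
  also have "(\<lambda>n. \<Sum>b<d. \<rho> n * ?w n * cis (2 * pi * real_of_int n * ((real a * x + real b) / real d))) =
      (\<lambda>n. if int d dvd n then of_nat d * \<rho> n * ?w n * cis (2 * pi * real_of_int n * (real a * x / real d)) else 0)"
  proof
    fix n
    have "(\<Sum>b<d. \<rho> n * ?w n * cis (2 * pi * real_of_int n * ((real a * x + real b) / real d))) =
        \<rho> n * ?w n * cis (2 * pi * real_of_int n * (real a * x / real d)) * (\<Sum>b<d. cis (2 * pi * real_of_int n * (real b / real d)))"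
      unfolding sum_distrib_left mult.assoc cis_mult
      by (intro sum.cong refl arg_cong2[where f = "(*)"] arg_cong[where f = cis]) (simp add: add_divide_distrib distrib_left)
    then show "(\<Sum>b<d. \<rho> n * ?w n * cis (2 * pi * real_of_int n * ((real a * x + real b) / real d))) =
        (if int d dvd n then of_nat d * \<rho> n * ?w n * cis (2 * pi * real_of_int n * (real a * x / real d)) else 0)"
      unfolding sum_roots_of_unity[OF ad(2)] by simp
  qed
  finally have s1: "((\<lambda>n. if int d dvd n then of_nat d * \<rho> n * ?w n * cis (2 * pi * real_of_int n * (real a * x / real d)) else 0)
      has_sum (\<Sum>b<d. F ((of_nat a * z + of_nat b) / of_nat d))) ?S" .
  let ?g = "\<lambda>n. of_nat d * \<rho> n * ?w n * cis (2 * pi * real_of_int n * (real a * x / real d))"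
  have "(?g has_sum (\<Sum>b<d. F ((of_nat a * z + of_nat b) / of_nat d))) ((\<lambda>k. int d * k) ` ?S)"
  proof (rule has_sum_cong_neutral[THEN iffD1, OF _ _ _ s1])
    fix n assume "n \<in> (\<lambda>k. int d * k) ` ?S - ?S"
    then show "?g n = 0" using ad by auto
  next
    fix n assume "n \<in> ?S - (\<lambda>k. int d * k) ` ?S"
    then show "(if int d dvd n then ?g n else 0) = 0" by (auto elim!: dvdE)
  qed auto
  then have s2: "(?g \<circ> (\<lambda>k. int d * k) has_sum (\<Sum>b<d. F ((of_nat a * z + of_nat b) / of_nat d))) ?S"
    using ad by (subst (asm) has_sum_reindex) (auto simp: inj_on_def)
  let ?h = "\<lambda>m. hecke_coeff a d \<rho> m * whittaker_W t (4 * pi * \<bar>real_of_int m\<bar> * y) * cis (2 * pi * real_of_int m * x)"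
  have e: "(?h \<circ> (\<lambda>k. int a * k)) k = (?g \<circ> (\<lambda>k. int d * k)) k" for k
  proof -
    have "4 * pi * \<bar>real_of_int (int a * k)\<bar> * y = 4 * pi * \<bar>real_of_int (int d * k)\<bar> * (real a * y / real d)"
      using ad by (simp add: abs_mult)
    moreover have "2 * pi * real_of_int (int a * k) * x = 2 * pi * real_of_int (int d * k) * (real a * x / real d)"
      using ad by simp
    moreover have "hecke_coeff a d \<rho> (int a * k) = of_nat d * \<rho> (int d * k)" using ad by (simp add: hecke_coeff_def)
    ultimately show ?thesis unfolding o_def by (simp only:)
  qed
  have "(?h \<circ> (\<lambda>k. int a * k) has_sum (\<Sum>b<d. F ((of_nat a * z + of_nat b) / of_nat d))) ?S"
    using s2 has_sum_cong[of ?S "?h \<circ> (\<lambda>k. int a * k)" "?g \<circ> (\<lambda>k. int d * k)"] e by blast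
  then have "(?h has_sum (\<Sum>b<d. F ((of_nat a * z + of_nat b) / of_nat d))) ((\<lambda>k. int a * k) ` ?S)"
    using ad by (subst has_sum_reindex) (auto simp: inj_on_def)
  then have "(?h has_sum (\<Sum>b<d. F ((of_nat a * z + of_nat b) / of_nat d))) ?S"
  proof (rule has_sum_cong_neutral[THEN iffD1, rotated -1])
    fix n assume "n \<in> ?S - (\<lambda>k. int a * k) ` ?S"
    then show "?h n = 0" by (auto simp: hecke_coeff_def elim!: dvdE)
  qed (use ad in auto)
  then show "((\<lambda>n. hecke_coeff a d \<rho> n * whittaker_W t (4 * pi * \<bar>real_of_int n\<bar> * Im z) * cis (2 * pi * real_of_int n * Re z))
      has_sum (\<Sum>b<d. F ((of_nat a * z + of_nat b) / of_nat d))) ?S"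
    by (simp add: x_def y_def)
qed

lemma fourier_coeffs_dilate:
  assumes "is_fourier_coeffs t F \<rho>" "d > 0"
  shows "is_fourier_coeffs t (dilate d F) (\<lambda>m. if int d dvd m then \<rho> (m div int d) else 0)"
  using fourier_coeffs_hecke[OF assms, of 1]
  by (simp add: dilate_def[abs_def] hecke_coeff_def[abs_def] cong: if_cong)

context newform
begin

context
  fixes \<rho> assumes \<rho>: "is_fourier_coeffs t f \<rho>"
begin

text \<open>Instead of estimating the Bessel integral: if the function vanished on the positive
  axis, the assumed expansion would make \<open>f\<close> zero.\<close>

lemma whittaker_nonzero: "\<exists>y>0. whittaker_W t y \<noteq> 0"
proof (rule ccontr)
  assume "\<not> ?thesis"
  then have W: "whittaker_W t y = 0" if "y > 0" for y using that by blast
  obtain z where z: "z \<in> uhp" "f z \<noteq> 0" using f_nonzero by blast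
  have "whittaker_W t (4 * pi * \<bar>real_of_int n\<bar> * Im z) = 0" if "n \<in> UNIV - {0}" for n
    using that z by (intro W) (simp add: uhp_def)
  then have "((\<lambda>n. 0) has_sum f z) (UNIV - {0 :: int})"
    by (intro has_sum_cong[THEN iffD1, OF _ \<rho>[unfolded is_fourier_coeffs_def, THEN bspec, OF z(1)]]) simp
  then have "f z = 0" using has_sum_unique[OF _ has_sum_0_simp] by blast
  then show False using z by simp
qed

lemma fourier_eq:
  assumes "is_fourier_coeffs t F A" "is_fourier_coeffs t F B" "m \<noteq> 0"
  shows "A m = B m"
  using fourier_coeffs_unique[OF assms(1,2) _ _ assms(3)] whittaker_nonzero by blast

lemma hecke_fourier:
  assumes n: "n > 0" and m: "m \<noteq> 0"
  shows "of_real (sqrt (real n)) * lam n * \<rho> m = (\<Sum>a | a dvd n \<and> coprime a N. hecke_coeff a (n div a) \<rho> m)"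
proof (rule fourier_eq[OF _ _ m])
  have fin: "finite {a. a dvd n \<and> coprime a N}" using n by simp
  have ad: "a > 0 \<and> n div a > 0" if "a dvd n" for a
    using that n by (auto elim!: dvdE)
  show "is_fourier_coeffs t (\<lambda>z. of_real (sqrt (real n)) * lam n * f z) (\<lambda>m. of_real (sqrt (real n)) * lam n * \<rho> m)"
    by (rule fourier_coeffs_scale[OF \<rho>])
  show "is_fourier_coeffs t (\<lambda>z. of_real (sqrt (real n)) * lam n * f z) (\<lambda>m. \<Sum>a | a dvd n \<and> coprime a N. hecke_coeff a (n div a) \<rho> m)"
    unfolding hecke_sum[OF n, symmetric]
    using ad by (intro fourier_coeffs_sum[OF fin] fourier_coeffs_hecke[OF \<rho>]) auto
qed

lemma rho_eq_lam:
  assumes n: "n > 0"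
  shows "of_real (sqrt (real n)) * \<rho> (int n) = lam n * \<rho> 1"
proof -
  have "of_real (sqrt (real n)) * lam n * \<rho> 1 = (\<Sum>a | a dvd n \<and> coprime a N. hecke_coeff a (n div a) \<rho> 1)"
    using hecke_fourier[OF n, of 1] by simp
  \<comment> \<open>A summand with \<open>a > 1\<close> contributes only to frequencies divisible by
    \<open>a\<close>, hence nothing at frequency 1.\<close>
  also have "\<dots> = (\<Sum>a\<in>{1}. hecke_coeff a (n div a) \<rho> 1)"
    using n by (intro sum.mono_neutral_right) (auto simp: hecke_coeff_def)
  also have "\<dots> = of_nat n * \<rho> (int n)" by (simp add: hecke_coeff_def)
  also have "(of_nat n :: complex) = of_real (sqrt (real n)) * of_real (sqrt (real n))" by (rule csqrt_of_nat_sq[symmetric])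
  finally have "of_real (sqrt (real n)) * (lam n * \<rho> 1) = of_real (sqrt (real n)) * (of_real (sqrt (real n)) * \<rho> (int n))"
    by (simp only: mult.assoc)
  moreover have "complex_of_real (sqrt (real n)) \<noteq> 0" using n by simp
  ultimately show ?thesis by (metis mult_left_cancel)
qed

text \<open>Compare the coefficients at \<open>p ^ (k + 1)\<close> in the eigenvalue equation for
  \<open>p\<close>; a nonzero first coefficient allows the passage from \<open>\<rho>\<close> to
  \<open>lam\<close>.\<close>

lemma lam_prime_power_recursion:
  assumes p: "prime p" "\<not> p dvd N" and 1: "\<rho> 1 \<noteq> 0"
  shows "lam (p ^ Suc (Suc k)) = lam p * lam (p ^ Suc k) - lam (p ^ k)"
proof -
  have p0: "p > 1" "p > 0" using p prime_gt_1_nat prime_gt_0_nat by auto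
  define s where "s = complex_of_real (sqrt (real p))"
  have s: "s \<noteq> 0" "s * s = of_nat p" using p0 csqrt_of_nat_sq by (auto simp: s_def)
  have r: "s ^ j * \<rho> (int (p ^ j)) = lam (p ^ j) * \<rho> 1" for j
    using rho_eq_lam[of "p ^ j"] p0 by (simp add: s_def real_sqrt_power)
  have cop: "coprime p N" using p by (simp add: prime_imp_coprime)
  have "{a. a dvd p \<and> coprime a N} = {1, p}" using p cop by (auto simp: prime_nat_iff)
  then have "s * lam p * \<rho> (int (p ^ Suc k)) = hecke_coeff 1 p \<rho> (int (p ^ Suc k)) + hecke_coeff p 1 \<rho> (int (p ^ Suc k))"
    using hecke_fourier[OF p0(2), of "int (p ^ Suc k)"] p0 by (simp add: s_def)
  also have "hecke_coeff 1 p \<rho> (int (p ^ Suc k)) = s * s * \<rho> (int (p ^ Suc (Suc k)))"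
    using s by (simp add: hecke_coeff_def)
  also have "hecke_coeff p 1 \<rho> (int (p ^ Suc k)) = \<rho> (int (p ^ k))"
    using p0 by (simp add: hecke_coeff_def)
  \<comment> \<open>The factor \<open>s ^ k\<close> completes the power of \<open>sqrt p\<close>
    that normalizes each coefficient in \<open>r\<close>.\<close>
  finally have "s ^ k * (s * lam p * \<rho> (int (p ^ Suc k))) = s ^ k * (s * s * \<rho> (int (p ^ Suc (Suc k))) + \<rho> (int (p ^ k)))"
    by simp
  then have "lam p * (s ^ Suc k * \<rho> (int (p ^ Suc k))) = s ^ Suc (Suc k) * \<rho> (int (p ^ Suc (Suc k))) + s ^ k * \<rho> (int (p ^ k))"
    by (simp add: algebra_simps)
  then have "lam p * (lam (p ^ Suc k) * \<rho> 1) = lam (p ^ Suc (Suc k)) * \<rho> 1 + lam (p ^ k) * \<rho> 1" unfolding r .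
  then have "(lam p * lam (p ^ Suc k)) * \<rho> 1 = (lam (p ^ Suc (Suc k)) + lam (p ^ k)) * \<rho> 1" by (simp only: distrib_right mult.assoc)
  then have "lam p * lam (p ^ Suc k) = lam (p ^ Suc (Suc k)) + lam (p ^ k)" using 1 by (metis mult_right_cancel)
  then show ?thesis by simp
qed

lemma bform_fourier:
  assumes g: "g > 0" and A: "is_fourier_coeffs t (bform g) A" and n: "n \<noteq> 0"
  shows "A n = (\<Sum>d | d dvd g. xi N lam g d * (if int d dvd n then \<rho> (n div int d) else 0))"
proof (rule fourier_eq[OF A _ n])
  show "is_fourier_coeffs t (bform g) (\<lambda>n. \<Sum>d | d dvd g. xi N lam g d * (if int d dvd n then \<rho> (n div int d) else 0))"
    unfolding maass_basis_form_def
    using g by (intro fourier_coeffs_sum fourier_coeffs_scale fourier_coeffs_dilate[OF \<rho>]) (auto intro: gr0I)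
qed

end

end

section \<open>Bounds\<close>

text \<open>A prime with \<open>K \<le> p powr \<epsilon>\<close> pays for its own factor
  \<open>K\<close>. The other primes lie below \<open>P\<close>, so they are at most
  \<open>P\<close> in number and cost a constant.\<close>

lemma power_card_prime_factors_le:
  fixes K \<epsilon> :: real
  assumes K: "K \<ge> 1" and e: "\<epsilon> > 0"
  obtains C where "C > 0" "\<And>g. g > 0 \<Longrightarrow> K ^ card (prime_factors g) \<le> C * real g powr \<epsilon>"
proof -
  obtain P :: nat where P: "real P \<ge> K powr (1 / \<epsilon>)" using real_arch_simple by blast
  have big: "K \<le> real p powr \<epsilon>" if "p \<ge> P" for p
  proof -
    have "K = (K powr (1 / \<epsilon>)) powr \<epsilon>" using K e by (simp add: powr_powr)
    also have "\<dots> \<le> real p powr \<epsilon>" using that P e K by (intro powr_mono2) auto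
    finally show ?thesis .
  qed
  have main: "K ^ card (prime_factors g) \<le> K ^ card {p \<in> prime_factors g. p < P} * real g powr \<epsilon>" if "g > 0" for g :: nat
    using that
  proof (induction g rule: prime_power_induct)
    case one
    then show ?case by simp
  next
    case (step p k a)
    have pa: "p \<notin> prime_factors a" using step by auto
    have p1: "real p > 1" using step prime_gt_1_nat by simp
    have pf: "prime_factors (p ^ k * a) = insert p (prime_factors a)"
      using prime_factors_prime_power_mult step by blast
    have pk: "real p powr \<epsilon> \<le> real (p ^ k) powr \<epsilon>"
      using step(2) p1 e by (intro powr_mono2) (auto intro: self_le_power)
    have ge1: "1 \<le> real (p ^ k) powr \<epsilon>"
      using p1 e by (intro ge_one_powr_ge_zero) auto
    have pw: "real (p ^ k * a) powr \<epsilon> = real (p ^ k) powr \<epsilon> * real a powr \<epsilon>"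
      by (simp add: powr_mult)
    have l: "K ^ card (prime_factors (p ^ k * a)) = K * K ^ card (prime_factors a)"
      unfolding pf using pa by simp
    show ?case
    proof (cases "p < P")
      case True
      then have "{q \<in> prime_factors (p ^ k * a). q < P} = insert p {q \<in> prime_factors a. q < P}"
        unfolding pf by auto
      then have r: "K ^ card {q \<in> prime_factors (p ^ k * a). q < P} = K * K ^ card {q \<in> prime_factors a. q < P}"
        using pa by simp
      have "K * K ^ card (prime_factors a) \<le> K * (K ^ card {q \<in> prime_factors a. q < P} * real a powr \<epsilon>)"
        using step(5) K by (intro mult_left_mono) auto
      also have "\<dots> \<le> K * (K ^ card {q \<in> prime_factors a. q < P} * (real (p ^ k) powr \<epsilon> * real a powr \<epsilon>))"
        using K mult_right_mono[OF ge1, of "real a powr \<epsilon>"] by (intro mult_left_mono) auto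
      finally show ?thesis unfolding l r pw by (simp only: mult.assoc)
    next
      case False
      then have r: "{q \<in> prime_factors (p ^ k * a). q < P} = {q \<in> prime_factors a. q < P}"
        unfolding pf by auto
      have "K \<le> real (p ^ k) powr \<epsilon>" using big[of p] False pk by simp
      then have "K * K ^ card (prime_factors a) \<le> real (p ^ k) powr \<epsilon> * (K ^ card {q \<in> prime_factors a. q < P} * real a powr \<epsilon>)"
        using step(5) K by (intro mult_mono) auto
      then show ?thesis unfolding l r pw by (simp only: mult_ac)
    qed
  qed
  show thesis
  proof (rule that[of "K ^ P"])
    show "K ^ P > 0" using K by simp
    fix g :: nat assume g: "g > 0"
    have "card {p \<in> prime_factors g. p < P} \<le> card {..<P}" by (intro card_mono) auto
    then have "K ^ card {p \<in> prime_factors g. p < P} \<le> K ^ P" using K by (intro power_increasing) auto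
    then have "K ^ card {p \<in> prime_factors g. p < P} * real g powr \<epsilon> \<le> K ^ P * real g powr \<epsilon>"
      by (intro mult_right_mono) auto
    then show "K ^ card (prime_factors g) \<le> K ^ P * real g powr \<epsilon>" using main[OF g] by simp
  qed
qed

text \<open>A lower bound for \<open>rloc p\<close> uniform in \<open>p\<close>. With
  \<open>v = sqrt p\<close> and \<open>u = p powr \<eta>\<close> the first factor bounds
  \<open>1 - u / v\<close> and the second \<open>1 - 1 / (u v)\<close> from below; the 2 comes from
  \<open>v + 1 / v \<le> 2 v\<close>.\<close>

definition rloc_bound :: "real \<Rightarrow> real" where
  "rloc_bound \<eta> = (1 - 2 powr (\<eta> - 1/2)) * (1 - 1 / sqrt 2) / 2"

text \<open>The 3 bounds the sum of the three unnormalized coefficients, at most 1 + 3/2 + 1/2; the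
  3/4 is the lower bound for \<open>aloc p\<close>.\<close>

definition xi_bound :: "real \<Rightarrow> real" where
  "xi_bound \<eta> = 3 / sqrt (rloc_bound \<eta> * (3 / 4))"

lemma rloc_bound_pos:
  assumes "0 \<le> \<eta>" "\<eta> < 1 / 2"
  shows "rloc_bound \<eta> > 0" "rloc_bound \<eta> \<le> 1 / 2"
proof -
  have "2 powr (\<eta> - 1/2) < (2 :: real) powr 0" using assms by (intro powr_less_mono) auto
  then have 1: "2 powr (\<eta> - 1/2) < (1 :: real)" "2 powr (\<eta> - 1/2) > (0 :: real)" by auto
  have 2: "1 / sqrt 2 < 1" "1 / sqrt 2 > (0 :: real)" by auto
  show "rloc_bound \<eta> > 0" unfolding rloc_bound_def using 1 2 by (intro divide_pos_pos mult_pos_pos) linarith+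
  have "(1 - 2 powr (\<eta> - 1/2)) * (1 - 1 / sqrt 2) \<le> 1 * (1 :: real)" using 1 2 by (intro mult_mono) auto
  then show "rloc_bound \<eta> \<le> 1 / 2" unfolding rloc_bound_def by simp
qed

context newform
begin

context
  fixes \<rho> \<eta> B
  assumes \<rho>: "is_fourier_coeffs t f \<rho>" and rho_1: "\<rho> 1 \<noteq> 0" and eta: "0 \<le> \<eta>" "\<eta> < 1 / 2"
    and B: "\<And>n. n > 0 \<Longrightarrow> cmod (lam n) \<le> B * real n powr \<eta>"
begin

text \<open>If \<open>rlam p\<close> exceeded \<open>A + 1 / A\<close> for \<open>A = p powr \<eta>\<close>, then \<open>lam (p ^ k)\<close> would grow
  at least like \<open>q ^ k\<close> for some \<open>q > A\<close>.\<close>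

lemma rlam_le:
  assumes p: "prime p" "\<not> p dvd N"
  shows "\<bar>rlam p\<bar> \<le> real p powr \<eta> + 1 / real p powr \<eta>"
proof (rule ccontr)
  assume gt: "\<not> ?thesis"
  have p1: "real p > 1" using p prime_gt_1_nat by simp
  define A where "A = real p powr \<eta>"
  have A: "A \<ge> 1" using p1 eta unfolding A_def by (intro ge_one_powr_ge_zero) auto
  \<comment> \<open>Chosen so that \<open>q + 1 / q\<close> is at most the modulus of
    \<open>rlam p\<close> while \<open>q > A\<close>; then \<open>lam (p ^ k)\<close> grows at least
    by the factor \<open>q\<close> in each step.\<close>
  define q where "q = \<bar>rlam p\<bar> - 1 / A"
  have q: "q > A" using gt by (simp add: q_def A_def)
  have "1 / q \<le> 1 / A" using q A by (intro divide_left_mono) auto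
  then have lq: "\<bar>rlam p\<bar> \<ge> q + 1 / q" by (simp add: q_def)
  have q0: "q > 0" using q A by simp
  have "q * cmod (lam (p ^ k)) \<le> cmod (lam (p ^ Suc k)) \<and> cmod (lam (p ^ k)) \<ge> q ^ k" for k
  proof (induction k)
    case 0
    have "1 / q \<ge> 0" using q0 by simp
    then have "q \<le> \<bar>rlam p\<bar>" using lq by linarith
    then have "q \<le> cmod (lam p)" unfolding lam_eq_rlam[OF p(1)] by simp
    then show ?case using lam_1 by simp
  next
    case (Suc k)
    have e: "lam p * lam (p ^ Suc k) = lam (p ^ Suc (Suc k)) + lam (p ^ k)"
      using lam_prime_power_recursion[OF \<rho> p rho_1, of k] by simp
    have "cmod (lam p) * cmod (lam (p ^ Suc k)) \<le> cmod (lam (p ^ Suc (Suc k))) + cmod (lam (p ^ k))"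
      using norm_triangle_ineq[of "lam (p ^ Suc (Suc k))" "lam (p ^ k)"] unfolding e[symmetric] norm_mult .
    moreover have "(q + 1 / q) * cmod (lam (p ^ Suc k)) \<le> cmod (lam p) * cmod (lam (p ^ Suc k))"
      using lq unfolding lam_eq_rlam[OF p(1)] by (intro mult_right_mono) auto
    moreover have "cmod (lam (p ^ k)) \<le> 1 / q * cmod (lam (p ^ Suc k))"
      using Suc q0 by (simp add: field_simps)
    ultimately have "q * cmod (lam (p ^ Suc k)) \<le> cmod (lam (p ^ Suc (Suc k)))"
      by (simp only: distrib_right)
    moreover have "q ^ Suc k \<le> cmod (lam (p ^ Suc k))"
    proof -
      have "q ^ Suc k \<le> q * cmod (lam (p ^ k))" using Suc q0 by simp
      then show ?thesis using Suc by linarith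
    qed
    ultimately show ?case by blast
  qed
  then have low: "q ^ k \<le> cmod (lam (p ^ k))" for k by blast
  have up: "cmod (lam (p ^ k)) \<le> B * A ^ k" for k
  proof -
    have "real (p ^ k) powr \<eta> = A ^ k"
      using p1 by (simp add: A_def powr_powr powr_realpow[symmetric] mult.commute)
    then show ?thesis using B[of "p ^ k"] p1 by simp
  qed
  have "(q / A) ^ k \<le> B" for k
    using order_trans[OF low up, of k] A by (simp add: power_divide field_simps)
  moreover obtain k where "(q / A) ^ k > B" using real_arch_pow[of "q / A" B] q A by auto
  ultimately show False by (meson not_less)
qed

text \<open>If \<open>p\<close> divides the level, the modulus of \<open>lam p\<close> is at most
  \<open>1 / sqrt p\<close>, so \<open>kap p 1\<close> is at most 1/2 in modulus. Otherwise
  \<open>kap p 1\<close> is \<open>rlam p\<close> divided by \<open>v + 1 / v\<close>, and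
  \<open>rlam_le\<close> reduces the claim to the gap
  \<open>(v + 1 / v) - (u + 1 / u) = (v - u) (1 - 1 / (u v))\<close>.\<close>

lemma kap_1_le:
  assumes p: "prime p"
  shows "\<bar>kap p 1\<bar> \<le> 1 - rloc_bound \<eta>"
proof -
  have p2: "real p \<ge> 2" using p prime_ge_2_nat by auto
  define v where "v = sqrt (real p)"
  have v: "v * v = real p" "v \<ge> sqrt 2" "v > 0" using p2 by (auto simp: v_def)
  have s2: "sqrt 2 > (1 :: real)" by simp
  then have v1: "v > 1" using v by linarith
  show ?thesis
  proof (cases "p dvd N")
    case True
    have "\<bar>kap p 1\<bar> = \<bar>rlam p\<bar> / v"
      using True v by (simp add: rchi_def v(1)[symmetric] abs_mult v_def[symmetric])
    moreover have "\<bar>rlam p\<bar> \<le> 1 / v"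
    proof -
      from lam_ramified[OF p True] have "rlam p = 0 \<or> (rlam p)\<^sup>2 * real p = 1"
      proof
        assume "(lam p)\<^sup>2 * of_nat p = 1"
        then have "complex_of_real ((rlam p)\<^sup>2 * real p) = of_real 1" unfolding lam_eq_rlam[OF p] by simp
        then show ?thesis by (simp only: of_real_eq_iff simp_thms)
      qed (simp add: lam_eq_rlam[OF p])
      then show ?thesis
      proof
        assume "(rlam p)\<^sup>2 * real p = 1"
        then have "(rlam p * v)\<^sup>2 = 1" unfolding v(1)[symmetric] by (simp add: power2_eq_square mult_ac)
        then have "\<bar>rlam p * v\<bar> = 1" by (simp add: power2_eq_1_iff abs_if) linarith
        then show ?thesis using v by (simp add: abs_mult field_simps)
      qed (use v in simp)
    qed
    ultimately have "\<bar>kap p 1\<bar> \<le> 1 / v / v"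
      by (simp only:) (rule divide_right_mono, use v in auto)
    also have "\<dots> = 1 / real p" by (simp add: v(1))
    also have "\<dots> \<le> 1 / 2" using p2 by (intro divide_left_mono) auto
    also have "\<dots> \<le> 1 - rloc_bound \<eta>" using rloc_bound_pos(2)[OF eta] by simp
    finally show ?thesis .
  next
    case False
    define u where "u = real p powr \<eta>"
    define \<tau> where "\<tau> = (2 :: real) powr (\<eta> - 1/2)"
    have u1: "u \<ge> 1" using p2 eta unfolding u_def by (intro ge_one_powr_ge_zero) auto
    have "u / v = real p powr (\<eta> - 1/2)" using p2 by (simp add: u_def v_def powr_diff powr_half_sqrt)
    also have "\<dots> \<le> \<tau>" unfolding \<tau>_def using p2 eta by (intro powr_mono2') auto
    finally have uv: "u \<le> \<tau> * v" using v by (simp add: divide_le_eq)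
    have k: "\<bar>kap p 1\<bar> = \<bar>rlam p\<bar> / (v + 1 / v)"
    proof -
      have "kap p 1 = v * rlam p / (v * v + 1)" using False by (simp add: rchi_def v v_def[symmetric])
      also have "v * v + 1 = v * (v + 1 / v)" using v by (simp add: field_simps)
      also have "v * rlam p / (v * (v + 1 / v)) = rlam p / (v + 1 / v)" using v by simp
      finally have "\<bar>kap p 1\<bar> = \<bar>rlam p\<bar> / \<bar>v + 1 / v\<bar>" by simp
      moreover have "v + 1 / v > 0" using v by (simp add: add_pos_pos)
      ultimately show ?thesis by simp
    qed
    have "v * (2 * rloc_bound \<eta>) = v * (1 - \<tau>) * (1 - 1 / sqrt 2)"
      unfolding rloc_bound_def \<tau>_def by simp
    also have "\<dots> \<le> (v - u) * (1 - 1 / (u * v))"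
    proof (rule mult_mono)
      show "v * (1 - \<tau>) \<le> v - u" using uv by (simp add: algebra_simps)
      have "u * v \<ge> 1 * sqrt 2" using u1 v by (intro mult_mono) auto
      then have "1 / (u * v) \<le> 1 / sqrt 2" by (intro divide_left_mono) (use s2 v u1 in auto)
      then show "1 - 1 / sqrt 2 \<le> 1 - 1 / (u * v)" by simp
      have "\<tau> \<le> 2 powr 0" unfolding \<tau>_def using eta by (intro powr_mono) auto
      then have "\<tau> * v \<le> 1 * v" using v by (intro mult_right_mono) auto
      then show "0 \<le> v - u" using uv by simp
      show "0 \<le> 1 - 1 / sqrt (2 :: real)" by simp
    qed
    also have "\<dots> = v + 1 / v - (u + 1 / u)" using v u1 by (simp add: field_simps)
    finally have "u + 1 / u \<le> v + 1 / v - v * (2 * rloc_bound \<eta>)" by simp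
    moreover have "v * 2 * rloc_bound \<eta> \<ge> (v + 1 / v) * rloc_bound \<eta>"
    proof (rule mult_right_mono)
      have "1 / v \<le> 1" using v1 by simp
      then show "v + 1 / v \<le> v * 2" using v1 by linarith
    qed (use rloc_bound_pos[OF eta] in simp)
    ultimately have "u + 1 / u \<le> (v + 1 / v) * (1 - rloc_bound \<eta>)" by (simp add: algebra_simps)
    then have "\<bar>rlam p\<bar> \<le> (v + 1 / v) * (1 - rloc_bound \<eta>)"
      using rlam_le[OF p False] unfolding u_def[symmetric] by simp
    then show ?thesis unfolding k using v by (simp add: pos_divide_le_eq add_pos_pos mult.commute)
  qed
qed

lemma rloc_ge:
  assumes p: "prime p"
  shows "rloc p \<ge> rloc_bound \<eta>"
proof -
  have k: "\<bar>kap p 1\<bar> \<le> 1 - rloc_bound \<eta>" "\<bar>kap p 1\<bar> \<le> 1"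
    using kap_1_le[OF p] rloc_bound_pos[OF eta] by auto
  have "(kap p 1)\<^sup>2 = \<bar>kap p 1\<bar> * \<bar>kap p 1\<bar>" by (simp only: power2_eq_square abs_mult_self_eq)
  also have "\<dots> \<le> \<bar>kap p 1\<bar> * 1" using k by (intro mult_left_mono) auto
  finally show ?thesis using k by (simp add: rloc_def)
qed

lemma sum_abs_xloc_le:
  assumes p: "prime p" and k: "k > 0"
  shows "(\<Sum>i\<le>k. \<bar>xloc p k i\<bar>) \<le> xi_bound \<eta>"
proof -
  note b = rloc_bound_pos[OF eta]
  have r: "rloc p \<ge> rloc_bound \<eta>" "rloc p > 0" using rloc_ge[OF p] b by auto
  have a: "aloc p \<ge> 3 / 4" by (rule aloc_ge[OF p])
  have p2: "real p \<ge> 2" using p prime_ge_2_nat by auto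
  have k1: "\<bar>kap p 1\<bar> \<le> 1" using kap_1_le[OF p] b by simp
  have e: "rchi p / real p \<ge> 0" "rchi p / real p \<le> 1 / 2"
    using rchi_cases[of p] p2 by (auto simp: field_simps)
  show ?thesis
  proof (cases "k = 1")
    case True
    have "(\<Sum>i\<le>1. \<bar>xloc p 1 i\<bar>) = (1 + \<bar>kap p 1\<bar>) / sqrt (rloc p)"
      using r by (simp add: xloc_def add_divide_distrib del: kap.simps)
    also have "\<dots> \<le> 3 / sqrt (rloc p)" using k1 r by (intro divide_right_mono) auto
    also have "\<dots> \<le> 3 / sqrt (rloc_bound \<eta> * (3 / 4))"
      using r b by (intro divide_left_mono mult_pos_pos) auto
    finally show ?thesis using True by (simp add: xi_bound_def)
  next
    case False
    then obtain m where m: "k = Suc (Suc m)" using k by (metis One_nat_def gr0_conv_Suc not0_implies_Suc)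
    have L: "\<bar>rlam p / sqrt (real p)\<bar> \<le> 3 / 2"
    proof -
      have "\<bar>rlam p / sqrt (real p)\<bar> = \<bar>kap p 1\<bar> * (1 + rchi p / real p)"
        unfolding kap_1_eq[OF p, symmetric] abs_mult using e by simp
      also have "\<dots> \<le> 1 * (3 / 2)" using k1 e by (intro mult_mono) auto
      finally show ?thesis by simp
    qed
    define R where "R = sqrt (rloc p * aloc p)"
    have R: "R > 0" using r a by (simp add: R_def)
    have "(\<Sum>i\<le>k. \<bar>xloc p k i\<bar>) = (\<Sum>i\<in>{k, k - 1, k - 2}. \<bar>xloc p k i\<bar>)"
      using m by (intro sum.mono_neutral_right) (auto simp: xloc_def)
    also have "\<dots> = \<bar>xloc p k k\<bar> + (\<bar>xloc p k (k - 1)\<bar> + \<bar>xloc p k (k - 2)\<bar>)"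
      using m by simp
    also have "\<dots> = (1 + \<bar>rlam p / sqrt (real p)\<bar> + \<bar>rchi p / real p\<bar>) / R"
    proof -
      have "xloc p k k = 1 / R" "xloc p k (k - 1) = - (rlam p / sqrt (real p)) / R" "xloc p k (k - 2) = rchi p / real p / R"
        using m by (simp_all add: xloc_def R_def)
      then show ?thesis
        by (simp only: abs_divide abs_minus_cancel abs_one abs_of_pos[OF R] add_divide_distrib add.assoc)
    qed
    also have "\<dots> \<le> 3 / R"
    proof (rule divide_right_mono)
      have "\<bar>rchi p / real p\<bar> \<le> 1 / 2" using e by (simp only: abs_of_nonneg)
      then show "1 + \<bar>rlam p / sqrt (real p)\<bar> + \<bar>rchi p / real p\<bar> \<le> 3" using L by linarith
    qed (use R in simp)
    also have "\<dots> \<le> xi_bound \<eta>"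
      unfolding xi_bound_def R_def using r a b by (intro divide_left_mono real_sqrt_le_mono mult_mono mult_pos_pos) auto
    finally show ?thesis .
  qed
qed

lemma sum_norm_xi_le:
  assumes "g > 0"
  shows "(\<Sum>d | d dvd g. cmod (xi N lam g d)) \<le> xi_bound \<eta> ^ card (prime_factors g)"
  using assms
proof (induction g rule: prime_power_induct)
  case one
  have "{d. d dvd Suc 0} = {Suc 0}" by auto
  then show ?case by (simp add: xi_1)
next
  case (step p k a)
  have b: "xi_bound \<eta> \<ge> 0" using rloc_bound_pos[OF eta] by (simp add: xi_bound_def)
  have "(\<Sum>d | d dvd p ^ k * a. cmod (xi N lam (p ^ k * a) d)) =
      (\<Sum>i\<le>k. \<Sum>d | d dvd a. cmod (xi N lam (p ^ k * a) (p ^ i * d)))"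
    by (rule sum_divisors_prime_power[OF step(1,3,4)])
  also have "\<dots> = (\<Sum>i\<le>k. \<Sum>d | d dvd a. \<bar>xloc p k i\<bar> * cmod (xi N lam a d))"
    using step by (intro sum.cong refl) (simp add: xi_prime_power_mult norm_mult)
  also have "\<dots> = (\<Sum>i\<le>k. \<bar>xloc p k i\<bar> * (\<Sum>d | d dvd a. cmod (xi N lam a d)))"
    by (simp only: sum_distrib_left)
  also have "\<dots> = (\<Sum>i\<le>k. \<bar>xloc p k i\<bar>) * (\<Sum>d | d dvd a. cmod (xi N lam a d))"
    by (simp only: sum_distrib_right)
  also have "\<dots> \<le> xi_bound \<eta> * xi_bound \<eta> ^ card (prime_factors a)"
    using sum_abs_xloc_le[OF step(1,2)] step(5) b by (intro mult_mono sum_nonneg) auto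
  also have "\<dots> = xi_bound \<eta> ^ card (prime_factors (p ^ k * a))"
  proof -
    have "p \<notin> prime_factors a" using step by auto
    then show ?thesis using prime_factors_prime_power_mult[OF step(1,2,3)] by simp
  qed
  finally show ?case .
qed

text \<open>Only those \<open>d\<close> contribute that divide \<open>n\<close> as well as
  \<open>g\<close>, and such a \<open>d\<close> divides \<open>gcd l n\<close>. With
  \<open>n = d m\<close> the normalization of the coefficient at \<open>m\<close> leaves a factor
  \<open>d powr (1/2)\<close>.\<close>

lemma bform_coeff_le:
  assumes g: "g > 0" and A: "is_fourier_coeffs t (bform g) A" and n: "n > 0"
    and D: "\<And>n. n > 0 \<Longrightarrow> cmod (lam n) \<le> D * real n powr (\<theta> + \<epsilon>)" and te: "\<theta> < 1 / 2" "\<epsilon> > 0" "D \<ge> 0"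
    and l: "l > 0" "g dvd l"
  shows "sqrt (real n) * cmod (A (int n)) \<le>
    D * xi_bound \<eta> ^ card (prime_factors g) * real n powr (\<theta> + \<epsilon>) * real (gcd l n) powr (1 / 2 - \<theta>) * cmod (\<rho> 1)"
proof -
  define M where "M = D * real n powr (\<theta> + \<epsilon>) * real (gcd l n) powr (1 / 2 - \<theta>) * cmod (\<rho> 1)"
  have M0: "M \<ge> 0" using te by (simp add: M_def)
  have each: "sqrt (real n) * cmod (if int d dvd int n then \<rho> (int n div int d) else 0) \<le> M" if d: "d dvd g" for d
  proof (cases "d dvd n")
    case True
    define m where "m = n div d"
    have nm: "n = d * m" using True by (simp add: m_def)
    have d0: "d > 0" and m0: "m > 0" using n nm by (auto intro: gr0I)
    have "int n div int d = int m" by (simp add: m_def zdiv_int)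
    then have "sqrt (real n) * cmod (if int d dvd int n then \<rho> (int n div int d) else 0) =
        sqrt (real d) * cmod (of_real (sqrt (real m)) * \<rho> (int m))"
      using True by (simp add: nm real_sqrt_mult norm_mult)
    also have "\<dots> = sqrt (real d) * (cmod (lam m) * cmod (\<rho> 1))"
      unfolding rho_eq_lam[OF \<rho> m0] norm_mult ..
    also have "\<dots> \<le> sqrt (real d) * (D * real m powr (\<theta> + \<epsilon>) * cmod (\<rho> 1))"
      using D[OF m0] by (intro mult_left_mono mult_right_mono) auto
    also have "\<dots> = D * (real d powr (1 / 2) * real m powr (\<theta> + \<epsilon>)) * cmod (\<rho> 1)"
      using d0 by (simp add: powr_half_sqrt)
    \<comment> \<open>The bound for \<open>lam m\<close> is rewritten in terms of \<open>n\<close>;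
      the remaining power of \<open>d\<close> has its exponent raised by \<open>\<epsilon>\<close>
      and is then majorized by that of \<open>gcd l n\<close>, where \<open>\<theta> < 1 / 2\<close>
      gives monotonicity.\<close>
    also have "real d powr (1 / 2) * real m powr (\<theta> + \<epsilon>) = real d powr (1 / 2 - \<theta> - \<epsilon>) * real n powr (\<theta> + \<epsilon>)"
    proof -
      have "real d powr (1 / 2 - \<theta> - \<epsilon>) * real d powr (\<theta> + \<epsilon>) = real d powr (1 / 2)"
        unfolding powr_add[symmetric] by simp
      then show ?thesis by (simp add: nm powr_mult mult.assoc[symmetric])
    qed
    also have "D * (real d powr (1 / 2 - \<theta> - \<epsilon>) * real n powr (\<theta> + \<epsilon>)) * cmod (\<rho> 1) \<le>
        D * (real (gcd l n) powr (1 / 2 - \<theta>) * real n powr (\<theta> + \<epsilon>)) * cmod (\<rho> 1)"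
    proof (intro mult_left_mono mult_right_mono)
      have "d dvd gcd l n" using True d l by (auto intro: dvd_trans)
      then have dg: "d \<le> gcd l n" using l by (intro dvd_imp_le) auto
      have "real d powr (1 / 2 - \<theta> - \<epsilon>) \<le> real d powr (1 / 2 - \<theta>)" using d0 te by (intro powr_mono) auto
      also have "\<dots> \<le> real (gcd l n) powr (1 / 2 - \<theta>)" using dg te by (intro powr_mono2) auto
      finally show "real d powr (1 / 2 - \<theta> - \<epsilon>) \<le> real (gcd l n) powr (1 / 2 - \<theta>)" .
    qed (use te in auto)
    also have "\<dots> = M" by (simp add: M_def)
    finally show ?thesis .
  next
    case False
    then show ?thesis using M0 by simp
  qed
  have "sqrt (real n) * cmod (A (int n)) =
      sqrt (real n) * cmod (\<Sum>d | d dvd g. xi N lam g d * (if int d dvd int n then \<rho> (int n div int d) else 0))"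
    using bform_fourier[OF \<rho> g A, of "int n"] n by simp
  also have "\<dots> \<le> sqrt (real n) * (\<Sum>d | d dvd g. cmod (xi N lam g d * (if int d dvd int n then \<rho> (int n div int d) else 0)))"
    by (intro mult_left_mono norm_sum) auto
  also have "\<dots> = (\<Sum>d | d dvd g. cmod (xi N lam g d) * (sqrt (real n) * cmod (if int d dvd int n then \<rho> (int n div int d) else 0)))"
    unfolding sum_distrib_left norm_mult by (intro sum.cong refl) (simp only: mult.left_commute)
  also have "\<dots> \<le> (\<Sum>d | d dvd g. cmod (xi N lam g d) * M)"
    using each by (intro sum_mono mult_left_mono) auto
  also have "\<dots> = (\<Sum>d | d dvd g. cmod (xi N lam g d)) * M" by (simp only: sum_distrib_right)
  also have "\<dots> \<le> xi_bound \<eta> ^ card (prime_factors g) * M"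
    using sum_norm_xi_le[OF g] M0 by (intro mult_right_mono)
  finally show ?thesis by (simp add: M_def mult_ac)
qed

end

end

theorem lemma2:
  "(\<forall>l l1 :: nat. \<forall>(t :: complex) (fstar :: complex \<Rightarrow> complex).
      l > 0 \<and> l1 dvd l \<and> maass_newform l1 t fstar \<and> petersson l fstar fstar = 1 \<longrightarrow>
      (\<exists>V. is_direct_sum_of_lines {d. d dvd l div l1} (\<lambda>d. dilate d fstar) V \<and>
           is_orthonormal_basis (petersson l) {g. g dvd l div l1} (maass_basis_form l1 fstar) V)) \<and>
   (\<forall>(\<theta> :: real) (\<epsilon> :: real). ramanujan_petersson_exponent \<theta> \<and> \<epsilon> > 0 \<longrightarrow>
      (\<exists>C :: real. \<forall>(l :: nat) (l1 :: nat) (t :: complex) (fstar :: complex \<Rightarrow> complex)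
           (\<rho>star :: int \<Rightarrow> complex) (g :: nat) (\<rho> :: int \<Rightarrow> complex) (n :: nat).
         l > 0 \<and> l1 dvd l \<and> maass_newform l1 t fstar \<and> petersson l fstar fstar = 1 \<and>
         is_fourier_coeffs t fstar \<rho>star \<and>
         g dvd l div l1 \<and> is_fourier_coeffs t (maass_basis_form l1 fstar g) \<rho> \<and> n > 0 \<longrightarrow>
         sqrt (real n) * cmod (\<rho> (int n)) \<le>
           C * (real n * real l) powr \<epsilon> * real n powr \<theta>
             * real (gcd l n) powr (1 / 2 - \<theta>) * cmod (\<rho>star 1)))"
proof (rule conjI; intro allI impI)
  fix l l1 :: nat and t :: complex and fstar :: "complex \<Rightarrow> complex"
  assume a: "l > 0 \<and> l1 dvd l \<and> maass_newform l1 t fstar \<and> petersson l fstar fstar = 1"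
  then interpret newform l1 t fstar by unfold_locales (auto intro: gr0I)
  show "\<exists>V. is_direct_sum_of_lines {d. d dvd l div l1} (\<lambda>d. dilate d fstar) V \<and>
      is_orthonormal_basis (petersson l) {g. g dvd l div l1} (maass_basis_form l1 fstar) V"
    using a by (intro basis_forms_orthonormal) auto
next
  fix \<theta> \<epsilon> :: real
  assume "ramanujan_petersson_exponent \<theta> \<and> \<epsilon> > 0"
  then have \<theta>: "\<theta> < 1 / 2" and \<epsilon>: "\<epsilon> > 0"
    and RP: "\<And>\<epsilon>. \<epsilon> > 0 \<Longrightarrow> \<exists>C. \<forall>N t f n. N > 0 \<and> maass_newform N t f \<and> n > 0
        \<longrightarrow> cmod (hecke_eigenvalue N f n) \<le> C * real n powr (\<theta> + \<epsilon>)"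
    by (auto simp: ramanujan_petersson_exponent_def)
  \<comment> \<open>The hypothesis is used twice: with this exponent, midway between
    \<open>max \<theta> 0\<close> and 1/2, to bound the local norms by constants depending on
    \<open>\<theta>\<close> only, and with \<open>\<theta> + \<epsilon>\<close> for the final
    estimate.\<close>
  define \<eta> where "\<eta> = (max \<theta> 0 + 1 / 2) / 2"
  have \<eta>: "0 \<le> \<eta>" "\<eta> < 1 / 2" "\<eta> - \<theta> > 0" using \<theta> by (auto simp: \<eta>_def max_def)
  obtain B where B: "\<And>N t f n. N > 0 \<Longrightarrow> maass_newform N t f \<Longrightarrow> n > 0
      \<Longrightarrow> cmod (hecke_eigenvalue N f n) \<le> B * real n powr (\<theta> + (\<eta> - \<theta>))"
    using RP[OF \<eta>(3)] by blast
  obtain D0 where D0: "\<And>N t f n. N > 0 \<Longrightarrow> maass_newform N t f \<Longrightarrow> n > 0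
      \<Longrightarrow> cmod (hecke_eigenvalue N f n) \<le> D0 * real n powr (\<theta> + \<epsilon>)"
    using RP[OF \<epsilon>] by blast
  \<comment> \<open>The hypothesis gives a constant of unspecified sign; later inequalities are
    multiplied by \<open>D\<close>, so it is replaced by a nonnegative one.\<close>
  define D where "D = max D0 0"
  have D: "cmod (hecke_eigenvalue N f n) \<le> D * real n powr (\<theta> + \<epsilon>)"
    if "N > 0" "maass_newform N t f" "n > 0" for N t f n
    using D0[OF that] mult_right_mono[of D0 D "real n powr (\<theta> + \<epsilon>)"] by (simp add: D_def)
  have Dp: "D \<ge> 0" by (simp add: D_def)
  define K where "K = max (xi_bound \<eta>) 1"
  obtain C where C: "C > 0" "\<And>g. g > 0 \<Longrightarrow> K ^ card (prime_factors g) \<le> C * real g powr \<epsilon>"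
    using power_card_prime_factors_le[of K \<epsilon>] \<epsilon> by (auto simp: K_def)
  show "\<exists>C :: real. \<forall>(l :: nat) (l1 :: nat) (t :: complex) (fstar :: complex \<Rightarrow> complex)
           (\<rho>star :: int \<Rightarrow> complex) (g :: nat) (\<rho> :: int \<Rightarrow> complex) (n :: nat).
         l > 0 \<and> l1 dvd l \<and> maass_newform l1 t fstar \<and> petersson l fstar fstar = 1 \<and>
         is_fourier_coeffs t fstar \<rho>star \<and>
         g dvd l div l1 \<and> is_fourier_coeffs t (maass_basis_form l1 fstar g) \<rho> \<and> n > 0 \<longrightarrow>
         sqrt (real n) * cmod (\<rho> (int n)) \<le>
           C * (real n * real l) powr \<epsilon> * real n powr \<theta>
             * real (gcd l n) powr (1 / 2 - \<theta>) * cmod (\<rho>star 1)"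
  proof (intro exI[of _ "D * C"] allI impI)
    fix l l1 :: nat and t :: complex and f :: "complex \<Rightarrow> complex" and \<rho>star \<rho> :: "int \<Rightarrow> complex" and g n :: nat
    assume a: "l > 0 \<and> l1 dvd l \<and> maass_newform l1 t f \<and> petersson l f f = 1 \<and>
         is_fourier_coeffs t f \<rho>star \<and>
         g dvd l div l1 \<and> is_fourier_coeffs t (maass_basis_form l1 f g) \<rho> \<and> n > 0"
    then interpret newform l1 t f by unfold_locales (auto intro: gr0I)
    have l: "l > 0" and n: "n > 0" and F: "is_fourier_coeffs t f \<rho>star" and A: "is_fourier_coeffs t (bform g) \<rho>"
      using a by auto
    have "l div l1 dvd l" using a by (metis dvd_def dvd_div_mult_self)
    then have gl: "g dvd l" using a by (meson dvd_trans)
    then have g: "g > 0" using l by (auto intro: gr0I)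
    have lamB: "cmod (lam m) \<le> B * real m powr \<eta>" if "m > 0" for m
      using B[OF N newform that] by simp
    have lamD: "cmod (lam m) \<le> D * real m powr (\<theta> + \<epsilon>)" if "m > 0" for m
      by (rule D[OF N newform that])
    show "sqrt (real n) * cmod (\<rho> (int n)) \<le> D * C * (real n * real l) powr \<epsilon> * real n powr \<theta>
             * real (gcd l n) powr (1 / 2 - \<theta>) * cmod (\<rho>star 1)"
    \<comment> \<open>If the first coefficient vanishes, \<open>rho_eq_lam\<close> makes all
      coefficients of positive index vanish, and both sides are zero.\<close>
    proof (cases "\<rho>star 1 = 0")
      case True
      have "\<rho>star (int m) = 0" if "m > 0" for m
        using rho_eq_lam[OF F that] True that by simp
      then have z: "\<rho>star (int n div int d) = 0" if "int d dvd int n" for d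
      proof -
        have "n div d > 0" using that n by (auto elim!: dvdE)
        then have "\<rho>star (int (n div d)) = 0" by (rule \<open>\<And>m. m > 0 \<Longrightarrow> \<rho>star (int m) = 0\<close>)
        then show ?thesis by (simp add: zdiv_int)
      qed
      have "\<rho> (int n) = 0"
        using bform_fourier[OF F g A, of "int n"] n z by (simp add: sum.neutral)
      then show ?thesis using True by simp
    next
      case False
      have x0: "xi_bound \<eta> \<ge> 0" using rloc_bound_pos[OF \<eta>(1,2)] by (simp add: xi_bound_def)
      let ?Y = "real n powr (\<theta> + \<epsilon>) * real (gcd l n) powr (1 / 2 - \<theta>) * cmod (\<rho>star 1)"
      have "sqrt (real n) * cmod (\<rho> (int n)) \<le> D * xi_bound \<eta> ^ card (prime_factors g) * ?Y"
        using bform_coeff_le[OF F False \<eta>(1,2) lamB g A n lamD \<theta> \<epsilon> Dp l gl] by (simp only: mult.assoc)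
      also have "\<dots> \<le> D * (C * real l powr \<epsilon>) * ?Y"
      proof (intro mult_right_mono mult_left_mono Dp)
        have "xi_bound \<eta> ^ card (prime_factors g) \<le> K ^ card (prime_factors g)"
          using x0 by (intro power_mono) (auto simp: K_def)
        also have "\<dots> \<le> C * real g powr \<epsilon>" by (rule C(2)[OF g])
        also have "\<dots> \<le> C * real l powr \<epsilon>"
          using C(1) gl l \<epsilon> by (intro mult_left_mono powr_mono2) (auto dest: dvd_imp_le)
        finally show "xi_bound \<eta> ^ card (prime_factors g) \<le> C * real l powr \<epsilon>" .
      qed auto
      also have "\<dots> = D * C * (real n * real l) powr \<epsilon> * real n powr \<theta>
             * real (gcd l n) powr (1 / 2 - \<theta>) * cmod (\<rho>star 1)"
        by (simp add: powr_mult powr_add mult_ac)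
      finally show ?thesis .
    qed
  qed
qed

end
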